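(* Let $G_1,G_2$ be finitely presented groups and put $n_i:=\operatorname{rk}G_i/G_i'$ for $i=1,2$. Assume that there are subgroups $G_1'\leq K_1\leq G_1$ and $G_2'\leq K_2\leq G_2$, both finitely generated and of co-rank $m$ and $k$ respectively. Then there is some normal finitely presented fibre product in $G_1\times G_2$ of co-rank $$n:=\min\{m+k,n_1,n_2\}.$$
   Context: $G'$ denotes the commutator subgroup of $G$, and $\operatorname{rk}$ denotes the torsion-free rank of a finitely generated abelian group. A subgroup $K$ with $G'\leq K\leq G$ has co-rank $\operatorname{rk}G/K$ in $G$. A fibre product in $G_1\times G_2$ is a subgroup of the form $H_\mu=\{(g_1,g_2)\in G_1\times G_2\mid \mu(g_1N_1)=g_2N_2\}$ where $N_i\lhd G_i$ and $\mu:G_1/N_1\to G_2/N_2$ is an isomorphism. It is normal in $G_1\times G_2$ if and only if $G_i'\leq N_i$ for $i=1,2$, and then its co-rank is $\operatorname{rk}(G_1\times G_2)/H_\mu=\operatorname{rk}G_1/N_1=\operatorname{rk}G_2/N_2$. *)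

theory Defs
  imports "HOL-Algebra.Generated_Groups" "HOL-Algebra.FiniteProduct"
begin

section \<open>Free groups as groups of reduced words\<close>

text \<open>
  A letter \<open>(b, x)\<close> stands for the generator \<open>x\<close> if \<open>b\<close> holds and for its inverse otherwise.
\<close>

type_synonym 'a letter = "bool \<times> 'a"

definition inv_letter :: "'a letter \<Rightarrow> 'a letter" where
  "inv_letter a = (\<not> fst a, snd a)"

fun reduced :: "'a letter list \<Rightarrow> bool" where
  "reduced [] = True"
| "reduced [a] = True"
| "reduced (a # b # w) = (b \<noteq> inv_letter a \<and> reduced (b # w))"

fun reduced_cons :: "'a letter \<Rightarrow> 'a letter list \<Rightarrow> 'a letter list" where
  "reduced_cons a [] = [a]"
| "reduced_cons a (b # w) = (if b = inv_letter a then w else a # b # w)"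

definition free_group :: "'a set \<Rightarrow> 'a letter list monoid" where
  "free_group X =
     \<lparr>carrier = {w. reduced w \<and> set w \<subseteq> UNIV \<times> X},
      monoid.mult = (\<lambda>u v. foldr reduced_cons u v),
      one = []\<rparr>"

lemma inv_letter_idem [simp]: "inv_letter (inv_letter a) = a"
  by (simp add: inv_letter_def)

lemma reduced_tail: "reduced (a # w) \<Longrightarrow> reduced w"
  by (cases w) auto

lemma reduced_reduced_cons: "reduced w \<Longrightarrow> reduced (reduced_cons a w)"
  by (cases w) (auto dest: reduced_tail)

lemma set_reduced_cons: "set (reduced_cons a w) \<subseteq> insert a (set w)"
  by (cases w) auto

lemma reduced_cons_cancel:
  assumes "reduced w"
  shows "reduced_cons (inv_letter a) (reduced_cons a w) = w"
proof (cases w)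
  case (Cons b v)
  then show ?thesis
    using assms by (cases v) auto
qed simp

lemma reduced_foldr: "reduced v \<Longrightarrow> reduced (foldr reduced_cons u v)"
  by (induction u) (auto intro: reduced_reduced_cons)

lemma set_foldr_reduced_cons: "set (foldr reduced_cons u v) \<subseteq> set u \<union> set v"
proof (induction u)
  case (Cons a u)
  then show ?case
    using set_reduced_cons[of a "foldr reduced_cons u v"] by auto
qed simp

lemma foldr_reduced_cons:
  assumes "reduced v"
  shows "foldr reduced_cons (reduced_cons a u) v = reduced_cons a (foldr reduced_cons u v)"
proof (cases u)
  case (Cons b w)
  show ?thesis
  proof (cases "b = inv_letter a")
    case True
    then have "a = inv_letter b" by simp
    then show ?thesis
      using Cons True reduced_cons_cancel[OF reduced_foldr[OF assms, of w], of b] by auto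
  qed (use Cons in auto)
qed simp

lemma foldr_reduced_cons_assoc:
  assumes "reduced w"
  shows "foldr reduced_cons (foldr reduced_cons u v) w
       = foldr reduced_cons u (foldr reduced_cons v w)"
  by (induction u) (simp_all add: foldr_reduced_cons[OF assms])

lemma foldr_reduced_cons_Nil: "reduced w \<Longrightarrow> foldr reduced_cons w [] = w"
proof (induction w)
  case (Cons a w)
  then show ?case
    using reduced_tail[of a w] by (cases w) auto
qed simp

lemma reduced_left_inverse:
  assumes "reduced w"
  shows "foldr reduced_cons (foldr reduced_cons (rev (map inv_letter w)) []) w = []"
proof -
  have "foldr reduced_cons (rev (map inv_letter u)) (u @ v) = v" if "reduced (u @ v)" for u v
    using that
  proof (induction u)
    case (Cons a u)
    have "reduced_cons (inv_letter a) (a # u @ v) = u @ v" by simp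
    then show ?case
      using Cons.IH Cons.prems reduced_tail[of a "u @ v"] by simp
  qed simp
  from this[of w "[]"] show ?thesis
    using assms foldr_reduced_cons_assoc[OF assms] by simp
qed

lemma group_free_group: "group (free_group X)"
proof (rule groupI)
  fix u v assume "u \<in> carrier (free_group X)" "v \<in> carrier (free_group X)"
  then show "u \<otimes>\<^bsub>free_group X\<^esub> v \<in> carrier (free_group X)"
    using set_foldr_reduced_cons[of u v] by (auto simp: free_group_def reduced_foldr)
next
  fix w assume w: "w \<in> carrier (free_group X)"
  let ?w' = "foldr reduced_cons (rev (map inv_letter w)) []"
  have "?w' \<in> carrier (free_group X)"
    using w set_foldr_reduced_cons[of "rev (map inv_letter w)" "[]"]
    by (fastforce simp: free_group_def inv_letter_def intro: reduced_foldr)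
  moreover have "?w' \<otimes>\<^bsub>free_group X\<^esub> w = \<one>\<^bsub>free_group X\<^esub>"
    using w reduced_left_inverse by (auto simp: free_group_def)
  ultimately show "\<exists>v\<in>carrier (free_group X). v \<otimes>\<^bsub>free_group X\<^esub> w = \<one>\<^bsub>free_group X\<^esub>"
    by blast
qed (auto simp: free_group_def foldr_reduced_cons_assoc)


section \<open>Finiteness properties\<close>

definition finitely_generated :: "('a, 'b) monoid_scheme \<Rightarrow> bool" where
  "finitely_generated G \<longleftrightarrow> (\<exists>S. finite S \<and> S \<subseteq> carrier G \<and> generate G S = carrier G)"

definition normal_closure :: "('a, 'b) monoid_scheme \<Rightarrow> 'a set \<Rightarrow> 'a set" where
  "normal_closure G R = \<Inter>{N. N \<lhd> G \<and> R \<subseteq> N}"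

definition finitely_presented :: "('a, 'b) monoid_scheme \<Rightarrow> bool" where
  "finitely_presented G \<longleftrightarrow>
     (\<exists>(d::nat) R. finite R \<and> R \<subseteq> carrier (free_group {..<d}) \<and>
        free_group {..<d} Mod normal_closure (free_group {..<d}) R \<cong> G)"


section \<open>Torsion-free rank\<close>

definition int_independent :: "('a, 'b) monoid_scheme \<Rightarrow> 'a set \<Rightarrow> bool" where
  "int_independent A S \<longleftrightarrow> finite S \<and> S \<subseteq> carrier A \<and>
     (\<forall>c :: 'a \<Rightarrow> int. finprod A (\<lambda>x. x [^]\<^bsub>A\<^esub> c x) S = \<one>\<^bsub>A\<^esub> \<longrightarrow> (\<forall>x\<in>S. c x = 0))"

text \<open>
  Meaningful for finitely generated abelian groups only: there the cardinalities of independent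
  sets are bounded, so that the maximum exists.
\<close>

definition torsion_free_rank :: "('a, 'b) monoid_scheme \<Rightarrow> nat" where
  "torsion_free_rank A = Max {card S | S. int_independent A S}"

text \<open>To be used for \<open>derived G (carrier G) \<subseteq> K\<close> only, which makes \<open>K\<close> normal.\<close>

definition co_rank :: "('a, 'b) monoid_scheme \<Rightarrow> 'a set \<Rightarrow> nat" where
  "co_rank G K = torsion_free_rank (G Mod K)"


section \<open>Fibre products\<close>

definition fibre_product ::
  "('a, 'c) monoid_scheme \<Rightarrow> ('b, 'd) monoid_scheme \<Rightarrow> 'a set \<Rightarrow> 'b set
    \<Rightarrow> ('a set \<Rightarrow> 'b set) \<Rightarrow> ('a \<times> 'b) set" where
  "fibre_product G1 G2 N1 N2 \<mu> =
     {(g1, g2) \<in> carrier G1 \<times> carrier G2. \<mu> (N1 #>\<^bsub>G1\<^esub> g1) = N2 #>\<^bsub>G2\<^esub> g2}"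

definition is_fibre_product ::
  "('a, 'c) monoid_scheme \<Rightarrow> ('b, 'd) monoid_scheme \<Rightarrow> ('a \<times> 'b) set \<Rightarrow> bool" where
  "is_fibre_product G1 G2 H \<longleftrightarrow>
     (\<exists>N1 N2 \<mu>. N1 \<lhd> G1 \<and> N2 \<lhd> G2 \<and> \<mu> \<in> iso (G1 Mod N1) (G2 Mod N2) \<and>
        H = fibre_product G1 G2 N1 N2 \<mu>)"

end

theory Submission
  imports Defs "HOL-Algebra.Coset" "HOL-Library.Multiset" "HOL-Algebra.Bij"
begin

text \<open>
  Choose homomorphisms \<open>f\<^sub>i : G1 \<rightarrow> \<int>\<close> and \<open>h\<^sub>i : G2 \<rightarrow> \<int>\<close> for \<open>i < n\<close>, each family with dual elements,
  such that the first \<open>m' \<le> m\<close> of the \<open>f\<^sub>i\<close> vanish on \<open>K1\<close> and the first \<open>k' \<le> k\<close> of the \<open>h\<^sub>i\<close>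
  vanish on \<open>K2\<close>, where \<open>m' + k' = n\<close> and, by symmetry, \<open>k' \<le> m'\<close>. Then the common kernels of the first
  \<open>j \<le> m'\<close> of the \<open>f\<^sub>i\<close>, and of the first \<open>j \<le> k'\<close> of the \<open>h\<^sub>i\<close>, are finitely generated. Put \<open>\<psi>\<^sub>i = f\<^sub>i\<close> for
  \<open>i < m'\<close> and \<open>\<psi>\<^sub>i = f\<^sub>i + T f\<^sub>j\<close> for \<open>i = m' + j\<close>, with \<open>T\<close> large. The fibre product consists of the
  pairs \<open>(a, b)\<close> with \<open>\<psi>\<^sub>i a = h\<^sub>i b\<close> for all \<open>i\<close>, and it is finitely presented because imposing one of
  these equations after the other preserves finite presentability.

  Each step passes to the kernel of a character \<open>\<chi>\<close> of a finitely presented subgroup of \<open>G1 \<times> G2\<close>. It suffices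
  to cover this kernel by a finitely presented group \<open>\<Gamma>\<close> with commuting normal subgroups \<open>A\<close>, \<open>B\<close> lying
  over its intersections with the two factors, \<open>A\<close> being the normal closure of a finite set:
  conjugation by an element of \<open>G1\<close> with \<open>\<chi> = 1\<close> lifts to an automorphism of a suitable finitely
  presented quotient of \<open>\<Gamma>\<close>, and the corresponding extension by \<open>\<int>\<close> maps onto a finitely presented group.
  That \<open>A\<close> and \<open>B\<close> commute amounts to infinitely many relations \<open>[u r u\<inverse>, s] = 1\<close>, one for each word \<open>u\<close>
  in finitely many letters; the shear by \<open>T\<close> deduces all of them from those with \<open>u\<close> short.
\<close>

section \<open>Normal closures and presentations\<close>

text \<open>In the notation of \<open>fibre_data\<close>: after \<open>J\<close> equations the
  intersections \<open>N1\<close>, \<open>N2\<close> of the fibre product with the factors need not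
  be finitely generated. Finitely many elements still generate them under conjugation by letters,
  namely \<open>g1 i\<close> with \<open>m \<le> i < J\<close> for \<open>N1\<close> and
  \<open>g2 i\<close> with \<open>J - m \<le> i < J\<close> for \<open>N2\<close>. For
  \<open>i\<close> in the second range the pairs \<open>(g1 i, g2 i)\<close> solve the first
  \<open>J\<close> sheared equations, so one set of words acts on both sides. Nothing in a finite
  presentation forces long words to behave like short ones. What helps is an element acting at
  different speeds: \<open>(g1 (i - m), g2 (i - m) g2 i\<^sup>T)\<close> moves the first side by a
  bounded amount \<open>c\<close>, and after division by the \<open>T\<close>-th power of the
  diagonal letter it moves the second side by at most \<open>c\<close>. Conjugation by it removes
  \<open>T\<close> equal letters from the middle of a word at the price of \<open>2 c\<close> new
  ones, whence \<open>2 c < T\<close>. They receive a large weight, so that conjugating a relator by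
  one of them yields an element of weight less than that of the letter.\<close>

context group
begin

lemma inv_cancel_left: "x \<in> carrier G \<Longrightarrow> y \<in> carrier G \<Longrightarrow> x \<otimes> (inv x \<otimes> y) = y"
  by (simp add: m_assoc[symmetric])

lemma inv_cancel_left': "x \<in> carrier G \<Longrightarrow> y \<in> carrier G \<Longrightarrow> inv x \<otimes> (x \<otimes> y) = y"
  by (simp add: m_assoc[symmetric])

lemmas word_simps = m_assoc inv_mult_group inv_cancel_left inv_cancel_left'

lemma normal_closure_normal:
  assumes "R \<subseteq> carrier G"
  shows "normal_closure G R \<lhd> G"
  unfolding normal_inv_iff
proof
  show "subgroup (normal_closure G R) G"
    unfolding normal_closure_def
    by (rule subgroups_Inter) (use assms normal_self in \<open>auto simp: normal_inv_iff\<close>)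
  show "\<forall>x\<in>carrier G. \<forall>h\<in>normal_closure G R. x \<otimes> h \<otimes> inv x \<in> normal_closure G R"
    unfolding normal_closure_def normal_inv_iff by blast
qed

lemma normal_closure_subgroup: "R \<subseteq> carrier G \<Longrightarrow> subgroup (normal_closure G R) G"
  using normal_closure_normal normal_imp_subgroup by blast

end

lemma normal_closure_superset: "R \<subseteq> normal_closure G R"
  unfolding normal_closure_def by blast

lemma normal_closure_minimal: "N \<lhd> G \<Longrightarrow> R \<subseteq> N \<Longrightarrow> normal_closure G R \<subseteq> N"
  unfolding normal_closure_def by blast

lemma normal_closureI:
  assumes "group G" "N \<lhd> G" "R \<subseteq> N" "N \<subseteq> normal_closure G R"
  shows "normal_closure G R = N"
  using normal_closure_minimal[OF assms(2,3)] assms(4) by blast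

lemma (in group_hom) normal_vimage:
  assumes "M \<lhd> H"
  shows "{x \<in> carrier G. h x \<in> M} \<lhd> G"
proof -
  interpret M: normal M H by (rule assms)
  show ?thesis
    unfolding G.normal_inv_iff
  proof (intro conjI ballI)
    show "subgroup {x \<in> carrier G. h x \<in> M} G"
      by (rule G.subgroupI) auto
    fix x a assume "x \<in> carrier G" "a \<in> {x \<in> carrier G. h x \<in> M}"
    then show "x \<otimes> a \<otimes> inv x \<in> {x \<in> carrier G. h x \<in> M}"
      using M.inv_op_closed2 by auto
  qed
qed

lemma (in group_hom) normal_closure_image:
  assumes "M \<lhd> H" "R \<subseteq> carrier G" "h ` R \<subseteq> M"
  shows "h ` normal_closure G R \<subseteq> M"
  using normal_closure_minimal[OF normal_vimage[OF assms(1)], of R] assms by blast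

text \<open>The universal property of a quotient, stated for an arbitrary surjection so that it
  serves coset maps and presentations alike. The inclusion of kernels makes the value independent of
  the chosen preimage.\<close>

lemma hom_factor:
  assumes "group E" "group F" "group X" "\<phi> \<in> hom E F" "\<phi> ` carrier E = carrier F" "f \<in> hom E X"
    and ker: "kernel E F \<phi> \<subseteq> kernel E X f"
  obtains g where "g \<in> hom F X" "\<And>e. e \<in> carrier E \<Longrightarrow> g (\<phi> e) = f e"
proof -
  interpret \<phi>: group_hom E F \<phi>
    using assms by (simp add: group_hom_def group_hom_axioms_def)
  interpret f: group_hom E X f
    using assms by (simp add: group_hom_def group_hom_axioms_def)
  have f_eq: "f a = f b" if "a \<in> carrier E" "b \<in> carrier E" "\<phi> a = \<phi> b" for a b
  proof -
    have "a \<otimes>\<^bsub>E\<^esub> inv\<^bsub>E\<^esub> b \<in> kernel E F \<phi>"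
      using that by (simp add: kernel_def)
    then have "f (a \<otimes>\<^bsub>E\<^esub> inv\<^bsub>E\<^esub> b) = \<one>\<^bsub>X\<^esub>"
      using ker by (auto simp: kernel_def)
    then have "f a \<otimes>\<^bsub>X\<^esub> inv\<^bsub>X\<^esub> f b = \<one>\<^bsub>X\<^esub>"
      using that by simp
    then show ?thesis
      using that by (metis f.H.inv_equality f.H.inv_inv f.hom_closed f.H.inv_closed)
  qed
  define s where "s = (\<lambda>y. SOME e. e \<in> carrier E \<and> \<phi> e = y)"
  have s: "s y \<in> carrier E \<and> \<phi> (s y) = y" if "y \<in> carrier F" for y
  proof -
    have "\<exists>e. e \<in> carrier E \<and> \<phi> e = y"
      using that unfolding assms(5)[symmetric] by blast
    then show ?thesis
      unfolding s_def by (rule someI_ex)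
  qed
  have eq: "f (s (\<phi> e)) = f e" if "e \<in> carrier E" for e
    using f_eq[of "s (\<phi> e)" e] s[of "\<phi> e"] that by simp
  have "(\<lambda>y. f (s y)) \<in> hom F X"
  proof (rule homI)
    fix y assume "y \<in> carrier F"
    then show "f (s y) \<in> carrier X" using s by simp
  next
    fix y z assume y: "y \<in> carrier F" "z \<in> carrier F"
    have "f (s (y \<otimes>\<^bsub>F\<^esub> z)) = f (s y \<otimes>\<^bsub>E\<^esub> s z)"
      by (rule f_eq) (use s y in auto)
    then show "f (s (y \<otimes>\<^bsub>F\<^esub> z)) = f (s y) \<otimes>\<^bsub>X\<^esub> f (s z)"
      using s y by simp
  qed
  then show ?thesis
    using that eq by blast
qed

section \<open>Values of words and presentations as surjections from free groups\<close>

definition letter_val :: "('a, 'c) monoid_scheme \<Rightarrow> ('i \<Rightarrow> 'a) \<Rightarrow> 'i letter \<Rightarrow> 'a" where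
  "letter_val G x l = (if fst l then x (snd l) else inv\<^bsub>G\<^esub> (x (snd l)))"

primrec word_val :: "('a, 'c) monoid_scheme \<Rightarrow> ('i \<Rightarrow> 'a) \<Rightarrow> 'i letter list \<Rightarrow> 'a" where
  "word_val G x [] = \<one>\<^bsub>G\<^esub>"
| "word_val G x (l # u) = letter_val G x l \<otimes>\<^bsub>G\<^esub> word_val G x u"

context group
begin

lemma letter_val_closed [simp]: "x (snd l) \<in> carrier G \<Longrightarrow> letter_val G x l \<in> carrier G"
  by (simp add: letter_val_def)

lemma letter_val_inv_letter [simp]:
  "x (snd l) \<in> carrier G \<Longrightarrow> letter_val G x (inv_letter l) = inv (letter_val G x l)"
  by (simp add: letter_val_def inv_letter_def)

lemma word_val_closed: "(\<forall>l\<in>set u. x (snd l) \<in> carrier G) \<Longrightarrow> word_val G x u \<in> carrier G"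
  by (induction u) auto

lemma word_val_append:
  "(\<forall>l\<in>set u. x (snd l) \<in> carrier G) \<Longrightarrow> (\<forall>l\<in>set v. x (snd l) \<in> carrier G) \<Longrightarrow>
    word_val G x (u @ v) = word_val G x u \<otimes> word_val G x v"
  by (induction u) (auto simp: word_val_closed m_assoc)

lemma word_val_inverse:
  "(\<forall>l\<in>set u. x (snd l) \<in> carrier G) \<Longrightarrow> word_val G x (rev (map inv_letter u)) = inv (word_val G x u)"
proof (induction u)
  case (Cons l u)
  have "\<forall>l\<in>set (rev (map inv_letter u)). x (snd l) \<in> carrier G"
    using Cons.prems by (auto simp: inv_letter_def)
  then show ?case
    using Cons by (auto simp: word_val_append word_val_closed inv_mult_group inv_letter_def letter_val_def)
qed simp

lemma word_val_reduced_cons: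
  "x (snd l) \<in> carrier G \<Longrightarrow> (\<forall>l\<in>set u. x (snd l) \<in> carrier G) \<Longrightarrow>
    word_val G x (reduced_cons l u) = letter_val G x l \<otimes> word_val G x u"
  by (cases u) (auto simp: word_val_closed inv_cancel_left)

lemma word_val_foldr_reduced_cons:
  "(\<forall>l\<in>set u. x (snd l) \<in> carrier G) \<Longrightarrow> (\<forall>l\<in>set v. x (snd l) \<in> carrier G) \<Longrightarrow>
    word_val G x (foldr reduced_cons u v) = word_val G x u \<otimes> word_val G x v"
proof (induction u)
  case (Cons l u)
  have "\<forall>l\<in>set (foldr reduced_cons u v). x (snd l) \<in> carrier G"
    using Cons.prems set_foldr_reduced_cons[of u v] by auto
  then show ?case
    using Cons by (auto simp: word_val_reduced_cons word_val_closed m_assoc)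
qed (simp add: word_val_closed)

lemma word_val_hom:
  assumes "x ` X \<subseteq> carrier G"
  shows "word_val G x \<in> hom (free_group X) G"
proof (rule homI)
  have *: "\<forall>l\<in>set u. x (snd l) \<in> carrier G" if "u \<in> carrier (free_group X)" for u
    using that assms by (force simp: free_group_def)
  then show "word_val G x u \<in> carrier G" if "u \<in> carrier (free_group X)" for u
    using that word_val_closed by blast
  show "word_val G x (u \<otimes>\<^bsub>free_group X\<^esub> v) = word_val G x u \<otimes> word_val G x v"
    if "u \<in> carrier (free_group X)" "v \<in> carrier (free_group X)" for u v
    using word_val_foldr_reduced_cons[OF *[OF that(1)] *[OF that(2)]] by (simp add: free_group_def)
qed

end

lemma (in group_hom) word_val_image:
  "(\<forall>l\<in>set u. x (snd l) \<in> carrier G) \<Longrightarrow> h (word_val G x u) = word_val H (h \<circ> x) u"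
  by (induction u) (auto simp: G.word_val_closed letter_val_def)

definition free_gen :: "'a \<Rightarrow> 'a letter list" where
  "free_gen i = [(True, i)]"

lemma free_gen_closed: "i \<in> X \<Longrightarrow> free_gen i \<in> carrier (free_group X)"
  by (simp add: free_gen_def free_group_def)

lemma letter_val_free_gen:
  assumes "snd l \<in> X"
  shows "letter_val (free_group X) free_gen l = [l]"
proof -
  interpret group "free_group X" by (rule group_free_group)
  have "inv\<^bsub>free_group X\<^esub> [(True, snd l)] = [(False, snd l)]"
    by (rule inv_equality) (use assms in \<open>auto simp: free_group_def inv_letter_def\<close>)
  then show ?thesis
    by (cases l) (auto simp: letter_val_def free_gen_def)
qed

lemma word_val_free_gen:
  assumes "w \<in> carrier (free_group X)"
  shows "word_val (free_group X) free_gen w = w"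
  using assms
proof (induction w)
  case (Cons l w)
  have "w \<in> carrier (free_group X)"
    using Cons.prems by (cases w) (auto simp: free_group_def)
  moreover have "foldr reduced_cons [l] w = l # w"
    using Cons.prems by (cases w) (auto simp: free_group_def)
  ultimately show ?case
    using Cons letter_val_free_gen[of l X] by (auto simp: free_group_def)
qed (simp add: free_group_def)

lemma (in group) word_val_in_generate: "word_val G x u \<in> generate G (x ` snd ` set u)"
proof (induction u)
  case (Cons l u)
  have "word_val G x u \<in> generate G (x ` snd ` set (l # u))"
    using Cons mono_generate[of "x ` snd ` set u" "x ` snd ` set (l # u)"] by auto
  moreover have "letter_val G x l \<in> generate G (x ` snd ` set (l # u))"
    by (simp add: letter_val_def generate.incl generate.inv)
  ultimately show ?case
    unfolding word_val.simps by (rule generate.eng[rotated])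
next
  case Nil
  show ?case unfolding word_val.simps by (rule generate.one)
qed

lemma generate_free_group: "generate (free_group X) (free_gen ` X) = carrier (free_group X)"
proof -
  interpret group "free_group X" by (rule group_free_group)
  have *: "free_gen ` X \<subseteq> carrier (free_group X)"
    using free_gen_closed[of _ X] by (simp add: image_subset_iff)
  have "w \<in> generate (free_group X) (free_gen ` X)" if "w \<in> carrier (free_group X)" for w
  proof -
    have "snd ` set w \<subseteq> X" using that by (auto simp: free_group_def)
    then show ?thesis
      using word_val_in_generate[of free_gen w] word_val_free_gen[OF that]
        mono_generate[of "free_gen ` snd ` set w" "free_gen ` X"] by auto
  qed
  then show ?thesis
    using generate_in_carrier[OF *] by blast
qed

text \<open>Replaces the isomorphism with a factor group by a surjection from a free group with
  prescribed kernel, the form in which presentations can be composed with other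
  homomorphisms.\<close>

lemma finitely_presented_iff:
  assumes "group G"
  shows "finitely_presented G \<longleftrightarrow> (\<exists>(d::nat) R \<phi>. finite R \<and> R \<subseteq> carrier (free_group {..<d}) \<and>
    \<phi> \<in> hom (free_group {..<d}) G \<and> \<phi> ` carrier (free_group {..<d}) = carrier G \<and>
    kernel (free_group {..<d}) G \<phi> = normal_closure (free_group {..<d}) R)" (is "_ = ?rhs")
proof
  assume "finitely_presented G"
  then obtain d :: nat and R \<psi> where R: "finite R" "R \<subseteq> carrier (free_group {..<d})"
    and \<psi>: "\<psi> \<in> iso (free_group {..<d} Mod normal_closure (free_group {..<d}) R) G"
    unfolding finitely_presented_def is_iso_def by blast
  let ?F = "free_group {..<d}" let ?N = "normal_closure ?F R"
  interpret F: group ?F by (rule group_free_group)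
  interpret N: normal ?N ?F by (rule F.normal_closure_normal[OF R(2)])
  interpret Q: group "?F Mod ?N" by (rule N.factorgroup_is_group)
  let ?q = "\<lambda>w. ?N #>\<^bsub>?F\<^esub> w"
  have q: "?q \<in> hom ?F (?F Mod ?N)" by (rule N.r_coset_hom_Mod)
  have \<psi>': "\<psi> \<in> hom (?F Mod ?N) G" "bij_betw \<psi> (carrier (?F Mod ?N)) (carrier G)"
    using \<psi> by (auto simp: iso_def)
  let ?\<phi> = "\<psi> \<circ> ?q"
  have "?\<phi> \<in> hom ?F G"
    using hom_compose[OF q \<psi>'(1)] .
  moreover have "?\<phi> ` carrier ?F = carrier G"
    using \<psi>'(2) by (auto simp: bij_betw_def image_comp[symmetric] carrier_FactGroup)
  moreover have "kernel ?F G ?\<phi> = ?N"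
  proof -
    interpret \<psi>: group_hom "?F Mod ?N" G \<psi>
      using assms \<psi>' by (simp add: group_hom_def group_hom_axioms_def N.factorgroup_is_group)
    have "\<psi> X = \<one>\<^bsub>G\<^esub> \<longleftrightarrow> X = ?N" if "X \<in> carrier (?F Mod ?N)" for X
      using \<psi>'(2) that \<psi>.hom_one Q.one_closed unfolding bij_betw_def inj_on_def one_FactGroup by metis
    then have "kernel ?F G ?\<phi> = {w \<in> carrier ?F. ?q w = ?N}"
      by (auto simp: kernel_def carrier_FactGroup)
    also have "\<dots> = ?N"
      using F.coset_join1[OF _ _ N.subgroup_axioms] F.coset_join2[OF _ N.subgroup_axioms] N.subset by blast
    finally show ?thesis .
  qed
  ultimately show ?rhs
    using R by blast
next
  assume ?rhs
  then obtain d :: nat and R \<phi> where R: "finite R" "R \<subseteq> carrier (free_group {..<d})"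
    and \<phi>: "\<phi> \<in> hom (free_group {..<d}) G" "\<phi> ` carrier (free_group {..<d}) = carrier G"
    "kernel (free_group {..<d}) G \<phi> = normal_closure (free_group {..<d}) R"
    by blast
  interpret \<phi>: group_hom "free_group {..<d}" G \<phi>
    using assms \<phi> by (simp add: group_hom_def group_hom_axioms_def group_free_group)
  show "finitely_presented G"
    unfolding finitely_presented_def is_iso_def
    using R \<phi>.FactGroup_iso_set[OF \<phi>(2)] unfolding \<phi>(3) by blast
qed

lemma finitely_generated_image:
  assumes "group E" "group G" "\<phi> \<in> hom E G" "\<phi> ` carrier E = carrier G" "finitely_generated E"
  shows "finitely_generated G"
proof -
  interpret group_hom E G \<phi>
    using assms by (simp add: group_hom_def group_hom_axioms_def)
  obtain S where S: "finite S" "S \<subseteq> carrier E" "generate E S = carrier E"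
    using assms(5) unfolding finitely_generated_def by blast
  then have "generate G (\<phi> ` S) = carrier G"
    using generate_img[OF S(2)] assms(4) by simp
  then show ?thesis
    unfolding finitely_generated_def using S assms(4) by (metis finite_imageI image_mono)
qed

lemma finitely_presented_imp_finitely_generated:
  assumes "group G" "finitely_presented G"
  shows "finitely_generated G"
proof -
  obtain d :: nat and \<phi> where \<phi>: "\<phi> \<in> hom (free_group {..<d}) G"
      "\<phi> ` carrier (free_group {..<d}) = carrier G"
    using assms(2) unfolding finitely_presented_iff[OF assms(1)] by blast
  have "finitely_generated (free_group {..<d})"
    unfolding finitely_generated_def
    using generate_free_group[of "{..<d}"] free_gen_closed[of _ "{..<d}"]
    by (intro exI[of _ "free_gen ` {..<d}"]) blast
  then show ?thesis
    using finitely_generated_image[OF group_free_group assms(1) \<phi>] by blast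
qed

text \<open>Lifts of the elements of \<open>Y\<close> to the free group of a presentation of
  \<open>E\<close>, added to its relators, present \<open>G\<close>.\<close>

lemma finitely_presented_quotient:
  assumes "group E" "group G" "finitely_presented E" "\<phi> \<in> hom E G" "\<phi> ` carrier E = carrier G"
    and Y: "finite Y" "Y \<subseteq> carrier E" "kernel E G \<phi> \<subseteq> normal_closure E Y" "Y \<subseteq> kernel E G \<phi>"
  shows "finitely_presented G"
proof -
  obtain d :: nat and R p where R: "finite R" "R \<subseteq> carrier (free_group {..<d})"
    and p: "p \<in> hom (free_group {..<d}) E" "p ` carrier (free_group {..<d}) = carrier E"
      "kernel (free_group {..<d}) E p = normal_closure (free_group {..<d}) R"
    using assms(3) unfolding finitely_presented_iff[OF assms(1)] by blast
  let ?F = "free_group {..<d}"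
  interpret p: group_hom ?F E p
    using assms p by (simp add: group_hom_def group_hom_axioms_def group_free_group)
  interpret \<phi>: group_hom E G \<phi>
    using assms by (simp add: group_hom_def group_hom_axioms_def)
  obtain Z where Z: "Z \<subseteq> carrier ?F" "finite Z" "Y = p ` Z"
    using Y(1,2) p(2) finite_subset_image[of Y p "carrier ?F"] by blast
  let ?M = "normal_closure ?F (R \<union> Z)"
  have comp: "\<phi> \<circ> p \<in> hom ?F G"
    using hom_compose[OF p(1) assms(4)] .
  interpret \<phi>p: group_hom ?F G "\<phi> \<circ> p"
    using assms comp by (simp add: group_hom_def group_hom_axioms_def group_free_group)
  have M: "?M \<lhd> ?F" "R \<union> Z \<subseteq> ?M"
    using p.G.normal_closure_normal[of "R \<union> Z"] normal_closure_superset[of "R \<union> Z" ?F] R(2) Z(1) by simp_all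
  have pM: "p ` ?M \<lhd> E"
    using normal.surj_hom_normal_subgroup[OF M(1) p.group_hom_axioms p(2)] .
  have "kernel ?F G (\<phi> \<circ> p) = ?M"
  proof
    have "R \<subseteq> kernel ?F E p" unfolding p(3) by (rule normal_closure_superset)
    then have "R \<union> Z \<subseteq> kernel ?F G (\<phi> \<circ> p)"
      using Y(4) Z by (auto simp: kernel_def subset_iff)
    then show "?M \<subseteq> kernel ?F G (\<phi> \<circ> p)"
      using normal_closure_minimal[OF \<phi>p.normal_kernel] by blast
    show "kernel ?F G (\<phi> \<circ> p) \<subseteq> ?M"
    proof
      fix f assume f: "f \<in> kernel ?F G (\<phi> \<circ> p)"
      then have "p f \<in> kernel E G \<phi>" by (auto simp: kernel_def)
      moreover have "normal_closure E Y \<subseteq> p ` ?M"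
        using normal_closure_minimal[OF pM] M(2) Z(3) by blast
      ultimately obtain m where m: "m \<in> ?M" "p f = p m" using Y(3) by blast
      have mc: "m \<in> carrier ?F" "f \<in> carrier ?F"
        using subgroup.mem_carrier[OF normal_imp_subgroup[OF M(1)] m(1)] f by (simp_all add: kernel_def)
      then have "f \<otimes>\<^bsub>?F\<^esub> inv\<^bsub>?F\<^esub> m \<in> kernel ?F E p"
        using m by (simp add: kernel_def)
      then have "f \<otimes>\<^bsub>?F\<^esub> inv\<^bsub>?F\<^esub> m \<in> ?M"
        using normal_closure_minimal[OF M(1), of R] M(2) unfolding p(3) by (meson Un_subset_iff subsetD)
      then have "f \<otimes>\<^bsub>?F\<^esub> inv\<^bsub>?F\<^esub> m \<otimes>\<^bsub>?F\<^esub> m \<in> ?M"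
        by (rule subgroup.m_closed[OF normal_imp_subgroup[OF M(1)] _ m(1)])
      then show "f \<in> ?M" using mc by (simp add: p.G.m_assoc)
    qed
  qed
  moreover have "(\<phi> \<circ> p) ` carrier ?F = carrier G"
    by (simp only: image_comp[symmetric] p(2) assms(5))
  moreover have "finite (R \<union> Z)" "R \<union> Z \<subseteq> carrier ?F"
    using R Z by simp_all
  ultimately show ?thesis
    unfolding finitely_presented_iff[OF assms(2)]
    using comp by blast
qed

text \<open>Each generator of \<open>E\<close> is compared with a word in lifts \<open>x\<close> of
  the generators that present \<open>G\<close>. The finitely many quotients of generators by these
  words, together with the relators of \<open>G\<close> evaluated at the lifts, generate the kernel
  normally.\<close>

lemma finitely_presented_kernel:
  assumes "group E" "group G" "finitely_generated E" "finitely_presented G"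
    "\<phi> \<in> hom E G" "\<phi> ` carrier E = carrier G"
  obtains Y where "finite Y" "Y \<subseteq> kernel E G \<phi>" "kernel E G \<phi> = normal_closure E Y"
proof -
  obtain d :: nat and R p where R: "finite R" "R \<subseteq> carrier (free_group {..<d})"
    and p: "p \<in> hom (free_group {..<d}) G" "p ` carrier (free_group {..<d}) = carrier G"
      "kernel (free_group {..<d}) G p = normal_closure (free_group {..<d}) R"
    using assms(4) unfolding finitely_presented_iff[OF assms(2)] by blast
  let ?F = "free_group {..<d}"
  interpret p: group_hom ?F G p
    using assms p by (simp add: group_hom_def group_hom_axioms_def group_free_group)
  interpret \<phi>: group_hom E G \<phi>
    using assms by (simp add: group_hom_def group_hom_axioms_def)
  obtain S where S: "finite S" "S \<subseteq> carrier E" "generate E S = carrier E"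
    using assms(3) unfolding finitely_generated_def by blast
  have "\<exists>x. \<forall>i\<in>{..<d}. x i \<in> carrier E \<and> \<phi> (x i) = p (free_gen i)"
  proof (rule bchoice, rule ballI)
    fix i assume "i \<in> {..<d}"
    then have "p (free_gen i) \<in> carrier G" using free_gen_closed[of i "{..<d}"] by simp
    then show "\<exists>e. e \<in> carrier E \<and> \<phi> e = p (free_gen i)"
      unfolding assms(6)[symmetric] by fastforce
  qed
  then obtain x where x: "\<And>i. i < d \<Longrightarrow> x i \<in> carrier E" "\<And>i. i < d \<Longrightarrow> \<phi> (x i) = p (free_gen i)"
    by auto
  let ?l = "word_val E x"
  have l: "?l \<in> hom ?F E"
    by (rule \<phi>.G.word_val_hom) (use x in auto)
  interpret l: group_hom ?F E ?l
    using assms l by (simp add: group_hom_def group_hom_axioms_def group_free_group)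
  have \<phi>l: "\<phi> (?l w) = p w" if w: "w \<in> carrier ?F" for w
  proof -
    have set_w: "snd ` set w \<subseteq> {..<d}" using w by (auto simp: free_group_def)
    have "\<phi> (?l w) = word_val G (\<phi> \<circ> x) w"
      by (rule \<phi>.word_val_image) (use x set_w in \<open>auto simp: image_subset_iff\<close>)
    also have "\<dots> = word_val G (p \<circ> free_gen) w"
      using set_w
    proof (induction w)
      case (Cons a w)
      then show ?case using x by (auto simp: letter_val_def)
    qed simp
    also have "\<dots> = p (word_val ?F free_gen w)"
      by (rule p.word_val_image[symmetric]) (use set_w free_gen_closed[of _ "{..<d}"] in \<open>auto simp: image_subset_iff\<close>)
    finally show ?thesis using word_val_free_gen[OF w] by simp
  qed
  have "\<exists>v. \<forall>e\<in>S. v e \<in> carrier ?F \<and> p (v e) = \<phi> e"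
  proof (rule bchoice, rule ballI)
    fix e assume "e \<in> S"
    then have "\<phi> e \<in> carrier G" using S by auto
    then show "\<exists>f. f \<in> carrier ?F \<and> p f = \<phi> e"
      unfolding p(2)[symmetric] by fastforce
  qed
  then obtain v where v: "\<And>e. e \<in> S \<Longrightarrow> v e \<in> carrier ?F" "\<And>e. e \<in> S \<Longrightarrow> p (v e) = \<phi> e"
    by auto
  define Y where "Y = (\<lambda>e. e \<otimes>\<^bsub>E\<^esub> inv\<^bsub>E\<^esub> (?l (v e))) ` S \<union> ?l ` R"
  have Rker: "R \<subseteq> kernel ?F G p" unfolding p(3) by (rule normal_closure_superset)
  have Yker: "Y \<subseteq> kernel E G \<phi>"
    using S(2) v \<phi>l Rker R(2) by (auto simp: Y_def kernel_def subset_iff)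
  then have Yc: "Y \<subseteq> carrier E" by (auto simp: kernel_def)
  let ?M = "normal_closure E Y"
  have M: "?M \<lhd> E" using \<phi>.G.normal_closure_normal[OF Yc] .
  interpret M: normal ?M E by (rule M)
  \<comment> \<open>\<open>L e f\<close> says that \<open>e\<close> is congruent modulo the closure
    of \<open>Y\<close> to the word \<open>f\<close> evaluated at the lifts. It holds for the
    generators of \<open>E\<close> and is compatible with products and inverses, so every element of
    \<open>E\<close> has such a word.\<close>
  define L where "L e f \<longleftrightarrow> e \<in> carrier E \<and> f \<in> carrier ?F \<and> e \<otimes>\<^bsub>E\<^esub> inv\<^bsub>E\<^esub> (?l f) \<in> ?M" for e f
  have Lm: "L (e \<otimes>\<^bsub>E\<^esub> e') (f \<otimes>\<^bsub>?F\<^esub> f')" if "L e f" "L e' f'" for e e' f f'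
  proof -
    note f = that[unfolded L_def]
    have "e \<otimes>\<^bsub>E\<^esub> (e' \<otimes>\<^bsub>E\<^esub> inv\<^bsub>E\<^esub> (?l f')) \<otimes>\<^bsub>E\<^esub> inv\<^bsub>E\<^esub> e \<otimes>\<^bsub>E\<^esub> (e \<otimes>\<^bsub>E\<^esub> inv\<^bsub>E\<^esub> (?l f)) \<in> ?M"
      using M.inv_op_closed2 f by simp
    also have "e \<otimes>\<^bsub>E\<^esub> (e' \<otimes>\<^bsub>E\<^esub> inv\<^bsub>E\<^esub> (?l f')) \<otimes>\<^bsub>E\<^esub> inv\<^bsub>E\<^esub> e \<otimes>\<^bsub>E\<^esub> (e \<otimes>\<^bsub>E\<^esub> inv\<^bsub>E\<^esub> (?l f))
        = e \<otimes>\<^bsub>E\<^esub> e' \<otimes>\<^bsub>E\<^esub> inv\<^bsub>E\<^esub> (?l (f \<otimes>\<^bsub>?F\<^esub> f'))"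
      using f by (simp add: \<phi>.G.word_simps)
    finally show ?thesis using f by (simp add: L_def)
  qed
  have Li: "L (inv\<^bsub>E\<^esub> e) (inv\<^bsub>?F\<^esub> f)" if "L e f" for e f
  proof -
    note f = that[unfolded L_def]
    have "inv\<^bsub>E\<^esub> e \<otimes>\<^bsub>E\<^esub> inv\<^bsub>E\<^esub> (e \<otimes>\<^bsub>E\<^esub> inv\<^bsub>E\<^esub> (?l f)) \<otimes>\<^bsub>E\<^esub> e \<in> ?M"
      using M.inv_op_closed1 M.m_inv_closed f by blast
    also have "inv\<^bsub>E\<^esub> e \<otimes>\<^bsub>E\<^esub> inv\<^bsub>E\<^esub> (e \<otimes>\<^bsub>E\<^esub> inv\<^bsub>E\<^esub> (?l f)) \<otimes>\<^bsub>E\<^esub> e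
        = inv\<^bsub>E\<^esub> e \<otimes>\<^bsub>E\<^esub> inv\<^bsub>E\<^esub> (?l (inv\<^bsub>?F\<^esub> f))"
      using f by (simp add: \<phi>.G.word_simps)
    finally show ?thesis using f by (simp add: L_def)
  qed
  have Ls: "L s (v s)" if "s \<in> S" for s
  proof -
    have "s \<otimes>\<^bsub>E\<^esub> inv\<^bsub>E\<^esub> (?l (v s)) \<in> Y"
      using that by (simp add: Y_def)
    then show ?thesis
      using that v S(2) normal_closure_superset[of Y E] by (auto simp: L_def)
  qed
  have L: "\<exists>f. L e f" if "e \<in> carrier E" for e
    using that unfolding S(3)[symmetric]
  proof (induction rule: generate.induct)
    case one
    have "L \<one>\<^bsub>E\<^esub> \<one>\<^bsub>?F\<^esub>"
      by (simp add: L_def M.one_closed)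
    then show ?case ..
  qed (use Ls Li Lm in blast)+
  have "kernel E G \<phi> \<subseteq> ?M"
  proof
    fix e assume e: "e \<in> kernel E G \<phi>"
    then have "e \<in> carrier E" by (simp add: kernel_def)
    then obtain f where "L e f" using L by blast
    then have f: "f \<in> carrier ?F" "e \<otimes>\<^bsub>E\<^esub> inv\<^bsub>E\<^esub> (?l f) \<in> ?M" "e \<in> carrier E"
      by (simp_all add: L_def)
    have "\<phi> (e \<otimes>\<^bsub>E\<^esub> inv\<^bsub>E\<^esub> (?l f)) = \<one>\<^bsub>G\<^esub>"
      using normal_closure_minimal[OF \<phi>.normal_kernel Yker] f(2) by (auto simp: kernel_def)
    then have "p f = \<one>\<^bsub>G\<^esub>"
      using e f \<phi>l by (auto simp: kernel_def)
    then have "f \<in> normal_closure ?F R"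
      using f p(3) by (auto simp: kernel_def)
    then have "?l f \<in> ?M"
      using l.normal_closure_image[OF M R(2)] normal_closure_superset[of Y E] by (auto simp: Y_def)
    then have "e \<otimes>\<^bsub>E\<^esub> inv\<^bsub>E\<^esub> (?l f) \<otimes>\<^bsub>E\<^esub> ?l f \<in> ?M" using f(2) by simp
    then show "e \<in> ?M" using f by (simp add: \<phi>.G.word_simps)
  qed
  moreover have "?M \<subseteq> kernel E G \<phi>"
    using normal_closure_minimal[OF \<phi>.normal_kernel Yker] .
  ultimately have "kernel E G \<phi> = ?M" by blast
  moreover have "finite Y" using S(1) R(1) by (simp add: Y_def)
  ultimately show ?thesis
    using that[of Y] Yker by blast
qed

section \<open>Commuting normal subgroups\<close>

definition conj_by :: "('a, 'c) monoid_scheme \<Rightarrow> 'a \<Rightarrow> 'a \<Rightarrow> 'a" where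
  "conj_by G g r = g \<otimes>\<^bsub>G\<^esub> r \<otimes>\<^bsub>G\<^esub> inv\<^bsub>G\<^esub> g"

definition commute :: "('a, 'c) monoid_scheme \<Rightarrow> 'a \<Rightarrow> 'a \<Rightarrow> bool" where
  "commute G a b \<longleftrightarrow> a \<otimes>\<^bsub>G\<^esub> b = b \<otimes>\<^bsub>G\<^esub> a"

definition word_weight :: "('i \<Rightarrow> nat) \<Rightarrow> 'i letter list \<Rightarrow> nat" where
  "word_weight \<omega> u = (\<Sum>l\<leftarrow>u. \<omega> (snd l))"

text \<open>The steps of a filtration: for \<open>R\<close> and the letters in the carrier, the
  union over all \<open>p\<close> is the smallest subgroup that contains \<open>R\<close> and is
  stable under conjugation by the letters and their inverses. Weights in place of lengths allow some
  letters to be made expensive.\<close>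

definition conj_span ::
  "('a, 'c) monoid_scheme \<Rightarrow> ('i \<Rightarrow> 'a) \<Rightarrow> 'i set \<Rightarrow> ('i \<Rightarrow> nat) \<Rightarrow> 'a set \<Rightarrow> nat \<Rightarrow> 'a set" where
  "conj_span G x I \<omega> R p = generate G
     {conj_by G (word_val G x u) r | u r. snd ` set u \<subseteq> I \<and> word_weight \<omega> u \<le> p \<and> r \<in> R}"

lemma word_weight_simps [simp]:
  "word_weight \<omega> [] = 0" "word_weight \<omega> (l # u) = \<omega> (snd l) + word_weight \<omega> u"
  "word_weight \<omega> (u @ v) = word_weight \<omega> u + word_weight \<omega> v"
  by (simp_all add: word_weight_def)

lemma word_weight_inverse [simp]: "word_weight \<omega> (rev (map inv_letter u)) = word_weight \<omega> u"
  by (induction u) (simp_all add: inv_letter_def)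

lemma word_weight_mset: "mset u = mset v \<Longrightarrow> word_weight \<omega> u = word_weight \<omega> v"
  by (metis word_weight_def mset_map sum_mset_sum_list)

lemma set_inverse_word [simp]: "snd ` set (rev (map inv_letter u)) = snd ` set u"
  by (force simp: inv_letter_def image_iff)

context group
begin

lemma conj_by_closed [simp]: "g \<in> carrier G \<Longrightarrow> r \<in> carrier G \<Longrightarrow> conj_by G g r \<in> carrier G"
  by (simp add: conj_by_def)

lemma conj_by_mult:
  "g \<in> carrier G \<Longrightarrow> h \<in> carrier G \<Longrightarrow> r \<in> carrier G \<Longrightarrow> conj_by G (g \<otimes> h) r = conj_by G g (conj_by G h r)"
  by (simp add: conj_by_def word_simps)

lemma conj_by_one [simp]: "r \<in> carrier G \<Longrightarrow> conj_by G \<one> r = r"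
  by (simp add: conj_by_def)

lemma conj_by_mult_right:
  "g \<in> carrier G \<Longrightarrow> a \<in> carrier G \<Longrightarrow> b \<in> carrier G \<Longrightarrow>
    conj_by G g (a \<otimes> b) = conj_by G g a \<otimes> conj_by G g b"
  by (simp add: conj_by_def word_simps)

lemma conj_by_inv_right:
  "g \<in> carrier G \<Longrightarrow> a \<in> carrier G \<Longrightarrow> conj_by G g (inv a) = inv (conj_by G g a)"
  by (simp add: conj_by_def word_simps)

lemma conj_by_one_right [simp]: "g \<in> carrier G \<Longrightarrow> conj_by G g \<one> = \<one>"
  by (simp add: conj_by_def)

lemma conj_by_commute:
  "g \<in> carrier G \<Longrightarrow> a \<in> carrier G \<Longrightarrow> commute G g a \<Longrightarrow> conj_by G g a = a"
  by (simp add: conj_by_def commute_def m_assoc)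

lemma conj_by_inv_cancel:
  "g \<in> carrier G \<Longrightarrow> a \<in> carrier G \<Longrightarrow> conj_by G g (conj_by G (inv g) a) = a"
  "g \<in> carrier G \<Longrightarrow> a \<in> carrier G \<Longrightarrow> conj_by G (inv g) (conj_by G g a) = a"
  by (simp_all add: conj_by_mult[symmetric])

lemma commute_conj_by:
  assumes "g \<in> carrier G" "a \<in> carrier G" "b \<in> carrier G"
  shows "commute G (conj_by G g a) (conj_by G g b) \<longleftrightarrow> commute G a b"
proof -
  have "conj_by G g a \<otimes> conj_by G g b = conj_by G g b \<otimes> conj_by G g a \<longleftrightarrow>
      conj_by G g (a \<otimes> b) = conj_by G g (b \<otimes> a)"
    using assms by (simp add: conj_by_mult_right)
  also have "\<dots> \<longleftrightarrow> a \<otimes> b = b \<otimes> a"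
    using assms conj_by_inv_cancel(2) m_closed by metis
  finally show ?thesis by (simp add: commute_def)
qed

lemma commute_sym: "commute G a b \<longleftrightarrow> commute G b a"
  by (auto simp: commute_def)

lemma conj_by_subgroup: "subgroup H G \<Longrightarrow> g \<in> H \<Longrightarrow> a \<in> H \<Longrightarrow> conj_by G g a \<in> H"
  by (simp add: conj_by_def subgroup.m_closed subgroup.m_inv_closed)

lemma subgroup_commutant:
  assumes "a \<in> carrier G"
  shows "subgroup {b \<in> carrier G. commute G a b} G"
proof (rule subgroupI)
  fix b assume "b \<in> {b \<in> carrier G. commute G a b}"
  then have b: "b \<in> carrier G" "a \<otimes> b = b \<otimes> a" by (auto simp: commute_def)
  then have "inv b \<otimes> (a \<otimes> b) \<otimes> inv b = inv b \<otimes> (b \<otimes> a) \<otimes> inv b" by simp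
  then show "inv b \<in> {b \<in> carrier G. commute G a b}"
    using b(1) assms by (simp add: commute_def word_simps)
next
  fix b c assume "b \<in> {b \<in> carrier G. commute G a b}" "c \<in> {b \<in> carrier G. commute G a b}"
  then have b: "b \<in> carrier G" "a \<otimes> b = b \<otimes> a" "c \<in> carrier G" "a \<otimes> c = c \<otimes> a"
    by (auto simp: commute_def)
  have "a \<otimes> (b \<otimes> c) = (a \<otimes> b) \<otimes> c" using b(1,3) assms by (simp add: m_assoc)
  also have "\<dots> = b \<otimes> (a \<otimes> c)" unfolding b(2) using b(1,3) assms by (simp add: m_assoc)
  also have "\<dots> = b \<otimes> c \<otimes> a" unfolding b(4) using b(1,3) assms by (simp add: m_assoc)
  finally show "b \<otimes> c \<in> {b \<in> carrier G. commute G a b}"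
    using b by (simp add: commute_def)
qed (auto simp: commute_def assms)

lemma commute_generate:
  assumes "X \<subseteq> carrier G" "Y \<subseteq> carrier G" "\<And>x y. x \<in> X \<Longrightarrow> y \<in> Y \<Longrightarrow> commute G x y"
    and ab: "a \<in> generate G X" "b \<in> generate G Y"
  shows "commute G a b"
proof -
  have *: "commute G x b" if "x \<in> X" for x
    using generate_subgroup_incl[OF _ subgroup_commutant[of x], of Y] assms that by blast
  have b: "b \<in> carrier G" using ab(2) assms(2) generate_in_carrier by blast
  have "X \<subseteq> {c \<in> carrier G. commute G b c}"
    using * assms(1) commute_sym by blast
  then have "commute G b a"
    using generate_subgroup_incl[OF _ subgroup_commutant[OF b]] ab(1) by blast
  then show ?thesis by (simp add: commute_sym)
qed

lemma conj_by_generate: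
  assumes "g \<in> carrier G" "X \<subseteq> carrier G" "subgroup H G" "\<And>x. x \<in> X \<Longrightarrow> conj_by G g x \<in> H"
    and a: "a \<in> generate G X"
  shows "conj_by G g a \<in> H"
  using a
proof (induction rule: generate.induct)
  case one
  then show ?case using assms(1,3) by (simp add: subgroup.one_closed)
next
  case (incl h)
  then show ?case using assms(4) by blast
next
  case (inv h)
  then show ?case
    using assms(1-4) by (auto simp: conj_by_inv_right subgroup.m_inv_closed)
next
  case (eng a b)
  then show ?case
    using assms(1-3) generate_in_carrier[OF assms(2)]
    by (simp add: conj_by_mult_right subgroup.m_closed)
qed

end

locale conj_span_group = group G for G (structure) +
  fixes x :: "'i \<Rightarrow> 'a" and I :: "'i set" and \<omega> :: "'i \<Rightarrow> nat"
  assumes letters_closed: "\<And>i. i \<in> I \<Longrightarrow> x i \<in> carrier G"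
begin

abbreviation A where "A \<equiv> conj_span G x I \<omega>"
abbreviation word where "word \<equiv> word_val G x"
abbreviation letter where "letter \<equiv> letter_val G x"
abbreviation weight where "weight \<equiv> word_weight \<omega>"

lemma letter_closed: "snd l \<in> I \<Longrightarrow> letter l \<in> carrier G"
  using letters_closed by simp

lemma word_closed: "snd ` set u \<subseteq> I \<Longrightarrow> word u \<in> carrier G"
  using letters_closed by (intro word_val_closed) auto

lemma word_append: "snd ` set u \<subseteq> I \<Longrightarrow> snd ` set v \<subseteq> I \<Longrightarrow> word (u @ v) = word u \<otimes> word v"
  using letters_closed by (intro word_val_append) auto

lemma word_inverse: "snd ` set u \<subseteq> I \<Longrightarrow> word (rev (map inv_letter u)) = inv (word u)"
  using letters_closed by (intro word_val_inverse) auto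

context
  fixes R assumes R: "R \<subseteq> carrier G"
begin

lemma conj_span_gens_closed:
  "{conj_by G (word u) r | u r. snd ` set u \<subseteq> I \<and> weight u \<le> p \<and> r \<in> R} \<subseteq> carrier G"
  using R word_closed by auto

lemma conj_span_subgroup: "subgroup (A R p) G"
  unfolding conj_span_def by (rule generate_is_subgroup[OF conj_span_gens_closed])

lemma conj_span_closed: "a \<in> A R p \<Longrightarrow> a \<in> carrier G"
  using conj_span_subgroup subgroup.mem_carrier by fast

lemma conj_span_mono: "p \<le> q \<Longrightarrow> A R p \<subseteq> A R q"
  unfolding conj_span_def by (rule mono_generate) force

lemma conj_span_gen:
  "snd ` set u \<subseteq> I \<Longrightarrow> weight u \<le> p \<Longrightarrow> r \<in> R \<Longrightarrow> conj_by G (word u) r \<in> A R p"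
  unfolding conj_span_def by (rule generate.incl) blast

lemma conj_span_incl: "R \<subseteq> A R p"
proof
  fix r assume "r \<in> R"
  then show "r \<in> A R p"
    using conj_span_gen[of "[]" p r] R by auto
qed

lemma conj_span_word:
  assumes "snd ` set v \<subseteq> I" "a \<in> A R p"
  shows "conj_by G (word v) a \<in> A R (weight v + p)"
  using assms(2) unfolding conj_span_def[of _ _ _ _ _ p]
proof (rule conj_by_generate[OF word_closed[OF assms(1)] conj_span_gens_closed conj_span_subgroup, rotated])
  fix y assume "y \<in> {conj_by G (word u) r | u r. snd ` set u \<subseteq> I \<and> weight u \<le> p \<and> r \<in> R}"
  then obtain u r where u: "snd ` set u \<subseteq> I" "weight u \<le> p" "r \<in> R" "y = conj_by G (word u) r"
    by blast
  have "conj_by G (word v) y = conj_by G (word (v @ u)) r"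
    using u assms(1) R by (auto simp: word_append conj_by_mult word_closed)
  also have "\<dots> \<in> A R (weight v + p)"
    using u assms(1) by (intro conj_span_gen) auto
  finally show "conj_by G (word v) y \<in> A R (weight v + p)" .
qed

lemma conj_span_letter:
  assumes "snd l \<in> I" "a \<in> A R p"
  shows "conj_by G (letter l) a \<in> A R (\<omega> (snd l) + p)"
  using conj_span_word[of "[l]" a p] assms letter_closed by simp

text \<open>Conjugation by \<open>t\<close> multiplies each letter by an element \<open>a\<close> of
  small weight and by a factor \<open>b\<close> that is invisible on the relevant part of the
  filtration. By induction on the conjugating word, \<open>t\<close> then raises the weight by the
  constant \<open>c\<close> once, and not once for every letter.\<close>

lemma conj_span_shift:
  assumes t: "t \<in> carrier G" "\<And>r. r \<in> R \<Longrightarrow> conj_by G t r \<in> A R c"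
    and l: "\<And>l. snd l \<in> I \<Longrightarrow> \<exists>a\<in>A R c. \<exists>b\<in>carrier G. (\<forall>z\<in>A R m. commute G b z) \<and>
      conj_by G t (letter l) = letter l \<otimes> a \<otimes> b"
    and "p + c \<le> m" and a: "a \<in> A R p"
  shows "conj_by G t a \<in> A R (p + c)"
  using a unfolding conj_span_def[of _ _ _ _ _ p]
proof (rule conj_by_generate[OF t(1) conj_span_gens_closed conj_span_subgroup, rotated])
  have "conj_by G t (conj_by G (word u) r) \<in> A R (weight u + c)"
    if "snd ` set u \<subseteq> I" "weight u \<le> p" "r \<in> R" for u r
    using that
  proof (induction u)
    case Nil
    then show ?case using t R by auto
  next
    case (Cons k u)
    let ?z = "conj_by G (word u) r"
    let ?z' = "conj_by G t ?z"
    have z': "?z' \<in> A R (weight u + c)" using Cons by simp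
    then have zm: "?z' \<in> A R m"
      using conj_span_mono[of "weight u + c" m] Cons.prems assms(4) by auto
    have k: "snd k \<in> I" "letter k \<in> carrier G" "word u \<in> carrier G" "r \<in> carrier G"
      using Cons.prems letter_closed word_closed R by auto
    obtain a b where ab: "a \<in> A R c" "b \<in> carrier G" "\<forall>z\<in>A R m. commute G b z"
      "conj_by G t (letter k) = letter k \<otimes> a \<otimes> b"
      using l[OF k(1)] by blast
    have ac: "a \<in> carrier G" using ab(1) conj_span_closed by blast
    have "conj_by G t (conj_by G (word (k # u)) r)
        = conj_by G (conj_by G t (letter k)) ?z'"
      using k t(1) by (simp add: conj_by_def word_simps)
    also have "\<dots> = conj_by G (letter k) (conj_by G a (conj_by G b ?z'))"
      unfolding ab(4) using k ac ab(2) t(1) by (simp add: conj_by_mult)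
    also have "conj_by G b ?z' = ?z'"
      using ab zm conj_span_closed by (intro conj_by_commute) auto
    finally have eq: "conj_by G t (conj_by G (word (k # u)) r) = conj_by G (letter k) (conj_by G a ?z')" .
    \<comment> \<open>The element \<open>a\<close> already belongs to the subgroup in which
      \<open>?z'\<close> lies, and so conjugates it into itself. This is why the cost
      \<open>c\<close> does not accumulate.\<close>
    have "conj_by G a ?z' \<in> A R (weight u + c)"
      using conj_by_subgroup[OF conj_span_subgroup _ z'] conj_span_mono[of c "weight u + c"] ab(1) by auto
    then show ?case
      unfolding eq word_weight_simps add.assoc by (rule conj_span_letter[OF k(1)])
  qed
  then have "conj_by G t (conj_by G (word u) r) \<in> A R (p + c)"
    if "snd ` set u \<subseteq> I" "weight u \<le> p" "r \<in> R" for u r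
    using that conj_span_mono[of "weight u + c" "p + c"] by (meson add_le_mono1 subsetD)
  then show "conj_by G t y \<in> A R (p + c)"
    if "y \<in> {conj_by G (word u) r | u r. snd ` set u \<subseteq> I \<and> weight u \<le> p \<and> r \<in> R}" for y
    using that by blast
qed

end

end

context conj_span_group
begin

lemma conj_span_Union_subgroup:
  assumes R: "R \<subseteq> carrier G"
  shows "subgroup (\<Union>p. A R p) G"
proof (rule subgroupI)
  note sub = conj_span_subgroup[OF R]
  show "(\<Union>p. A R p) \<subseteq> carrier G" using conj_span_closed[OF R] by blast
  show "(\<Union>p. A R p) \<noteq> {}" using subgroup.one_closed[OF sub] by blast
  show "inv a \<in> (\<Union>p. A R p)" if "a \<in> (\<Union>p. A R p)" for a
    using that subgroup.m_inv_closed[OF sub] by blast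
  show "a \<otimes> b \<in> (\<Union>p. A R p)" if ab: "a \<in> (\<Union>p. A R p)" "b \<in> (\<Union>p. A R p)" for a b
  proof -
    obtain p q where "a \<in> A R p" "b \<in> A R q" using ab by blast
    then have "a \<in> A R (max p q)" "b \<in> A R (max p q)"
      using conj_span_mono[OF R, of p "max p q"] conj_span_mono[OF R, of q "max p q"] by auto
    then show ?thesis using subgroup.m_closed[OF sub] by blast
  qed
qed

end

section \<open>Commutation relations for long words\<close>

lemma mset_swap_induct:
  assumes "mset u = mset v" "P u" and swap: "\<And>xs a b ys. P (xs @ a # b # ys) \<Longrightarrow> P (xs @ b # a # ys)"
  shows "P v"
proof -
  have move: "P (xs @ a # ys @ zs) \<Longrightarrow> P (xs @ ys @ a # zs)" for xs a ys zs
  proof (induction ys arbitrary: xs)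
    case (Cons b ys)
    then show ?case using swap[of xs a b "ys @ zs"] Cons.IH[of "xs @ [b]"] by simp
  qed simp
  have "P (xs @ u) \<Longrightarrow> P (xs @ v)" for xs
    using assms(1)
  proof (induction u arbitrary: v xs)
    case (Cons a u)
    then obtain v1 v2 where v: "v = v1 @ a # v2"
      by (metis list.set_intros(1) set_mset_mset split_list)
    then have "mset u = mset (v1 @ v2)" using Cons.prems by simp
    then show ?case
      using Cons.IH[of "xs @ [a]" "v1 @ v2"] Cons.prems(1) move[of xs a v1 v2] v by simp
  qed simp
  from this[of "[]"] show ?thesis using assms(2) by simp
qed

lemma pigeonhole_list:
  assumes "set u \<subseteq> L" "finite L" "length u > card L * n"
  obtains l where "l \<in> L" "count (mset u) l \<ge> n"
proof -
  have "length u = (\<Sum>l\<in>set u. count (mset u) l)"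
    using size_multiset_overloaded_eq[of "mset u"] by simp
  also have "\<dots> = (\<Sum>l\<in>L. count (mset u) l)"
    using assms(1,2) by (intro sum.mono_neutral_left) auto
  finally have "length u = (\<Sum>l\<in>L. count (mset u) l)" .
  then have "\<not> (\<forall>l\<in>L. count (mset u) l \<le> n)"
    using assms(3) sum_bounded_above[of L "count (mset u)" n] by auto
  then show ?thesis using that by (meson nat_le_linear)
qed


locale conj_span_pair = conj_span_group +
  fixes R S :: "'a set"
  assumes R: "R \<subseteq> carrier G" and S: "S \<subseteq> carrier G"
begin

definition comm_word :: "'c letter list \<Rightarrow> bool" where
  "comm_word u \<longleftrightarrow> (\<forall>r\<in>R. \<forall>s\<in>S. commute G (conj_by G (word u) r) s)"

text \<open>Conjugating back by the second of two words turns the commutation of two conjugates into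
  the relation for a single word, whose weight is the sum of the two weights.\<close>

lemma conj_spans_commute:
  assumes hyp: "\<And>u. snd ` set u \<subseteq> I \<Longrightarrow> weight u \<le> N \<Longrightarrow> comm_word u"
    and "p + q \<le> N" and ab: "a \<in> A R p" "b \<in> A S q"
  shows "commute G a b"
  using ab unfolding conj_span_def
proof (rule commute_generate[OF conj_span_gens_closed[OF R] conj_span_gens_closed[OF S], rotated])
  fix y z assume "y \<in> {conj_by G (word u) r |u r. snd ` set u \<subseteq> I \<and> weight u \<le> p \<and> r \<in> R}"
    "z \<in> {conj_by G (word u) r |u r. snd ` set u \<subseteq> I \<and> weight u \<le> q \<and> r \<in> S}"
  then obtain u r v s where u: "snd ` set u \<subseteq> I" "weight u \<le> p" "r \<in> R" "y = conj_by G (word u) r"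
    and v: "snd ` set v \<subseteq> I" "weight v \<le> q" "s \<in> S" "z = conj_by G (word v) s"
    by blast
  let ?v = "rev (map inv_letter v)"
  have v': "snd ` set ?v \<subseteq> I" "word ?v = inv (word v)" "weight ?v = weight v"
    using v(1) word_inverse by (simp_all only: set_inverse_word word_weight_inverse)
  have c: "word u \<in> carrier G" "word v \<in> carrier G" "r \<in> carrier G" "s \<in> carrier G"
    using u v R S word_closed by auto
  have "comm_word (?v @ u)"
  proof (rule hyp)
    show "snd ` set (?v @ u) \<subseteq> I"
      using v'(1) u(1) by (simp only: set_append image_Un Un_subset_iff)
    show "weight (?v @ u) \<le> N"
      using v'(3) u(2) v(2) assms(2) by simp
  qed
  then have "commute G (conj_by G (word (?v @ u)) r) s"
    using u v by (simp add: comm_word_def)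
  also have "conj_by G (word (?v @ u)) r = conj_by G (inv (word v)) y"
    using c u v' word_append[OF v'(1) u(1)] by (simp only: u(4) v'(2) conj_by_mult inv_closed)
  finally have "commute G (conj_by G (word v) (conj_by G (inv (word v)) y)) (conj_by G (word v) s)"
    using c u(4) by (subst commute_conj_by) auto
  then show "commute G y z"
    using c u(4) v(4) by (simp add: conj_by_inv_cancel)
qed


text \<open>Swapping two letters produces errors \<open>a\<close> and \<open>b\<close>. The error
  \<open>b\<close> meets the conjugate of \<open>r\<close> by \<open>ys\<close>, and the conjugate
  of \<open>a\<close> by \<open>xs\<close> meets \<open>s\<close>. Both pairs commute by relations
  of weight at most \<open>N\<close>, since the two letters themselves account for a weight of at
  least 2.\<close>

lemma comm_word_swap:
  assumes hyp: "\<And>u. snd ` set u \<subseteq> I \<Longrightarrow> weight u \<le> N \<Longrightarrow> comm_word u"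
    and \<omega>: "\<And>i. i \<in> I \<Longrightarrow> 1 \<le> \<omega> i"
    and swap: "\<exists>a\<in>A R 0. \<exists>b\<in>A S 0. letter l \<otimes> letter m = a \<otimes> letter m \<otimes> letter l \<otimes> b"
    and u: "snd ` set (xs @ l # m # ys) \<subseteq> I" "weight (xs @ l # m # ys) \<le> Suc N"
    and comm: "comm_word (xs @ m # l # ys)"
  shows "comm_word (xs @ l # m # ys)"
  unfolding comm_word_def
proof (intro ballI)
  fix r s assume r: "r \<in> R" and s: "s \<in> S"
  obtain a b where ab: "a \<in> A R 0" "b \<in> A S 0"
    "letter l \<otimes> letter m = a \<otimes> letter m \<otimes> letter l \<otimes> b"
    using swap by blast
  have I: "snd ` set xs \<subseteq> I" "snd ` set ys \<subseteq> I" "snd l \<in> I" "snd m \<in> I"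
    using u(1) by auto
  have w: "weight xs < N" "weight ys < N"
    using u(2) \<omega>[OF I(3)] \<omega>[OF I(4)] by auto
  define z where "z = conj_by G (word ys) r"
  define y where "y = conj_by G (letter m) (conj_by G (letter l) z)"
  note c = word_closed[OF I(1)] word_closed[OF I(2)] letter_closed[OF I(3)] letter_closed[OF I(4)]
  have ab': "a \<in> carrier G" "b \<in> carrier G" "r \<in> carrier G" "s \<in> carrier G"
    using ab conj_span_closed R S r s by blast+
  then have zc: "z \<in> carrier G" "y \<in> carrier G"
    using c by (simp_all add: z_def y_def)
  have "z \<in> A R (weight ys)"
    unfolding z_def by (rule conj_span_gen[OF R I(2) _ r]) simp
  then have "commute G z b"
    using conj_spans_commute[OF hyp, where p = "weight ys" and q = 0 and a = z and b = b] ab(2) w by simp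
  then have bz: "conj_by G b z = z"
    using ab' zc by (intro conj_by_commute) (auto simp: commute_sym)
  define a' where "a' = conj_by G (word xs) a"
  have a': "a' \<in> carrier G" using ab' c by (simp add: a'_def)
  have "a' \<in> A R (weight xs)"
    unfolding a'_def using conj_span_word[OF R I(1) ab(1)] by simp
  moreover have "s \<in> A S 0" using conj_span_incl[OF S] s by blast
  ultimately have "commute G a' s"
    using conj_spans_commute[OF hyp, where p = "weight xs" and q = 0 and a = a' and b = s] w by simp
  then have a's: "conj_by G a' s = s"
    using ab' a' by (intro conj_by_commute)
  have "word (xs @ l # m # ys) = word xs \<otimes> (letter l \<otimes> letter m \<otimes> word ys)"
    using word_append[OF I(1), of "l # m # ys"] I c by (simp add: m_assoc)
  then have "conj_by G (word (xs @ l # m # ys)) r = conj_by G (word xs) (conj_by G (letter l \<otimes> letter m) z)"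
    using c ab' by (simp add: conj_by_mult z_def)
  also have "conj_by G (letter l \<otimes> letter m) z = conj_by G a y"
    unfolding ab(3) y_def using c ab' zc bz by (simp add: conj_by_mult)
  also have "conj_by G (word xs) (conj_by G a y) = conj_by G a' (conj_by G (word xs) y)"
    using c ab' zc by (simp add: a'_def conj_by_def word_simps)
  also have "conj_by G (word xs) y = conj_by G (word (xs @ m # l # ys)) r"
    using word_append[OF I(1), of "m # l # ys"] I c ab' by (simp add: conj_by_mult y_def z_def)
  finally have eq: "conj_by G (word (xs @ l # m # ys)) r
      = conj_by G a' (conj_by G (word (xs @ m # l # ys)) r)" .
  have "commute G (conj_by G (word (xs @ m # l # ys)) r) s"
    using comm r s by (simp add: comm_word_def)
  moreover have "word (xs @ m # l # ys) \<in> carrier G"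
    using I by (intro word_closed) auto
  ultimately have "commute G (conj_by G a' (conj_by G (word (xs @ m # l # ys)) r)) (conj_by G a' s)"
    using a' ab' by (subst commute_conj_by) auto
  then show "commute G (conj_by G (word (xs @ l # m # ys)) r) s"
    unfolding eq a's .
qed


text \<open>
  Up to a permutation of its letters, a long word contains a \<open>T\<close>-fold repetition of a letter \<open>l\<close> between two parts of
  weight more than \<open>2 c\<close>. The element \<open>t\<close> moves \<open>R\<close> and \<open>t l\<^sup>-\<^sup>T\<close> moves \<open>S\<close> by the weight \<open>c\<close> only, so that
  conjugation by \<open>t\<close> trades the relation for this word for relations for shorter words.
\<close>

theorem comm_word_all:
  assumes fin: "finite I" and \<omega>: "\<And>i. i \<in> I \<Longrightarrow> 1 \<le> \<omega> i"
    and swap: "\<And>l m. snd l \<in> I \<Longrightarrow> snd m \<in> I \<Longrightarrow>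
      \<exists>a\<in>A R 0. \<exists>b\<in>A S 0. letter l \<otimes> letter m = a \<otimes> letter m \<otimes> letter l \<otimes> b"
    and V: "\<And>l r. snd l \<in> I - W \<Longrightarrow> r \<in> R \<Longrightarrow> conj_by G (letter l) r \<in> A R (\<omega> (snd l) - 1)"
    and \<omega>W: "\<And>i. i \<in> W \<Longrightarrow> \<omega> i = 1"
    and W: "\<And>l. snd l \<in> I \<inter> W \<Longrightarrow> \<exists>t\<in>carrier G.
      (\<forall>r\<in>R. conj_by G t r \<in> A R c) \<and>
      (\<forall>m. snd m \<in> I \<longrightarrow> (\<exists>a\<in>A R c. \<exists>b\<in>A S (T + c). conj_by G t (letter m) = letter m \<otimes> a \<otimes> b)) \<and>
      (\<forall>s\<in>S. conj_by G (t \<otimes> inv (letter l [^] T)) s \<in> A S c) \<and>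
      (\<forall>m. snd m \<in> I \<longrightarrow> (\<exists>a\<in>A R (T + c). \<exists>b\<in>A S c.
        conj_by G (t \<otimes> inv (letter l [^] T)) (letter m) = letter m \<otimes> b \<otimes> a))"
    and T: "2 * c < (T :: nat)"
    and base: "\<And>u. snd ` set u \<subseteq> I \<Longrightarrow> weight u \<le> 2 * card I * T + T + 4 * c + 2 \<Longrightarrow> comm_word u"
    and u: "snd ` set u \<subseteq> I"
  shows "comm_word u"
proof -
  \<comment> \<open>More than \<open>2 * card I * T\<close> letters force some letter, counted with
    its sign, to occur \<open>T\<close> times; \<open>T + 4 * c + 2\<close> letters leave room for
    this block between two parts of length at least \<open>2 * c + 1\<close>.\<close>
  let ?N0 = "2 * card I * T + T + 4 * c + 2"
  have "\<forall>u. snd ` set u \<subseteq> I \<longrightarrow> weight u \<le> N \<longrightarrow> comm_word u" if "?N0 \<le> N" for N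
    using that
  proof (induction N rule: dec_induct)
    case base
    then show ?case using assms(8) by blast
  next
    case (step N)
    have hyp: "comm_word u" if "snd ` set u \<subseteq> I" "weight u \<le> N" for u
      using step.IH that by blast
    have perm: "comm_word u" if "mset v = mset u" "comm_word v" "snd ` set v \<subseteq> I" "weight v \<le> Suc N" for u v
    proof -
      let ?P = "\<lambda>u. comm_word u \<and> snd ` set u \<subseteq> I \<and> weight u \<le> Suc N"
      have sw: "?P (xs @ b # a # ys)" if P: "?P (xs @ a # b # ys)" for xs a b ys
      proof -
        have I: "snd a \<in> I" "snd b \<in> I" using P by auto
        have "snd ` set (xs @ b # a # ys) \<subseteq> I" "weight (xs @ b # a # ys) \<le> Suc N" using P by auto
        then show ?thesis
          using comm_word_swap[OF hyp \<omega> swap[OF I(2) I(1)], where xs = xs and ys = ys] P by blast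
      qed
      have "?P u"
        by (rule mset_swap_induct[of v u ?P, OF that(1) _ sw]) (use that in auto)
      then show ?thesis by blast
    qed
    show ?case
    proof (intro allI impI)
      fix u assume u: "snd ` set u \<subseteq> I" "weight u \<le> Suc N"
      consider "weight u \<le> N" | l where "weight u = Suc N" "l \<in> set u" "snd l \<in> I - W"
        | "weight u = Suc N" "snd ` set u \<subseteq> I \<inter> W"
        using u by fastforce
      then show "comm_word u"
      proof cases
        case 1
        then show ?thesis using hyp u by blast
      next
        case 2
        \<comment> \<open>A letter outside \<open>W\<close> is moved to the end of the word, where
          it acts directly on \<open>r\<close>. By assumption the result has weight at most
          \<open>\<omega> (snd l) - 1\<close>, so one unit of weight is saved and the induction
          hypothesis applies.\<close>
        let ?v = "remove1 l u"
        have v: "mset (?v @ [l]) = mset u" using 2 by simp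
        then have set_v: "set (?v @ [l]) = set u" by (metis set_mset_mset)
        then have vI: "snd ` set ?v \<subseteq> I" using u(1) by auto
        have wv: "weight (?v @ [l]) = Suc N" using word_weight_mset[OF v] 2 by simp
        have \<omega>l: "1 \<le> \<omega> (snd l)" using \<omega> 2 by blast
        have "comm_word (?v @ [l])"
          unfolding comm_word_def
        proof (intro ballI)
          fix r s assume r: "r \<in> R" "s \<in> S"
          have "conj_by G (word (?v @ [l])) r = conj_by G (word ?v) (conj_by G (letter l) r)"
            using word_append[OF vI, of "[l]"] word_closed[OF vI] letter_closed[of l] 2 r R
            by (auto simp: conj_by_mult)
          also have "\<dots> \<in> A R (weight ?v + (\<omega> (snd l) - 1))"
            by (rule conj_span_word[OF R vI V[OF 2(3) r(1)]])
          finally show "commute G (conj_by G (word (?v @ [l])) r) s"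
            using conj_spans_commute[OF hyp, where p = "weight ?v + (\<omega> (snd l) - 1)" and q = 0 and b = s]
              conj_span_incl[OF S, of 0] r wv \<omega>l by auto
        qed
        moreover have "snd ` set (?v @ [l]) \<subseteq> I" unfolding set_v by (rule u(1))
        ultimately show ?thesis
          using perm[OF v] wv by simp
      next
        case 3
        have len: "length u = weight u"
          using 3(2) \<omega>W by (induction u) (auto simp: word_weight_def)
        have "set u \<subseteq> UNIV \<times> (I \<inter> W)" using 3(2) by force
        moreover have "finite (UNIV \<times> (I \<inter> W) :: 'c letter set)" using fin by simp
        moreover have "card (UNIV \<times> (I \<inter> W) :: 'c letter set) * T < length u"
        proof -
          have "card (UNIV \<times> (I \<inter> W) :: 'c letter set) = 2 * card (I \<inter> W)"
            by (simp add: card_cartesian_product)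
          also have "\<dots> \<le> 2 * card I" using fin by (simp add: card_mono)
          finally have "card (UNIV \<times> (I \<inter> W) :: 'c letter set) * T \<le> 2 * card I * T"
            by (rule mult_le_mono1)
          then show ?thesis using len 3 step.hyps by linarith
        qed
        ultimately obtain l where l: "l \<in> UNIV \<times> (I \<inter> W)" "T \<le> count (mset u) l"
          by (rule pigeonhole_list)
        then have lW: "snd l \<in> I \<inter> W" by auto
        then have lI: "snd l \<in> I" by blast
        have "replicate_mset T l \<subseteq># mset u"
          using l(2) by (simp add: count_le_replicate_mset_subset_eq)
        then obtain M where M: "mset u = replicate_mset T l + M"
          by (metis subset_mset.less_eqE)
        obtain rest where rest: "mset rest = M" using ex_mset by blast
        \<comment> \<open>With \<open>2 * c + 1\<close> letters in \<open>u1\<close> and at least as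
          many in \<open>u2\<close>, the weights \<open>T + 2 * c + length u2\<close> and
          \<open>T + 2 * c + length u1\<close> are at most \<open>N\<close>. These are the
          commutation relations that dispose of the error terms of weight \<open>T + c\<close>
          below.\<close>
        define u1 where "u1 = take (2 * c + 1) rest"
        define u2 where "u2 = drop (2 * c + 1) rest"
        let ?L = "replicate T l"
        have "length rest + T = Suc N"
          using M rest len 3(1) by (metis add.commute size_mset size_replicate_mset size_union)
        then have lens: "length u1 = 2 * c + 1" "2 * c + 1 \<le> length u2" "length u1 + length u2 + T = Suc N"
          using step.hyps by (auto simp: u1_def u2_def)
        have "mset (u1 @ u2) = M" unfolding u1_def u2_def rest[symmetric] by simp
        then have v: "mset (u1 @ ?L @ u2) = mset u" using M by (simp add: ac_simps)
        then have set_v: "set (u1 @ ?L @ u2) = set u" by (metis set_mset_mset)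
        then have I: "snd ` set u1 \<subseteq> I" "snd ` set u2 \<subseteq> I" "snd ` set ?L \<subseteq> I"
          using u(1) by (auto simp del: set_replicate)
        have W: "snd ` set u1 \<subseteq> W" "snd ` set u2 \<subseteq> W"
          using 3(2) set_v by (auto simp del: set_replicate)
        have wt: "weight u1 = length u1" "weight u2 = length u2"
          using W \<omega>W by (induction u1, auto, induction u2, auto)
        let ?T = "letter l [^] T"
        have wL: "word ?L = ?T"
        proof -
          have "word (replicate n l) = letter l [^] n" for n :: nat
            using nat_pow_Suc2[OF letter_closed[OF lI]] by (induction n) simp_all
          then show ?thesis .
        qed
        obtain t where t: "t \<in> carrier G" "\<And>r. r \<in> R \<Longrightarrow> conj_by G t r \<in> A R c"
          "\<And>m. snd m \<in> I \<Longrightarrow> \<exists>a\<in>A R c. \<exists>b\<in>A S (T + c). conj_by G t (letter m) = letter m \<otimes> a \<otimes> b"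
          "\<And>s. s \<in> S \<Longrightarrow> conj_by G (t \<otimes> inv ?T) s \<in> A S c"
          "\<And>m. snd m \<in> I \<Longrightarrow> \<exists>a\<in>A R (T + c). \<exists>b\<in>A S c.
             conj_by G (t \<otimes> inv ?T) (letter m) = letter m \<otimes> b \<otimes> a"
          using assms(6)[OF lW] by blast
        have Tc: "?T \<in> carrier G" using letter_closed[OF lI] by simp
        have "comm_word (u1 @ ?L @ u2)"
          unfolding comm_word_def
        proof (intro ballI)
          fix r s assume r: "r \<in> R" and s: "s \<in> S"
          let ?u1 = "rev (map inv_letter u1)"
          have u1': "snd ` set ?u1 \<subseteq> I" using I(1) by (simp only: set_inverse_word)
          have rc: "r \<in> carrier G" "s \<in> carrier G" using r s R S by auto
          have w1: "word u1 \<in> carrier G" "word u2 \<in> carrier G" "word ?u1 \<in> carrier G"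
            using word_closed I u1' by blast+
          define y where "y = conj_by G (word u2) r"
          define z where "z = conj_by G (word ?u1) s"
          have yz: "y \<in> carrier G" "z \<in> carrier G" using rc w1 by (simp_all add: y_def z_def)
          have y0: "y \<in> A R (length u2)"
            unfolding y_def by (rule conj_span_gen[OF R I(2) _ r]) (simp add: wt)
          have "\<exists>a\<in>A R c. \<exists>b\<in>carrier G. (\<forall>z\<in>A R (length u2 + c). commute G b z) \<and>
              conj_by G t (letter m) = letter m \<otimes> a \<otimes> b" if m: "snd m \<in> I" for m
          proof -
            obtain a b where ab: "a \<in> A R c" "b \<in> A S (T + c)" "conj_by G t (letter m) = letter m \<otimes> a \<otimes> b"
              using t(3)[OF m] by blast
            have "commute G b z" if "z \<in> A R (length u2 + c)" for z
              using conj_spans_commute[OF hyp _ that ab(2)] lens by (simp add: commute_sym)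
            then show ?thesis
              using ab conj_span_closed[OF S] by blast
          qed
          then have y: "conj_by G t y \<in> A R (length u2 + c)"
            using conj_span_shift[OF R t(1,2) _ order.refl y0] by blast
          have z0: "z \<in> A S (length u1)"
            unfolding z_def by (rule conj_span_gen[OF S u1' _ s]) (simp only: word_weight_inverse wt)
          have tT: "t \<otimes> inv ?T \<in> carrier G" using t(1) Tc by simp
          have "\<exists>b\<in>A S c. \<exists>a\<in>carrier G. (\<forall>z\<in>A S (length u1 + c). commute G a z) \<and>
              conj_by G (t \<otimes> inv ?T) (letter m) = letter m \<otimes> b \<otimes> a" if m: "snd m \<in> I" for m
          proof -
            obtain a b where ab: "a \<in> A R (T + c)" "b \<in> A S c"
              "conj_by G (t \<otimes> inv ?T) (letter m) = letter m \<otimes> b \<otimes> a"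
              using t(5)[OF m] by blast
            have "commute G a z" if "z \<in> A S (length u1 + c)" for z
              using conj_spans_commute[OF hyp _ ab(1) that] lens by simp
            then show ?thesis
              using ab conj_span_closed[OF R] by blast
          qed
          then have z: "conj_by G (t \<otimes> inv ?T) z \<in> A S (length u1 + c)"
            using conj_span_shift[OF S tT t(4) _ order.refl z0] by blast
          \<comment> \<open>Here \<open>2 * c < T\<close> enters: the two weights add up to
            \<open>N + 1 - T + 2 * c\<close>, which is at most \<open>N\<close>.\<close>
          have "commute G (conj_by G t y) (conj_by G (t \<otimes> inv ?T) z)"
            by (rule conj_spans_commute[OF hyp _ y z]) (use lens T in auto)
          also have "conj_by G (t \<otimes> inv ?T) z = conj_by G t (conj_by G (inv ?T) z)"
            using t(1) Tc yz by (simp add: conj_by_mult)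
          finally have "commute G y (conj_by G (inv ?T) z)"
            using t(1) Tc yz by (subst (asm) commute_conj_by) auto
          then have "commute G (conj_by G (word u1 \<otimes> ?T) y) (conj_by G (word u1 \<otimes> ?T) (conj_by G (inv ?T) z))"
            using Tc yz w1 by (subst commute_conj_by) auto
          moreover have "conj_by G (word u1 \<otimes> ?T) y = conj_by G (word (u1 @ ?L @ u2)) r"
          proof -
            have "snd ` set (?L @ u2) \<subseteq> I"
              using I(2,3) by (simp only: set_append image_Un Un_subset_iff)
            then have "word (u1 @ ?L @ u2) = word u1 \<otimes> (?T \<otimes> word u2)"
              using word_append[OF I(1)] word_append[OF I(3,2)] wL by simp
            then show ?thesis using w1 Tc rc by (simp add: y_def conj_by_mult)
          qed
          moreover have "conj_by G (word u1 \<otimes> ?T) (conj_by G (inv ?T) z) = s"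
            using w1 Tc rc word_inverse[OF I(1)] yz(2)
            by (simp add: conj_by_mult conj_by_inv_cancel z_def)
          ultimately show "commute G (conj_by G (word (u1 @ ?L @ u2)) r) s" by simp
        qed
        moreover have "snd ` set (u1 @ ?L @ u2) \<subseteq> I" unfolding set_v by (rule u(1))
        ultimately show ?thesis
          using perm[OF v] u(2) word_weight_mset[OF v, of \<omega>] by metis
      qed
    qed
  qed
  from this[of "max ?N0 (weight u)"] show ?thesis using u by auto
qed

end

section \<open>The kernel of a character\<close>

lemma (in normal) quotient_hom:
  "(\<lambda>g. H #> g) \<in> hom G (G Mod H)" "(\<lambda>g. H #> g) ` carrier G = carrier (G Mod H)"
  "kernel G (G Mod H) (\<lambda>g. H #> g) = H"
proof -
  show "(\<lambda>g. H #> g) \<in> hom G (G Mod H)" by (rule r_coset_hom_Mod)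
  show "(\<lambda>g. H #> g) ` carrier G = carrier (G Mod H)" by (simp add: carrier_FactGroup)
  show "kernel G (G Mod H) (\<lambda>g. H #> g) = H"
    using coset_join1[OF _ _ subgroup_axioms] coset_join2[OF _ subgroup_axioms] subset
    by (auto simp: kernel_def)
qed

text \<open>\<open>A\<close> and \<open>B\<close> hit the right elements only up to the kernel of
  \<open>\<pi>\<close>. As \<open>G1\<close> and \<open>G2\<close> are finitely presented, the
  kernels of \<open>\<Gamma>\<close> over them are normal closures of finite sets. Each element of
  these sets is a product \<open>z b\<close> with \<open>z\<close> in the kernel of
  \<open>\<pi>\<close> and \<open>b\<close> in \<open>B\<close>, respectively \<open>A\<close>.
  Killing the finitely many \<open>z\<close> keeps the group finitely presented and removes the
  ambiguity.\<close>

lemma refine_cover: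
  fixes \<Gamma> :: "('g, 'h) monoid_scheme"
  assumes "group \<Gamma>" "group P" "group G1" "group G2"
    and fp: "finitely_presented \<Gamma>" "finitely_presented G1" "finitely_presented G2"
    and \<pi>: "\<pi> \<in> hom \<Gamma> P" and p1: "p1 \<in> hom P G1" and p2: "p2 \<in> hom P G2"
    and onto: "(p1 \<circ> \<pi>) ` carrier \<Gamma> = carrier G1" "(p2 \<circ> \<pi>) ` carrier \<Gamma> = carrier G2"
    and A: "A \<lhd> \<Gamma>" "\<And>g. g \<in> carrier \<Gamma> \<Longrightarrow> p2 (\<pi> g) = \<one>\<^bsub>G2\<^esub> \<Longrightarrow> \<pi> g \<in> \<pi> ` A"
    and B: "B \<lhd> \<Gamma>" "\<And>g. g \<in> carrier \<Gamma> \<Longrightarrow> p1 (\<pi> g) = \<one>\<^bsub>G1\<^esub> \<Longrightarrow> \<pi> g \<in> \<pi> ` B"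
  obtains \<Gamma>' :: "'g set monoid" and q \<pi>' where "group \<Gamma>'" "finitely_presented \<Gamma>'"
    "q \<in> hom \<Gamma> \<Gamma>'" "q ` carrier \<Gamma> = carrier \<Gamma>'" "\<pi>' \<in> hom \<Gamma>' P" "\<And>g. g \<in> carrier \<Gamma> \<Longrightarrow> \<pi>' (q g) = \<pi> g"
    "\<And>g. g \<in> carrier \<Gamma>' \<Longrightarrow> p2 (\<pi>' g) = \<one>\<^bsub>G2\<^esub> \<Longrightarrow> g \<in> q ` A"
    "\<And>g. g \<in> carrier \<Gamma>' \<Longrightarrow> p1 (\<pi>' g) = \<one>\<^bsub>G1\<^esub> \<Longrightarrow> g \<in> q ` B"
proof -
  interpret \<pi>: group_hom \<Gamma> P \<pi>
    using assms by (simp add: group_hom_def group_hom_axioms_def)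
  have fg: "finitely_generated \<Gamma>"
    using finitely_presented_imp_finitely_generated assms(1) fp(1) by blast
  have one_side: "\<exists>E Z. finite E \<and> finite Z \<and> E \<subseteq> carrier \<Gamma> \<and> Z \<subseteq> kernel \<Gamma> P \<pi> \<and>
      {g \<in> carrier \<Gamma>. p (\<pi> g) = \<one>\<^bsub>H\<^esub>} = normal_closure \<Gamma> E \<and>
      (\<forall>e\<in>E. \<exists>z\<in>Z. \<exists>b\<in>B. e = z \<otimes>\<^bsub>\<Gamma>\<^esub> b)"
    if H: "group H" "finitely_presented H" "p \<in> hom P H" "(p \<circ> \<pi>) ` carrier \<Gamma> = carrier H"
      and B: "B \<lhd> \<Gamma>" "\<And>g. g \<in> carrier \<Gamma> \<Longrightarrow> p (\<pi> g) = \<one>\<^bsub>H\<^esub> \<Longrightarrow> \<pi> g \<in> \<pi> ` B"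
    for H :: "('x, 'y) monoid_scheme" and p B
  proof -
    obtain E where E: "finite E" "E \<subseteq> kernel \<Gamma> H (p \<circ> \<pi>)" "kernel \<Gamma> H (p \<circ> \<pi>) = normal_closure \<Gamma> E"
      using finitely_presented_kernel[OF assms(1) H(1) fg H(2) hom_compose[OF \<pi> H(3)] H(4)] .
    have "\<forall>e\<in>E. \<exists>b. b \<in> B \<and> \<pi> b = \<pi> e"
    proof
      fix e assume "e \<in> E"
      then have "e \<in> carrier \<Gamma>" "p (\<pi> e) = \<one>\<^bsub>H\<^esub>" using E(2) by (auto simp: kernel_def)
      then show "\<exists>b. b \<in> B \<and> \<pi> b = \<pi> e" using B(2)[of e] by (metis imageE)
    qed
    then obtain b where b: "\<And>e. e \<in> E \<Longrightarrow> b e \<in> B" "\<And>e. e \<in> E \<Longrightarrow> \<pi> (b e) = \<pi> e"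
      using bchoice[of E "\<lambda>e b. b \<in> B \<and> \<pi> b = \<pi> e"] by blast
    have Bc: "B \<subseteq> carrier \<Gamma>" using B(1) by (simp add: normal_imp_subgroup subgroup.subset)
    have Ec: "E \<subseteq> carrier \<Gamma>" using E(2) by (auto simp: kernel_def)
    let ?Z = "(\<lambda>e. e \<otimes>\<^bsub>\<Gamma>\<^esub> inv\<^bsub>\<Gamma>\<^esub> (b e)) ` E"
    have bc: "b e \<in> carrier \<Gamma>" "e \<in> carrier \<Gamma>" if "e \<in> E" for e using b Bc Ec that by blast+
    have "?Z \<subseteq> kernel \<Gamma> P \<pi>"
      using bc b by (auto simp: kernel_def)
    moreover have "\<forall>e\<in>E. e = (e \<otimes>\<^bsub>\<Gamma>\<^esub> inv\<^bsub>\<Gamma>\<^esub> (b e)) \<otimes>\<^bsub>\<Gamma>\<^esub> b e"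
      using bc by (simp add: \<pi>.G.m_assoc)
    then have "\<forall>e\<in>E. \<exists>z\<in>?Z. \<exists>b\<in>B. e = z \<otimes>\<^bsub>\<Gamma>\<^esub> b"
      using b by blast
    moreover have "{g \<in> carrier \<Gamma>. p (\<pi> g) = \<one>\<^bsub>H\<^esub>} = normal_closure \<Gamma> E"
      using E(3) by (simp add: kernel_def)
    ultimately show ?thesis using E(1) Ec by (meson finite_imageI)
  qed
  obtain E1 Z1 where E1: "finite Z1" "E1 \<subseteq> carrier \<Gamma>" "Z1 \<subseteq> kernel \<Gamma> P \<pi>"
      "{g \<in> carrier \<Gamma>. p1 (\<pi> g) = \<one>\<^bsub>G1\<^esub>} = normal_closure \<Gamma> E1"
      "\<forall>e\<in>E1. \<exists>z\<in>Z1. \<exists>b\<in>B. e = z \<otimes>\<^bsub>\<Gamma>\<^esub> b"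
    using one_side[OF assms(3) fp(2) p1 onto(1) B] by blast
  obtain E2 Z2 where E2: "finite Z2" "E2 \<subseteq> carrier \<Gamma>" "Z2 \<subseteq> kernel \<Gamma> P \<pi>"
      "{g \<in> carrier \<Gamma>. p2 (\<pi> g) = \<one>\<^bsub>G2\<^esub>} = normal_closure \<Gamma> E2"
      "\<forall>e\<in>E2. \<exists>z\<in>Z2. \<exists>a\<in>A. e = z \<otimes>\<^bsub>\<Gamma>\<^esub> a"
    using one_side[OF assms(4) fp(3) p2 onto(2) A] by blast
  define Y where "Y = normal_closure \<Gamma> (Z1 \<union> Z2)"
  have Zc: "Z1 \<union> Z2 \<subseteq> carrier \<Gamma>" using E1(3) E2(3) by (auto simp: kernel_def)
  have Y: "Y \<lhd> \<Gamma>" unfolding Y_def by (rule \<pi>.G.normal_closure_normal[OF Zc])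
  interpret Y: normal Y \<Gamma> by (rule Y)
  have ZY: "Z1 \<union> Z2 \<subseteq> Y" unfolding Y_def by (rule normal_closure_superset)
  have Yk: "Y \<subseteq> kernel \<Gamma> P \<pi>"
    unfolding Y_def by (rule normal_closure_minimal[OF \<pi>.normal_kernel]) (use E1 E2 in blast)
  let ?\<Gamma>' = "\<Gamma> Mod Y" let ?q = "\<lambda>g. Y #>\<^bsub>\<Gamma>\<^esub> g"
  have grp: "group ?\<Gamma>'" by (rule Y.factorgroup_is_group)
  interpret q: group_hom \<Gamma> ?\<Gamma>' ?q
    using assms(1) grp Y.quotient_hom(1) by (simp add: group_hom_def group_hom_axioms_def)
  obtain \<pi>' where \<pi>': "\<pi>' \<in> hom ?\<Gamma>' P" "\<And>g. g \<in> carrier \<Gamma> \<Longrightarrow> \<pi>' (?q g) = \<pi> g"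
    using hom_factor[OF assms(1) grp assms(2) Y.quotient_hom(1,2) \<pi>] Yk Y.quotient_hom(3) by auto
  have fp': "finitely_presented ?\<Gamma>'"
  proof (rule finitely_presented_quotient[OF assms(1) grp fp(1) Y.quotient_hom(1,2) _ Zc])
    show "finite (Z1 \<union> Z2)" using E1(1) E2(1) by simp
    show "kernel \<Gamma> ?\<Gamma>' ?q \<subseteq> normal_closure \<Gamma> (Z1 \<union> Z2)"
      unfolding Y.quotient_hom(3) by (simp add: Y_def)
    show "Z1 \<union> Z2 \<subseteq> kernel \<Gamma> ?\<Gamma>' ?q"
      unfolding Y.quotient_hom(3) by (rule ZY)
  qed
  have ker: "g \<in> ?q ` B" if H: "normal_closure \<Gamma> E = {g \<in> carrier \<Gamma>. p (\<pi> g) = \<one>\<^bsub>H\<^esub>}" "E \<subseteq> carrier \<Gamma>"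
      and EZ: "\<forall>e\<in>E. \<exists>z\<in>Z. \<exists>b\<in>B. e = z \<otimes>\<^bsub>\<Gamma>\<^esub> b" "Z \<subseteq> Y" and B: "B \<lhd> \<Gamma>"
      and g: "g \<in> carrier ?\<Gamma>'" "p (\<pi>' g) = \<one>\<^bsub>H\<^esub>"
    for H :: "('x, 'y) monoid_scheme" and p B E Z g
  proof -
    have "?q ` E \<subseteq> ?q ` B"
    proof
      fix y assume "y \<in> ?q ` E"
      then obtain e where e: "e \<in> E" "y = ?q e" by (rule imageE)
      from bspec[OF EZ(1) e(1)] obtain z b where "z \<in> Z" "b \<in> B" "e = z \<otimes>\<^bsub>\<Gamma>\<^esub> b"
        by (elim bexE)
      then have zb: "z \<in> Y" "b \<in> B" "y = ?q (z \<otimes>\<^bsub>\<Gamma>\<^esub> b)" using EZ(2) e(2) by auto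
      have c: "z \<in> carrier \<Gamma>" "b \<in> carrier \<Gamma>"
        using zb(1) subgroup.mem_carrier[OF normal_imp_subgroup[OF B] zb(2)] by simp_all
      have "?q z = \<one>\<^bsub>?\<Gamma>'\<^esub>"
        using zb(1) Y.quotient_hom(3) unfolding kernel_def by blast
      then have "y = ?q b" unfolding zb(3) q.hom_mult[OF c] using q.H.l_one[OF q.hom_closed[OF c(2)]] by simp
      then show "y \<in> ?q ` B" using zb(2) by (simp only: imageI)
    qed
    moreover have "?q ` B \<lhd> ?\<Gamma>'"
      by (rule normal.surj_hom_normal_subgroup[OF B q.group_hom_axioms Y.quotient_hom(2)])
    ultimately have sub: "?q ` normal_closure \<Gamma> E \<subseteq> ?q ` B"
      by (intro q.normal_closure_image H(2))
    obtain \<gamma> where \<gamma>: "\<gamma> \<in> carrier \<Gamma>" "g = ?q \<gamma>"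
      using g(1) unfolding Y.quotient_hom(2)[symmetric] by (rule imageE) blast
    then have "\<gamma> \<in> normal_closure \<Gamma> E" using g(2) \<pi>'(2) H(1) by simp
    then show ?thesis using subsetD[OF sub imageI] \<gamma>(2) by simp
  qed
  show ?thesis
  proof (rule that[OF grp fp' Y.quotient_hom(1,2) \<pi>'])
    show "g \<in> ?q ` A" if "g \<in> carrier ?\<Gamma>'" "p2 (\<pi>' g) = \<one>\<^bsub>G2\<^esub>" for g
      using ker[OF E2(4)[symmetric] E2(2) E2(5) _ A(1) that] ZY by blast
    show "g \<in> ?q ` B" if "g \<in> carrier ?\<Gamma>'" "p1 (\<pi>' g) = \<one>\<^bsub>G1\<^esub>" for g
      using ker[OF E1(4)[symmetric] E1(2) E1(5) _ B(1) that] ZY by blast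
  qed auto
qed

section \<open>Extensions by the integers\<close>

lemma (in group) automorphism_powers:
  assumes \<theta>: "\<theta> \<in> hom G G" "bij_betw \<theta> (carrier G) (carrier G)"
  obtains pw :: "int \<Rightarrow> 'a \<Rightarrow> 'a" where "\<And>i. pw i \<in> hom G G"
    "\<And>h. h \<in> carrier G \<Longrightarrow> pw 0 h = h" "\<And>h. h \<in> carrier G \<Longrightarrow> pw 1 h = \<theta> h"
    "\<And>i j h. h \<in> carrier G \<Longrightarrow> pw (i + j) h = pw i (pw j h)"
proof -
  let ?A = "AutoGroup G"
  let ?t = "restrict \<theta> (carrier G)"
  interpret A: group ?A by (rule AutoGroup)
  have t: "?t \<in> carrier ?A"
    using \<theta>(2) hom_restrict[OF \<theta>(1), of ?t]
    by (auto simp: AutoGroup_def auto_def Bij_def bij_betw_restrict_eq)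
  define pw where "pw = (\<lambda>i::int. ?t [^]\<^bsub>?A\<^esub> i)"
  have pc: "pw i \<in> carrier ?A" for i using t by (simp add: pw_def)
  have hom: "pw i \<in> hom G G" and Bij: "pw i \<in> Bij (carrier G)" for i
    using pc[of i] by (auto simp: AutoGroup_def auto_def)
  have mult: "(f \<otimes>\<^bsub>?A\<^esub> g) h = f (g h)" if "f \<in> Bij (carrier G)" "g \<in> Bij (carrier G)" "h \<in> carrier G" for f g h
    using that by (simp add: AutoGroup_def BijGroup_def compose_def)
  show ?thesis
  proof (rule that[of pw])
    show "pw 0 h = h" if "h \<in> carrier G" for h
      using that by (simp add: pw_def AutoGroup_def BijGroup_def)
    show "pw 1 h = \<theta> h" if "h \<in> carrier G" for h
      using that A.int_pow_1[OF t] by (simp add: pw_def)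
    show "pw (i + j) h = pw i (pw j h)" if "h \<in> carrier G" for i j h
      using mult[OF Bij Bij that, of i j] A.int_pow_mult[OF t, of i j] by (simp add: pw_def)
  qed (rule hom)
qed

definition int_semidirect :: "('a, 'c) monoid_scheme \<Rightarrow> (int \<Rightarrow> 'a \<Rightarrow> 'a) \<Rightarrow> ('a \<times> int) monoid" where
  "int_semidirect G pw = \<lparr>carrier = carrier G \<times> UNIV,
     monoid.mult = (\<lambda>(g, i) (h, j). (g \<otimes>\<^bsub>G\<^esub> pw i h, i + j)), one = (\<one>\<^bsub>G\<^esub>, 0)\<rparr>"

locale automorphism_action = group G for G (structure) +
  fixes pw :: "int \<Rightarrow> 'a \<Rightarrow> 'a"
  assumes pw_hom: "\<And>i. pw i \<in> hom G G"
    and pw_0: "\<And>h. h \<in> carrier G \<Longrightarrow> pw 0 h = h"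
    and pw_add: "\<And>i j h. h \<in> carrier G \<Longrightarrow> pw (i + j) h = pw i (pw j h)"
begin

abbreviation E where "E \<equiv> int_semidirect G pw"

lemma pw_closed [simp]: "h \<in> carrier G \<Longrightarrow> pw i h \<in> carrier G"
  by (rule hom_in_carrier[OF pw_hom])

lemma pw_mult: "g \<in> carrier G \<Longrightarrow> h \<in> carrier G \<Longrightarrow> pw i (g \<otimes> h) = pw i g \<otimes> pw i h"
  by (rule hom_mult[OF pw_hom])

lemma pw_one [simp]: "pw i \<one> = \<one>"
  using hom_one[OF pw_hom is_group is_group] .

lemma E_simps [simp]:
  "carrier E = carrier G \<times> UNIV" "(g, i) \<otimes>\<^bsub>E\<^esub> (h, j) = (g \<otimes> pw i h, i + j)" "\<one>\<^bsub>E\<^esub> = (\<one>, 0)"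
  by (simp_all add: int_semidirect_def)

lemma group_E: "group E"
proof (rule groupI)
  fix a b c assume "a \<in> carrier E" "b \<in> carrier E" "c \<in> carrier E"
  then show "a \<otimes>\<^bsub>E\<^esub> b \<otimes>\<^bsub>E\<^esub> c = a \<otimes>\<^bsub>E\<^esub> (b \<otimes>\<^bsub>E\<^esub> c)"
    by (cases a; cases b; cases c) (simp add: pw_mult pw_add m_assoc)
next
  fix a assume "a \<in> carrier E"
  then obtain g i where a: "a = (g, i)" "g \<in> carrier G" by auto
  have "pw (- i) (inv g) \<otimes> pw (- i) g = \<one>"
    using a by (simp add: pw_mult[symmetric])
  then show "\<exists>b\<in>carrier E. b \<otimes>\<^bsub>E\<^esub> a = \<one>\<^bsub>E\<^esub>"
    using a by (intro bexI[of _ "(pw (- i) (inv g), - i)"]) simp_all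
qed (auto simp: pw_0)

lemma inv_E:
  assumes "g \<in> carrier G"
  shows "inv\<^bsub>E\<^esub> (g, i) = (pw (- i) (inv g), - i)"
proof -
  interpret E: group E by (rule group_E)
  have "pw (- i) (inv g) \<otimes> pw (- i) g = \<one>"
    using assms by (simp add: pw_mult[symmetric])
  then show ?thesis
    using assms by (intro E.inv_equality) simp_all
qed

lemma conj_E:
  assumes "g \<in> carrier G" "h \<in> carrier G"
  shows "(g, i) \<otimes>\<^bsub>E\<^esub> (h, 0) \<otimes>\<^bsub>E\<^esub> inv\<^bsub>E\<^esub> (g, i) = (g \<otimes> pw i h \<otimes> inv g, 0)"
  using assms by (simp add: inv_E pw_add[symmetric] pw_0)

lemma finitely_generated_E:
  assumes "finitely_generated G"
  shows "finitely_generated E"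
proof -
  interpret E: group E by (rule group_E)
  obtain S where S: "finite S" "S \<subseteq> carrier G" "generate G S = carrier G"
    using assms unfolding finitely_generated_def by blast
  let ?S = "insert (\<one>, 1) ((\<lambda>s. (s, 0)) ` S)"
  have Sc: "?S \<subseteq> carrier E" using S by auto
  note sub = E.generate_is_subgroup[OF Sc]
  have t: "(\<one>, 1) \<in> generate E ?S" by (rule generate.incl) simp
  have 1: "(g, 0) \<in> generate E ?S" if "g \<in> generate G S" for g
    using that
  proof (induction rule: generate.induct)
    case one
    then show ?case using generate.one[of E ?S] by simp
  next
    case (incl h)
    then show ?case by (intro generate.incl) simp
  next
    case (inv h)
    then have "inv\<^bsub>E\<^esub> (h, 0) \<in> generate E ?S" by (intro generate.inv) simp
    then show ?case using inv S by (auto simp: inv_E pw_0)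
  next
    case (eng g h)
    then have "g \<in> carrier G" "h \<in> carrier G" using S by auto
    then show ?case using generate.eng[OF eng.IH] by (simp add: pw_0)
  qed
  have 2: "(\<one>, int n) \<in> generate E ?S" for n
  proof (induction n)
    case 0
    then show ?case using generate.one[of E ?S] by simp
  next
    case (Suc n)
    then show ?case using generate.eng[OF Suc t] by (simp add: add.commute)
  qed
  have 3: "(\<one>, i) \<in> generate E ?S" for i
  proof (cases "0 \<le> i")
    case True
    then show ?thesis using 2[of "nat i"] by simp
  next
    case False
    then show ?thesis using subgroup.m_inv_closed[OF sub 2[of "nat (- i)"]] by (simp add: inv_E)
  qed
  have "(g, i) \<in> generate E ?S" if "g \<in> carrier G" for g i
    using generate.eng[OF 1 3, of g i] that S(3) by (simp add: pw_0)
  then have "generate E ?S = carrier E"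
    using E.generate_incl[OF Sc] by auto
  then show ?thesis
    unfolding finitely_generated_def using S(1) Sc by (meson finite.insertI finite_imageI)
qed

end

text \<open>The semidirect product of \<int> with a suitable finitely presented quotient
  \<open>\<Gamma>1\<close> of \<open>\<Gamma>\<close> maps onto \<open>P\<close>. Finite
  presentability of \<open>P\<close> makes the kernel of this map the normal closure of a finite
  set; it is at the same time the kernel of \<open>\<Gamma>1\<close> over the kernel of
  \<open>\<chi>\<close>. On it the automorphism is conjugation by an element of
  \<open>\<Gamma>1\<close>, which is why the same finite set generates it normally in
  \<open>\<Gamma>1\<close> already.\<close>

theorem finitely_presented_character_kernel:
  fixes \<chi> :: "'p \<Rightarrow> int" and P :: "('p, 'q) monoid_scheme"
  assumes "group \<Gamma>" "group P" "group G1" "group G2"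
    and fp: "finitely_presented \<Gamma>" "finitely_presented P"
    and \<pi>: "\<pi> \<in> hom \<Gamma> P" and p1: "p1 \<in> hom P G1" and p2: "p2 \<in> hom P G2"
    and inj: "\<And>p. p \<in> carrier P \<Longrightarrow> p1 p = \<one>\<^bsub>G1\<^esub> \<Longrightarrow> p2 p = \<one>\<^bsub>G2\<^esub> \<Longrightarrow> p = \<one>\<^bsub>P\<^esub>"
    and \<chi>: "\<And>p q. p \<in> carrier P \<Longrightarrow> q \<in> carrier P \<Longrightarrow> \<chi> (p \<otimes>\<^bsub>P\<^esub> q) = \<chi> p + \<chi> q"
    and img: "\<pi> ` carrier \<Gamma> = {p \<in> carrier P. \<chi> p = 0}"
    and R: "finite R" "R \<subseteq> carrier \<Gamma>"
    and B: "B \<lhd> \<Gamma>" "\<And>a b. a \<in> normal_closure \<Gamma> R \<Longrightarrow> b \<in> B \<Longrightarrow> commute \<Gamma> a b"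
    and kerA: "\<And>g. g \<in> carrier \<Gamma> \<Longrightarrow> p2 (\<pi> g) = \<one>\<^bsub>G2\<^esub> \<Longrightarrow> g \<in> normal_closure \<Gamma> R"
    and imA: "\<And>g. g \<in> normal_closure \<Gamma> R \<Longrightarrow> p2 (\<pi> g) = \<one>\<^bsub>G2\<^esub>"
    and kerB: "\<And>g. g \<in> carrier \<Gamma> \<Longrightarrow> p1 (\<pi> g) = \<one>\<^bsub>G1\<^esub> \<Longrightarrow> g \<in> B"
    and x0: "x0 \<in> carrier P" "p2 x0 = \<one>\<^bsub>G2\<^esub>" "\<chi> x0 = 1"
    and y0: "y0 \<in> carrier P" "p1 y0 = \<one>\<^bsub>G1\<^esub>" "\<chi> y0 = - 1"
  shows "finitely_presented (P\<lparr>carrier := {p \<in> carrier P. \<chi> p = 0}\<rparr>)"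
proof -
  interpret \<pi>: group_hom \<Gamma> P \<pi>
    using assms by (simp add: group_hom_def group_hom_axioms_def)
  interpret p1: group_hom P G1 p1
    using assms by (simp add: group_hom_def group_hom_axioms_def)
  interpret p2: group_hom P G2 p2
    using assms by (simp add: group_hom_def group_hom_axioms_def)
  let ?A = "normal_closure \<Gamma> R"
  have A: "?A \<lhd> \<Gamma>" by (rule \<pi>.G.normal_closure_normal[OF R(2)])
  interpret A: normal ?A \<Gamma> by (rule A)
  interpret B: normal B \<Gamma> by (rule B(1))
  have \<chi>1: "\<chi> \<one>\<^bsub>P\<^esub> = 0" using \<chi>[of "\<one>\<^bsub>P\<^esub>" "\<one>\<^bsub>P\<^esub>"] by simp
  have \<chi>inv: "\<chi> (inv\<^bsub>P\<^esub> p) = - \<chi> p" if "p \<in> carrier P" for p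
    using \<chi>[of p "inv\<^bsub>P\<^esub> p"] that \<chi>1 by simp
  have \<chi>\<pi>: "\<chi> (\<pi> g) = 0" if "g \<in> carrier \<Gamma>" for g
    using imageI[OF that, of \<pi>] unfolding img by simp
  have lift: "\<exists>g. g \<in> carrier \<Gamma> \<and> \<pi> g = p" if "p \<in> carrier P" "\<chi> p = 0" for p
  proof -
    have "p \<in> \<pi> ` carrier \<Gamma>" unfolding img using that by simp
    then show ?thesis by (elim imageE) blast
  qed
  have ker\<pi>: "g \<in> ?A" if "g \<in> kernel \<Gamma> P \<pi>" for g
    using that kerA[of g] by (simp add: kernel_def)
  let ?c = "conj_by P x0"
  have c_closed: "?c p \<in> carrier P" if "p \<in> carrier P" for p
    using that x0(1) by (simp add: conj_by_def)
  have \<chi>c: "\<chi> (conj_by P a p) = \<chi> p" if "p \<in> carrier P" "a \<in> carrier P" for p a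
    using that by (simp add: conj_by_def \<chi> \<chi>inv)
  \<comment> \<open>\<open>x0\<close> has no lift to \<open>\<Gamma>\<close>, because
    \<open>\<chi> x0 = 1\<close>. The factor \<open>y0\<close> corrects the value of
    \<open>\<chi>\<close> without changing conjugation on elements that are trivial in
    \<open>G2\<close>.\<close>
  obtain w where w: "w \<in> carrier \<Gamma>" "\<pi> w = x0 \<otimes>\<^bsub>P\<^esub> y0"
    using lift[of "x0 \<otimes>\<^bsub>P\<^esub> y0"] x0 y0 \<chi> by auto
  have y0_fix: "conj_by P y0 p = p" if p: "p \<in> carrier P" "p2 p = \<one>\<^bsub>G2\<^esub>" for p
  proof -
    let ?z = "conj_by P y0 p \<otimes>\<^bsub>P\<^esub> inv\<^bsub>P\<^esub> p"
    have "?z \<in> carrier P" "p1 ?z = \<one>\<^bsub>G1\<^esub>" "p2 ?z = \<one>\<^bsub>G2\<^esub>"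
      using p y0 by (simp_all add: conj_by_def)
    then have "?z = \<one>\<^bsub>P\<^esub>" using inj by blast
    then have "?z \<otimes>\<^bsub>P\<^esub> p = p" using p by simp
    then show ?thesis using p y0 by (simp add: \<pi>.H.m_assoc)
  qed
  have \<pi>wa: "\<pi> (conj_by \<Gamma> w a) = ?c (\<pi> a)" if "a \<in> ?A" for a
  proof -
    have a: "a \<in> carrier \<Gamma>" "\<pi> a \<in> carrier P" "p2 (\<pi> a) = \<one>\<^bsub>G2\<^esub>"
      using that imA by simp_all
    have "\<pi> (conj_by \<Gamma> w a) = conj_by P (x0 \<otimes>\<^bsub>P\<^esub> y0) (\<pi> a)"
      using a w by (simp add: conj_by_def)
    then show ?thesis
      using a x0 y0 y0_fix by (simp add: \<pi>.H.conj_by_mult)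
  qed
  obtain d :: nat and Rel \<phi> where Rel: "finite Rel" "Rel \<subseteq> carrier (free_group {..<d})"
    and \<phi>: "\<phi> \<in> hom (free_group {..<d}) \<Gamma>" "\<phi> ` carrier (free_group {..<d}) = carrier \<Gamma>"
      "kernel (free_group {..<d}) \<Gamma> \<phi> = normal_closure (free_group {..<d}) Rel"
    using fp(1) unfolding finitely_presented_iff[OF assms(1)] by blast
  let ?F = "free_group {..<d}"
  interpret \<phi>: group_hom ?F \<Gamma> \<phi>
    using assms(1) \<phi>(1) group_free_group by (simp add: group_hom_def group_hom_axioms_def)
  have "\<forall>i. \<exists>g. i < d \<longrightarrow> g \<in> carrier \<Gamma> \<and> \<pi> g = ?c (\<pi> (\<phi> (free_gen i)))"
  proof (intro allI)
    fix i
    show "\<exists>g. i < d \<longrightarrow> g \<in> carrier \<Gamma> \<and> \<pi> g = ?c (\<pi> (\<phi> (free_gen i)))"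
    proof (cases "i < d")
      case True
      then have "\<phi> (free_gen i) \<in> carrier \<Gamma>" using free_gen_closed[of i "{..<d}"] by simp
      then show ?thesis
        using lift[of "?c (\<pi> (\<phi> (free_gen i)))"] c_closed \<chi>c \<chi>\<pi> x0(1) by simp
    qed simp
  qed
  then obtain gen where gen: "\<And>i. i < d \<Longrightarrow> gen i \<in> carrier \<Gamma>"
    "\<And>i. i < d \<Longrightarrow> \<pi> (gen i) = ?c (\<pi> (\<phi> (free_gen i)))"
    by metis
  let ?\<theta>F = "word_val \<Gamma> gen"
  have \<theta>F: "?\<theta>F \<in> hom ?F \<Gamma>"
    by (rule \<pi>.G.word_val_hom) (use gen(1) in auto)
  interpret \<theta>F: group_hom ?F \<Gamma> ?\<theta>F
    using assms(1) \<theta>F group_free_group by (simp add: group_hom_def group_hom_axioms_def)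
  have c_hom: "?c \<in> hom P P"
    by (rule homI) (use x0(1) in \<open>simp_all add: \<pi>.H.conj_by_mult_right\<close>)
  interpret c: group_hom P P ?c
    using assms(2) c_hom by (simp add: group_hom_def group_hom_axioms_def)
  have \<pi>\<theta>F: "\<pi> (?\<theta>F f) = ?c (\<pi> (\<phi> f))" if f: "f \<in> carrier ?F" for f
  proof -
    have set_f: "snd ` set f \<subseteq> {..<d}" using f by (auto simp: free_group_def)
    have gens: "\<forall>l\<in>set f. free_gen (snd l) \<in> carrier ?F"
      using set_f free_gen_closed[of _ "{..<d}"] by (auto simp: image_subset_iff)
    have "\<pi> (?\<theta>F f) = word_val P (\<pi> \<circ> gen) f"
      by (rule \<pi>.word_val_image) (use gen set_f in \<open>auto simp: image_subset_iff\<close>)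
    also have "\<dots> = word_val P (?c \<circ> (\<pi> \<circ> (\<phi> \<circ> free_gen))) f"
      using set_f
    proof (induction f)
      case (Cons l f)
      then show ?case using gen by (auto simp: letter_val_def)
    qed simp
    also have "\<dots> = ?c (word_val P (\<pi> \<circ> (\<phi> \<circ> free_gen)) f)"
      by (rule c.word_val_image[symmetric]) (use gens in auto)
    also have "word_val P (\<pi> \<circ> (\<phi> \<circ> free_gen)) f = \<pi> (word_val \<Gamma> (\<phi> \<circ> free_gen) f)"
      by (rule \<pi>.word_val_image[symmetric]) (use gens in auto)
    also have "word_val \<Gamma> (\<phi> \<circ> free_gen) f = \<phi> (word_val ?F free_gen f)"
      by (rule \<phi>.word_val_image[symmetric]) (rule gens)
    finally show ?thesis using word_val_free_gen[OF f] by simp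
  qed
  have lift\<phi>: "\<exists>f. f \<in> carrier ?F \<and> \<phi> f = g" if "g \<in> carrier \<Gamma>" for g
    using that unfolding \<phi>(2)[symmetric] by (elim imageE) blast
  then obtain s where s: "\<And>g. g \<in> carrier \<Gamma> \<Longrightarrow> s g \<in> carrier ?F" "\<And>g. g \<in> carrier \<Gamma> \<Longrightarrow> \<phi> (s g) = g"
    by metis
  \<comment> \<open>The first relators make the lift of conjugation by \<open>x0\<close> well
    defined on \<open>\<Gamma>\<close>; the others make it agree with conjugation by
    \<open>w\<close> on \<open>R\<close>. They lie in the kernel of \<open>\<pi>\<close>, as both
    maps lift conjugation by \<open>x0\<close>.\<close>
  define Y0 where "Y0 = ?\<theta>F ` Rel \<union> (\<lambda>r. ?\<theta>F (s r) \<otimes>\<^bsub>\<Gamma>\<^esub> inv\<^bsub>\<Gamma>\<^esub> (conj_by \<Gamma> w r)) ` R"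
  have Rel_ker: "\<phi> f = \<one>\<^bsub>\<Gamma>\<^esub>" if "f \<in> Rel" for f
    using normal_closure_superset[of Rel ?F] that unfolding \<phi>(3)[symmetric] kernel_def by blast
  have RA: "r \<in> ?A" if "r \<in> R" for r using normal_closure_superset[of R \<Gamma>] that by blast
  have Y0_ker: "Y0 \<subseteq> kernel \<Gamma> P \<pi>"
  proof
    fix y assume "y \<in> Y0"
    then consider f where "f \<in> Rel" "y = ?\<theta>F f"
      | r where "r \<in> R" "y = ?\<theta>F (s r) \<otimes>\<^bsub>\<Gamma>\<^esub> inv\<^bsub>\<Gamma>\<^esub> (conj_by \<Gamma> w r)"
      unfolding Y0_def by blast
    then show "y \<in> kernel \<Gamma> P \<pi>"
    proof cases
      case 1
      then have "f \<in> carrier ?F" using Rel(2) by blast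
      then show ?thesis using 1 Rel_ker[OF 1(1)] \<pi>\<theta>F by (simp add: kernel_def)
    next
      case 2
      have r: "r \<in> carrier \<Gamma>" using 2 R(2) by blast
      then show ?thesis
        using 2 s[OF r] \<pi>\<theta>F[OF s(1)[OF r]] \<pi>wa[OF RA[OF 2(1)]] w(1) c_closed by (simp add: kernel_def)
    qed
  qed
  then have Y0c: "Y0 \<subseteq> carrier \<Gamma>" by (auto simp: kernel_def)
  have "finite Y0" using Rel(1) R(1) by (simp add: Y0_def)
  define Y where "Y = normal_closure \<Gamma> Y0"
  have Y: "Y \<lhd> \<Gamma>" unfolding Y_def by (rule \<pi>.G.normal_closure_normal[OF Y0c])
  interpret Y: normal Y \<Gamma> by (rule Y)
  have Y0Y: "Y0 \<subseteq> Y" unfolding Y_def by (rule normal_closure_superset)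
  have Yk: "Y \<subseteq> kernel \<Gamma> P \<pi>"
    unfolding Y_def by (rule normal_closure_minimal[OF \<pi>.normal_kernel Y0_ker])
  note one_FactGroup [simp del] mult_FactGroup [simp del]
  let ?\<Gamma>1 = "\<Gamma> Mod Y"
  define q where "q = (\<lambda>g. Y #>\<^bsub>\<Gamma>\<^esub> g)"
  note quot = Y.quotient_hom[folded q_def]
  have grp1: "group ?\<Gamma>1" by (rule Y.factorgroup_is_group)
  interpret q: group_hom \<Gamma> ?\<Gamma>1 q
    using assms(1) grp1 quot(1) by (simp add: group_hom_def group_hom_axioms_def)
  have qY: "q y = \<one>\<^bsub>?\<Gamma>1\<^esub>" if "y \<in> Y" for y
    using that quot(3) unfolding kernel_def by blast
  have fp1: "finitely_presented ?\<Gamma>1"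
  proof (rule finitely_presented_quotient[OF assms(1) grp1 fp(1) quot(1,2) \<open>finite Y0\<close> Y0c])
    show "kernel \<Gamma> ?\<Gamma>1 q \<subseteq> normal_closure \<Gamma> Y0" unfolding quot(3) by (simp add: Y_def)
    show "Y0 \<subseteq> kernel \<Gamma> ?\<Gamma>1 q" unfolding quot(3) by (rule Y0Y)
  qed
  obtain \<pi>1 where \<pi>1: "\<pi>1 \<in> hom ?\<Gamma>1 P" "\<And>g. g \<in> carrier \<Gamma> \<Longrightarrow> \<pi>1 (q g) = \<pi> g"
    using hom_factor[OF assms(1) grp1 assms(2) quot(1,2) \<pi>] Yk unfolding quot(3) by blast
  interpret \<pi>1: group_hom ?\<Gamma>1 P \<pi>1
    using assms(2) grp1 \<pi>1(1) by (simp add: group_hom_def group_hom_axioms_def)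
  have liftq: "\<exists>g. g \<in> carrier \<Gamma> \<and> q g = h" if "h \<in> carrier ?\<Gamma>1" for h
    using that unfolding quot(2)[symmetric] by (elim imageE) blast
  obtain \<theta>1 where \<theta>1: "\<theta>1 \<in> hom \<Gamma> ?\<Gamma>1" "\<And>f. f \<in> carrier ?F \<Longrightarrow> \<theta>1 (\<phi> f) = q (?\<theta>F f)"
  proof -
    have comp: "q \<circ> ?\<theta>F \<in> hom ?F ?\<Gamma>1" by (rule hom_compose[OF \<theta>F quot(1)])
    interpret q\<theta>: group_hom ?F ?\<Gamma>1 "q \<circ> ?\<theta>F"
      using comp grp1 group_free_group by (simp add: group_hom_def group_hom_axioms_def)
    have "Rel \<subseteq> kernel ?F ?\<Gamma>1 (q \<circ> ?\<theta>F)"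
    proof
      fix f assume f: "f \<in> Rel"
      then have "?\<theta>F f \<in> Y" using Y0Y unfolding Y0_def by blast
      then show "f \<in> kernel ?F ?\<Gamma>1 (q \<circ> ?\<theta>F)"
        using subsetD[OF Rel(2) f] by (simp only: kernel_def mem_Collect_eq o_apply qY)
    qed
    then have "kernel ?F \<Gamma> \<phi> \<subseteq> kernel ?F ?\<Gamma>1 (q \<circ> ?\<theta>F)"
      unfolding \<phi>(3) by (rule normal_closure_minimal[OF q\<theta>.normal_kernel])
    then show ?thesis
      using hom_factor[OF group_free_group assms(1) grp1 \<phi>(1,2) comp] that by (metis o_apply)
  qed
  interpret \<theta>1: group_hom \<Gamma> ?\<Gamma>1 \<theta>1
    using assms(1) grp1 \<theta>1(1) by (simp add: group_hom_def group_hom_axioms_def)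
  have \<pi>1\<theta>1: "\<pi>1 (\<theta>1 g) = ?c (\<pi> g)" if g: "g \<in> carrier \<Gamma>" for g
    using \<theta>1(2)[OF s(1)[OF g]] \<pi>1(2) \<pi>\<theta>F[OF s(1)[OF g]] s[OF g] by simp
  let ?w = "conj_by \<Gamma> w"
  have \<theta>1A: "\<theta>1 a = q (?w a)" if "a \<in> ?A" for a
  proof -
    let ?M = "{a \<in> ?A. \<theta>1 a = q (?w a)}"
    have Ac: "a \<in> carrier \<Gamma>" if "a \<in> ?A" for a using that by simp
    have "?M \<lhd> \<Gamma>"
      unfolding \<pi>.G.normal_inv_iff
    proof (intro conjI ballI)
      show "subgroup ?M \<Gamma>"
      proof (rule \<pi>.G.subgroupI)
        show "?M \<noteq> {}" using A.one_closed w(1) by (auto intro!: exI[of _ "\<one>\<^bsub>\<Gamma>\<^esub>"])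
      qed (use w(1) in \<open>auto simp: \<pi>.G.conj_by_inv_right \<pi>.G.conj_by_mult_right\<close>)
      fix \<gamma> a assume \<gamma>: "\<gamma> \<in> carrier \<Gamma>" and "a \<in> ?M"
      then have a: "a \<in> ?A" "\<theta>1 a = q (?w a)" by auto
      define g where "g = ?\<theta>F (s \<gamma>)"
      have g: "g \<in> carrier \<Gamma>" "\<theta>1 \<gamma> = q g" "\<pi> g = ?c (\<pi> \<gamma>)"
        using \<theta>1(2)[OF s(1)[OF \<gamma>]] \<pi>\<theta>F[OF s(1)[OF \<gamma>]] s[OF \<gamma>] by (simp_all add: g_def)
      \<comment> \<open>\<open>b\<close> is determined by \<open>g w = w b \<gamma>\<close>. In the
        first factor \<open>w\<close> becomes \<open>x0\<close> and \<open>g\<close> the conjugate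
        of \<open>\<gamma>\<close> by \<open>x0\<close>, so that \<open>b\<close> becomes trivial
        there and lies in \<open>B\<close>. It therefore centralises the closure of
        \<open>R\<close>, and the agreement with conjugation by \<open>w\<close> passes from
        \<open>a\<close> to its conjugate by \<open>\<gamma>\<close>.\<close>
      define b where "b = inv\<^bsub>\<Gamma>\<^esub> w \<otimes>\<^bsub>\<Gamma>\<^esub> g \<otimes>\<^bsub>\<Gamma>\<^esub> w \<otimes>\<^bsub>\<Gamma>\<^esub> inv\<^bsub>\<Gamma>\<^esub> \<gamma>"
      have bc: "b \<in> carrier \<Gamma>" using w(1) g(1) \<gamma> by (simp add: b_def)
      have "p1 (\<pi> b) = \<one>\<^bsub>G1\<^esub>"
        using w g(1,3) \<gamma> x0(1) y0(1,2) by (simp add: b_def conj_by_def p1.H.word_simps)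
      then have b: "b \<in> B" by (rule kerB[OF bc])
      have \<gamma>a: "conj_by \<Gamma> \<gamma> a \<in> ?A"
        unfolding conj_by_def by (rule A.inv_op_closed2[OF \<gamma> a(1)])
      have "g \<otimes>\<^bsub>\<Gamma>\<^esub> w = w \<otimes>\<^bsub>\<Gamma>\<^esub> (b \<otimes>\<^bsub>\<Gamma>\<^esub> \<gamma>)"
        using w(1) g(1) \<gamma> by (simp add: b_def \<pi>.G.word_simps)
      then have "conj_by \<Gamma> (g \<otimes>\<^bsub>\<Gamma>\<^esub> w) a = ?w (conj_by \<Gamma> b (conj_by \<Gamma> \<gamma> a))"
        using w(1) g(1) \<gamma> bc Ac[OF a(1)] by (simp add: \<pi>.G.conj_by_mult)
      also have "conj_by \<Gamma> b (conj_by \<Gamma> \<gamma> a) = conj_by \<Gamma> \<gamma> a"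
        using B(2)[OF \<gamma>a b] bc Ac[OF \<gamma>a] by (intro \<pi>.G.conj_by_commute) (simp_all add: \<pi>.G.commute_sym)
      finally have "q (conj_by \<Gamma> g (?w a)) = q (?w (conj_by \<Gamma> \<gamma> a))"
        using w(1) g(1) Ac[OF a(1)] by (simp add: \<pi>.G.conj_by_mult)
      moreover have "\<theta>1 (conj_by \<Gamma> \<gamma> a) = q (conj_by \<Gamma> g (?w a))"
        using \<gamma> Ac[OF a(1)] a(2) g w(1) by (simp add: conj_by_def)
      ultimately show "\<gamma> \<otimes>\<^bsub>\<Gamma>\<^esub> a \<otimes>\<^bsub>\<Gamma>\<^esub> inv\<^bsub>\<Gamma>\<^esub> \<gamma> \<in> ?M"
        using \<gamma>a by (simp add: conj_by_def)
    qed
    moreover have "R \<subseteq> ?M"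
    proof
      fix r assume r: "r \<in> R"
      then have rc: "r \<in> carrier \<Gamma>" using R(2) by blast
      have "?\<theta>F (s r) \<otimes>\<^bsub>\<Gamma>\<^esub> inv\<^bsub>\<Gamma>\<^esub> (?w r) \<in> Y" using Y0Y r unfolding Y0_def by blast
      then have "q (?\<theta>F (s r) \<otimes>\<^bsub>\<Gamma>\<^esub> inv\<^bsub>\<Gamma>\<^esub> (?w r)) = \<one>\<^bsub>?\<Gamma>1\<^esub>" by (rule qY)
      moreover have "?\<theta>F (s r) \<in> carrier \<Gamma>" "?w r \<in> carrier \<Gamma>"
        using s(1)[OF rc] rc w(1) by simp_all
      ultimately have "q (?\<theta>F (s r)) = q (?w r)"
        by (metis q.hom_mult q.hom_inv q.hom_closed q.H.inv_closed q.H.inv_equality q.H.inv_inv \<pi>.G.inv_closed)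
      then show "r \<in> ?M"
        using RA[OF r] \<theta>1(2)[OF s(1)[OF rc]] s(2)[OF rc] by simp
    qed
    ultimately show ?thesis using normal_closure_minimal that by blast
  qed
  have YA: "y \<in> ?A" if "y \<in> Y" for y using ker\<pi> Yk that by blast
  have wY: "?w y \<in> Y" if "y \<in> Y" for y
    unfolding conj_by_def by (rule Y.inv_op_closed2[OF w(1) that])
  \<comment> \<open>A single quotient is enough: \<open>Y\<close> lies in the closure of
    \<open>R\<close>, where \<open>\<theta>1\<close> is conjugation by \<open>w\<close>, and
    \<open>Y\<close> is normal. So the relators imposed on the target are respected by the
    source.\<close>
  have "kernel \<Gamma> ?\<Gamma>1 q \<subseteq> kernel \<Gamma> ?\<Gamma>1 \<theta>1"
  proof
    fix y assume "y \<in> kernel \<Gamma> ?\<Gamma>1 q"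
    then have y: "y \<in> Y" unfolding quot(3) .
    have "\<theta>1 y = \<one>\<^bsub>?\<Gamma>1\<^esub>" unfolding \<theta>1A[OF YA[OF y]] by (rule qY[OF wY[OF y]])
    then show "y \<in> kernel \<Gamma> ?\<Gamma>1 \<theta>1" using Y.mem_carrier[OF y] unfolding kernel_def by blast
  qed
  then obtain \<theta> where \<theta>: "\<theta> \<in> hom ?\<Gamma>1 ?\<Gamma>1" "\<And>g. g \<in> carrier \<Gamma> \<Longrightarrow> \<theta> (q g) = \<theta>1 g"
    using hom_factor[OF assms(1) grp1 grp1 quot(1,2) \<theta>1(1)] by blast
  interpret \<theta>: group_hom ?\<Gamma>1 ?\<Gamma>1 \<theta>
    using grp1 \<theta>(1) by (simp add: group_hom_def group_hom_axioms_def)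
  have \<pi>1\<theta>: "\<pi>1 (\<theta> h) = ?c (\<pi>1 h)" if "h \<in> carrier ?\<Gamma>1" for h
    using liftq[OF that] \<theta>(2) \<pi>1(2) \<pi>1\<theta>1 by metis
  have \<theta>A: "\<theta> (q a) = conj_by ?\<Gamma>1 (q w) (q a)" if "a \<in> ?A" for a
    using that w(1) \<theta>(2) \<theta>1A[OF that] by (simp add: conj_by_def)
  have ker\<pi>1: "\<exists>a\<in>?A. h = q a" if "h \<in> kernel ?\<Gamma>1 P \<pi>1" for h
  proof -
    have h: "h \<in> carrier ?\<Gamma>1" "\<pi>1 h = \<one>\<^bsub>P\<^esub>" using that unfolding kernel_def by blast+
    obtain g where g: "g \<in> carrier \<Gamma>" "q g = h" using liftq[OF h(1)] by blast
    then have "g \<in> kernel \<Gamma> P \<pi>" using h(2) \<pi>1(2)[OF g(1)] by (simp add: kernel_def)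
    then show ?thesis using ker\<pi> g(2) by blast
  qed
  have \<theta>ker: "\<theta> h = conj_by ?\<Gamma>1 (q w) h" if "h \<in> kernel ?\<Gamma>1 P \<pi>1" for h
    using ker\<pi>1[OF that] \<theta>A by blast
  have qw: "q w \<in> carrier ?\<Gamma>1" using w(1) by simp
  have ker_conj: "conj_by ?\<Gamma>1 g h \<in> kernel ?\<Gamma>1 P \<pi>1"
    if "h \<in> kernel ?\<Gamma>1 P \<pi>1" "g \<in> carrier ?\<Gamma>1" for g h
    using normal.inv_op_closed2[OF \<pi>1.normal_kernel that(2,1)] unfolding conj_by_def .
  have inj\<theta>: "h = \<one>\<^bsub>?\<Gamma>1\<^esub>" if h: "h \<in> carrier ?\<Gamma>1" "\<theta> h = \<one>\<^bsub>?\<Gamma>1\<^esub>" for h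
  proof -
    have "?c (\<pi>1 h) = \<one>\<^bsub>P\<^esub>" using \<pi>1\<theta>[OF h(1)] unfolding h(2) by simp
    then have "conj_by P (inv\<^bsub>P\<^esub> x0) (?c (\<pi>1 h)) = \<one>\<^bsub>P\<^esub>" using x0(1) by simp
    then have "\<pi>1 h = \<one>\<^bsub>P\<^esub>" using x0(1) h(1) by (simp add: \<pi>.H.conj_by_inv_cancel)
    then have "h \<in> kernel ?\<Gamma>1 P \<pi>1" using h(1) by (simp add: kernel_def)
    then have "conj_by ?\<Gamma>1 (inv\<^bsub>?\<Gamma>1\<^esub> (q w)) (conj_by ?\<Gamma>1 (q w) h) = \<one>\<^bsub>?\<Gamma>1\<^esub>"
      using \<theta>ker h(2) qw by simp
    then show ?thesis using q.H.conj_by_inv_cancel(2)[OF qw h(1)] by simp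
  qed
  have surj\<theta>: "\<exists>k. k \<in> carrier ?\<Gamma>1 \<and> \<theta> k = h" if h: "h \<in> carrier ?\<Gamma>1" for h
  proof -
    have "\<chi> (\<pi>1 h) = 0" using liftq[OF h] \<pi>1(2) \<chi>\<pi> by metis
    then obtain \<delta> where \<delta>: "\<delta> \<in> carrier \<Gamma>" "\<pi> \<delta> = conj_by P (inv\<^bsub>P\<^esub> x0) (\<pi>1 h)"
      using lift[of "conj_by P (inv\<^bsub>P\<^esub> x0) (\<pi>1 h)"] h x0(1) \<chi>c by auto
    have k1: "q \<delta> \<in> carrier ?\<Gamma>1" using \<delta>(1) by simp
    \<comment> \<open>\<open>\<theta> (q \<delta>)\<close> agrees with \<open>h\<close> up to this
      element of the kernel of \<open>\<pi>1\<close>, and on that kernel \<open>\<theta>\<close> is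
      conjugation by \<open>q w\<close>, hence invertible.\<close>
    define z where "z = inv\<^bsub>?\<Gamma>1\<^esub> (\<theta> (q \<delta>)) \<otimes>\<^bsub>?\<Gamma>1\<^esub> h"
    have zc: "z \<in> carrier ?\<Gamma>1" using h k1 unfolding z_def by (intro q.H.m_closed q.H.inv_closed \<theta>.hom_closed)
    have "\<pi>1 (\<theta> (q \<delta>)) = \<pi>1 h"
      using \<pi>1\<theta>[OF k1] \<pi>1(2)[OF \<delta>(1)] \<delta>(2) x0(1) h by (simp add: \<pi>.H.conj_by_inv_cancel)
    then have "\<pi>1 z = \<one>\<^bsub>P\<^esub>"
      unfolding z_def \<pi>1.hom_mult[OF q.H.inv_closed[OF \<theta>.hom_closed[OF k1]] h] \<pi>1.hom_inv[OF \<theta>.hom_closed[OF k1]]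
      using \<pi>1.hom_closed[OF h] by simp
    then have z: "z \<in> kernel ?\<Gamma>1 P \<pi>1" using zc by (simp add: kernel_def)
    let ?z' = "conj_by ?\<Gamma>1 (inv\<^bsub>?\<Gamma>1\<^esub> (q w)) z"
    have z': "?z' \<in> kernel ?\<Gamma>1 P \<pi>1" by (rule ker_conj[OF z q.H.inv_closed[OF qw]])
    then have z'c: "?z' \<in> carrier ?\<Gamma>1" by (simp add: kernel_def)
    have "\<theta> ?z' = z" unfolding \<theta>ker[OF z'] by (rule q.H.conj_by_inv_cancel(1)[OF qw zc])
    then have "\<theta> (q \<delta> \<otimes>\<^bsub>?\<Gamma>1\<^esub> ?z') = \<theta> (q \<delta>) \<otimes>\<^bsub>?\<Gamma>1\<^esub> z"
      using \<theta>.hom_mult[OF k1 z'c] by simp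
    also have "\<dots> = h"
      unfolding z_def by (rule q.H.inv_cancel_left[OF \<theta>.hom_closed[OF k1] h])
    finally show ?thesis using q.H.m_closed[OF k1 z'c] by blast
  qed
  have "bij_betw \<theta> (carrier ?\<Gamma>1) (carrier ?\<Gamma>1)"
    unfolding bij_betw_def
  proof
    show "inj_on \<theta> (carrier ?\<Gamma>1)"
      unfolding \<theta>.inj_on_one_iff using inj\<theta> by blast
    show "\<theta> ` carrier ?\<Gamma>1 = carrier ?\<Gamma>1"
      using surj\<theta> \<theta>.hom_closed by blast
  qed
  then obtain pw :: "int \<Rightarrow> _" where pw: "\<And>i. pw i \<in> hom ?\<Gamma>1 ?\<Gamma>1"
    "\<And>h. h \<in> carrier ?\<Gamma>1 \<Longrightarrow> pw 0 h = h" "\<And>h. h \<in> carrier ?\<Gamma>1 \<Longrightarrow> pw 1 h = \<theta> h"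
    "\<And>i j h. h \<in> carrier ?\<Gamma>1 \<Longrightarrow> pw (i + j) h = pw i (pw j h)"
    using q.H.automorphism_powers[OF \<theta>(1)] by metis
  interpret act: automorphism_action ?\<Gamma>1 pw
    by (rule automorphism_action.intro[OF grp1]) (simp add: automorphism_action_axioms_def pw)
  let ?E = "int_semidirect ?\<Gamma>1 pw"
  have \<pi>1pw: "\<pi>1 (pw i h) = conj_by P (x0 [^]\<^bsub>P\<^esub> i) (\<pi>1 h)" if "h \<in> carrier ?\<Gamma>1" for i h
    using that
  proof (induction i arbitrary: h rule: int_induct[of _ 0])
    case base
    then show ?case by (simp add: pw(2))
  next
    case (step1 i)
    have "\<pi>1 (pw (i + 1) h) = conj_by P (x0 [^]\<^bsub>P\<^esub> i) (?c (\<pi>1 h))"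
      using pw(4)[OF step1.prems, of i 1] step1.IH[OF act.pw_closed[OF step1.prems, of 1]]
        \<pi>1\<theta>[OF step1.prems] pw(3)[OF step1.prems] by simp
    then show ?case
      using step1.prems x0(1) by (simp add: \<pi>.H.conj_by_mult \<pi>.H.int_pow_mult)
  next
    case (step2 i)
    let ?h = "pw (- 1) h"
    have h: "?h \<in> carrier ?\<Gamma>1" "pw 1 ?h = h"
      using act.pw_closed[OF step2.prems] pw(4)[OF step2.prems, of 1 "- 1"] pw(2)[OF step2.prems] by simp_all
    have "?c (\<pi>1 ?h) = \<pi>1 h" using \<pi>1\<theta>[OF h(1)] pw(3)[OF h(1)] h(2) by simp
    then have "\<pi>1 ?h = conj_by P (inv\<^bsub>P\<^esub> x0) (\<pi>1 h)"
      using \<pi>.H.conj_by_inv_cancel(2)[OF x0(1) \<pi>1.hom_closed[OF h(1)]] by simp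
    moreover have "\<pi>1 (pw (i - 1) h) = conj_by P (x0 [^]\<^bsub>P\<^esub> i) (\<pi>1 ?h)"
      using pw(4)[OF step2.prems, of i "- 1"] step2.IH[OF h(1)] by simp
    moreover have "x0 [^]\<^bsub>P\<^esub> (i - 1) = x0 [^]\<^bsub>P\<^esub> i \<otimes>\<^bsub>P\<^esub> inv\<^bsub>P\<^esub> x0"
      using \<pi>.H.int_pow_diff[OF x0(1), of i 1] x0(1) by simp
    ultimately show ?case
      using x0(1) \<pi>1.hom_closed[OF step2.prems] by (simp add: \<pi>.H.conj_by_mult)
  qed
  define \<Psi> where "\<Psi> = (\<lambda>(h, i). \<pi>1 h \<otimes>\<^bsub>P\<^esub> x0 [^]\<^bsub>P\<^esub> (i :: int))"
  have \<Psi>: "\<Psi> \<in> hom ?E P"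
  proof (rule homI)
    fix a assume "a \<in> carrier ?E"
    then show "\<Psi> a \<in> carrier P" using x0(1) by (auto simp: \<Psi>_def)
  next
    fix a b assume "a \<in> carrier ?E" "b \<in> carrier ?E"
    then obtain g i h j where ab: "a = (g, i)" "b = (h, j)" "g \<in> carrier ?\<Gamma>1" "h \<in> carrier ?\<Gamma>1"
      by auto
    have "\<Psi> (a \<otimes>\<^bsub>?E\<^esub> b) = \<pi>1 g \<otimes>\<^bsub>P\<^esub> \<pi>1 (pw i h) \<otimes>\<^bsub>P\<^esub> x0 [^]\<^bsub>P\<^esub> (i + j)"
      using ab \<pi>1.hom_mult[OF ab(3) act.pw_closed[OF ab(4)]] by (simp add: \<Psi>_def)
    also have "\<dots> = \<Psi> a \<otimes>\<^bsub>P\<^esub> \<Psi> b"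
      unfolding \<pi>1pw[OF ab(4)] \<pi>.H.int_pow_mult[OF x0(1)]
      using \<pi>1.hom_closed[OF ab(3)] \<pi>1.hom_closed[OF ab(4)] x0(1)
      by (simp add: ab \<Psi>_def conj_by_def \<pi>.H.word_simps)
    finally show "\<Psi> (a \<otimes>\<^bsub>?E\<^esub> b) = \<Psi> a \<otimes>\<^bsub>P\<^esub> \<Psi> b" .
  qed
  have \<chi>pow: "\<chi> (x0 [^]\<^bsub>P\<^esub> i) = i" for i :: int
  proof (induction i rule: int_induct[of _ 0])
    case (step1 i)
    then show ?case using x0 by (simp add: \<pi>.H.int_pow_mult \<chi>)
  next
    case (step2 i)
    then show ?case using x0 by (simp add: \<pi>.H.int_pow_diff \<chi> \<chi>inv)
  qed (simp add: \<chi>1)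
  have \<chi>\<pi>1: "\<chi> (\<pi>1 h) = 0" if "h \<in> carrier ?\<Gamma>1" for h
    using liftq[OF that] \<pi>1(2) \<chi>\<pi> by metis
  have \<Psi>_onto: "\<Psi> ` carrier ?E = carrier P"
  proof
    show "\<Psi> ` carrier ?E \<subseteq> carrier P" by (rule hom_carrier[OF \<Psi>])
    show "carrier P \<subseteq> \<Psi> ` carrier ?E"
    proof
      fix p assume p: "p \<in> carrier P"
      let ?p = "p \<otimes>\<^bsub>P\<^esub> x0 [^]\<^bsub>P\<^esub> (- \<chi> p)"
      have "?p \<in> carrier P" "\<chi> ?p = 0" using p x0(1) \<chi>pow by (simp_all add: \<chi>)
      then obtain g where g: "g \<in> carrier \<Gamma>" "\<pi> g = ?p" using lift by blast
      have "\<Psi> (q g, \<chi> p) = p \<otimes>\<^bsub>P\<^esub> (x0 [^]\<^bsub>P\<^esub> (- \<chi> p) \<otimes>\<^bsub>P\<^esub> x0 [^]\<^bsub>P\<^esub> \<chi> p)"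
        using g \<pi>1(2)[OF g(1)] p x0(1) by (simp add: \<Psi>_def \<pi>.H.m_assoc)
      also have "\<dots> = p" using p x0(1) by (simp add: \<pi>.H.int_pow_mult[symmetric])
      finally show "p \<in> \<Psi> ` carrier ?E"
        using g(1) q.hom_closed by (intro image_eqI[of _ _ "(q g, \<chi> p)"]) simp_all
    qed
  qed
  have "finitely_generated ?E"
    by (rule act.finitely_generated_E[OF finitely_presented_imp_finitely_generated[OF grp1 fp1]])
  then obtain W0 where W0: "finite W0" "W0 \<subseteq> kernel ?E P \<Psi>" "kernel ?E P \<Psi> = normal_closure ?E W0"
    using finitely_presented_kernel[OF act.group_E assms(2) _ fp(2) \<Psi> \<Psi>_onto] by blast
  interpret E: group ?E by (rule act.group_E)
  \<comment> \<open>\<open>\<chi>\<close> vanishes on the image of \<open>\<pi>1\<close> and takes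
    the value \<open>i\<close> on the \<open>i\<close>-th power of \<open>x0\<close>, so the kernel
    of \<open>\<Psi>\<close> has no integer component.\<close>
  have kerE: "i = 0 \<and> h \<in> kernel ?\<Gamma>1 P \<pi>1" if "(h, i) \<in> kernel ?E P \<Psi>" for h i
  proof -
    have h: "h \<in> carrier ?\<Gamma>1" and e: "\<pi>1 h \<otimes>\<^bsub>P\<^esub> x0 [^]\<^bsub>P\<^esub> i = \<one>\<^bsub>P\<^esub>"
      using that by (auto simp: kernel_def \<Psi>_def)
    have "\<chi> (\<pi>1 h \<otimes>\<^bsub>P\<^esub> x0 [^]\<^bsub>P\<^esub> i) = i"
      using \<chi>[OF \<pi>1.hom_closed[OF h]] x0(1) \<chi>pow \<chi>\<pi>1[OF h] by simp
    then have "i = 0" unfolding e by (simp add: \<chi>1)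
    then show ?thesis using h e \<pi>1.hom_closed[OF h] by (simp add: kernel_def)
  qed
  define Z0 where "Z0 = fst ` W0"
  have Z0: "Z0 \<subseteq> kernel ?\<Gamma>1 P \<pi>1"
  proof
    fix z assume "z \<in> Z0"
    then obtain i where "(z, i) \<in> W0" unfolding Z0_def by (metis imageE prod.collapse)
    then show "z \<in> kernel ?\<Gamma>1 P \<pi>1" using W0(2) kerE by blast
  qed
  then have Z0c: "Z0 \<subseteq> carrier ?\<Gamma>1" unfolding kernel_def by blast
  let ?N = "normal_closure ?\<Gamma>1 Z0"
  have N: "?N \<lhd> ?\<Gamma>1" by (rule q.H.normal_closure_normal[OF Z0c])
  have Nker: "?N \<subseteq> kernel ?\<Gamma>1 P \<pi>1" by (rule normal_closure_minimal[OF \<pi>1.normal_kernel Z0])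
  have Nc: "n \<in> carrier ?\<Gamma>1" if "n \<in> ?N" for n
    using subsetD[OF Nker that] unfolding kernel_def by blast
  have Nconj: "conj_by ?\<Gamma>1 g n \<in> ?N" if "g \<in> carrier ?\<Gamma>1" "n \<in> ?N" for g n
    unfolding conj_by_def by (rule normal.inv_op_closed2[OF N that])
  \<comment> \<open>A normal subgroup of \<open>\<Gamma>1\<close> inside the kernel of
    \<open>\<pi>1\<close> is invariant under the automorphism and its inverse, since both act on
    that kernel as conjugations.\<close>
  have pwN: "pw i n \<in> ?N" if "n \<in> ?N" for i n
    using that
  proof (induction i arbitrary: n rule: int_induct[of _ 0])
    case base
    then show ?case using pw(2)[OF Nc] by simp
  next
    case (step1 i)
    have "pw 1 n \<in> ?N"
      using pw(3)[OF Nc[OF step1.prems]] \<theta>ker[OF subsetD[OF Nker step1.prems]] Nconj[OF qw step1.prems] by simp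
    then show ?case using pw(4)[OF Nc[OF step1.prems], of i 1] step1.IH by simp
  next
    case (step2 i)
    let ?n = "conj_by ?\<Gamma>1 (inv\<^bsub>?\<Gamma>1\<^esub> (q w)) n"
    have n: "?n \<in> ?N" by (rule Nconj[OF q.H.inv_closed[OF qw] step2.prems])
    have "pw 1 ?n = n"
      unfolding pw(3)[OF Nc[OF n]] \<theta>ker[OF subsetD[OF Nker n]]
      by (rule q.H.conj_by_inv_cancel(1)[OF qw Nc[OF step2.prems]])
    then have "pw (i - 1) n = pw i ?n"
      using pw(4)[OF Nc[OF n], of "i - 1" 1] by simp
    then show ?case using step2.IH[OF n] by simp
  qed
  have NE: "?N \<times> {0} \<lhd> ?E"
    unfolding E.normal_inv_iff
  proof (intro conjI ballI)
    have Nsub: "subgroup ?N ?\<Gamma>1" by (rule normal_imp_subgroup[OF N])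
    show "subgroup (?N \<times> {0}) ?E"
    proof (rule E.subgroupI)
      show "?N \<times> {0} \<subseteq> carrier ?E" using Nc by auto
      show "?N \<times> {0} \<noteq> {}" using subgroup.one_closed[OF Nsub] by blast
      show "inv\<^bsub>?E\<^esub> a \<in> ?N \<times> {0}" if "a \<in> ?N \<times> {0}" for a
      proof -
        obtain n where n: "a = (n, 0)" "n \<in> ?N" using \<open>a \<in> ?N \<times> {0}\<close> by blast
        have "inv\<^bsub>?\<Gamma>1\<^esub> n \<in> ?N" by (rule subgroup.m_inv_closed[OF Nsub n(2)])
        then show ?thesis using act.inv_E[OF Nc[OF n(2)], of 0] pw(2)[OF Nc] n(1) by simp
      qed
      show "a \<otimes>\<^bsub>?E\<^esub> b \<in> ?N \<times> {0}" if ab: "a \<in> ?N \<times> {0}" "b \<in> ?N \<times> {0}" for a b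
      proof -
        obtain n n' where n: "a = (n, 0)" "n \<in> ?N" "b = (n', 0)" "n' \<in> ?N" using ab by blast
        then show ?thesis using subgroup.m_closed[OF Nsub n(2,4)] pw(2)[OF Nc[OF n(4)]] by simp
      qed
    qed
    fix a b assume "a \<in> carrier ?E" "b \<in> ?N \<times> {0 :: int}"
    then obtain g i n where n: "a = (g, i)" "g \<in> carrier ?\<Gamma>1" "b = (n, 0)" "n \<in> ?N" by auto
    show "a \<otimes>\<^bsub>?E\<^esub> b \<otimes>\<^bsub>?E\<^esub> inv\<^bsub>?E\<^esub> a \<in> ?N \<times> {0}"
      unfolding n(1,3) act.conj_E[OF n(2) Nc[OF n(4)]]
      using Nconj[OF n(2) pwN[OF n(4), of i]] unfolding conj_by_def by blast
  qed
  have "W0 \<subseteq> ?N \<times> {0}"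
  proof
    fix a assume a: "a \<in> W0"
    obtain z i where zi: "a = (z, i)" by (cases a)
    have "i = 0" using kerE[of z i] a W0(2) zi by blast
    moreover have "z \<in> Z0" using a zi unfolding Z0_def by force
    ultimately show "a \<in> ?N \<times> {0}"
      using normal_closure_superset[of Z0 ?\<Gamma>1] zi by blast
  qed
  then have kerN: "kernel ?E P \<Psi> \<subseteq> ?N \<times> {0}"
    unfolding W0(3) by (rule normal_closure_minimal[OF NE])
  let ?P' = "P\<lparr>carrier := {p \<in> carrier P. \<chi> p = 0}\<rparr>"
  have sub': "subgroup {p \<in> carrier P. \<chi> p = 0} P"
    by (rule \<pi>.H.subgroupI) (use \<chi>1 \<chi> \<chi>inv in auto)
  have grp': "group ?P'" by (rule \<pi>.H.subgroup_imp_group[OF sub'])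
  have \<pi>1': "\<pi>1 \<in> hom ?\<Gamma>1 ?P'"
    by (rule homI) (use \<chi>\<pi>1 in auto)
  have "\<pi>1 ` carrier ?\<Gamma>1 = \<pi> ` carrier \<Gamma>"
    unfolding quot(2)[symmetric] image_image using \<pi>1(2) by (intro image_cong) simp_all
  then have onto': "\<pi>1 ` carrier ?\<Gamma>1 = carrier ?P'" using img by simp
  have ker': "kernel ?\<Gamma>1 ?P' \<pi>1 = kernel ?\<Gamma>1 P \<pi>1" by (simp add: kernel_def)
  show ?thesis
  proof (rule finitely_presented_quotient[OF grp1 grp' fp1 \<pi>1' onto' _ Z0c])
    show "finite Z0" using W0(1) by (simp add: Z0_def)
    show "kernel ?\<Gamma>1 ?P' \<pi>1 \<subseteq> ?N"
    proof
      fix h assume "h \<in> kernel ?\<Gamma>1 ?P' \<pi>1"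
      then have h: "h \<in> carrier ?\<Gamma>1" "\<pi>1 h = \<one>\<^bsub>P\<^esub>" by (simp_all add: kernel_def)
      then have "(h, 0) \<in> kernel ?E P \<Psi>" by (simp add: kernel_def \<Psi>_def)
      then show "h \<in> ?N" using kerN by blast
    qed
    show "Z0 \<subseteq> kernel ?\<Gamma>1 ?P' \<pi>1" unfolding ker' by (rule Z0)
  qed
qed

section \<open>Integer-valued characters and co-rank\<close>

definition int_hom :: "('a, 'c) monoid_scheme \<Rightarrow> ('a \<Rightarrow> int) \<Rightarrow> bool" where
  "int_hom G f \<longleftrightarrow> (\<forall>x\<in>carrier G. \<forall>y\<in>carrier G. f (x \<otimes>\<^bsub>G\<^esub> y) = f x + f y)"

text \<open>For finite \<open>I\<close> the elements \<open>x\<close> certify that the characters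
  \<open>f i\<close> together map onto the free abelian group over \<open>I\<close>, without that
  group having to be formed.\<close>

definition dual_system ::
  "('a, 'c) monoid_scheme \<Rightarrow> 'i set \<Rightarrow> ('i \<Rightarrow> 'a \<Rightarrow> int) \<Rightarrow> ('i \<Rightarrow> 'a) \<Rightarrow> bool" where
  "dual_system G I f x \<longleftrightarrow> (\<forall>i\<in>I. int_hom G (f i) \<and> x i \<in> carrier G) \<and>
     (\<forall>i\<in>I. \<forall>j\<in>I. f i (x j) = (if i = j then 1 else 0))"

lemma dual_system_subset: "dual_system G I f x \<Longrightarrow> J \<subseteq> I \<Longrightarrow> dual_system G J f x"
  unfolding dual_system_def by blast

context group
begin

context
  fixes f assumes f: "int_hom G f"
begin

lemma int_hom_mult: "x \<in> carrier G \<Longrightarrow> y \<in> carrier G \<Longrightarrow> f (x \<otimes> y) = f x + f y"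
  using f by (simp add: int_hom_def)

lemma int_hom_one: "f \<one> = 0"
  using int_hom_mult[of \<one> \<one>] by simp

lemma int_hom_inv: "x \<in> carrier G \<Longrightarrow> f (inv x) = - f x"
  using int_hom_mult[of x "inv x"] int_hom_one by simp

lemma int_hom_conj_by: "x \<in> carrier G \<Longrightarrow> y \<in> carrier G \<Longrightarrow> f (conj_by G x y) = f y"
  by (simp add: conj_by_def int_hom_mult int_hom_inv)

lemma int_hom_pow: "x \<in> carrier G \<Longrightarrow> f (x [^] (i :: int)) = i * f x"
proof (induction i rule: int_induct[of _ 0])
  case (step1 i)
  then show ?case by (simp add: int_pow_mult int_hom_mult algebra_simps)
next
  case (step2 i)
  then show ?case by (simp add: int_pow_diff int_hom_mult int_hom_inv algebra_simps)
qed (simp add: int_hom_one)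

end

lemma kernel_int_homs_subgroup:
  assumes "\<And>i. i \<in> I \<Longrightarrow> int_hom G (f i)"
  shows "subgroup {x \<in> carrier G. \<forall>i\<in>I. f i x = 0} G"
proof (rule subgroupI)
  show "{x \<in> carrier G. \<forall>i\<in>I. f i x = 0} \<noteq> {}"
    using assms by (auto simp: int_hom_one intro!: exI[of _ \<one>])
qed (use assms in \<open>auto simp: int_hom_mult int_hom_inv\<close>)

text \<open>The element is a product of powers of the \<open>x i\<close>. Quantifying over all
  characters at once lets it be evaluated both at a dual system and at a further character, as
  needed for extending the system.\<close>

lemma product_with_prescribed_values:
  fixes c :: "'i \<Rightarrow> int"
  assumes "finite I" "\<And>i. i \<in> I \<Longrightarrow> x i \<in> carrier G"
  shows "\<exists>\<xi>\<in>generate G (x ` I). \<forall>f. int_hom G f \<longrightarrow> f \<xi> = (\<Sum>i\<in>I. c i * f (x i))"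
  using assms
proof (induction I rule: finite_induct)
  case empty
  then show ?case using generate.one[of G "{}"] by (intro bexI[of _ \<one>]) (auto simp: int_hom_one)
next
  case (insert i I)
  then obtain \<xi> where \<xi>: "\<xi> \<in> generate G (x ` I)" "\<And>f. int_hom G f \<Longrightarrow> f \<xi> = (\<Sum>i\<in>I. c i * f (x i))"
    by auto
  have xc: "x ` insert i I \<subseteq> carrier G" using insert.prems by auto
  have 1: "\<xi> \<in> generate G (x ` insert i I)"
    using \<xi>(1) mono_generate[of "x ` I" "x ` insert i I"] by auto
  have 2: "x i [^] c i \<in> generate G (x ` insert i I)"
    by (rule subgroup_int_pow_closed[OF generate_is_subgroup[OF xc]]) (simp add: generate.incl)
  have c: "\<xi> \<in> carrier G" "x i \<in> carrier G" using generate_in_carrier[OF xc 1] xc by auto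
  show ?case
  proof (intro bexI allI impI)
    show "x i [^] c i \<otimes> \<xi> \<in> generate G (x ` insert i I)" by (rule generate.eng[OF 2 1])
    show "f (x i [^] c i \<otimes> \<xi>) = (\<Sum>i\<in>insert i I. c i * f (x i))" if "int_hom G f" for f
      using that c insert.hyps \<xi>(2)[OF that] by (simp add: int_hom_mult int_hom_pow)
  qed
qed

lemma dual_system_interpolation:
  assumes "finite I" "dual_system G I f x"
  obtains \<xi> where "\<xi> \<in> generate G (x ` I)" "\<xi> \<in> carrier G" "\<And>i. i \<in> I \<Longrightarrow> f i \<xi> = c i"
proof -
  have x: "\<And>i. i \<in> I \<Longrightarrow> x i \<in> carrier G" and f: "\<And>i. i \<in> I \<Longrightarrow> int_hom G (f i)"
    using assms(2) unfolding dual_system_def by blast+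
  obtain \<xi> where \<xi>: "\<xi> \<in> generate G (x ` I)" "\<And>f. int_hom G f \<Longrightarrow> f \<xi> = (\<Sum>i\<in>I. c i * f (x i))"
    using product_with_prescribed_values[where x = x and c = c, OF assms(1) x] by blast
  have "f i \<xi> = c i" if i: "i \<in> I" for i
  proof -
    have "f i \<xi> = (\<Sum>j\<in>I. c j * f i (x j))" by (rule \<xi>(2)[OF f[OF i]])
    also have "\<dots> = (\<Sum>j\<in>I. if i = j then c j else 0)"
      using assms(2) i by (intro sum.cong) (auto simp: dual_system_def)
    finally show ?thesis using assms(1) i by simp
  qed
  moreover have "\<xi> \<in> carrier G" using \<xi>(1) x generate_in_carrier[of "x ` I"] by blast
  ultimately show ?thesis using that \<xi>(1) by blast
qed

lemma normal_of_generators: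
  assumes N: "subgroup N G" and X: "X \<subseteq> carrier G" "generate G (N \<union> X) = carrier G"
    and conj: "\<And>y n. y \<in> X \<Longrightarrow> n \<in> N \<Longrightarrow> conj_by G y n \<in> N \<and> conj_by G (inv y) n \<in> N"
  shows "N \<lhd> G"
proof -
  have Nc: "n \<in> carrier G" if "n \<in> N" for n using subgroup.mem_carrier[OF N that] .
  have "\<forall>n\<in>N. conj_by G g n \<in> N" if "g \<in> generate G (N \<union> X)" for g
    using that
  proof (induction rule: generate.induct)
    case one
    then show ?case using Nc by simp
  next
    case (incl h)
    then show ?case using conj conj_by_subgroup[OF N] by blast
  next
    case (inv h)
    then show ?case using conj conj_by_subgroup[OF N subgroup.m_inv_closed[OF N]] by blast
  next
    case (eng g h)
    then have gh: "g \<in> carrier G" "h \<in> carrier G" using X(2) by auto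
    show ?case
    proof
      fix n assume n: "n \<in> N"
      show "conj_by G (g \<otimes> h) n \<in> N"
        unfolding conj_by_mult[OF gh Nc[OF n]] by (rule bspec[OF eng.IH(1) bspec[OF eng.IH(2) n]])
    qed
  qed
  then show ?thesis
    unfolding normal_inv_iff conj_by_def[symmetric] using N X(2) by simp
qed

end

lemma (in comm_group) generate_finprod:
  assumes "finite I" "\<And>i. i \<in> I \<Longrightarrow> x i \<in> carrier G" "\<xi> \<in> generate G (x ` I)"
  shows "\<exists>c :: 'i \<Rightarrow> int. \<xi> = (\<Otimes>i\<in>I. x i [^] c i)"
  using assms(3)
proof (induction rule: generate.induct)
  case one
  show ?case using assms(2) by (intro exI[of _ "\<lambda>_. 0"]) simp
next
  case (incl h)
  then obtain j where j: "j \<in> I" "h = x j" by blast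
  have "(\<Otimes>i\<in>I. x i [^] (if j = i then 1 else 0 :: int)) = (\<Otimes>i\<in>I. if j = i then x i else \<one>)"
    using assms(2) by (intro finprod_cong) (auto simp: simp_implies_def)
  also have "\<dots> = h"
    using finprod_singleton[OF j(1) assms(1), of x] assms(2) j by auto
  finally show ?case by (intro exI[of _ "\<lambda>i. if j = i then 1 else 0"]) simp
next
  case (inv h)
  then obtain j where j: "j \<in> I" "h = x j" by blast
  have "(\<Otimes>i\<in>I. x i [^] (if j = i then - 1 else 0 :: int)) = (\<Otimes>i\<in>I. if j = i then inv (x i) else \<one>)"
    using assms(2) by (intro finprod_cong) (auto simp: int_pow_neg simp_implies_def)
  also have "\<dots> = inv h"
    using finprod_singleton[OF j(1) assms(1), of "\<lambda>i. inv (x i)"] assms(2) j by auto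
  finally show ?case by (intro exI[of _ "\<lambda>i. if j = i then - 1 else 0"]) simp
next
  case (eng g h)
  then obtain c d :: "'i \<Rightarrow> int" where "g = (\<Otimes>i\<in>I. x i [^] c i)" "h = (\<Otimes>i\<in>I. x i [^] d i)" by blast
  moreover have "(\<Otimes>i\<in>I. x i [^] (c i + d i)) = (\<Otimes>i\<in>I. x i [^] c i \<otimes> x i [^] d i)"
    using assms(2) by (intro finprod_cong) (auto simp: int_pow_mult simp_implies_def)
  moreover have "\<dots> = (\<Otimes>i\<in>I. x i [^] c i) \<otimes> (\<Otimes>i\<in>I. x i [^] d i)"
    by (rule finprod_multf) (use assms(2) in auto)
  ultimately have "g \<otimes> h = (\<Otimes>i\<in>I. x i [^] (c i + d i))" by simp
  then show ?case by (intro exI)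
qed

lemma (in group_hom) finprod_lift:
  fixes c :: "'i \<Rightarrow> int"
  assumes "comm_group H" "finite I" "\<And>i. i \<in> I \<Longrightarrow> x i \<in> carrier G"
  shows "\<exists>\<eta>\<in>carrier G. h \<eta> = (\<Otimes>\<^bsub>H\<^esub>i\<in>I. h (x i) [^]\<^bsub>H\<^esub> c i) \<and>
    (\<forall>f. int_hom G f \<longrightarrow> f \<eta> = (\<Sum>i\<in>I. c i * f (x i)))"
  using assms(2,3)
proof (induction I rule: finite_induct)
  case empty
  interpret C: comm_group H by (rule assms(1))
  show ?case by (intro bexI[of _ "\<one>"]) (auto simp: G.int_hom_one)
next
  case (insert i I)
  interpret C: comm_group H by (rule assms(1))
  obtain \<eta> where \<eta>: "\<eta> \<in> carrier G" "h \<eta> = (\<Otimes>\<^bsub>H\<^esub>i\<in>I. h (x i) [^]\<^bsub>H\<^esub> c i)"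
      "\<And>f. int_hom G f \<Longrightarrow> f \<eta> = (\<Sum>i\<in>I. c i * f (x i))"
    using insert by auto
  have x: "x i \<in> carrier G" "\<And>j. j \<in> I \<Longrightarrow> x j \<in> carrier G" using insert.prems by auto
  have "h (x i [^] c i \<otimes> \<eta>) = (\<Otimes>\<^bsub>H\<^esub>i\<in>insert i I. h (x i) [^]\<^bsub>H\<^esub> c i)"
    using x \<eta>(1,2) insert.hyps by (simp add: hom_int_pow C.finprod_insert Pi_def)
  moreover have "f (x i [^] c i \<otimes> \<eta>) = (\<Sum>i\<in>insert i I. c i * f (x i))" if "int_hom G f" for f
    using that x \<eta>(1) insert.hyps \<eta>(3)[OF that] by (simp add: G.int_hom_mult G.int_hom_pow)
  ultimately show ?case using x \<eta>(1) by (intro bexI[of _ "x i [^] c i \<otimes> \<eta>"]) auto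
qed

text \<open>\<open>G Mod N\<close> is abelian and generated by the cosets of the \<open>x i\<close>.
  Modulo \<open>N\<close> every element is therefore a product of powers of the \<open>x i\<close>,
  and the \<open>f i\<close> read off the exponents.\<close>

lemma (in group) kernel_of_dual_system:
  assumes I: "finite I" "dual_system G I f x" and N: "subgroup N G"
    and gen: "generate G (N \<union> x ` I) = carrier G"
    and conj: "\<And>i n. i \<in> I \<Longrightarrow> n \<in> N \<Longrightarrow> conj_by G (x i) n \<in> N \<and> conj_by G (inv (x i)) n \<in> N"
    and comm: "\<And>i j. i \<in> I \<Longrightarrow> j \<in> I \<Longrightarrow> x i \<otimes> x j \<otimes> inv (x i) \<otimes> inv (x j) \<in> N"
    and fN: "\<And>i n. i \<in> I \<Longrightarrow> n \<in> N \<Longrightarrow> f i n = 0"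
  shows "N = {g \<in> carrier G. \<forall>i\<in>I. f i g = 0}"
proof
  show "N \<subseteq> {g \<in> carrier G. \<forall>i\<in>I. f i g = 0}"
    using fN subgroup.mem_carrier[OF N] by blast
  have x: "\<And>i. i \<in> I \<Longrightarrow> x i \<in> carrier G" and f: "\<And>i. i \<in> I \<Longrightarrow> int_hom G (f i)"
    using I(2) unfolding dual_system_def by blast+
  have "N \<lhd> G"
    by (rule normal_of_generators[OF N _ gen]) (use x conj in auto)
  then interpret N: normal N G .
  let ?C = "G Mod N" let ?q = "\<lambda>g. N #> g"
  note one_FactGroup [simp del] mult_FactGroup [simp del]
  interpret q: group_hom G ?C ?q
    using N.factorgroup_is_group N.quotient_hom(1) by (simp add: group_hom_def group_hom_axioms_def)
  have qN: "?q g = \<one>\<^bsub>?C\<^esub> \<longleftrightarrow> g \<in> N" if "g \<in> carrier G" for g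
    using N.quotient_hom(3) that unfolding kernel_def by blast
  have genC: "generate ?C ((\<lambda>i. ?q (x i)) ` I) = carrier ?C"
  proof
    show "generate ?C ((\<lambda>i. ?q (x i)) ` I) \<subseteq> carrier ?C"
      by (rule q.H.generate_incl) (use x in auto)
    have sub: "subgroup (generate ?C ((\<lambda>i. ?q (x i)) ` I)) ?C"
      by (rule q.H.generate_is_subgroup) (use x in auto)
    have "?q ` (N \<union> x ` I) \<subseteq> generate ?C ((\<lambda>i. ?q (x i)) ` I)"
    proof
      fix y assume "y \<in> ?q ` (N \<union> x ` I)"
      then consider n where "n \<in> N" "y = ?q n" | i where "i \<in> I" "y = ?q (x i)" by blast
      then show "y \<in> generate ?C ((\<lambda>i. ?q (x i)) ` I)"
      proof cases
        case 1
        then have "y = \<one>\<^bsub>?C\<^esub>" using qN by simp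
        then show ?thesis by (simp add: generate.one)
      next
        case 2
        then show ?thesis by (intro generate.incl) simp
      qed
    qed
    then have "generate ?C (?q ` (N \<union> x ` I)) \<subseteq> generate ?C ((\<lambda>i. ?q (x i)) ` I)"
      by (rule q.H.generate_subgroup_incl[OF _ sub])
    moreover have "generate ?C (?q ` (N \<union> x ` I)) = ?q ` carrier G"
      using q.generate_img[of "N \<union> x ` I"] N.subset x gen by auto
    ultimately show "carrier ?C \<subseteq> generate ?C ((\<lambda>i. ?q (x i)) ` I)"
      unfolding N.quotient_hom(2) by simp
  qed
  have comm_gens: "commute ?C (?q (x i)) (?q (x j))" if "i \<in> I" "j \<in> I" for i j
  proof -
    have c: "x i \<in> carrier G" "x j \<in> carrier G" using that x by auto
    have "?q (x i \<otimes> x j \<otimes> inv (x i) \<otimes> inv (x j)) = \<one>\<^bsub>?C\<^esub>"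
      using qN comm[OF that] by simp
    then have "?q (x i \<otimes> x j \<otimes> inv (x i) \<otimes> inv (x j)) \<otimes>\<^bsub>?C\<^esub> ?q (x j \<otimes> x i) = ?q (x j \<otimes> x i)"
      using c by simp
    then have "?q (x i \<otimes> x j \<otimes> inv (x i) \<otimes> inv (x j) \<otimes> (x j \<otimes> x i)) = ?q (x j \<otimes> x i)"
      using c q.hom_mult[of "x i \<otimes> x j \<otimes> inv (x i) \<otimes> inv (x j)" "x j \<otimes> x i"] by simp
    then have "?q (x i \<otimes> x j) = ?q (x j \<otimes> x i)"
      using c by (simp only: word_simps m_closed inv_closed l_inv r_inv r_one)
    then show ?thesis using c by (simp add: commute_def)
  qed
  have "comm_group ?C"
  proof (rule q.H.group_comm_groupI)
    fix a b assume "a \<in> carrier ?C" "b \<in> carrier ?C"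
    then have ab: "a \<in> generate ?C ((\<lambda>i. ?q (x i)) ` I)" "b \<in> generate ?C ((\<lambda>i. ?q (x i)) ` I)"
      unfolding genC by simp_all
    have "commute ?C a b"
      by (rule q.H.commute_generate[OF _ _ _ ab]) (use x comm_gens in auto)
    then show "a \<otimes>\<^bsub>?C\<^esub> b = b \<otimes>\<^bsub>?C\<^esub> a" by (simp add: commute_def)
  qed
  then interpret C: comm_group ?C .
  show "{g \<in> carrier G. \<forall>i\<in>I. f i g = 0} \<subseteq> N"
  proof
    fix g assume "g \<in> {g \<in> carrier G. \<forall>i\<in>I. f i g = 0}"
    then have g: "g \<in> carrier G" "\<And>i. i \<in> I \<Longrightarrow> f i g = 0" by auto
    have "?q g \<in> generate ?C ((\<lambda>i. ?q (x i)) ` I)" unfolding genC using g by simp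
    then obtain c :: "_ \<Rightarrow> int" where c: "?q g = (\<Otimes>\<^bsub>?C\<^esub>i\<in>I. ?q (x i) [^]\<^bsub>?C\<^esub> c i)"
      using C.generate_finprod[OF I(1), where x = "\<lambda>i. ?q (x i)" and \<xi> = "?q g"] x q.hom_closed by blast
    obtain \<eta> where \<eta>: "\<eta> \<in> carrier G" "?q \<eta> = (\<Otimes>\<^bsub>?C\<^esub>i\<in>I. ?q (x i) [^]\<^bsub>?C\<^esub> c i)"
      "\<And>f. int_hom G f \<Longrightarrow> f \<eta> = (\<Sum>i\<in>I. c i * f (x i))"
      using q.finprod_lift[OF \<open>comm_group ?C\<close> I(1), where x = x and c = c] x by blast
    have "?q g = ?q \<eta>" unfolding c \<eta>(2) ..
    then have "?q (g \<otimes> inv \<eta>) = \<one>\<^bsub>?C\<^esub>"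
      using g(1) \<eta>(1) q.H.r_inv[OF q.hom_closed[OF \<eta>(1)]] by simp
    then have gN: "g \<otimes> inv \<eta> \<in> N"
      by (rule iffD1[OF qN[OF m_closed[OF g(1) inv_closed[OF \<eta>(1)]]]])
    have "c i = 0" if i: "i \<in> I" for i
    proof -
      have "f i \<eta> = 0"
        using fN[OF i gN] g(1) g(2)[OF i] \<eta>(1) by (simp add: int_hom_mult[OF f[OF i]] int_hom_inv[OF f[OF i]])
      moreover have "f i \<eta> = (\<Sum>j\<in>I. c j * f i (x j))" by (rule \<eta>(3)[OF f[OF i]])
      moreover have "\<dots> = (\<Sum>j\<in>I. if i = j then c j else 0)"
        using I(2) i by (intro sum.cong) (auto simp: dual_system_def)
      ultimately show ?thesis using I(1) i by simp
    qed
    then have "?q g = (\<Otimes>\<^bsub>?C\<^esub>i\<in>I. \<one>\<^bsub>?C\<^esub>)"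
      unfolding c using x by (intro C.finprod_cong) (auto simp: simp_implies_def)
    then show "g \<in> N" using qN[OF g(1)] by simp
  qed
qed

section \<open>Torsion-free rank\<close>

lemma integer_relation:
  fixes f :: "nat \<Rightarrow> 's \<Rightarrow> int"
  assumes "finite S" "m < card S"
  shows "\<exists>c. (\<exists>s\<in>S. c s \<noteq> 0) \<and> (\<forall>i<m. (\<Sum>s\<in>S. c s * f i s) = 0)"
  using assms
proof (induction m arbitrary: S f)
  case 0
  then have "S \<noteq> {}" by auto
  then show ?case by (intro exI[of _ "\<lambda>_. 1"]) auto
next
  case (Suc m)
  show ?case
  proof (cases "\<forall>s\<in>S. f m s = 0")
    case True
    obtain c where "\<exists>s\<in>S. c s \<noteq> 0" "\<And>i. i < m \<Longrightarrow> (\<Sum>s\<in>S. c s * f i s) = 0"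
      using Suc.IH[of S f] Suc.prems by auto
    moreover have "(\<Sum>s\<in>S. c s * f m s) = 0" using True by simp
    ultimately show ?thesis by (metis less_Suc_eq)
  next
    case False
    then obtain t where t: "t \<in> S" "f m t \<noteq> 0" by blast
    let ?S = "S - {t}"
    have "m < card ?S" "finite ?S" using Suc.prems t by (simp_all add: card_Diff_singleton less_diff_conv)
    then obtain c where c: "\<exists>s\<in>?S. c s \<noteq> 0"
      "\<And>i. i < m \<Longrightarrow> (\<Sum>s\<in>?S. c s * (f m t * f i s - f m s * f i t)) = 0"
      using Suc.IH[of ?S "\<lambda>i s. f m t * f i s - f m s * f i t"] by blast
    \<comment> \<open>The unknown at \<open>t\<close> is eliminated with the help of row
      \<open>m\<close>. All other coefficients are multiplied by \<open>f m t\<close>, which avoids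
      division, and the value at \<open>t\<close> makes row \<open>m\<close> vanish
      identically.\<close>
    define d where "d = (\<lambda>s. if s = t then - (\<Sum>s\<in>?S. f m s * c s) else f m t * c s)"
    have sum_d: "(\<Sum>s\<in>S. d s * f i s) = (\<Sum>s\<in>?S. c s * (f m t * f i s - f m s * f i t))" for i
    proof -
      have "(\<Sum>s\<in>S. d s * f i s) = d t * f i t + (\<Sum>s\<in>?S. d s * f i s)"
        using Suc.prems t by (simp add: sum.remove)
      also have "(\<Sum>s\<in>?S. d s * f i s) = (\<Sum>s\<in>?S. f m t * c s * f i s)"
        by (intro sum.cong) (auto simp: d_def)
      also have "d t * f i t = - (\<Sum>s\<in>?S. f m s * c s * f i t)"
        by (simp add: d_def sum_distrib_right)
      finally show ?thesis
        by (simp add: sum_subtractf algebra_simps)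
    qed
    have "\<forall>i<Suc m. (\<Sum>s\<in>S. d s * f i s) = 0"
      unfolding sum_d using c(2) by (auto simp: less_Suc_eq)
    moreover have "\<exists>s\<in>S. d s \<noteq> 0"
      using c(1) t by (auto simp: d_def)
    ultimately show ?thesis by blast
  qed
qed

lemma (in comm_group) int_hom_finprod:
  fixes c :: "'a \<Rightarrow> int"
  assumes "int_hom G f" "finite S" "S \<subseteq> carrier G"
  shows "f (\<Otimes>s\<in>S. s [^] c s) = (\<Sum>s\<in>S. c s * f s)"
  using assms(2,3)
proof (induction S rule: finite_induct)
  case empty
  then show ?case by (simp add: int_hom_one[OF assms(1)])
next
  case (insert s S)
  then have "(\<lambda>s. s [^] c s) \<in> S \<rightarrow> carrier G" "s \<in> carrier G" by auto
  then show ?case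
    using insert by (simp add: int_hom_mult[OF assms(1)] int_hom_pow[OF assms(1)])
qed

lemma (in comm_group) finprod_int_pow:
  fixes c :: "'a \<Rightarrow> int"
  assumes "finite S" "S \<subseteq> carrier G"
  shows "(\<Otimes>s\<in>S. s [^] c s) [^] (q :: int) = (\<Otimes>s\<in>S. s [^] (c s * q))"
  using assms
proof (induction S rule: finite_induct)
  case (insert s S)
  then have "(\<lambda>s. s [^] c s) \<in> S \<rightarrow> carrier G" "(\<lambda>s. s [^] (c s * q)) \<in> S \<rightarrow> carrier G" "s \<in> carrier G"
    by auto
  then show ?case
    using insert by (simp add: int_pow_distrib int_pow_pow)
qed simp

text \<open>Among more than \<open>r\<close> elements there is a nontrivial integer combination
  killed by all \<open>f i\<close>. It is a torsion element, and a multiple of the relation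
  contradicts independence. The dual elements form an independent set of size
  \<open>r\<close>.\<close>

lemma (in comm_group) torsion_free_rank_eq:
  fixes f :: "nat \<Rightarrow> 'a \<Rightarrow> int"
  assumes dual: "dual_system G {..<r} f x"
    and torsion: "\<And>y. y \<in> carrier G \<Longrightarrow> (\<forall>i<r. f i y = 0) \<Longrightarrow> \<exists>q :: int. q \<noteq> 0 \<and> y [^] q = \<one>"
  shows "torsion_free_rank G = r"
proof -
  have x: "\<And>i. i < r \<Longrightarrow> x i \<in> carrier G" and f: "\<And>i. i < r \<Longrightarrow> int_hom G (f i)"
    and fx: "\<And>i j. i < r \<Longrightarrow> j < r \<Longrightarrow> f i (x j) = (if i = j then 1 else 0)"
    using dual unfolding dual_system_def by auto
  have bound: "card S \<le> r" if S: "int_independent G S" for S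
  proof (rule ccontr)
    assume "\<not> card S \<le> r"
    moreover have S': "finite S" "S \<subseteq> carrier G" using S by (auto simp: int_independent_def)
    ultimately obtain c where c: "\<exists>s\<in>S. c s \<noteq> 0" "\<And>i. i < r \<Longrightarrow> (\<Sum>s\<in>S. c s * f i s) = 0"
      using integer_relation[of S r f] by auto
    let ?y = "\<Otimes>s\<in>S. s [^] c s"
    have "?y \<in> carrier G" using S' by (intro finprod_closed) auto
    moreover have "\<forall>i<r. f i ?y = 0" using int_hom_finprod[OF f S'] c(2) by simp
    ultimately obtain q :: int where q: "q \<noteq> 0" "?y [^] q = \<one>" using torsion by blast
    have "(\<Otimes>s\<in>S. s [^] (c s * q)) = \<one>" using finprod_int_pow[OF S', of c q] q(2) by simp
    then have "\<forall>s\<in>S. c s * q = 0"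
      using S unfolding int_independent_def by (elim conjE allE[of _ "\<lambda>s. c s * q"]) blast
    then show False using c(1) q(1) by auto
  qed
  have inj: "inj_on x {..<r}"
  proof (rule inj_onI)
    fix i j assume ij: "i \<in> {..<r}" "j \<in> {..<r}" "x i = x j"
    then have "f i (x j) = 1" using fx[of i i] by simp
    then show "i = j" using ij fx[of i j] by (simp split: if_splits)
  qed
  have S: "finite (x ` {..<r})" "x ` {..<r} \<subseteq> carrier G" using x by auto
  have "int_independent G (x ` {..<r})"
    unfolding int_independent_def
  proof (intro conjI S allI impI ballI)
    fix c :: "'a \<Rightarrow> int" and s
    assume c: "(\<Otimes>s\<in>x ` {..<r}. s [^] c s) = \<one>" and "s \<in> x ` {..<r}"
    then obtain i where i: "i < r" "s = x i" by blast
    have "0 = (\<Sum>s\<in>x ` {..<r}. c s * f i s)"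
      using int_hom_finprod[OF f[OF i(1)] S, of c] int_hom_one[OF f[OF i(1)]] unfolding c by simp
    also have "\<dots> = (\<Sum>j<r. c (x j) * f i (x j))" by (simp add: sum.reindex[OF inj])
    also have "\<dots> = (\<Sum>j<r. if i = j then c (x j) else 0)" using fx i(1) by (intro sum.cong) auto
    finally show "c s = 0" using i by simp
  qed
  moreover have "card (x ` {..<r}) = r" using card_image[OF inj] by simp
  ultimately have "r \<in> {card S | S. int_independent G S}" by (metis (mono_tags, lifting) mem_Collect_eq)
  moreover have "{card S | S. int_independent G S} \<subseteq> {..r}" using bound by auto
  ultimately show ?thesis
    unfolding torsion_free_rank_def
    by (intro Max_eqI) (auto intro: finite_subset)
qed

section \<open>Existence of characters\<close>

context group
begin

lemma commutator_in_derived: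
  "x \<in> carrier G \<Longrightarrow> y \<in> carrier G \<Longrightarrow> x \<otimes> y \<otimes> inv x \<otimes> inv y \<in> derived G (carrier G)"
  unfolding derived_def by (intro generate.incl) blast

lemma normal_of_derived:
  assumes "subgroup K G" "derived G (carrier G) \<subseteq> K"
  shows "K \<lhd> G"
  unfolding normal_inv_iff
proof (intro conjI assms ballI)
  fix x k assume x: "x \<in> carrier G" and k: "k \<in> K"
  then have kc: "k \<in> carrier G" using subgroup.mem_carrier[OF assms(1)] by blast
  have "x \<otimes> k \<otimes> inv x \<otimes> inv k \<in> K"
    using commutator_in_derived[OF x kc] assms(2) by blast
  then have "x \<otimes> k \<otimes> inv x \<otimes> inv k \<otimes> k \<in> K"
    by (rule subgroup.m_closed[OF assms(1) _ k])
  then show "x \<otimes> k \<otimes> inv x \<in> K" using x kc by (simp add: m_assoc)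
qed

lemma comm_group_of_derived:
  assumes "subgroup K G" "derived G (carrier G) \<subseteq> K"
  shows "comm_group (G Mod K)"
proof -
  interpret K: normal K G by (rule normal_of_derived[OF assms])
  note one_FactGroup [simp del] mult_FactGroup [simp del]
  interpret q: group_hom G "G Mod K" "\<lambda>g. K #> g"
    using K.factorgroup_is_group K.quotient_hom(1) by (simp add: group_hom_def group_hom_axioms_def)
  show ?thesis
  proof (rule q.H.group_comm_groupI)
    fix a b assume "a \<in> carrier (G Mod K)" "b \<in> carrier (G Mod K)"
    then obtain x y where xy: "x \<in> carrier G" "y \<in> carrier G" "a = K #> x" "b = K #> y"
      unfolding K.quotient_hom(2)[symmetric] by blast
    have "x \<otimes> y \<otimes> inv x \<otimes> inv y \<in> kernel G (G Mod K) (\<lambda>g. K #> g)"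
      unfolding K.quotient_hom(3) using commutator_in_derived xy(1,2) assms(2) by blast
    then have "K #> (x \<otimes> y \<otimes> inv x \<otimes> inv y) = \<one>\<^bsub>G Mod K\<^esub>" by (simp add: kernel_def)
    then have "K #> (x \<otimes> y \<otimes> inv x \<otimes> inv y \<otimes> (y \<otimes> x)) = K #> (y \<otimes> x)"
      using xy(1,2) q.hom_mult[of "x \<otimes> y \<otimes> inv x \<otimes> inv y" "y \<otimes> x"] q.H.l_one[OF q.hom_closed[of "y \<otimes> x"]]
      by simp
    then have "K #> (x \<otimes> y) = K #> (y \<otimes> x)"
      using xy(1,2) by (simp only: word_simps m_closed inv_closed l_inv r_inv r_one)
    then show "a \<otimes>\<^bsub>G Mod K\<^esub> b = b \<otimes>\<^bsub>G Mod K\<^esub> a" using xy by simp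
  qed
qed

text \<open>Values of \<open>F\<close> on powers of \<open>a\<close> need not be divisible by the
  exponent, so only a multiple \<open>q * F\<close> is extended, with value \<open>e\<close> at
  \<open>a\<close>. As \<open>B\<close> contains all commutators, the products
  \<open>b a\<^sup>i\<close> form a subgroup. Conjugation by \<open>a\<close> changes elements of
  \<open>B\<close> by commutators in \<open>K\<close>, where \<open>F\<close> vanishes, and so
  preserves \<open>F\<close>.\<close>

lemma extend_partial_int_hom:
  fixes F :: "'a \<Rightarrow> int" and q e :: int
  assumes K: "derived G (carrier G) \<subseteq> K" and B: "subgroup B G" "K \<subseteq> B"
    and F: "int_hom (G\<lparr>carrier := B\<rparr>) F" "\<And>k. k \<in> K \<Longrightarrow> F k = 0"
    and a: "a \<in> carrier G" "\<And>i :: int. a [^] i \<in> B \<Longrightarrow> q * F (a [^] i) = i * e"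
  shows "\<exists>B' F'. subgroup B' G \<and> B \<subseteq> B' \<and> a \<in> B' \<and> int_hom (G\<lparr>carrier := B'\<rparr>) F' \<and>
    (\<forall>b\<in>B. F' b = q * F b) \<and> F' a = e"
proof -
  have Bc: "b \<in> carrier G" if "b \<in> B" for b using subgroup.mem_carrier[OF B(1) that] .
  have Fm: "F (b \<otimes> c) = F b + F c" if "b \<in> B" "c \<in> B" for b c
    using F(1) that by (simp add: int_hom_def)
  have F1: "F \<one> = 0" using Fm[of \<one> \<one>] subgroup.one_closed[OF B(1)] by simp
  have Fi: "F (inv b) = - F b" if "b \<in> B" for b
    using Fm[OF that subgroup.m_inv_closed[OF B(1) that]] F1 Bc[OF that] by simp
  have conjB: "a [^] i \<otimes> b \<otimes> inv (a [^] i) \<in> B \<and> F (a [^] i \<otimes> b \<otimes> inv (a [^] i)) = F b" if b: "b \<in> B" for i :: int and b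
  proof -
    let ?c = "a [^] i \<otimes> b \<otimes> inv (a [^] i) \<otimes> inv b"
    have c: "?c \<in> K" using commutator_in_derived[of "a [^] i" b] a(1) Bc[OF b] K by auto
    have "a [^] i \<otimes> b \<otimes> inv (a [^] i) = ?c \<otimes> b" using a(1) Bc[OF b] by (simp add: m_assoc)
    then show ?thesis
      using subgroup.m_closed[OF B(1) _ b, of ?c] Fm[of ?c b] F(2)[OF c] c B(2) b by auto
  qed
  have well: "q * F b + i * e = q * F b' + j * e"
    if b: "b \<in> B" "b' \<in> B" and eq: "b \<otimes> a [^] i = b' \<otimes> a [^] j" for b b' and i j :: int
  proof -
    have c: "b \<in> carrier G" "b' \<in> carrier G" "a [^] i \<in> carrier G" "a [^] j \<in> carrier G"
      using b Bc a(1) by auto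
    have "inv b \<otimes> (b \<otimes> a [^] i) \<otimes> inv (a [^] j) = inv b \<otimes> (b' \<otimes> a [^] j) \<otimes> inv (a [^] j)"
      unfolding eq ..
    then have "a [^] (i - j) = inv b \<otimes> b'"
      using c a(1) by (simp add: int_pow_diff word_simps)
    moreover have "inv b \<otimes> b' \<in> B" using b B(1) by (simp add: subgroup.m_closed subgroup.m_inv_closed)
    ultimately have "q * F (inv b \<otimes> b') = (i - j) * e" using a(2)[of "i - j"] by simp
    then have "q * (F b' - F b) = (i - j) * e"
      using Fm[OF subgroup.m_inv_closed[OF B(1) b(1)] b(2)] Fi[OF b(1)] by simp
    then show ?thesis by (simp add: algebra_simps)
  qed
  define B' where "B' = {b \<otimes> a [^] i | b (i :: int). b \<in> B}"
  define F' where "F' = (\<lambda>z. SOME v. \<exists>b i. b \<in> B \<and> z = b \<otimes> a [^] (i :: int) \<and> v = q * F b + i * e)"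
  have F': "F' (b \<otimes> a [^] i) = q * F b + i * e" if b: "b \<in> B" for b and i :: int
  proof -
    have "\<exists>b' j. b' \<in> B \<and> b \<otimes> a [^] i = b' \<otimes> a [^] (j :: int) \<and> F' (b \<otimes> a [^] i) = q * F b' + j * e"
      unfolding F'_def by (rule someI_ex[of "\<lambda>v. \<exists>b' j. b' \<in> B \<and> b \<otimes> a [^] i = b' \<otimes> a [^] (j :: int) \<and> v = q * F b' + j * e"]) (use b in blast)
    then show ?thesis using well b by metis
  qed
  have prod: "b \<otimes> a [^] i \<otimes> (b' \<otimes> a [^] j) = b \<otimes> (a [^] i \<otimes> b' \<otimes> inv (a [^] i)) \<otimes> a [^] (i + j)"
    if "b \<in> B" "b' \<in> B" for b b' and i j :: int
    using that Bc a(1) by (simp add: int_pow_mult word_simps)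
  have closed: "b \<otimes> (a [^] i \<otimes> b' \<otimes> inv (a [^] i)) \<in> B" if "b \<in> B" "b' \<in> B" for b b' and i :: int
    using subgroup.m_closed[OF B(1) that(1)] conjB[OF that(2), of i] by blast
  have mem: "b \<otimes> a [^] i \<in> B'" if "b \<in> B" for b and i :: int using that unfolding B'_def by blast
  have "subgroup B' G"
  proof (rule subgroupI)
    show "B' \<subseteq> carrier G" using Bc a(1) by (auto simp: B'_def)
    show "B' \<noteq> {}" using mem[OF subgroup.one_closed[OF B(1)]] by blast
    show "inv z \<in> B'" if z: "z \<in> B'" for z
    proof -
      obtain b i where b: "b \<in> B" "z = b \<otimes> a [^] (i :: int)" using z unfolding B'_def by blast
      have ib: "inv b \<in> B" by (rule subgroup.m_inv_closed[OF B(1) b(1)])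
      have "inv z = \<one> \<otimes> (a [^] (- i) \<otimes> inv b \<otimes> inv (a [^] (- i))) \<otimes> a [^] (- i)"
        using b Bc a(1) by (simp add: int_pow_neg word_simps)
      then show ?thesis using mem[OF closed[OF subgroup.one_closed[OF B(1)] ib]] by metis
    qed
    show "y \<otimes> z \<in> B'" if yz: "y \<in> B'" "z \<in> B'" for y z
    proof -
      obtain b i b' j where "b \<in> B" "y = b \<otimes> a [^] (i :: int)" "b' \<in> B" "z = b' \<otimes> a [^] (j :: int)"
        using yz unfolding B'_def by blast
      then show ?thesis using prod[of b b' i j] mem[OF closed[of b b' i]] by simp
    qed
  qed
  moreover have "int_hom (G\<lparr>carrier := B'\<rparr>) F'"
    unfolding int_hom_def
  proof (intro ballI)
    fix y z assume "y \<in> carrier (G\<lparr>carrier := B'\<rparr>)" "z \<in> carrier (G\<lparr>carrier := B'\<rparr>)"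
    then obtain b i b' j where b: "b \<in> B" "y = b \<otimes> a [^] (i :: int)" "b' \<in> B" "z = b' \<otimes> a [^] (j :: int)"
      unfolding B'_def by auto
    have "F' (y \<otimes> z) = q * (F b + F b') + (i + j) * e"
      unfolding b(2,4) prod[OF b(1,3)] F'[OF closed[OF b(1,3)]]
      using Fm[OF b(1)] conjB[OF b(3), of i] by simp
    then show "F' (y \<otimes>\<^bsub>G\<lparr>carrier := B'\<rparr>\<^esub> z) = F' y + F' z"
      using F'[OF b(1), of i] F'[OF b(3), of j] b(2,4) by (simp add: algebra_simps)
  qed
  moreover have "B \<subseteq> B'"
  proof
    fix b assume "b \<in> B"
    then show "b \<in> B'" using mem[of b 0] Bc by simp
  qed
  moreover have "a \<in> B'" "F' a = e"
    using mem[OF subgroup.one_closed[OF B(1)], of 1] F'[OF subgroup.one_closed[OF B(1)], of 1] a(1) F1 by simp_all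
  moreover have "F' b = q * F b" if "b \<in> B" for b
    using F'[OF that, of 0] Bc[OF that] by simp
  ultimately show ?thesis by blast
qed

text \<open>A character on the group generated by \<open>K\<close> and \<open>y\<close> is extended
  over the generators of \<open>G\<close> one at a time. Each extension multiplies it by a nonzero
  integer, so the value at \<open>y\<close> stays nonzero; finite generation makes the process stop
  at \<open>G\<close>.\<close>

lemma int_hom_nonzero_on:
  assumes K: "subgroup K G" "derived G (carrier G) \<subseteq> K" and fg: "finitely_generated G"
    and y: "y \<in> carrier G" "\<And>q :: int. q \<noteq> 0 \<Longrightarrow> y [^] q \<notin> K"
  shows "\<exists>F. int_hom G F \<and> (\<forall>k\<in>K. F k = 0) \<and> F y \<noteq> 0"
proof -
  obtain S where S: "finite S" "S \<subseteq> carrier G" "generate G S = carrier G"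
    using fg unfolding finitely_generated_def by blast
  let ?P = "\<lambda>B F. subgroup B G \<and> K \<subseteq> B \<and> y \<in> B \<and> int_hom (G\<lparr>carrier := B\<rparr>) F \<and> (\<forall>k\<in>K. F k = 0) \<and> F y \<noteq> 0"
  have "\<exists>B F. ?P B F \<and> S \<subseteq> B"
    using S(1,2)
  proof (induction S rule: finite_induct)
    case empty
    \<comment> \<open>The zero character on \<open>K\<close> is extended with value \<open>1\<close>
      at \<open>y\<close>. Compatibility has to be checked for the zeroth power only, as no other
      power of \<open>y\<close> lies in \<open>K\<close>.\<close>
    have "\<exists>B' F'. subgroup B' G \<and> K \<subseteq> B' \<and> y \<in> B' \<and> int_hom (G\<lparr>carrier := B'\<rparr>) F' \<and>
        (\<forall>b\<in>K. F' b = 1 * 0) \<and> F' y = 1"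
      by (rule extend_partial_int_hom[OF K(2,1) order.refl _ _ y(1)]) (use y(2) in \<open>auto simp: int_hom_def\<close>)
    then show ?case by fastforce
  next
    case (insert a S)
    then obtain B F where BF: "?P B F" "S \<subseteq> B" by auto
    have B: "subgroup B G" "K \<subseteq> B" "int_hom (G\<lparr>carrier := B\<rparr>) F" "\<And>k. k \<in> K \<Longrightarrow> F k = 0"
      "y \<in> B" "F y \<noteq> 0" using BF(1) by auto
    have a: "a \<in> carrier G" using insert.prems by simp
    interpret GB: group "G\<lparr>carrier := B\<rparr>" by (rule subgroup_imp_group[OF B(1)])
    have Fpow: "F (b [^] j) = j * F b" if "b \<in> B" for b and j :: int
      using GB.int_hom_pow[OF B(3), of b j] that int_pow_consistent[OF B(1) that, of j] by simp
    \<comment> \<open>If a nonzero power \<open>a [^] i\<close> lies in \<open>B\<close>, the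
      multiplier \<open>i\<close> and the value of \<open>F\<close> at that power are consistent
      with all other powers in \<open>B\<close>. Otherwise no value at \<open>a\<close> is forced,
      and \<open>0\<close> is taken.\<close>
    have "\<exists>q e :: int. q \<noteq> 0 \<and> (\<forall>i :: int. a [^] i \<in> B \<longrightarrow> q * F (a [^] i) = i * e)"
    proof (cases "\<exists>i :: int. i \<noteq> 0 \<and> a [^] i \<in> B")
      case True
      then obtain i :: int where i: "i \<noteq> 0" "a [^] i \<in> B" by blast
      have "i * F (a [^] j) = j * F (a [^] i)" if j: "a [^] j \<in> B" for j :: int
        using Fpow[OF j, of i] Fpow[OF i(2), of j] a by (simp add: int_pow_pow mult.commute)
      then show ?thesis using i(1) by blast
    next
      case False
      then have "a [^] i \<in> B \<longrightarrow> 1 * F (a [^] i) = i * 0" for i :: int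
        using Fpow[OF subgroup.one_closed[OF B(1)], of 0] by (cases "i = 0") auto
      then have "(1 :: int) \<noteq> 0 \<and> (\<forall>i :: int. a [^] i \<in> B \<longrightarrow> 1 * F (a [^] i) = i * 0)"
        by simp
      then show ?thesis by blast
    qed
    then obtain q e :: int where q: "q \<noteq> 0" "\<And>i :: int. a [^] i \<in> B \<Longrightarrow> q * F (a [^] i) = i * e"
      by blast
    obtain B' F' where B': "subgroup B' G" "B \<subseteq> B'" "a \<in> B'" "int_hom (G\<lparr>carrier := B'\<rparr>) F'"
      "\<And>b. b \<in> B \<Longrightarrow> F' b = q * F b"
      using extend_partial_int_hom[OF K(2) B(1-4) a q(2)] by blast
    have "?P B' F'" using B' B q(1) by (auto simp: subset_iff)
    moreover have "insert a S \<subseteq> B'" using B'(2,3) BF(2) by auto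
    ultimately show ?case by blast
  qed
  then obtain B F where BF: "?P B F" "S \<subseteq> B" by blast
  then have B: "subgroup B G" by blast
  have "generate G S \<subseteq> B" by (rule generate_subgroup_incl[OF BF(2) B])
  then have "B = carrier G" using S(3) subgroup.subset[OF B] by auto
  then show ?thesis using BF(1) by auto
qed

text \<open>\<open>F\<close> is made to vanish on the old dual elements by subtracting a combination
  of the old characters, and then divided by its least positive value \<open>d\<close> on their
  common kernel. An element \<open>z0\<close> of that kernel with value \<open>d\<close> becomes the
  new dual element.\<close>

lemma dual_system_extend:
  fixes h :: "nat \<Rightarrow> 'a \<Rightarrow> int"
  assumes dual: "dual_system G {..<r} h g" and K: "K \<subseteq> carrier G" "\<And>i k. i < r \<Longrightarrow> k \<in> K \<Longrightarrow> h i k = 0"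
    and F: "int_hom G F" "\<And>k. k \<in> K \<Longrightarrow> F k = 0"
    and y: "y \<in> carrier G" "\<And>i. i < r \<Longrightarrow> h i y = 0" "F y \<noteq> 0"
  shows "\<exists>h' g'. dual_system G {..<Suc r} h' g' \<and> (\<forall>i<r. h' i = h i \<and> g' i = g i) \<and>
    (\<forall>i<Suc r. \<forall>k\<in>K. h' i k = 0)"
proof -
  have h: "\<And>i. i < r \<Longrightarrow> int_hom G (h i)" and g: "\<And>i. i < r \<Longrightarrow> g i \<in> carrier G"
    and hg: "\<And>i j. i < r \<Longrightarrow> j < r \<Longrightarrow> h i (g j) = (if i = j then 1 else 0)"
    using dual unfolding dual_system_def by auto
  define Z where "Z = {z \<in> carrier G. \<forall>i\<in>{..<r}. h i z = 0}"
  have Z: "subgroup Z G" unfolding Z_def by (rule kernel_int_homs_subgroup) (use h in simp)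
  have Zc: "z \<in> carrier G" if "z \<in> Z" for z using that by (simp add: Z_def)
  define P where "P = (\<lambda>d. 0 < d \<and> (\<exists>z\<in>Z. F z = int d))"
  have "\<exists>d. P d"
  proof (cases "0 < F y")
    case True
    then show ?thesis using y by (intro exI[of _ "nat (F y)"]) (auto simp: P_def Z_def)
  next
    case False
    have "inv y \<in> Z" using y h by (auto simp: Z_def int_hom_inv)
    then show ?thesis
      using False y int_hom_inv[OF F(1) y(1)]
      by (intro exI[of _ "nat (- F y)"]) (auto simp: P_def intro!: bexI[of _ "inv y"])
  qed
  then obtain d where d: "P d" "\<And>d'. P d' \<Longrightarrow> d \<le> d'"
    by (metis LeastI_ex Least_le)
  then obtain z0 where z0: "z0 \<in> Z" "F z0 = int d" "0 < d" unfolding P_def by blast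
  have dvd: "int d dvd F z" if z: "z \<in> Z" for z
  proof (rule ccontr)
    assume "\<not> int d dvd F z"
    then have pos: "0 < F z mod int d" using z0(3) by (simp add: dvd_eq_mod_eq_0 order.not_eq_order_implies_strict)
    let ?z = "z \<otimes> z0 [^] (- (F z div int d))"
    have "?z \<in> Z" using subgroup.m_closed[OF Z z subgroup_int_pow_closed[OF Z z0(1)]] .
    moreover have "F ?z = F z mod int d"
      using Zc[OF z] Zc[OF z0(1)] z0(2)
      by (simp add: int_hom_mult[OF F(1)] int_hom_pow[OF F(1)] minus_div_mult_eq_mod[symmetric] algebra_simps)
    ultimately have "P (nat (F z mod int d))"
      using pos unfolding P_def by (intro conjI bexI[of _ ?z]) simp_all
    then have "d \<le> nat (F z mod int d)" by (rule d(2))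
    moreover have "F z mod int d < int d" using z0(3) by simp
    ultimately show False using pos by linarith
  qed
  \<comment> \<open>\<open>G' z\<close> is the value of \<open>F\<close> on the component of
    \<open>z\<close> in the common kernel \<open>Z\<close>, obtained by dividing \<open>z\<close> by
    a product of dual elements. Divisibility by \<open>d\<close> on \<open>Z\<close> thus gives
    divisibility on the whole group.\<close>
  define G' where "G' = (\<lambda>z. F z - (\<Sum>l<r. h l z * F (g l)))"
  have dvd': "int d dvd G' z" if z: "z \<in> carrier G" for z
  proof -
    obtain \<xi> where \<xi>: "\<xi> \<in> generate G (g ` {..<r})" "\<And>f. int_hom G f \<Longrightarrow> f \<xi> = (\<Sum>l<r. h l z * f (g l))"
      using product_with_prescribed_values[where x = g and c = "\<lambda>l. h l z" and I = "{..<r}"] g by blast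
    have \<xi>c: "\<xi> \<in> carrier G" using \<xi>(1) g generate_in_carrier[of "g ` {..<r}"] by blast
    have "h i \<xi> = h i z" if i: "i < r" for i
    proof -
      have "h i \<xi> = (\<Sum>l<r. if i = l then h l z else 0)"
        unfolding \<xi>(2)[OF h[OF i]] using hg i by (intro sum.cong) auto
      then show ?thesis using i by simp
    qed
    then have "z \<otimes> inv \<xi> \<in> Z" using z \<xi>c h by (auto simp: Z_def int_hom_mult int_hom_inv)
    moreover have "F (z \<otimes> inv \<xi>) = G' z"
      using z \<xi>c \<xi>(2)[OF F(1)] by (simp add: int_hom_mult[OF F(1)] int_hom_inv[OF F(1)] G'_def)
    ultimately show ?thesis using dvd by metis
  qed
  define h' where "h' = h(r := \<lambda>z. G' z div int d)"
  define g' where "g' = g(r := z0)"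
  have G'm: "G' (x \<otimes> z) = G' x + G' z" if "x \<in> carrier G" "z \<in> carrier G" for x z
    using that h by (simp add: G'_def int_hom_mult[OF F(1)] int_hom_mult sum.distrib algebra_simps)
  have "int_hom G (h' r)"
    unfolding int_hom_def using dvd' G'm by (simp add: h'_def div_plus_div_distrib_dvd_left)
  moreover have "h' r (g i) = 0" if i: "i < r" for i
  proof -
    have "(\<Sum>l<r. h l (g i) * F (g l)) = (\<Sum>l<r. if i = l then F (g l) else 0)"
      using hg i by (intro sum.cong) auto
    then show ?thesis using i by (simp add: h'_def G'_def)
  qed
  moreover have "h' r z0 = 1" using z0 by (simp add: h'_def G'_def Z_def)
  moreover have "h i z0 = 0" if "i < r" for i using z0(1) that by (simp add: Z_def)
  moreover have "z0 \<in> carrier G" by (rule Zc[OF z0(1)])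
  moreover have "h' r k = 0" if "k \<in> K" for k
    using that K F(2) by (simp add: h'_def G'_def)
  ultimately show ?thesis
    using h g hg K(2)
    by (intro exI[of _ h'] exI[of _ g']) (auto simp: dual_system_def h'_def g'_def less_Suc_eq)
qed

end

context group
begin

lemma int_hom_quotient:
  assumes "K \<lhd> G" and f: "int_hom G f" "\<And>k. k \<in> K \<Longrightarrow> f k = 0"
  shows "\<exists>f'. int_hom (G Mod K) f' \<and> (\<forall>g\<in>carrier G. f' (K #> g) = f g)"
proof -
  interpret K: normal K G by (rule assms(1))
  let ?Z = "\<lparr>carrier = UNIV :: int set, monoid.mult = (+), one = 0\<rparr>"
  have Z: "group ?Z"
    by (rule groupI) (auto intro: exI[of _ "- _"])
  have "f \<in> hom G ?Z" using f(1) by (intro homI) (auto simp: int_hom_def)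
  moreover have "kernel G (G Mod K) (\<lambda>g. K #> g) \<subseteq> kernel G ?Z f"
    unfolding K.quotient_hom(3) using f(2) K.subset by (auto simp: kernel_def)
  ultimately obtain f' where f': "f' \<in> hom (G Mod K) ?Z" "\<And>g. g \<in> carrier G \<Longrightarrow> f' (K #> g) = f g"
    using hom_factor[OF is_group K.factorgroup_is_group Z K.quotient_hom(1,2)] by blast
  have "int_hom (G Mod K) f'"
    unfolding int_hom_def using hom_mult[OF f'(1)] by simp
  then show ?thesis using f'(2) by blast
qed

lemma co_rank_eq:
  fixes f :: "nat \<Rightarrow> 'a \<Rightarrow> int"
  assumes K: "subgroup K G" "derived G (carrier G) \<subseteq> K"
    and dual: "dual_system G {..<r} f x" and fK: "\<And>i k. i < r \<Longrightarrow> k \<in> K \<Longrightarrow> f i k = 0"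
    and torsion: "\<And>y. y \<in> carrier G \<Longrightarrow> (\<forall>i<r. f i y = 0) \<Longrightarrow> \<exists>q :: int. q \<noteq> 0 \<and> y [^] q \<in> K"
  shows "co_rank G K = r"
proof -
  have KN: "K \<lhd> G" by (rule normal_of_derived[OF K])
  interpret K: normal K G by (rule KN)
  interpret C: comm_group "G Mod K" by (rule comm_group_of_derived[OF K])
  note one_FactGroup [simp del] mult_FactGroup [simp del]
  interpret q: group_hom G "G Mod K" "\<lambda>g. K #> g"
    using K.factorgroup_is_group K.quotient_hom(1) by (simp add: group_hom_def group_hom_axioms_def)
  have "\<exists>f'. int_hom (G Mod K) f' \<and> (\<forall>g\<in>carrier G. f' (K #> g) = f i g)" if "i < r" for i
    by (rule int_hom_quotient[OF KN]) (use that dual fK in \<open>auto simp: dual_system_def\<close>)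
  then obtain f' where f': "\<And>i. i < r \<Longrightarrow> int_hom (G Mod K) (f' i)"
    "\<And>i g. i < r \<Longrightarrow> g \<in> carrier G \<Longrightarrow> f' i (K #> g) = f i g"
    by metis
  have x: "\<And>i. i < r \<Longrightarrow> x i \<in> carrier G" using dual by (simp add: dual_system_def)
  have "dual_system (G Mod K) {..<r} f' (\<lambda>i. K #> x i)"
    unfolding dual_system_def
  proof (intro conjI ballI)
    fix i j assume "i \<in> {..<r}" "j \<in> {..<r}"
    then show "f' i (K #> x j) = (if i = j then 1 else 0)"
      using dual f'(2) x unfolding dual_system_def by simp
  qed (use f' x in auto)
  then have "torsion_free_rank (G Mod K) = r"
  proof (rule C.torsion_free_rank_eq)
    fix X assume X: "X \<in> carrier (G Mod K)" "\<forall>i<r. f' i X = 0"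
    then obtain y where y: "y \<in> carrier G" "X = K #> y"
      unfolding K.quotient_hom(2)[symmetric] by blast
    then obtain q :: int where q: "q \<noteq> 0" "y [^] q \<in> K" using torsion[OF y(1)] X(2) f'(2) by auto
    have "K #> (y [^] q) = \<one>\<^bsub>G Mod K\<^esub>"
      using q(2) K.quotient_hom(3) unfolding kernel_def by blast
    then have "X [^]\<^bsub>G Mod K\<^esub> q = \<one>\<^bsub>G Mod K\<^esub>" using q.hom_int_pow[OF y(1), of q] y(2) by simp
    then show "\<exists>q :: int. q \<noteq> 0 \<and> X [^]\<^bsub>G Mod K\<^esub> q = \<one>\<^bsub>G Mod K\<^esub>" using q(1) by blast
  qed
  then show ?thesis by (simp add: co_rank_def)
qed

text \<open>With more characters than generators, some nontrivial combination of the characters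
  vanishes on all generators and hence everywhere. Its values at the dual elements are its
  coefficients.\<close>

lemma dual_system_bound:
  fixes h :: "nat \<Rightarrow> 'a \<Rightarrow> int"
  assumes E: "finite E" "E \<subseteq> carrier G" "generate G E = carrier G" and dual: "dual_system G {..<r} h g"
  shows "r \<le> card E"
proof (rule ccontr)
  assume "\<not> r \<le> card E"
  then have "card E < card {..<r}" by simp
  obtain e where e: "E = e ` {..<card E}" using ex_bij_betw_nat_finite[OF E(1)]
    by (metis atLeast0LessThan bij_betw_imp_surj_on)
  obtain c where c: "\<exists>i<r. c i \<noteq> 0" "\<And>j. j < card E \<Longrightarrow> (\<Sum>i<r. c i * h i (e j)) = 0"
    using integer_relation[of "{..<r}" "card E" "\<lambda>j i. h i (e j)"] \<open>card E < card {..<r}\<close> by auto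
  define \<Phi> where "\<Phi> = (\<lambda>z. \<Sum>i<r. c i * h i z)"
  have h: "\<And>i. i < r \<Longrightarrow> int_hom G (h i)" using dual by (simp add: dual_system_def)
  have \<Phi>: "int_hom G \<Phi>"
    unfolding int_hom_def \<Phi>_def using h by (simp add: int_hom_mult sum.distrib distrib_left)
  have "subgroup {z \<in> carrier G. \<forall>i\<in>{()}. \<Phi> z = 0} G"
    by (rule kernel_int_homs_subgroup) (rule \<Phi>)
  moreover have "E \<subseteq> {z \<in> carrier G. \<forall>i\<in>{()}. \<Phi> z = 0}"
  proof
    fix z assume z: "z \<in> E"
    then obtain j where "j < card E" "z = e j" using e by blast
    then show "z \<in> {z \<in> carrier G. \<forall>i\<in>{()}. \<Phi> z = 0}" using c(2) E(2) z by (auto simp: \<Phi>_def)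
  qed
  ultimately have zero: "\<Phi> z = 0" if "z \<in> carrier G" for z
    using generate_subgroup_incl[of E "{z \<in> carrier G. \<forall>i\<in>{()}. \<Phi> z = 0}"] that unfolding E(3) by auto
  obtain i where i: "i < r" "c i \<noteq> 0" using c(1) by blast
  have "\<Phi> (g i) = (\<Sum>j<r. if j = i then c j else 0)"
    unfolding \<Phi>_def using dual i(1) by (intro sum.cong) (auto simp: dual_system_def)
  then show False using zero[of "g i"] i dual by (simp add: dual_system_def)
qed

text \<open>Systems vanishing on \<open>K\<close> have bounded size, so a largest one among those
  that continue the given characters exists. An element of its common kernel of infinite order
  modulo \<open>K\<close> would allow one more character; so its size is the co-rank. Keeping the
  given characters in front preserves their positions.\<close>

lemma dual_system_complete:
  fixes h :: "nat \<Rightarrow> 'a \<Rightarrow> int"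
  assumes K: "subgroup K G" "derived G (carrier G) \<subseteq> K" and fg: "finitely_generated G"
    and dual: "dual_system G {..<r0} h g" and hK: "\<And>i k. i < r0 \<Longrightarrow> k \<in> K \<Longrightarrow> h i k = 0"
  obtains h' g' where "dual_system G {..<co_rank G K} h' g'" "r0 \<le> co_rank G K"
    "\<And>i. i < r0 \<Longrightarrow> h' i = h i" "\<And>i k. i < co_rank G K \<Longrightarrow> k \<in> K \<Longrightarrow> h' i k = 0"
proof -
  define P where "P = (\<lambda>r. \<exists>h' g'. dual_system G {..<r} h' g' \<and> r0 \<le> r \<and> (\<forall>i<r0. h' i = h i) \<and>
    (\<forall>i<r. \<forall>k\<in>K. h' i k = 0))"
  obtain E where E: "finite E" "E \<subseteq> carrier G" "generate G E = carrier G"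
    using fg unfolding finitely_generated_def by blast
  have P0: "P r0" unfolding P_def using dual hK by blast
  have bound: "r \<le> card E" if "P r" for r using that dual_system_bound[OF E] unfolding P_def by blast
  define r where "r = Greatest P"
  have Pr: "P r" unfolding r_def by (rule GreatestI_nat[where P = P, OF P0 bound])
  have max: "r' \<le> r" if "P r'" for r' unfolding r_def by (rule Greatest_le_nat[where P = P, OF that bound])
  obtain h' g' where h': "dual_system G {..<r} h' g'" "r0 \<le> r" "\<And>i. i < r0 \<Longrightarrow> h' i = h i"
    "\<And>i k. i < r \<Longrightarrow> k \<in> K \<Longrightarrow> h' i k = 0"
    using Pr unfolding P_def by blast
  have "co_rank G K = r"
  proof (rule co_rank_eq[OF K h'(1,4)])
    fix y assume y: "y \<in> carrier G" "\<forall>i<r. h' i y = 0"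
    show "\<exists>q :: int. q \<noteq> 0 \<and> y [^] q \<in> K"
    proof (rule ccontr)
      assume "\<not> (\<exists>q :: int. q \<noteq> 0 \<and> y [^] q \<in> K)"
      then have "\<exists>F. int_hom G F \<and> (\<forall>k\<in>K. F k = 0) \<and> F y \<noteq> 0"
        by (intro int_hom_nonzero_on[OF K fg y(1)]) blast
      then obtain F where F: "int_hom G F" "\<And>k. k \<in> K \<Longrightarrow> F k = 0" "F y \<noteq> 0"
        by blast
      have Kc: "K \<subseteq> carrier G" by (rule subgroup.subset[OF K(1)])
      have ex: "\<exists>h'' g''. dual_system G {..<Suc r} h'' g'' \<and> (\<forall>i<r. h'' i = h' i \<and> g'' i = g' i) \<and>
          (\<forall>i<Suc r. \<forall>k\<in>K. h'' i k = 0)"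
        using y(2) by (intro dual_system_extend[OF h'(1) Kc h'(4) F(1,2) y(1) _ F(3)]) simp_all
      obtain h'' g'' where h'': "dual_system G {..<Suc r} h'' g''" "\<And>i. i < r \<Longrightarrow> h'' i = h' i"
        "\<And>i k. i < Suc r \<Longrightarrow> k \<in> K \<Longrightarrow> h'' i k = 0"
        using ex by blast
      have "P (Suc r)"
        unfolding P_def using h'' h'(2,3) by (intro exI[of _ h''] exI[of _ g'']) auto
      then show False using max by fastforce
    qed
  qed
  then show ?thesis using that h' by simp
qed

text \<open>Generators of \<open>K\<close>, together with the generators of \<open>G\<close>
  corrected by products of dual elements, generate the kernel. No conjugates are required, because a
  subgroup containing \<open>K\<close>, and with it the derived subgroup, is normal.\<close>

lemma finitely_generated_dual_kernel:
  fixes h :: "nat \<Rightarrow> 'a \<Rightarrow> int"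
  assumes K: "subgroup K G" "derived G (carrier G) \<subseteq> K" and fg: "finitely_generated G"
    and fgK: "finitely_generated (G\<lparr>carrier := K\<rparr>)"
    and dual: "dual_system G {..<m} h g" and hK: "\<And>i k. i < m \<Longrightarrow> k \<in> K \<Longrightarrow> h i k = 0"
    and "j \<le> m"
  shows "finitely_generated (G\<lparr>carrier := {x \<in> carrier G. \<forall>i<j. h i x = 0}\<rparr>)"
proof -
  let ?I = "{..<j}"
  have dualj: "dual_system G ?I h g" by (rule dual_system_subset[OF dual]) (use assms(7) in auto)
  have h: "\<And>i. i \<in> ?I \<Longrightarrow> int_hom G (h i)" and g: "\<And>i. i \<in> ?I \<Longrightarrow> g i \<in> carrier G"
    using dualj unfolding dual_system_def by blast+
  have hgj: "\<And>i l. i \<in> ?I \<Longrightarrow> l \<in> ?I \<Longrightarrow> h i (g l) = (if i = l then 1 else 0)"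
    using dualj unfolding dual_system_def by blast
  obtain E where E: "finite E" "E \<subseteq> carrier G" "generate G E = carrier G"
    using fg unfolding finitely_generated_def by blast
  obtain S where S: "finite S" "S \<subseteq> K" "generate (G\<lparr>carrier := K\<rparr>) S = K"
    using fgK unfolding finitely_generated_def by auto
  have genS: "generate G S = K" using S(3) generate_consistent[OF S(2) K(1)] by simp
  have "\<exists>\<xi>. \<xi> \<in> generate G (g ` ?I) \<and> \<xi> \<in> carrier G \<and> (\<forall>i\<in>?I. h i \<xi> = h i e)" for e
    by (rule dual_system_interpolation[OF _ dualj, of "\<lambda>i. h i e"]) auto
  then obtain \<xi> where \<xi>: "\<And>e. \<xi> e \<in> generate G (g ` ?I)" "\<And>e. \<xi> e \<in> carrier G"
    "\<And>e i. i \<in> ?I \<Longrightarrow> h i (\<xi> e) = h i e" by metis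
  let ?X = "S \<union> (\<lambda>e. e \<otimes> inv (\<xi> e)) ` E"
  define N where "N = generate G ?X"
  have Kc: "K \<subseteq> carrier G" by (rule subgroup.subset[OF K(1)])
  have Xc: "?X \<subseteq> carrier G" using S(2) Kc E(2) \<xi>(2) by auto
  have N: "subgroup N G" unfolding N_def by (rule generate_is_subgroup[OF Xc])
  have KN: "K \<subseteq> N" unfolding N_def genS[symmetric] by (rule mono_generate) blast
  have "N \<lhd> G" by (rule normal_of_derived[OF N]) (use K(2) KN in blast)
  then interpret N: normal N G .
  have "E \<subseteq> generate G (N \<union> g ` ?I)"
  proof
    fix e assume e: "e \<in> E"
    have sub: "subgroup (generate G (N \<union> g ` ?I)) G"
      by (rule generate_is_subgroup) (use N.subset g in auto)
    have "e \<otimes> inv (\<xi> e) \<in> N" unfolding N_def by (rule generate.incl) (use e in blast)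
    then have "e \<otimes> inv (\<xi> e) \<in> generate G (N \<union> g ` ?I)" by (intro generate.incl) blast
    moreover have "\<xi> e \<in> generate G (N \<union> g ` ?I)"
      using \<xi>(1)[of e] mono_generate[of "g ` ?I" "N \<union> g ` ?I"] by blast
    ultimately have "e \<otimes> inv (\<xi> e) \<otimes> \<xi> e \<in> generate G (N \<union> g ` ?I)" by (rule subgroup.m_closed[OF sub])
    then show "e \<in> generate G (N \<union> g ` ?I)" using e E(2) \<xi>(2)[of e] by (simp add: m_assoc subset_iff)
  qed
  then have gen: "generate G (N \<union> g ` ?I) = carrier G"
    using generate_subgroup_incl[OF _ generate_is_subgroup[of "N \<union> g ` ?I"], of E]
      generate_incl[of "N \<union> g ` ?I"] N.subset g E(3) by blast
  have ker_sub: "subgroup {x \<in> carrier G. \<forall>i\<in>?I. h i x = 0} G"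
    by (rule kernel_int_homs_subgroup[OF h])
  have "?X \<subseteq> {x \<in> carrier G. \<forall>i\<in>?I. h i x = 0}"
  proof
    fix x assume x: "x \<in> ?X"
    then consider "x \<in> K" | e where "e \<in> E" "x = e \<otimes> inv (\<xi> e)" using S(2) by blast
    then show "x \<in> {x \<in> carrier G. \<forall>i\<in>?I. h i x = 0}"
    proof cases
      case 1
      then show ?thesis using Kc hK assms(7) by auto
    next
      case 2
      then have "e \<in> carrier G" using E(2) by blast
      then show ?thesis using 2(2) \<xi>(2,3) h by (auto simp: int_hom_mult int_hom_inv)
    qed
  qed
  then have "N \<subseteq> {x \<in> carrier G. \<forall>i\<in>?I. h i x = 0}"
    unfolding N_def by (rule generate_subgroup_incl[OF _ ker_sub])
  moreover have "g i \<otimes> g l \<otimes> inv (g i) \<otimes> inv (g l) \<in> N" if "i \<in> ?I" "l \<in> ?I" for i l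
    using commutator_in_derived[OF g[OF that(1)] g[OF that(2)]] K(2) KN by blast
  ultimately have N_eq: "N = {x \<in> carrier G. \<forall>i\<in>?I. h i x = 0}"
    by (intro kernel_of_dual_system[OF _ dualj N gen])
      (use g N.inv_op_closed1 N.inv_op_closed2 in \<open>auto simp: conj_by_def\<close>)
  have "generate (G\<lparr>carrier := N\<rparr>) ?X = N"
    using generate_consistent[OF _ N, of ?X] generate.incl[of _ ?X G] unfolding N_def by blast
  moreover have "?X \<subseteq> N" unfolding N_def using generate.incl[of _ ?X G] by blast
  moreover have "finite ?X" using S(1) E(1) by simp
  ultimately have "finitely_generated (G\<lparr>carrier := N\<rparr>)"
    unfolding finitely_generated_def by (intro exI[of _ ?X]) simp
  then show ?thesis unfolding N_eq Ball_def lessThan_iff .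
qed

end

context conj_span_group
begin

text \<open>Generators of \<open>G\<close> corrected by products of dual elements, together with the
  commutators of dual elements, generate the kernel under conjugation by dual elements. The
  conclusion covers every larger subset of the kernel, since further commutators are added to it
  later.\<close>

lemma conj_span_dual_kernel:
  fixes f :: "'i \<Rightarrow> 'a \<Rightarrow> int"
  assumes fg: "finitely_generated G" and fin: "finite I" and dual: "dual_system G I f x"
  obtains R0 where "finite R0" "R0 \<subseteq> {g \<in> carrier G. \<forall>i\<in>I. f i g = 0}"
    "\<And>R. R0 \<subseteq> R \<Longrightarrow> R \<subseteq> {g \<in> carrier G. \<forall>i\<in>I. f i g = 0} \<Longrightarrow>
      (\<Union>p. A R p) = {g \<in> carrier G. \<forall>i\<in>I. f i g = 0}"
proof -
  have f: "\<And>i. i \<in> I \<Longrightarrow> int_hom G (f i)" using dual unfolding dual_system_def by blast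
  obtain E where E: "finite E" "E \<subseteq> carrier G" "generate G E = carrier G"
    using fg unfolding finitely_generated_def by blast
  have "\<exists>\<xi>. \<xi> \<in> generate G (x ` I) \<and> \<xi> \<in> carrier G \<and> (\<forall>i\<in>I. f i \<xi> = f i e)" for e
    by (rule dual_system_interpolation[OF fin dual, of "\<lambda>i. f i e"]) auto
  then obtain \<xi> where \<xi>: "\<And>e. \<xi> e \<in> generate G (x ` I)" "\<And>e. \<xi> e \<in> carrier G"
    "\<And>e i. i \<in> I \<Longrightarrow> f i (\<xi> e) = f i e" by metis
  let ?N = "{g \<in> carrier G. \<forall>i\<in>I. f i g = 0}"
  define R0 where "R0 = (\<lambda>e. e \<otimes> inv (\<xi> e)) ` E \<union> (\<lambda>(i, j). x i \<otimes> x j \<otimes> inv (x i) \<otimes> inv (x j)) ` (I \<times> I)"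
  have R0N: "R0 \<subseteq> ?N"
  proof
    fix y assume "y \<in> R0"
    then consider e where "e \<in> E" "y = e \<otimes> inv (\<xi> e)"
      | i j where "i \<in> I" "j \<in> I" "y = x i \<otimes> x j \<otimes> inv (x i) \<otimes> inv (x j)"
      unfolding R0_def by auto
    then show "y \<in> ?N"
    proof cases
      case 1
      then have "e \<in> carrier G" using E(2) by blast
      then show ?thesis using 1(2) \<xi>(2,3) f by (auto simp: int_hom_mult int_hom_inv)
    next
      case 2
      then show ?thesis using letters_closed f by (auto simp: int_hom_mult int_hom_inv)
    qed
  qed
  have Nsub: "subgroup ?N G" by (rule kernel_int_homs_subgroup[OF f])
  have main: "(\<Union>p. A R p) = ?N" if R: "R0 \<subseteq> R" "R \<subseteq> ?N" for R
  proof -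
    have Rc: "R \<subseteq> carrier G" using R(2) by blast
    let ?M = "\<Union>p. A R p"
    have M: "subgroup ?M G" by (rule conj_span_Union_subgroup[OF Rc])
    have RM: "R \<subseteq> ?M" using conj_span_incl[OF Rc] by blast
    have letter_conj: "conj_by G (letter l) n \<in> ?M" if "snd l \<in> I" "n \<in> ?M" for l n
      using that(2) conj_span_letter[OF Rc that(1)] by blast
    have norm: "conj_by G (x i) n \<in> ?M \<and> conj_by G (inv (x i)) n \<in> ?M" if "i \<in> I" "n \<in> ?M" for i n
      using letter_conj[of "(True, i)" n] letter_conj[of "(False, i)" n] that by (simp add: letter_val_def)
    have comm: "x i \<otimes> x j \<otimes> inv (x i) \<otimes> inv (x j) \<in> ?M" if "i \<in> I" "j \<in> I" for i j
    proof -
      have "x i \<otimes> x j \<otimes> inv (x i) \<otimes> inv (x j) \<in> R0" unfolding R0_def using that by force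
      then show ?thesis using R(1) RM by blast
    qed
    have genMc: "?M \<union> x ` I \<subseteq> carrier G" using subgroup.subset[OF M] letters_closed by blast
    have "E \<subseteq> generate G (?M \<union> x ` I)"
    proof
      fix e assume e: "e \<in> E"
      have sub: "subgroup (generate G (?M \<union> x ` I)) G"
        by (rule generate_is_subgroup[OF genMc])
      have "e \<otimes> inv (\<xi> e) \<in> ?M" using R(1) RM e unfolding R0_def by blast
      then have "e \<otimes> inv (\<xi> e) \<in> generate G (?M \<union> x ` I)" by (intro generate.incl) blast
      moreover have "\<xi> e \<in> generate G (?M \<union> x ` I)"
        using \<xi>(1)[of e] mono_generate[of "x ` I" "?M \<union> x ` I"] by blast
      ultimately have "e \<otimes> inv (\<xi> e) \<otimes> \<xi> e \<in> generate G (?M \<union> x ` I)" by (rule subgroup.m_closed[OF sub])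
      then show "e \<in> generate G (?M \<union> x ` I)" using e E(2) \<xi>(2)[of e] by (simp add: m_assoc subset_iff)
    qed
    then have gen: "generate G (?M \<union> x ` I) = carrier G"
      using generate_subgroup_incl[OF _ generate_is_subgroup[OF genMc], of E]
        generate_incl[OF genMc] E(3) by blast
    have "A R p \<subseteq> ?N" for p
      unfolding conj_span_def
    proof (rule generate_subgroup_incl[OF _ Nsub], rule subsetI)
      fix y assume "y \<in> {conj_by G (word u) r | u r. snd ` set u \<subseteq> I \<and> weight u \<le> p \<and> r \<in> R}"
      then obtain u r where u: "snd ` set u \<subseteq> I" "r \<in> R" "y = conj_by G (word u) r" by blast
      have "word u \<in> carrier G" "r \<in> carrier G" "\<forall>i\<in>I. f i r = 0" using word_closed u R(2) by auto
      then show "y \<in> ?N" using u(3) f by (simp add: int_hom_conj_by)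
    qed
    then have fM: "f i n = 0" if "i \<in> I" "n \<in> ?M" for i n using that by blast
    show ?thesis
      by (rule kernel_of_dual_system[OF fin dual M gen norm comm fM])
  qed
  show ?thesis
    by (rule that[OF _ R0N main]) (use E(1) fin in \<open>auto simp: R0_def\<close>)
qed

end

section \<open>Transfer of conjugation spans\<close>

lemma word_val_cong:
  "(\<And>l. l \<in> set u \<Longrightarrow> x (snd l) = y (snd l)) \<Longrightarrow> word_val G x u = word_val G y u"
  by (induction u) (auto simp: letter_val_def)

lemma conj_span_cong:
  assumes "\<And>i. i \<in> I \<Longrightarrow> x i = y i" "\<And>i. i \<in> I \<Longrightarrow> \<omega> i = \<omega>' i"
  shows "conj_span G x I \<omega> R p = conj_span G y I \<omega>' R p"
proof -
  have "word_val G x u = word_val G y u" "word_weight \<omega> u = word_weight \<omega>' u" if "snd ` set u \<subseteq> I" for u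
  proof -
    show "word_val G x u = word_val G y u" by (rule word_val_cong) (use that assms(1) in auto)
    show "word_weight \<omega> u = word_weight \<omega>' u" using that assms(2) by (induction u) auto
  qed
  then have "{conj_by G (word_val G x u) r | u r. snd ` set u \<subseteq> I \<and> word_weight \<omega> u \<le> p \<and> r \<in> R} =
      {conj_by G (word_val G y u) r | u r. snd ` set u \<subseteq> I \<and> word_weight \<omega>' u \<le> p \<and> r \<in> R}"
    by (intro Collect_cong) metis
  then show ?thesis by (simp add: conj_span_def)
qed

context group
begin

lemma word_val_subgroup:
  assumes "subgroup H G" "\<forall>l\<in>set u. x (snd l) \<in> H"
  shows "word_val (G\<lparr>carrier := H\<rparr>) x u = word_val G x u \<and> word_val G x u \<in> H"
  using assms(2)
proof (induction u)
  case Nil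
  then show ?case using subgroup.one_closed[OF assms(1)] by simp
next
  case (Cons l u)
  then show ?case
    using m_inv_consistent[OF assms(1)]
    by (auto simp: letter_val_def subgroup.m_closed[OF assms(1)] subgroup.m_inv_closed[OF assms(1)])
qed

lemma conj_span_subgroup_eq:
  assumes H: "subgroup H G" and x: "x ` I \<subseteq> H" and R: "R \<subseteq> H"
  shows "conj_span (G\<lparr>carrier := H\<rparr>) x I \<omega> R p = conj_span G x I \<omega> R p"
proof -
  let ?G = "G\<lparr>carrier := H\<rparr>"
  have word: "word_val ?G x u = word_val G x u" "word_val G x u \<in> H" if "snd ` set u \<subseteq> I" for u
    using word_val_subgroup[OF H, of u x] x that by (auto simp: image_subset_iff)
  have conj: "conj_by ?G g r = conj_by G g r" if "g \<in> H" for g r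
    using m_inv_consistent[OF H that] by (simp add: conj_by_def)
  have eq: "{conj_by ?G (word_val ?G x u) r | u r. snd ` set u \<subseteq> I \<and> word_weight \<omega> u \<le> p \<and> r \<in> R} =
      {conj_by G (word_val G x u) r | u r. snd ` set u \<subseteq> I \<and> word_weight \<omega> u \<le> p \<and> r \<in> R}"
    by (intro Collect_cong) (metis word conj)
  have sub: "{conj_by G (word_val G x u) r | u r. snd ` set u \<subseteq> I \<and> word_weight \<omega> u \<le> p \<and> r \<in> R} \<subseteq> H"
  proof
    fix y assume "y \<in> {conj_by G (word_val G x u) r | u r. snd ` set u \<subseteq> I \<and> word_weight \<omega> u \<le> p \<and> r \<in> R}"
    then obtain u r where "snd ` set u \<subseteq> I" "r \<in> R" "y = conj_by G (word_val G x u) r" by blast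
    then show "y \<in> H" using conj_by_subgroup[OF H word(2)] R by blast
  qed
  show ?thesis
    unfolding conj_span_def eq by (rule generate_consistent[OF sub H])
qed

lemma conj_span_mono_letters:
  assumes "J \<subseteq> I"
  shows "conj_span G x J \<omega> R p \<subseteq> conj_span G x I \<omega> R p"
  unfolding conj_span_def using assms by (intro mono_generate) blast

end

lemma (in group_hom) conj_by_image:
  "a \<in> carrier G \<Longrightarrow> r \<in> carrier G \<Longrightarrow> h (conj_by G a r) = conj_by H (h a) (h r)"
  by (simp add: conj_by_def)

lemma (in group_hom) conj_span_image:
  assumes x: "x ` I \<subseteq> carrier G" and R: "R \<subseteq> carrier G"
  shows "h ` conj_span G x I \<omega> R p = conj_span H (h \<circ> x) I \<omega> (h ` R) p"
proof -
  let ?X = "{conj_by G (word_val G x u) r | u r. snd ` set u \<subseteq> I \<and> word_weight \<omega> u \<le> p \<and> r \<in> R}"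
  have word: "word_val G x u \<in> carrier G" "h (word_val G x u) = word_val H (h \<circ> x) u"
    if "snd ` set u \<subseteq> I" for u
    using that x by (auto intro!: G.word_val_closed word_val_image)
  have img: "h (conj_by G (word_val G x u) r) = conj_by H (word_val H (h \<circ> x) u) (h r)"
    if "snd ` set u \<subseteq> I" "r \<in> R" for u r
    using conj_by_image[OF word(1)[OF that(1)] subsetD[OF R that(2)]] word(2)[OF that(1)] by simp
  have "?X \<subseteq> carrier G"
  proof
    fix y assume "y \<in> ?X"
    then obtain u r where u: "snd ` set u \<subseteq> I" "r \<in> R" "y = conj_by G (word_val G x u) r" by blast
    then show "y \<in> carrier G" using word(1)[OF u(1)] subsetD[OF R u(2)] by simp
  qed
  then have "h ` generate G ?X = generate H (h ` ?X)" by (rule generate_img[symmetric])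
  also have "h ` ?X = {conj_by H (word_val H (h \<circ> x) u) r | u r. snd ` set u \<subseteq> I \<and> word_weight \<omega> u \<le> p \<and> r \<in> h ` R}"
    (is "_ = ?Y")
  proof
    show "h ` ?X \<subseteq> ?Y"
    proof
      fix y assume "y \<in> h ` ?X"
      then obtain u r where "snd ` set u \<subseteq> I" "word_weight \<omega> u \<le> p" "r \<in> R" "y = h (conj_by G (word_val G x u) r)"
        by blast
      then show "y \<in> ?Y" using img by blast
    qed
    show "?Y \<subseteq> h ` ?X"
    proof
      fix y assume "y \<in> ?Y"
      then obtain u r' where u: "snd ` set u \<subseteq> I" "word_weight \<omega> u \<le> p" "r' \<in> h ` R"
          "y = conj_by H (word_val H (h \<circ> x) u) r'"
        by blast
      obtain r where r: "r \<in> R" "r' = h r" using u(3) by (rule imageE)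
      have "conj_by G (word_val G x u) r \<in> ?X" using u(1,2) r(1) by blast
      then show "y \<in> h ` ?X" unfolding u(4) r(2) img[OF u(1) r(1), symmetric] by (rule imageI)
    qed
  qed
  finally show ?thesis by (simp add: conj_span_def)
qed

context conj_span_group
begin

lemma conj_span_in_subgroup:
  assumes H: "subgroup H G" and "x ` I \<subseteq> H" "R \<subseteq> H"
  shows "A R p \<subseteq> H"
  unfolding conj_span_def
proof (rule generate_subgroup_incl[OF _ H], rule subsetI)
  fix y assume "y \<in> {conj_by G (word u) r | u r. snd ` set u \<subseteq> I \<and> weight u \<le> p \<and> r \<in> R}"
  then obtain u r where u: "snd ` set u \<subseteq> I" "r \<in> R" "y = conj_by G (word u) r" by blast
  have "word u \<in> H" using word_val_subgroup[OF H, of u x] assms(2) u(1) by auto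
  then show "y \<in> H" using conj_by_subgroup[OF H] assms(3) u by blast
qed

lemma finite_subset_conj_span:
  assumes R: "R \<subseteq> carrier G" and "finite X" "X \<subseteq> (\<Union>p. A R p)"
  shows "\<exists>p. \<forall>q\<ge>p. X \<subseteq> A R q"
  using assms(2,3)
proof (induction X rule: finite_induct)
  case (insert a X)
  then obtain p where p: "\<And>q. p \<le> q \<Longrightarrow> X \<subseteq> A R q" by auto
  obtain p' where "a \<in> A R p'" using insert.prems by auto
  then have "insert a X \<subseteq> A R q" if "max p p' \<le> q" for q
    using p[of q] conj_span_mono[OF R, of p' q] that by auto
  then show ?case by blast
qed simp

text \<open>Conjugation by the \<open>T\<close>-th power of a letter multiplies another letter by
  commutators of letters, which lie in \<open>R\<close>, conjugated by fewer than \<open>T\<close>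
  further letters of weight 1. Conjugation by \<open>u\<close> raises their weight by
  \<open>c\<close> at most. This is the behaviour of a shifted pair on the side where the power is
  visible.\<close>

lemma conj_span_shift_power:
  assumes R: "R \<subseteq> carrier G"
    and comm: "\<And>l l'. snd l \<in> I \<Longrightarrow> snd l' \<in> I \<Longrightarrow> letter l \<otimes> letter l' \<otimes> inv (letter l) \<otimes> inv (letter l') \<in> R"
    and k: "snd k \<in> I" "\<omega> (snd k) = 1"
    and u: "u \<in> carrier G" "\<And>r. r \<in> R \<Longrightarrow> conj_by G u r \<in> A R c"
      "\<And>l. snd l \<in> I \<Longrightarrow> \<exists>a\<in>A R c. conj_by G u (letter l) = letter l \<otimes> a"
    and l: "snd l \<in> I"
  shows "\<exists>a\<in>A R (T + c). conj_by G (u \<otimes> letter k [^] (T :: nat)) (letter l) = letter l \<otimes> a"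
proof -
  note c = letter_closed[OF k(1)] letter_closed[OF l] u(1)
  have pow: "\<exists>a\<in>A R n. conj_by G (letter k [^] n) (letter l) = letter l \<otimes> a" for n :: nat
  proof (induction n)
    case 0
    show ?case
      using c subgroup.one_closed[OF conj_span_subgroup[OF R], of 0] by (intro bexI[of _ \<one>]) auto
  next
    case (Suc n)
    then obtain a where a: "a \<in> A R n" "conj_by G (letter k [^] n) (letter l) = letter l \<otimes> a" by blast
    have ac: "a \<in> carrier G" by (rule conj_span_closed[OF R a(1)])
    let ?b = "inv (letter l) \<otimes> letter k \<otimes> letter l \<otimes> inv (letter k)"
    have "?b = letter (inv_letter l) \<otimes> letter k \<otimes> inv (letter (inv_letter l)) \<otimes> inv (letter k)"
      using letters_closed[OF l] by simp
    moreover have "snd (inv_letter l) \<in> I" using l by (simp add: inv_letter_def)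
    ultimately have "?b \<in> R" using comm[of "inv_letter l" k] k(1) by metis
    then have b: "?b \<in> A R (Suc n)" using conj_span_incl[OF R] by blast
    have "conj_by G (letter k [^] Suc n) (letter l) = conj_by G (letter k) (conj_by G (letter k [^] n) (letter l))"
      using c by (simp only: nat_pow_Suc2 conj_by_mult nat_pow_closed)
    also have "\<dots> = letter l \<otimes> (?b \<otimes> conj_by G (letter k) a)"
      unfolding a(2) using c ac by (simp add: conj_by_def word_simps)
    finally have eq: "conj_by G (letter k [^] Suc n) (letter l) = letter l \<otimes> (?b \<otimes> conj_by G (letter k) a)" .
    have "conj_by G (letter k) a \<in> A R (Suc n)" using conj_span_letter[OF R k(1) a(1)] k(2) by simp
    then have "?b \<otimes> conj_by G (letter k) a \<in> A R (Suc n)"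
      by (rule subgroup.m_closed[OF conj_span_subgroup[OF R] b])
    then show ?case using eq by blast
  qed
  obtain a where a: "a \<in> A R T" "conj_by G (letter k [^] T) (letter l) = letter l \<otimes> a" using pow by blast
  obtain b where b: "b \<in> A R c" "conj_by G u (letter l) = letter l \<otimes> b" using u(3)[OF l] by blast
  have ac: "a \<in> carrier G" "b \<in> carrier G" using conj_span_closed[OF R] a(1) b(1) by blast+
  have letters: "\<exists>a\<in>A R c. \<exists>b\<in>carrier G. (\<forall>z\<in>A R (T + c). commute G b z) \<and>
      conj_by G u (letter l') = letter l' \<otimes> a \<otimes> b" if l': "snd l' \<in> I" for l'
  proof -
    obtain a where a: "a \<in> A R c" "conj_by G u (letter l') = letter l' \<otimes> a" using u(3)[OF l'] by blast
    then show ?thesis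
      using conj_span_closed[OF R] letter_closed[OF l']
      by (intro bexI[of _ a] bexI[of _ \<one>]) (auto simp: commute_def)
  qed
  have ua: "conj_by G u a \<in> A R (T + c)"
    by (rule conj_span_shift[OF R u(1,2) letters order.refl a(1)])
  have "conj_by G (u \<otimes> letter k [^] T) (letter l) = letter l \<otimes> (b \<otimes> conj_by G u a)"
    using c ac a(2) b(2) by (simp add: conj_by_mult conj_by_mult_right m_assoc)
  moreover have "b \<otimes> conj_by G u a \<in> A R (T + c)"
    using subgroup.m_closed[OF conj_span_subgroup[OF R] _ ua] conj_span_mono[OF R, of c "T + c"] b(1) by auto
  ultimately show ?thesis by blast
qed

end

lemma (in group) conj_by_DirProd:
  assumes "group H" "a \<in> carrier G" "b \<in> carrier H"
  shows "conj_by (G \<times>\<times> H) (a, b) (r, s) = (conj_by G a r, conj_by H b s)"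
  using assms inv_DirProd[OF is_group assms(1)] by (simp add: conj_by_def)

lemma word_val_DirProd:
  assumes "group G" "group H" "\<forall>l\<in>set u. x (snd l) \<in> carrier G" "\<forall>l\<in>set u. y (snd l) \<in> carrier H"
  shows "word_val (G \<times>\<times> H) (\<lambda>i. (x i, y i)) u = (word_val G x u, word_val H y u)"
  using assms(3,4)
  by (induction u) (auto simp: letter_val_def inv_DirProd[OF assms(1,2)])

section \<open>Fibre products over free abelian groups\<close>

text \<open>The description of the kernel by conjugates is applied inside the finitely generated
  kernel \<open>D\<close> of the first \<open>j\<close> characters. Only the letters in
  \<open>L\<close> are then needed; they lie in \<open>D\<close> because \<open>L\<close> avoids the
  first \<open>j\<close> indices.\<close>

lemma (in group) side_generators:
  fixes h :: "nat \<Rightarrow> 'a \<Rightarrow> int"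
  assumes dual: "dual_system G {..<n} h g" and fg: "finitely_generated (G\<lparr>carrier := {x \<in> carrier G. \<forall>i<j. h i x = 0}\<rparr>)"
    and L: "finite L" "L \<subseteq> {..<n}" "L \<inter> {..<j} = {}" "j \<le> n"
    and N: "N = {x \<in> carrier G. \<forall>i\<in>{..<j} \<union> L. h i x = 0}"
  obtains R0 where "finite R0" "R0 \<subseteq> N"
    "\<And>R. R0 \<subseteq> R \<Longrightarrow> R \<subseteq> N \<Longrightarrow> (\<Union>p. conj_span G g L \<omega> R p) = N"
proof -
  define D where "D = {x \<in> carrier G. \<forall>i\<in>{..<j}. h i x = 0}"
  let ?D = "G\<lparr>carrier := D\<rparr>"
  have h: "\<And>i. i < n \<Longrightarrow> int_hom G (h i)" and g: "\<And>i. i < n \<Longrightarrow> g i \<in> carrier G"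
    and hg: "\<And>i l. i < n \<Longrightarrow> l < n \<Longrightarrow> h i (g l) = (if i = l then 1 else 0)"
    using dual unfolding dual_system_def by auto
  have D: "subgroup D G" unfolding D_def by (rule kernel_int_homs_subgroup) (use h L(4) in auto)
  have gD: "g ` L \<subseteq> D"
  proof
    fix y assume "y \<in> g ` L"
    then obtain l where l: "l \<in> L" "y = g l" by blast
    have ln: "l < n" "\<not> l < j" using L(2,3) l(1) by auto
    have "h i (g l) = 0" if "i < j" for i using hg[of i l] ln L(4) that by auto
    then show "y \<in> D" using g[OF ln(1)] l(2) by (simp add: D_def)
  qed
  interpret D: group ?D by (rule subgroup_imp_group[OF D])
  interpret DS: conj_span_group ?D g L \<omega>
    by unfold_locales (use gD in auto)
  have Dc: "x \<in> carrier G" if "x \<in> D" for x using subgroup.mem_carrier[OF D that] .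
  have Ln: "l < n" if "l \<in> L" for l using L(2) that by auto
  have dualD: "dual_system ?D L h g"
    unfolding dual_system_def
  proof (intro conjI ballI)
    fix l assume l: "l \<in> L"
    show "int_hom ?D (h l)" using h[OF Ln[OF l]] Dc by (simp add: int_hom_def)
    show "g l \<in> carrier ?D" using gD l by auto
    show "h l (g l') = (if l = l' then 1 else 0)" if "l' \<in> L" for l'
      by (rule hg[OF Ln[OF l] Ln[OF that]])
  qed
  have fgD: "finitely_generated ?D" using fg unfolding D_def Ball_def lessThan_iff .
  have N_eq: "{x \<in> carrier ?D. \<forall>i\<in>L. h i x = 0} = N" unfolding N D_def by auto
  obtain R0 where R0: "finite R0" "R0 \<subseteq> N"
    "\<And>R. R0 \<subseteq> R \<Longrightarrow> R \<subseteq> N \<Longrightarrow> (\<Union>p. conj_span ?D g L \<omega> R p) = N"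
    by (rule DS.conj_span_dual_kernel[OF fgD L(1) dualD, unfolded N_eq]) blast
  have "N \<subseteq> D" unfolding N D_def by auto
  then have "(\<Union>p. conj_span G g L \<omega> R p) = N" if "R0 \<subseteq> R" "R \<subseteq> N" for R
    using R0(3)[OF that] conj_span_subgroup_eq[OF D gD, of R] that(2) by simp
  then show ?thesis
    using that[OF R0(1,2)] by blast
qed

text \<open>
  A pair \<open>(f, X)\<close> stands for the requirement that \<open>f\<close> and some element of \<open>X\<close> have the same image; as this
  holds in \<open>H\<close>, a single relator enforces it.
\<close>

lemma finite_relations_cover:
  assumes "group H" and \<pi>: "\<pi> \<in> hom (free_group {..<d :: nat}) H"
    and C: "finite C" "\<And>f X. (f, X) \<in> C \<Longrightarrow>
      f \<in> carrier (free_group {..<d}) \<and> X \<subseteq> carrier (free_group {..<d}) \<and> \<pi> f \<in> \<pi> ` X"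
  obtains \<Gamma> :: "nat letter list set monoid" and q \<pi>' where "group \<Gamma>" "finitely_presented \<Gamma>"
    "q \<in> hom (free_group {..<d}) \<Gamma>" "q ` carrier (free_group {..<d}) = carrier \<Gamma>" "\<pi>' \<in> hom \<Gamma> H"
    "\<And>f. f \<in> carrier (free_group {..<d}) \<Longrightarrow> \<pi>' (q f) = \<pi> f" "\<And>f X. (f, X) \<in> C \<Longrightarrow> q f \<in> q ` X"
proof -
  let ?F = "free_group {..<d}"
  have F: "group ?F" by (rule group_free_group)
  interpret \<pi>: group_hom ?F H \<pi>
    using assms F by (simp add: group_hom_def group_hom_axioms_def)
  have "\<exists>x. x \<in> snd c \<and> \<pi> (fst c) = \<pi> x" if "c \<in> C" for c
    using C(2)[of "fst c" "snd c"] that by (metis imageE prod.collapse)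
  then obtain s where s: "\<And>c. c \<in> C \<Longrightarrow> s c \<in> snd c \<and> \<pi> (fst c) = \<pi> (s c)" by metis
  have sc: "fst c \<in> carrier ?F" "s c \<in> carrier ?F" if "c \<in> C" for c
    using C(2)[of "fst c" "snd c"] s[OF that] that by auto
  define Rel where "Rel = (\<lambda>c. fst c \<otimes>\<^bsub>?F\<^esub> inv\<^bsub>?F\<^esub> (s c)) ` C"
  have Rel: "finite Rel" "Rel \<subseteq> carrier ?F" "Rel \<subseteq> kernel ?F H \<pi>"
    using C(1) sc s by (auto simp: Rel_def kernel_def)
  define Y where "Y = normal_closure ?F Rel"
  have "Y \<lhd> ?F" unfolding Y_def by (rule \<pi>.G.normal_closure_normal[OF Rel(2)])
  then interpret Y: normal Y ?F .
  have Yk: "Y \<subseteq> kernel ?F H \<pi>"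
    unfolding Y_def by (rule normal_closure_minimal[OF \<pi>.normal_kernel Rel(3)])
  note one_FactGroup [simp del] mult_FactGroup [simp del]
  define q where "q = (\<lambda>g. Y #>\<^bsub>?F\<^esub> g)"
  note quot = Y.quotient_hom[folded q_def]
  let ?\<Gamma> = "?F Mod Y"
  have grp: "group ?\<Gamma>" by (rule Y.factorgroup_is_group)
  interpret q: group_hom ?F ?\<Gamma> q
    using F grp quot(1) by (simp add: group_hom_def group_hom_axioms_def)
  have fp: "finitely_presented ?\<Gamma>"
    unfolding finitely_presented_iff[OF grp]
    using Rel(1,2) quot unfolding Y_def by blast
  obtain \<pi>' where \<pi>': "\<pi>' \<in> hom ?\<Gamma> H" "\<And>g. g \<in> carrier ?F \<Longrightarrow> \<pi>' (q g) = \<pi> g"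
    using hom_factor[OF F grp assms(1) quot(1,2) \<pi>] Yk unfolding quot(3) by blast
  have qX: "q f \<in> q ` X" if c: "(f, X) \<in> C" for f X
  proof -
    have "f \<otimes>\<^bsub>?F\<^esub> inv\<^bsub>?F\<^esub> (s (f, X)) \<in> Rel" unfolding Rel_def using c by force
    then have "f \<otimes>\<^bsub>?F\<^esub> inv\<^bsub>?F\<^esub> (s (f, X)) \<in> Y"
      unfolding Y_def by (rule subsetD[OF normal_closure_superset])
    then have "f \<otimes>\<^bsub>?F\<^esub> inv\<^bsub>?F\<^esub> (s (f, X)) \<in> kernel ?F ?\<Gamma> q"
      unfolding quot(3) .
    then have "q f \<otimes>\<^bsub>?\<Gamma>\<^esub> inv\<^bsub>?\<Gamma>\<^esub> q (s (f, X)) = \<one>\<^bsub>?\<Gamma>\<^esub>"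
      using sc[OF c] by (simp add: kernel_def)
    then have "inv\<^bsub>?\<Gamma>\<^esub> (inv\<^bsub>?\<Gamma>\<^esub> q (s (f, X))) = q f"
      using sc[OF c] by (intro q.H.inv_equality) simp_all
    then have "q f = q (s (f, X))" using sc[OF c] by simp
    then show ?thesis using s[OF c] by simp
  qed
  show ?thesis by (rule that[OF grp fp quot(1,2) \<pi>' qX])
qed

section \<open>Uniform bounds in the two factors\<close>

context conj_span_group
begin

lemma conj_span_in_kernel:
  assumes "R \<subseteq> {g \<in> carrier G. \<forall>i<J. h i g = 0}" and h: "\<And>i. i < J \<Longrightarrow> int_hom G (h i)"
  shows "A R p \<subseteq> {g \<in> carrier G. \<forall>i<(J::nat). h i g = 0}"
  unfolding conj_span_def
proof (rule generate_subgroup_incl, rule subsetI)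
  show "subgroup {g \<in> carrier G. \<forall>i<J. h i g = 0} G"
    using kernel_int_homs_subgroup[of "{..<J}" h] h unfolding Ball_def lessThan_iff by blast
  fix y assume "y \<in> {conj_by G (word u) r | u r. snd ` set u \<subseteq> I \<and> weight u \<le> p \<and> r \<in> R}"
  then obtain u r where u: "snd ` set u \<subseteq> I" "r \<in> R" "y = conj_by G (word u) r" by blast
  have "r \<in> carrier G" "\<And>i. i < J \<Longrightarrow> h i r = 0" using subsetD[OF assms(1) u(2)] by simp_all
  then show "y \<in> {g \<in> carrier G. \<forall>i<J. h i g = 0}"
    using u(3) word_closed[OF u(1)] h by (simp add: int_hom_conj_by)
qed

text \<open>Characters are invariant under conjugation, so the elements of \<open>U\<close> move
  \<open>R\<close> and change letters within the kernel. Finitely many elements of the kernel are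
  involved, and they all lie in one step of the filtration.\<close>

lemma conj_span_bound:
  assumes R: "finite R" "R \<subseteq> carrier G" and fin: "finite I" and U: "finite U" "U \<subseteq> carrier G"
    and N: "(\<Union>p. A R p) = {g \<in> carrier G. \<forall>i<(J::nat). h i g = 0}"
    and h: "\<And>i. i < J \<Longrightarrow> int_hom G (h i)"
  shows "\<exists>c. \<forall>q\<ge>c. \<forall>u\<in>U. (\<forall>r\<in>R. conj_by G u r \<in> A R q) \<and>
    (\<forall>l. snd l \<in> I \<longrightarrow> (\<exists>a\<in>A R q. conj_by G u (letter l) = letter l \<otimes> a))"
proof -
  let ?L = "UNIV \<times> I"
  define X where "X = (\<lambda>(u, r). conj_by G u r) ` (U \<times> R) \<union> (\<lambda>(u, l). inv (letter l) \<otimes> conj_by G u (letter l)) ` (U \<times> ?L)"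
  have RN: "\<And>r i. r \<in> R \<Longrightarrow> i < J \<Longrightarrow> h i r = 0"
    using conj_span_incl[OF R(2), of 0] N by blast
  have "X \<subseteq> (\<Union>p. A R p)"
    unfolding N
  proof
    fix y assume "y \<in> X"
    then consider u r where "u \<in> U" "r \<in> R" "y = conj_by G u r"
      | u l where "u \<in> U" "snd l \<in> I" "y = inv (letter l) \<otimes> conj_by G u (letter l)"
      unfolding X_def by auto
    then show "y \<in> {g \<in> carrier G. \<forall>i<J. h i g = 0}"
    proof cases
      case 1
      then have "u \<in> carrier G" "r \<in> carrier G" using U(2) R(2) by auto
      then show ?thesis using 1 RN h by (simp add: int_hom_conj_by)
    next
      case 2
      then have "u \<in> carrier G" "letter l \<in> carrier G" using U(2) letter_closed by auto
      then show ?thesis using 2(3) h by (simp add: int_hom_conj_by int_hom_mult int_hom_inv)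
    qed
  qed
  moreover have "finite X" using R(1) U(1) fin by (simp add: X_def)
  ultimately obtain c where c: "\<And>q. c \<le> q \<Longrightarrow> X \<subseteq> A R q"
    using finite_subset_conj_span[OF R(2)] by blast
  show ?thesis
  proof (intro exI[of _ c] allI impI ballI conjI)
    fix q u assume q: "c \<le> q" and u: "u \<in> U"
    show "conj_by G u r \<in> A R q" if r: "r \<in> R" for r
    proof -
      have "conj_by G u r \<in> X" unfolding X_def by (intro UnI1 image_eqI[of _ _ "(u, r)"]) (use u r in simp_all)
      then show ?thesis by (rule subsetD[OF c[OF q]])
    qed
    fix l :: "bool \<times> 'i" assume l: "snd l \<in> I"
    have "(u, l) \<in> U \<times> ?L" using u l by (cases l) simp
    then have "inv (letter l) \<otimes> conj_by G u (letter l) \<in> X"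
      unfolding X_def by (intro UnI2 image_eqI[of _ _ "(u, l)"]) simp_all
    then have "inv (letter l) \<otimes> conj_by G u (letter l) \<in> A R q" by (rule subsetD[OF c[OF q]])
    moreover have "conj_by G u (letter l) = letter l \<otimes> (inv (letter l) \<otimes> conj_by G u (letter l))"
      using u U(2) letter_closed[OF l] by (auto simp: inv_cancel_left)
    ultimately show "\<exists>a\<in>A R q. conj_by G u (letter l) = letter l \<otimes> a" by blast
  qed
qed

end

lemma (in group) letter_commutators:
  fixes h :: "nat \<Rightarrow> 'a \<Rightarrow> int" and g :: "nat \<Rightarrow> 'a"
  assumes "finite I" "\<And>i. i \<in> I \<Longrightarrow> g i \<in> carrier G" "\<And>i. i < J \<Longrightarrow> int_hom G (h i)"
  obtains C where "finite C" "C \<subseteq> {x \<in> carrier G. \<forall>i<J. h i x = 0}"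
    "\<And>l l'. snd l \<in> I \<Longrightarrow> snd l' \<in> I \<Longrightarrow> letter_val G g l \<otimes> letter_val G g l' \<otimes>
       inv (letter_val G g l) \<otimes> inv (letter_val G g l') \<in> C"
proof
  let ?f = "\<lambda>(l, l'). letter_val G g l \<otimes> letter_val G g l' \<otimes> inv (letter_val G g l) \<otimes> inv (letter_val G g l')"
  let ?L = "UNIV \<times> I"
  show "finite (?f ` (?L \<times> ?L))" using assms(1) by simp
  show "?f ` (?L \<times> ?L) \<subseteq> {x \<in> carrier G. \<forall>i<J. h i x = 0}"
    using assms(2,3) by (auto simp: int_hom_mult int_hom_inv)
  show "letter_val G g l \<otimes> letter_val G g l' \<otimes> inv (letter_val G g l) \<otimes> inv (letter_val G g l') \<in> ?f ` (?L \<times> ?L)"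
    if "snd l \<in> I" "snd l' \<in> I" for l l'
  proof -
    have "(l, l') \<in> ?L \<times> ?L" using that by (cases l; cases l') simp
    then show ?thesis by force
  qed
qed

text \<open>By \<open>k \<le> m\<close> every \<open>i < m + k\<close> satisfies
  \<open>i < m\<close> or \<open>i - m < m\<close>. The shear therefore adds only characters that
  are not sheared themselves, and it is triangular.\<close>

locale fibre_data =
  fixes G1 :: "('a, 'c) monoid_scheme" and G2 :: "('b, 'd) monoid_scheme"
    and h1 :: "nat \<Rightarrow> 'a \<Rightarrow> int" and g1 :: "nat \<Rightarrow> 'a"
    and h2 :: "nat \<Rightarrow> 'b \<Rightarrow> int" and g2 :: "nat \<Rightarrow> 'b" and m k :: nat
  assumes grp1: "group G1" and grp2: "group G2"
    and fp1: "finitely_presented G1" and fp2: "finitely_presented G2" and km: "k \<le> m"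
    and dual1: "dual_system G1 {..<m + k} h1 g1" and dual2: "dual_system G2 {..<m + k} h2 g2"
    and fg1: "\<And>j. j \<le> m \<Longrightarrow> finitely_generated (G1\<lparr>carrier := {x \<in> carrier G1. \<forall>i<j. h1 i x = 0}\<rparr>)"
    and fg2: "\<And>j. j \<le> k \<Longrightarrow> finitely_generated (G2\<lparr>carrier := {x \<in> carrier G2. \<forall>i<j. h2 i x = 0}\<rparr>)"
begin

sublocale G1: group G1 by (rule grp1)
sublocale G2: group G2 by (rule grp2)

abbreviation GG where "GG \<equiv> G1 \<times>\<times> G2"

sublocale GG: group GG by (rule DirProd_group[OF grp1 grp2])

text \<open>
  For \<open>i \<ge> m\<close> the shear makes the pairs \<open>(g1 (i - m), g2 (i - m) g2 i\<^sup>T)\<close> satisfy all equations. They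
  conjugate the first factor as the short element \<open>g1 (i - m)\<close> does, and the second factor so up to the
  power of the letter \<open>g2 i\<close>.
\<close>

definition \<psi> :: "nat \<Rightarrow> nat \<Rightarrow> 'a \<Rightarrow> int" where
  "\<psi> T i x = (if i < m then h1 i x else h1 i x + int T * h1 (i - m) x)"

text \<open>\<open>J\<close> is the number of equations imposed so far, from the full product at
  \<open>J = 0\<close> to the fibre product at \<open>J = m + k\<close>.\<close>

definition P :: "nat \<Rightarrow> nat \<Rightarrow> ('a \<times> 'b) set" where
  "P T J = {(a, b). a \<in> carrier G1 \<and> b \<in> carrier G2 \<and> (\<forall>i<J. \<psi> T i a = h2 i b)}"

lemma h1: "i < m + k \<Longrightarrow> int_hom G1 (h1 i)" and g1: "i < m + k \<Longrightarrow> g1 i \<in> carrier G1"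
  and h1g1: "i < m + k \<Longrightarrow> l < m + k \<Longrightarrow> h1 i (g1 l) = (if i = l then 1 else 0)"
  using dual1 unfolding dual_system_def by auto

lemma h2: "i < m + k \<Longrightarrow> int_hom G2 (h2 i)" and g2: "i < m + k \<Longrightarrow> g2 i \<in> carrier G2"
  and h2g2: "i < m + k \<Longrightarrow> l < m + k \<Longrightarrow> h2 i (g2 l) = (if i = l then 1 else 0)"
  using dual2 unfolding dual_system_def by auto

lemma \<psi>_int_hom: "i < m + k \<Longrightarrow> int_hom G1 (\<psi> T i)"
  unfolding int_hom_def
  using h1[of i] h1[of "i - m"] by (auto simp: \<psi>_def int_hom_def algebra_simps)

text \<open>The triangular system is solved over \<int>: for \<open>i \<ge> m\<close> the
  contribution of the shear is \<open>T\<close> times the value already prescribed at the index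
  \<open>i - m\<close>.\<close>

lemma lift1: "\<exists>a\<in>carrier G1. \<forall>i<m + k. \<psi> T i a = v i"
proof -
  obtain a where a: "a \<in> carrier G1"
    "\<And>i. i \<in> {..<m + k} \<Longrightarrow> h1 i a = (if i < m then v i else v i - int T * v (i - m))"
    by (rule G1.dual_system_interpolation[OF _ dual1, where c = "\<lambda>i. if i < m then v i else v i - int T * v (i - m)"]) auto
  have "\<psi> T i a = v i" if "i < m + k" for i
  proof (cases "i < m")
    case False
    then have "i - m < m" "i - m < m + k" using that km by linarith+
    then show ?thesis using a(2)[of i] a(2)[of "i - m"] that False by (simp add: \<psi>_def)
  qed (use a(2)[of i] that in \<open>simp add: \<psi>_def\<close>)
  then show ?thesis using a(1) by blast
qed

lemma lift2: "\<exists>b\<in>carrier G2. \<forall>i<m + k. h2 i b = v i"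
  by (rule G2.dual_system_interpolation[OF _ dual2, where c = v]) auto

lemma P_subgroup:
  assumes "J \<le> m + k"
  shows "subgroup (P T J) GG"
proof (rule GG.subgroupI)
  show "P T J \<subseteq> carrier GG" by (auto simp: P_def)
  have hom: "int_hom G1 (\<psi> T i)" "int_hom G2 (h2 i)" if "i < J" for i
    using that assms \<psi>_int_hom h2 by auto
  have "(\<one>\<^bsub>G1\<^esub>, \<one>\<^bsub>G2\<^esub>) \<in> P T J"
    using hom by (auto simp: P_def G1.int_hom_one G2.int_hom_one)
  then show "P T J \<noteq> {}" by blast
  show "inv\<^bsub>GG\<^esub> p \<in> P T J" if "p \<in> P T J" for p
    using that hom by (auto simp: P_def inv_DirProd[OF grp1 grp2] G1.int_hom_inv G2.int_hom_inv)
  show "p \<otimes>\<^bsub>GG\<^esub> p' \<in> P T J" if "p \<in> P T J" "p' \<in> P T J" for p p'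
    using that hom by (auto simp: P_def G1.int_hom_mult G2.int_hom_mult)
qed

text \<open>Triangularity gives the sheared and the original characters the same common kernel at
  every stage, so the intersection with \<open>G1\<close> does not depend on
  \<open>T\<close>.\<close>

lemma \<psi>_kernel:
  assumes "J \<le> m + k"
  shows "(\<forall>i<J. \<psi> T i a = 0) \<longleftrightarrow> (\<forall>i<J. h1 i a = 0)"
proof
  assume *: "\<forall>i<J. \<psi> T i a = 0"
  show "\<forall>i<J. h1 i a = 0"
  proof (intro allI impI)
    fix i assume i: "i < J"
    have "i - m < m \<and> i - m < J" if "\<not> i < m" using that i assms km by linarith
    then have "\<not> i < m \<Longrightarrow> h1 (i - m) a = 0" using * by (auto simp: \<psi>_def dest!: spec[of _ "i - m"])
    then show "h1 i a = 0" using *[rule_format, OF i] by (auto simp: \<psi>_def split: if_splits)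
  qed
next
  assume *: "\<forall>i<J. h1 i a = 0"
  show "\<forall>i<J. \<psi> T i a = 0" using * by (auto simp: \<psi>_def)
qed

text \<open>The indices in \<open>W\<close> lie beyond those whose common kernel in
  \<open>G1\<close> is known to be finitely generated, those in \<open>I\<close> beyond the first
  \<open>J - m\<close>, a number at most \<open>k\<close>, which plays this role in
  \<open>G2\<close>. By \<open>k \<le> m\<close> the set \<open>W\<close> is contained in
  \<open>I\<close>. The constant \<open>c\<close> bounds the effect of the short elements
  \<open>g1 (i - m)\<close> and \<open>g2 (i - m)\<close>. All data are independent of
  \<open>T\<close>, which can therefore be chosen afterwards.\<close>

lemma one_sided_data:
  assumes J: "J \<le> m + k"
  defines "I \<equiv> {J - m..<J}" and "W \<equiv> {m..<J}"
  obtains R S \<omega> c where "finite R" "finite S"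
    "R \<subseteq> {x \<in> carrier G1. \<forall>i<J. h1 i x = 0}" "S \<subseteq> {x \<in> carrier G2. \<forall>i<J. h2 i x = 0}"
    "(\<Union>p. conj_span G1 g1 I \<omega> R p) = {x \<in> carrier G1. \<forall>i<J. h1 i x = 0}"
    "(\<Union>p. conj_span G2 g2 I \<omega> S p) = {x \<in> carrier G2. \<forall>i<J. h2 i x = 0}"
    "\<And>l l'. snd l \<in> I \<Longrightarrow> snd l' \<in> I \<Longrightarrow> letter_val G1 g1 l \<otimes>\<^bsub>G1\<^esub> letter_val G1 g1 l' \<otimes>\<^bsub>G1\<^esub>
       inv\<^bsub>G1\<^esub> (letter_val G1 g1 l) \<otimes>\<^bsub>G1\<^esub> inv\<^bsub>G1\<^esub> (letter_val G1 g1 l') \<in> R"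
    "\<And>l l'. snd l \<in> I \<Longrightarrow> snd l' \<in> I \<Longrightarrow> letter_val G2 g2 l \<otimes>\<^bsub>G2\<^esub> letter_val G2 g2 l' \<otimes>\<^bsub>G2\<^esub>
       inv\<^bsub>G2\<^esub> (letter_val G2 g2 l) \<otimes>\<^bsub>G2\<^esub> inv\<^bsub>G2\<^esub> (letter_val G2 g2 l') \<in> S"
    "\<And>i. 1 \<le> \<omega> i" "\<And>i. i \<in> W \<Longrightarrow> \<omega> i = 1"
    "\<And>l r. snd l \<in> I - W \<Longrightarrow> r \<in> R \<Longrightarrow> conj_by G1 (letter_val G1 g1 l) r \<in> conj_span G1 g1 I \<omega> R (\<omega> (snd l) - 1)"
    "\<And>e i r. i \<in> W \<Longrightarrow> r \<in> R \<Longrightarrow> conj_by G1 (letter_val G1 g1 (e, i - m)) r \<in> conj_span G1 g1 I \<omega> R c"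
    "\<And>e i l. i \<in> W \<Longrightarrow> snd l \<in> I \<Longrightarrow> \<exists>a\<in>conj_span G1 g1 I \<omega> R c.
       conj_by G1 (letter_val G1 g1 (e, i - m)) (letter_val G1 g1 l) = letter_val G1 g1 l \<otimes>\<^bsub>G1\<^esub> a"
    "\<And>e i s. i \<in> W \<Longrightarrow> s \<in> S \<Longrightarrow> conj_by G2 (letter_val G2 g2 (e, i - m)) s \<in> conj_span G2 g2 I \<omega> S c"
    "\<And>e i l. i \<in> W \<Longrightarrow> snd l \<in> I \<Longrightarrow> \<exists>b\<in>conj_span G2 g2 I \<omega> S c.
       conj_by G2 (letter_val G2 g2 (e, i - m)) (letter_val G2 g2 l) = letter_val G2 g2 l \<otimes>\<^bsub>G2\<^esub> b"
proof -
  \<comment> \<open>Subtraction is truncated: for \<open>J \<le> m\<close> this is \<open>0\<close>,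
    \<open>I\<close> consists of all indices below \<open>J\<close>, and \<open>W\<close> is
    empty.\<close>
  define i where "i = J - m"
  define j where "j = min J m"
  have ij: "i \<le> k" "j \<le> m" "i \<le> m" "i \<le> j" using J km by (auto simp: i_def j_def)
  let ?N1 = "{x \<in> carrier G1. \<forall>i<J. h1 i x = 0}" and ?N2 = "{x \<in> carrier G2. \<forall>i<J. h2 i x = 0}"
  have h1J: "\<And>l. l < J \<Longrightarrow> int_hom G1 (h1 l)" and h2J: "\<And>l. l < J \<Longrightarrow> int_hom G2 (h2 l)"
    using h1 h2 J by simp_all
  have WI: "W \<subseteq> I" and finI: "finite I" "finite W" using ij(3) by (auto simp: W_def I_def i_def)
  have g1I: "\<And>l. l \<in> I \<Longrightarrow> g1 l \<in> carrier G1" and g2I: "\<And>l. l \<in> I \<Longrightarrow> g2 l \<in> carrier G2"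
    using g1 g2 J by (simp_all add: I_def)
  have W_split: "{..<j} \<union> W = {..<J}" "W \<inter> {..<j} = {}" by (auto simp: W_def j_def)
  have I_split: "{..<i} \<union> I = {..<J}" "I \<inter> {..<i} = {}" by (auto simp: I_def i_def)
  obtain R0 where R0: "finite R0" "R0 \<subseteq> ?N1"
    "\<And>R. R0 \<subseteq> R \<Longrightarrow> R \<subseteq> ?N1 \<Longrightarrow> (\<Union>p. conj_span G1 g1 W (\<lambda>_. 1) R p) = ?N1"
  proof (rule G1.side_generators[OF dual1 fg1[OF ij(2)] finI(2) _ W_split(2), of ?N1 "\<lambda>_. 1"])
    show "W \<subseteq> {..<m + k}" using J by (auto simp: W_def)
    show "?N1 = {x \<in> carrier G1. \<forall>i\<in>{..<j} \<union> W. h1 i x = 0}" unfolding W_split(1) by auto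
  qed (use ij in auto)
  obtain C1 where C1: "finite C1" "C1 \<subseteq> ?N1"
    "\<And>l l'. snd l \<in> I \<Longrightarrow> snd l' \<in> I \<Longrightarrow> letter_val G1 g1 l \<otimes>\<^bsub>G1\<^esub> letter_val G1 g1 l' \<otimes>\<^bsub>G1\<^esub>
       inv\<^bsub>G1\<^esub> (letter_val G1 g1 l) \<otimes>\<^bsub>G1\<^esub> inv\<^bsub>G1\<^esub> (letter_val G1 g1 l') \<in> C1"
    by (rule G1.letter_commutators[where g = g1 and h = h1 and J = J, OF finI(1) g1I h1J]) (assumption, assumption, rule that)
  define R where "R = R0 \<union> C1"
  have R: "finite R" "R \<subseteq> ?N1" "R \<subseteq> carrier G1" using R0 C1 unfolding R_def by auto
  have NW: "(\<Union>p. conj_span G1 g1 W (\<lambda>_. 1) R p) = ?N1" using R0(3)[of R] R(2) by (simp add: R_def)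
  interpret WS: conj_span_group G1 g1 W "\<lambda>_. 1" by unfold_locales (use WI g1I in auto)
  let ?V = "letter_val G1 g1 ` (UNIV \<times> (I - W))"
  have V: "finite ?V" "?V \<subseteq> carrier G1" using finI(1) g1I by auto
  obtain p0 where p0': "\<forall>q\<ge>p0. \<forall>u\<in>?V. (\<forall>r\<in>R. conj_by G1 u r \<in> conj_span G1 g1 W (\<lambda>_. 1) R q) \<and>
    (\<forall>l. snd l \<in> W \<longrightarrow> (\<exists>a\<in>conj_span G1 g1 W (\<lambda>_. 1) R q. conj_by G1 u (letter_val G1 g1 l) = letter_val G1 g1 l \<otimes>\<^bsub>G1\<^esub> a))"
    by (rule exE[OF WS.conj_span_bound[OF R(1,3) finI(2) V NW h1J]]) (assumption, rule that)
  have p0: "conj_by G1 v r \<in> conj_span G1 g1 W (\<lambda>_. 1) R p0" if "v \<in> ?V" "r \<in> R" for v r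
    by (rule bspec[OF conjunct1[OF bspec[OF spec[OF p0', THEN mp, OF order.refl] that(1)]] that(2)])
  \<comment> \<open>Letters in \<open>W\<close> alone already span the kernel in \<open>G1\<close>,
    and conjugation by a letter of \<open>I - W\<close> sends \<open>R\<close> into step
    \<open>p0\<close> of that span. Weight \<open>p0 + 1\<close> makes such a letter heavier than
    its effect on \<open>R\<close>.\<close>
  define \<omega> where "\<omega> = (\<lambda>i. if i \<in> W then 1 else p0 + 1)"
  interpret S1: conj_span_group G1 g1 I \<omega> by unfold_locales (use g1I in auto)
  interpret S2: conj_span_group G2 g2 I \<omega> by unfold_locales (use g2I in auto)
  have W_sub: "conj_span G1 g1 W (\<lambda>_. 1) R p \<subseteq> conj_span G1 g1 I \<omega> R p" for p
  proof -
    have "conj_span G1 g1 W (\<lambda>_. 1) R p = conj_span G1 g1 W \<omega> R p"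
      by (rule conj_span_cong) (auto simp: \<omega>_def)
    then show ?thesis using G1.conj_span_mono_letters[OF WI, of g1 \<omega> R p] by simp
  qed
  have N1: "(\<Union>p. conj_span G1 g1 I \<omega> R p) = ?N1"
  proof
    show "(\<Union>p. conj_span G1 g1 I \<omega> R p) \<subseteq> ?N1"
      by (rule UN_least) (rule S1.conj_span_in_kernel[OF R(2) h1J])
    show "?N1 \<subseteq> (\<Union>p. conj_span G1 g1 I \<omega> R p)"
      unfolding NW[symmetric] by (rule UN_mono[OF order.refl W_sub])
  qed
  obtain S0 where S0: "finite S0" "S0 \<subseteq> ?N2"
    "\<And>S. S0 \<subseteq> S \<Longrightarrow> S \<subseteq> ?N2 \<Longrightarrow> (\<Union>p. conj_span G2 g2 I \<omega> S p) = ?N2"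
  proof (rule G2.side_generators[OF dual2 fg2[OF ij(1)] finI(1) _ I_split(2), of ?N2 \<omega>])
    show "I \<subseteq> {..<m + k}" using J by (auto simp: I_def)
    show "?N2 = {x \<in> carrier G2. \<forall>l\<in>{..<i} \<union> I. h2 l x = 0}" unfolding I_split(1) by auto
  qed (use ij in auto)
  obtain C2 where C2: "finite C2" "C2 \<subseteq> ?N2"
    "\<And>l l'. snd l \<in> I \<Longrightarrow> snd l' \<in> I \<Longrightarrow> letter_val G2 g2 l \<otimes>\<^bsub>G2\<^esub> letter_val G2 g2 l' \<otimes>\<^bsub>G2\<^esub>
       inv\<^bsub>G2\<^esub> (letter_val G2 g2 l) \<otimes>\<^bsub>G2\<^esub> inv\<^bsub>G2\<^esub> (letter_val G2 g2 l') \<in> C2"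
    by (rule G2.letter_commutators[where g = g2 and h = h2 and J = J, OF finI(1) g2I h2J]) (assumption, assumption, rule that)
  define S where "S = S0 \<union> C2"
  have S: "finite S" "S \<subseteq> ?N2" "S \<subseteq> carrier G2" using S0 C2 unfolding S_def by auto
  have N2: "(\<Union>p. conj_span G2 g2 I \<omega> S p) = ?N2" using S0(3)[of S] S(2) by (simp add: S_def)
  let ?U1 = "(\<lambda>(e, i). letter_val G1 g1 (e, i - m)) ` (UNIV \<times> W)"
  let ?U2 = "(\<lambda>(e, i). letter_val G2 g2 (e, i - m)) ` (UNIV \<times> W)"
  have gW: "g1 (l - m) \<in> carrier G1" "g2 (l - m) \<in> carrier G2" if "l \<in> W" for l
    using g1[of "l - m"] g2[of "l - m"] that J by (auto simp: W_def)
  have U1: "finite ?U1" "?U1 \<subseteq> carrier G1" and U2: "finite ?U2" "?U2 \<subseteq> carrier G2"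
    using finI(2) gW by auto
  obtain c1 where c1: "\<forall>q\<ge>c1. \<forall>u\<in>?U1. (\<forall>r\<in>R. conj_by G1 u r \<in> conj_span G1 g1 I \<omega> R q) \<and>
    (\<forall>l. snd l \<in> I \<longrightarrow> (\<exists>a\<in>conj_span G1 g1 I \<omega> R q. conj_by G1 u (letter_val G1 g1 l) = letter_val G1 g1 l \<otimes>\<^bsub>G1\<^esub> a))"
    by (rule exE[OF S1.conj_span_bound[OF R(1,3) finI(1) U1 N1 h1J]]) (assumption, rule that)
  obtain c2 where c2: "\<forall>q\<ge>c2. \<forall>u\<in>?U2. (\<forall>r\<in>S. conj_by G2 u r \<in> conj_span G2 g2 I \<omega> S q) \<and>
    (\<forall>l. snd l \<in> I \<longrightarrow> (\<exists>a\<in>conj_span G2 g2 I \<omega> S q. conj_by G2 u (letter_val G2 g2 l) = letter_val G2 g2 l \<otimes>\<^bsub>G2\<^esub> a))"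
    by (rule exE[OF S2.conj_span_bound[OF S(1,3) finI(1) U2 N2 h2J]]) (assumption, rule that)
  let ?c = "max c1 c2"
  have mem: "letter_val G1 g1 (e, l - m) \<in> ?U1" "letter_val G2 g2 (e, l - m) \<in> ?U2" if "l \<in> W" for e l
    using that by force+
  note c1' = bspec[OF spec[OF c1, THEN mp, OF max.cobounded1] mem(1)]
    and c2' = bspec[OF spec[OF c2, THEN mp, OF max.cobounded2] mem(2)]
  show ?thesis
  proof (rule that[of R S \<omega> ?c])
    show "conj_by G1 (letter_val G1 g1 l) r \<in> conj_span G1 g1 I \<omega> R (\<omega> (snd l) - 1)"
      if "snd l \<in> I - W" "r \<in> R" for l r
    proof -
      have "letter_val G1 g1 l \<in> ?V" using that(1) by (cases l) force
      then show ?thesis using p0[OF _ that(2)] W_sub[of p0] that(1) by (auto simp: \<omega>_def)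
    qed
    show "conj_by G1 (letter_val G1 g1 (e, i - m)) r \<in> conj_span G1 g1 I \<omega> R ?c" if "i \<in> W" "r \<in> R" for e i r
      using c1'[OF that(1)] that(2) by blast
    show "\<exists>a\<in>conj_span G1 g1 I \<omega> R ?c. conj_by G1 (letter_val G1 g1 (e, i - m)) (letter_val G1 g1 l)
        = letter_val G1 g1 l \<otimes>\<^bsub>G1\<^esub> a" if "i \<in> W" "snd l \<in> I" for e i l
      using c1'[OF that(1)] that(2) by blast
    show "conj_by G2 (letter_val G2 g2 (e, i - m)) r \<in> conj_span G2 g2 I \<omega> S ?c" if "i \<in> W" "r \<in> S" for e i r
      using c2'[OF that(1)] that(2) by blast
    show "\<exists>a\<in>conj_span G2 g2 I \<omega> S ?c. conj_by G2 (letter_val G2 g2 (e, i - m)) (letter_val G2 g2 l)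
        = letter_val G2 g2 l \<otimes>\<^bsub>G2\<^esub> a" if "i \<in> W" "snd l \<in> I" for e i l
      using c2'[OF that(1)] that(2) by blast
  qed (use R S N1 N2 C1(3) C2(3) in \<open>auto simp: R_def S_def \<omega>_def\<close>)
qed

end

lemma (in group_hom) letter_val_image:
  "x (snd l) \<in> carrier G \<Longrightarrow> h (letter_val G x l) = letter_val H (h \<circ> x) l"
  by (simp add: letter_val_def)

text \<open>The union is by construction stable under conjugation by the letters only. A generator
  \<open>y\<close> of \<open>G\<close> changes a letter by an element of the union and by one that
  centralises the union; by induction on the word, conjugates of \<open>R\<close> stay in the union
  under \<open>y\<close> as well.\<close>

lemma (in conj_span_group) normal_closure_eq_Union:
  assumes R: "R \<subseteq> carrier G" and Y: "Y \<subseteq> carrier G" "generate G Y = carrier G"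
    and conjR: "\<And>y r. y \<in> Y \<union> m_inv G ` Y \<Longrightarrow> r \<in> R \<Longrightarrow> conj_by G y r \<in> (\<Union>p. A R p)"
    and conjl: "\<And>y l. y \<in> Y \<union> m_inv G ` Y \<Longrightarrow> snd l \<in> I \<Longrightarrow> \<exists>a\<in>\<Union>p. A R p. \<exists>b\<in>carrier G.
      (\<forall>z\<in>\<Union>p. A R p. commute G b z) \<and> conj_by G y (letter l) = letter l \<otimes> a \<otimes> b"
  shows "normal_closure G R = (\<Union>p. A R p)"
proof (rule normal_closureI)
  define N where "N = (\<Union>p. A R p)"
  have sub: "subgroup N G" unfolding N_def by (rule conj_span_Union_subgroup[OF R])
  have Nc: "n \<in> carrier G" if "n \<in> N" for n by (rule subgroup.mem_carrier[OF sub that])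
  have letterN: "conj_by G (letter l) n \<in> N" if l: "snd l \<in> I" and n: "n \<in> N" for l n
  proof -
    obtain p where "n \<in> A R p" using n unfolding N_def by blast
    then have "conj_by G (letter l) n \<in> A R (\<omega> (snd l) + p)" by (rule conj_span_letter[OF R l])
    then show ?thesis unfolding N_def by blast
  qed
  have gens: "conj_by G y (conj_by G (word u) r) \<in> N"
    if y: "y \<in> Y \<union> m_inv G ` Y" and r: "r \<in> R" and u: "snd ` set u \<subseteq> I" for y r u
    using u
  proof (induction u)
    case Nil
    have "r \<in> carrier G" using r R by blast
    then show ?case using conjR[OF y r] unfolding N_def by simp
  next
    case (Cons k u)
    have yc: "y \<in> carrier G" using y Y by auto
    have k: "snd k \<in> I" "snd ` set u \<subseteq> I" using Cons.prems by auto
    note c = letter_closed[OF k(1)] word_closed[OF k(2)] yc subsetD[OF R r]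
    define z where "z = conj_by G y (conj_by G (word u) r)"
    have z: "z \<in> N" unfolding z_def by (rule Cons.IH[OF k(2)])
    obtain a b where ab: "a \<in> N" "b \<in> carrier G" "\<forall>z\<in>N. commute G b z"
      "conj_by G y (letter k) = letter k \<otimes> a \<otimes> b"
      using conjl[OF y k(1)] unfolding N_def by blast
    have "conj_by G y (conj_by G (word (k # u)) r) = conj_by G (conj_by G y (letter k)) z"
      using c by (simp add: z_def conj_by_def word_simps)
    also have "\<dots> = conj_by G (letter k) (conj_by G a (conj_by G b z))"
      unfolding ab(4) using c Nc[OF ab(1)] ab(2) Nc[OF z] by (simp add: conj_by_mult)
    also have "conj_by G b z = z"
      by (rule conj_by_commute[OF ab(2) Nc[OF z] bspec[OF ab(3) z]])
    finally show ?case
      using letterN[OF k(1) conj_by_subgroup[OF sub ab(1) z]] by simp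
  qed
  have step: "conj_by G y n \<in> N" if y: "y \<in> Y \<union> m_inv G ` Y" and n: "n \<in> N" for y n
  proof -
    have yc: "y \<in> carrier G" using y Y by auto
    obtain p where p: "n \<in> A R p" using n unfolding N_def by blast
    show ?thesis
      using p unfolding conj_span_def
    proof (rule conj_by_generate[OF yc conj_span_gens_closed[OF R] sub, rotated])
      fix z assume "z \<in> {conj_by G (word u) r | u r. snd ` set u \<subseteq> I \<and> weight u \<le> p \<and> r \<in> R}"
      then obtain u r where u: "snd ` set u \<subseteq> I" "r \<in> R" "z = conj_by G (word u) r" by blast
      show "conj_by G y z \<in> N" unfolding u(3) by (rule gens[OF y u(2,1)])
    qed
  qed
  have "N \<lhd> G"
  proof (rule normal_of_generators[OF sub Y(1)])
    have "generate G Y \<subseteq> generate G (N \<union> Y)" by (rule mono_generate) blast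
    then show "generate G (N \<union> Y) = carrier G"
      using generate_incl[of "N \<union> Y"] Y subgroup.subset[OF sub] by auto
    show "conj_by G y n \<in> N \<and> conj_by G (inv y) n \<in> N" if "y \<in> Y" "n \<in> N" for y n
      using step[OF UnI1[OF that(1)] that(2)] step[OF UnI2[OF imageI[OF that(1)]] that(2)] by simp
  qed
  then show "(\<Union>p. A R p) \<lhd> G" unfolding N_def .
  show "R \<subseteq> (\<Union>p. A R p)" using conj_span_incl[OF R] by blast
  show "(\<Union>p. A R p) \<subseteq> normal_closure G R"
  proof
    fix n assume "n \<in> (\<Union>p. A R p)"
    then obtain p where n: "n \<in> A R p" by blast
    have "A R p \<subseteq> normal_closure G R"
      unfolding conj_span_def
    proof (rule generate_subgroup_incl[OF _ normal_closure_subgroup[OF R]], rule subsetI)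
      fix y assume "y \<in> {conj_by G (word u) r | u r. snd ` set u \<subseteq> I \<and> weight u \<le> p \<and> r \<in> R}"
      then obtain u r where u: "snd ` set u \<subseteq> I" "r \<in> R" "y = conj_by G (word u) r" by blast
      show "y \<in> normal_closure G R"
        unfolding u(3) conj_by_def
        by (rule normal.inv_op_closed2[OF normal_closure_normal[OF R] word_closed[OF u(1)]
              subsetD[OF normal_closure_superset u(2)]])
    qed
    then show "n \<in> normal_closure G R" using n by (rule subsetD)
  qed
qed (rule is_group)

lemma conj_span_DirProd:
  assumes "group G" "group H" "\<And>i. i \<in> I \<Longrightarrow> x i \<in> carrier G" "\<And>i. i \<in> I \<Longrightarrow> y i \<in> carrier H"
    "R \<subseteq> carrier G" "S \<subseteq> carrier H"
  shows "conj_span (G \<times>\<times> H) (\<lambda>i. (x i, y i)) I \<omega> ((\<lambda>a. (a, \<one>\<^bsub>H\<^esub>)) ` R) p =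
      (\<lambda>a. (a, \<one>\<^bsub>H\<^esub>)) ` conj_span G x I \<omega> R p" (is ?left)
    and "conj_span (G \<times>\<times> H) (\<lambda>i. (x i, y i)) I \<omega> ((\<lambda>b. (\<one>\<^bsub>G\<^esub>, b)) ` S) p =
      (\<lambda>b. (\<one>\<^bsub>G\<^esub>, b)) ` conj_span H y I \<omega> S p" (is ?right)
proof -
  interpret G: group G by (rule assms(1))
  interpret H: group H by (rule assms(2))
  let ?w = "\<lambda>i. (x i, y i)"
  have word: "word_val (G \<times>\<times> H) ?w u = (word_val G x u, word_val H y u)"
      "word_val G x u \<in> carrier G" "word_val H y u \<in> carrier H"
    if "snd ` set u \<subseteq> I" for u
  proof -
    have c: "\<forall>l\<in>set u. x (snd l) \<in> carrier G" "\<forall>l\<in>set u. y (snd l) \<in> carrier H"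
      using that assms(3,4) by auto
    show "word_val (G \<times>\<times> H) ?w u = (word_val G x u, word_val H y u)"
      by (rule word_val_DirProd[OF assms(1,2) c])
    show "word_val G x u \<in> carrier G" "word_val H y u \<in> carrier H"
      using G.word_val_closed[OF c(1)] H.word_val_closed[OF c(2)] by auto
  qed
  have Gone: "conj_by G a \<one>\<^bsub>G\<^esub> = \<one>\<^bsub>G\<^esub>" if "a \<in> carrier G" for a using that by simp
  show ?left
  proof -
    let ?i = "\<lambda>a. (a, \<one>\<^bsub>H\<^esub>)"
    let ?X = "{conj_by G (word_val G x u) r | u r. snd ` set u \<subseteq> I \<and> word_weight \<omega> u \<le> p \<and> r \<in> R}"
    have "?i \<in> hom G (G \<times>\<times> H)" by (rule homI) auto
    then interpret i: group_hom G "G \<times>\<times> H" ?i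
      using assms(1,2) by (simp add: group_hom_def group_hom_axioms_def DirProd_group)
    have Xc: "?X \<subseteq> carrier G"
    proof
      fix z assume "z \<in> ?X"
      then obtain u r where "snd ` set u \<subseteq> I" "r \<in> R" "z = conj_by G (word_val G x u) r" by blast
      then show "z \<in> carrier G" using word(2) assms(5) by auto
    qed
    have conj: "conj_by (G \<times>\<times> H) (word_val (G \<times>\<times> H) ?w u) (?i r) = ?i (conj_by G (word_val G x u) r)"
      if "snd ` set u \<subseteq> I" for u r
      unfolding word(1)[OF that] using G.conj_by_DirProd[OF assms(2) word(2,3)[OF that]] word(3)[OF that] by simp
    have "{conj_by (G \<times>\<times> H) (word_val (G \<times>\<times> H) ?w u) r | u r.
        snd ` set u \<subseteq> I \<and> word_weight \<omega> u \<le> p \<and> r \<in> ?i ` R} = ?i ` ?X" (is "?Y = _")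
    proof
      show "?Y \<subseteq> ?i ` ?X"
      proof
        fix z assume "z \<in> ?Y"
        then obtain u r' where u: "snd ` set u \<subseteq> I" "word_weight \<omega> u \<le> p" "r' \<in> ?i ` R"
          "z = conj_by (G \<times>\<times> H) (word_val (G \<times>\<times> H) ?w u) r'" by blast
        obtain r where r: "r' = ?i r" "r \<in> R" using u(3) by (rule imageE)
        have "conj_by G (word_val G x u) r \<in> ?X" using u(1,2) r(2) by blast
        then show "z \<in> ?i ` ?X" unfolding u(4) r(1) conj[OF u(1)] by (rule imageI)
      qed
      show "?i ` ?X \<subseteq> ?Y"
      proof
        fix z assume "z \<in> ?i ` ?X"
        then obtain z' where z': "z = ?i z'" "z' \<in> ?X" by (rule imageE)
        then obtain u r where u: "snd ` set u \<subseteq> I" "word_weight \<omega> u \<le> p" "r \<in> R"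
          "z' = conj_by G (word_val G x u) r" by blast
        have "z = conj_by (G \<times>\<times> H) (word_val (G \<times>\<times> H) ?w u) (?i r)" unfolding z'(1) u(4) conj[OF u(1)] ..
        then show "z \<in> ?Y" using u(1,2) imageI[OF u(3), of ?i] by blast
      qed
    qed
    then show ?thesis unfolding conj_span_def using i.generate_img[OF Xc] by simp
  qed
  show ?right
  proof -
    let ?i = "\<lambda>b. (\<one>\<^bsub>G\<^esub>, b)"
    let ?X = "{conj_by H (word_val H y u) r | u r. snd ` set u \<subseteq> I \<and> word_weight \<omega> u \<le> p \<and> r \<in> S}"
    have "?i \<in> hom H (G \<times>\<times> H)" by (rule homI) auto
    then interpret i: group_hom H "G \<times>\<times> H" ?i
      using assms(1,2) by (simp add: group_hom_def group_hom_axioms_def DirProd_group)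
    have Xc: "?X \<subseteq> carrier H"
    proof
      fix z assume "z \<in> ?X"
      then obtain u r where "snd ` set u \<subseteq> I" "r \<in> S" "z = conj_by H (word_val H y u) r" by blast
      then show "z \<in> carrier H" using word(3) assms(6) by auto
    qed
    have conj: "conj_by (G \<times>\<times> H) (word_val (G \<times>\<times> H) ?w u) (?i r) = ?i (conj_by H (word_val H y u) r)"
      if "snd ` set u \<subseteq> I" for u r
      unfolding word(1)[OF that] using G.conj_by_DirProd[OF assms(2) word(2,3)[OF that]] word(2)[OF that] by simp
    have "{conj_by (G \<times>\<times> H) (word_val (G \<times>\<times> H) ?w u) r | u r.
        snd ` set u \<subseteq> I \<and> word_weight \<omega> u \<le> p \<and> r \<in> ?i ` S} = ?i ` ?X" (is "?Y = _")
    proof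
      show "?Y \<subseteq> ?i ` ?X"
      proof
        fix z assume "z \<in> ?Y"
        then obtain u r' where u: "snd ` set u \<subseteq> I" "word_weight \<omega> u \<le> p" "r' \<in> ?i ` S"
          "z = conj_by (G \<times>\<times> H) (word_val (G \<times>\<times> H) ?w u) r'" by blast
        obtain r where r: "r' = ?i r" "r \<in> S" using u(3) by (rule imageE)
        have "conj_by H (word_val H y u) r \<in> ?X" using u(1,2) r(2) by blast
        then show "z \<in> ?i ` ?X" unfolding u(4) r(1) conj[OF u(1)] by (rule imageI)
      qed
      show "?i ` ?X \<subseteq> ?Y"
      proof
        fix z assume "z \<in> ?i ` ?X"
        then obtain z' where z': "z = ?i z'" "z' \<in> ?X" by (rule imageE)
        then obtain u r where u: "snd ` set u \<subseteq> I" "word_weight \<omega> u \<le> p" "r \<in> S"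
          "z' = conj_by H (word_val H y u) r" by blast
        have "z = conj_by (G \<times>\<times> H) (word_val (G \<times>\<times> H) ?w u) (?i r)" unfolding z'(1) u(4) conj[OF u(1)] ..
        then show "z \<in> ?Y" using u(1,2) imageI[OF u(3), of ?i] by blast
      qed
    qed
    then show ?thesis unfolding conj_span_def using i.generate_img[OF Xc] by simp
  qed
qed

lemma (in group) free_cover:
  assumes "finite S" "S \<subseteq> carrier G"
  obtains d :: nat and \<pi> where "\<pi> \<in> hom (free_group {..<d}) G"
    "\<pi> ` carrier (free_group {..<d}) = generate G S"
proof -
  obtain e where e: "S = e ` {..<card S}" using ex_bij_betw_nat_finite[OF assms(1)]
    by (metis atLeast0LessThan bij_betw_imp_surj_on)
  have ec: "e ` {..<card S} \<subseteq> carrier G" using e assms(2) by simp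
  let ?F = "free_group {..<card S}"
  have hom: "word_val G e \<in> hom ?F G" by (rule word_val_hom[OF ec])
  interpret \<pi>: group_hom ?F G "word_val G e"
    using hom group_free_group by (simp add: group_hom_def group_hom_axioms_def)
  have gc: "free_gen ` {..<card S} \<subseteq> carrier ?F"
    using free_gen_closed[of _ "{..<card S}"] by (simp add: image_subset_iff)
  have "word_val G e ` free_gen ` {..<card S} = e ` {..<card S}"
    unfolding image_image using ec by (intro image_cong) (auto simp: free_gen_def letter_val_def)
  then have "word_val G e ` carrier ?F = generate G S"
    using \<pi>.generate_img[OF gc] unfolding generate_free_group using e by simp
  then show ?thesis using that[OF hom] by blast
qed

text \<open>Relations with existentially quantified error factors are stored as memberships in sets
  of products. Such sets have to be carried both along the map to the direct product and along the
  quotient map.\<close>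

lemma (in group_hom) image_mult_left:
  assumes "v \<in> carrier G" "X \<subseteq> carrier G" "Y \<subseteq> carrier G"
  shows "h ` ((\<lambda>(a, b). v \<otimes> a \<otimes> b) ` (X \<times> Y)) = (\<lambda>(a, b). h v \<otimes>\<^bsub>H\<^esub> a \<otimes>\<^bsub>H\<^esub> b) ` (h ` X \<times> h ` Y)"
proof -
  have "h (v \<otimes> a \<otimes> b) = h v \<otimes>\<^bsub>H\<^esub> h a \<otimes>\<^bsub>H\<^esub> h b" if "a \<in> X" "b \<in> Y" for a b
    using assms(1) subsetD[OF assms(2) that(1)] subsetD[OF assms(3) that(2)] by simp
  then show ?thesis by (force simp: image_iff)
qed

lemma (in group_hom) image_mult_middle:
  assumes "v \<in> carrier G" "X \<subseteq> carrier G" "Y \<subseteq> carrier G"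
  shows "h ` ((\<lambda>(a, b). a \<otimes> v \<otimes> b) ` (X \<times> Y)) = (\<lambda>(a, b). a \<otimes>\<^bsub>H\<^esub> h v \<otimes>\<^bsub>H\<^esub> b) ` (h ` X \<times> h ` Y)"
proof -
  have "h (a \<otimes> v \<otimes> b) = h a \<otimes>\<^bsub>H\<^esub> h v \<otimes>\<^bsub>H\<^esub> h b" if "a \<in> X" "b \<in> Y" for a b
    using assms(1) subsetD[OF assms(2) that(1)] subsetD[OF assms(3) that(2)] by simp
  then show ?thesis by (force simp: image_iff)
qed

lemma (in group) image_mult_middle_closed:
  "v \<in> carrier G \<Longrightarrow> X \<subseteq> carrier G \<Longrightarrow> Y \<subseteq> carrier G \<Longrightarrow> (\<lambda>(a, b). a \<otimes> v \<otimes> b) ` (X \<times> Y) \<subseteq> carrier G"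
  by (auto simp: subset_iff)

lemma image_case_prod_bex: "z \<in> case_prod f ` (X \<times> Y) \<Longrightarrow> \<exists>a\<in>X. \<exists>b\<in>Y. z = f a b"
  by auto

lemma DirProd_nat_pow: "(x, y) [^]\<^bsub>G \<times>\<times> H\<^esub> (n :: nat) = (x [^]\<^bsub>G\<^esub> n, y [^]\<^bsub>H\<^esub> n)"
  by (induction n) auto

lemma finite_words: "finite I \<Longrightarrow> (\<And>i. i \<in> I \<Longrightarrow> 1 \<le> \<omega> i) \<Longrightarrow>
  finite {u :: 'i letter list. snd ` set u \<subseteq> I \<and> word_weight \<omega> u \<le> N}"
proof -
  assume I: "finite I" "\<And>i. i \<in> I \<Longrightarrow> 1 \<le> \<omega> i"
  have len: "length u \<le> word_weight \<omega> u" if "snd ` set u \<subseteq> I" for u :: "'i letter list"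
    using that
  proof (induction u)
    case (Cons l u)
    then have "1 \<le> \<omega> (snd l)" "length u \<le> word_weight \<omega> u" using I(2) by auto
    then show ?case by simp
  qed simp
  have "{u :: 'i letter list. snd ` set u \<subseteq> I \<and> word_weight \<omega> u \<le> N} \<subseteq>
      {u. set u \<subseteq> UNIV \<times> I \<and> length u \<le> N}"
  proof
    fix u :: "'i letter list" assume u: "u \<in> {u. snd ` set u \<subseteq> I \<and> word_weight \<omega> u \<le> N}"
    have "l \<in> UNIV \<times> I" if "l \<in> set u" for l using that u by (auto simp: mem_Times_iff)
    then show "u \<in> {u. set u \<subseteq> UNIV \<times> I \<and> length u \<le> N}" using u len[of u] by auto
  qed
  then show ?thesis
    by (rule finite_subset) (use I(1) in \<open>simp add: finite_lists_length_le\<close>)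
qed

section \<open>A finitely presented cover with commuting subgroups\<close>

context fibre_data
begin

lemma h1_letter: "i < m + k \<Longrightarrow> snd l < m + k \<Longrightarrow>
    h1 i (letter_val G1 g1 l) = (if i = snd l then (if fst l then 1 else - 1) else 0)"
  using G1.int_hom_inv[OF h1, of i "g1 (snd l)"] g1[of "snd l"] h1g1[of i "snd l"]
  by (cases "fst l"; cases "i = snd l") (simp_all add: letter_val_def)

lemma h2_letter: "i < m + k \<Longrightarrow> snd l < m + k \<Longrightarrow>
    h2 i (letter_val G2 g2 l) = (if i = snd l then (if fst l then 1 else - 1) else 0)"
  using G2.int_hom_inv[OF h2, of i "g2 (snd l)"] g2[of "snd l"] h2g2[of i "snd l"]
  by (cases "fst l"; cases "i = snd l") (simp_all add: letter_val_def)

text \<open>The sign of the letter is carried over to every factor, so an inverse letter has a shift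
  element of its own.\<close>

definition shift_elem :: "nat \<Rightarrow> nat letter \<Rightarrow> 'a \<times> 'b" where
  "shift_elem T l = (letter_val G1 g1 (fst l, snd l - m),
     letter_val G2 g2 (fst l, snd l - m) \<otimes>\<^bsub>G2\<^esub> letter_val G2 g2 l [^]\<^bsub>G2\<^esub> T)"

text \<open>Only two equations are not trivial. At the index \<open>snd l - m\<close> both sides are
  the sign of the letter; at the index \<open>snd l\<close> the shear contributes \<open>T\<close>
  times the sign, matching the \<open>T\<close>-th power in the second component.\<close>

lemma shift_elem_in_P:
  assumes "J \<le> m + k" "m \<le> snd l" "snd l < J"
  shows "shift_elem T l \<in> P T J"
proof -
  define i where "i = snd l - m"
  have i: "i < m" "i < m + k" "snd l = i + m" "snd l < m + k" using assms km by (auto simp: i_def)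
  have c: "letter_val G1 g1 (fst l, i) \<in> carrier G1" "letter_val G2 g2 (fst l, i) \<in> carrier G2"
    "letter_val G2 g2 l \<in> carrier G2" using g1 g2 i by simp_all
  have "\<psi> T j (letter_val G1 g1 (fst l, i)) = h2 j (letter_val G2 g2 (fst l, i) \<otimes>\<^bsub>G2\<^esub> letter_val G2 g2 l [^]\<^bsub>G2\<^esub> T)"
    if "j < J" for j
  proof -
    have j: "j < m + k" "j - m < m + k" using that assms(1) by auto
    have "h2 j (letter_val G2 g2 l [^]\<^bsub>G2\<^esub> T) = int T * h2 j (letter_val G2 g2 l)"
      using G2.int_hom_pow[OF h2[OF j(1)] c(3), of "int T"] by (simp add: int_pow_int)
    then have "h2 j (letter_val G2 g2 (fst l, i) \<otimes>\<^bsub>G2\<^esub> letter_val G2 g2 l [^]\<^bsub>G2\<^esub> T) =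
        h2 j (letter_val G2 g2 (fst l, i)) + int T * h2 j (letter_val G2 g2 l)"
      using G2.int_hom_mult[OF h2[OF j(1)] c(2)] c(3) by simp
    then show ?thesis
      using j i h1_letter[of j "(fst l, i)"] h1_letter[of "j - m" "(fst l, i)"]
        h2_letter[of j "(fst l, i)"] h2_letter[of j l]
      by (auto simp: \<psi>_def)
  qed
  then show ?thesis using c by (simp add: P_def shift_elem_def i_def)
qed

text \<open>The shear does not affect these letters: for \<open>m \<le> j < J\<close> the extra term
  is evaluated at the index \<open>j - m < J - m \<le> i\<close>, where the dual element
  \<open>g1 i\<close> has value \<open>0\<close>.\<close>

lemma letters_in_P:
  assumes "J \<le> m + k" "J - m \<le> i" "i < J"
  shows "(g1 i, g2 i) \<in> P T J"
proof -
  have "\<psi> T j (g1 i) = h2 j (g2 i)" if j: "j < J" for j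
    using h1g1[of j i] h1g1[of "j - m" i] h2g2[of j i] that assms by (auto simp: \<psi>_def)
  then show ?thesis using g1 g2 assms by (simp add: P_def)
qed

lemma left_in_P:
  assumes "J \<le> m + k" "a \<in> carrier G1" "\<forall>i<J. h1 i a = 0"
  shows "(a, \<one>\<^bsub>G2\<^esub>) \<in> P T J"
  using assms \<psi>_kernel[of J T a] G2.int_hom_one[OF h2] by (simp add: P_def)

lemma right_in_P:
  assumes "J \<le> m + k" "b \<in> carrier G2" "\<forall>i<J. h2 i b = 0"
  shows "(\<one>\<^bsub>G1\<^esub>, b) \<in> P T J"
  using assms G1.int_hom_one[OF \<psi>_int_hom] by (simp add: P_def)

text \<open>Modulo the product of its intersections with the factors, \<open>P T J\<close> is free
  abelian with the pairs \<open>(d l, g2 l)\<close> as a basis.\<close>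

lemma P_generators:
  assumes J: "J \<le> m + k" and Q: "subgroup Q GG"
    and left: "\<And>a. a \<in> carrier G1 \<Longrightarrow> \<forall>i<J. h1 i a = 0 \<Longrightarrow> (a, \<one>\<^bsub>G2\<^esub>) \<in> Q"
    and right: "\<And>b. b \<in> carrier G2 \<Longrightarrow> \<forall>i<J. h2 i b = 0 \<Longrightarrow> (\<one>\<^bsub>G1\<^esub>, b) \<in> Q"
    and d: "\<And>l. l < J \<Longrightarrow> d l \<in> carrier G1 \<and> (\<forall>i<J. \<psi> T i (d l) = (if i = l then 1 else 0)) \<and> (d l, g2 l) \<in> Q"
  shows "P T J \<subseteq> Q"
proof
  fix p assume p: "p \<in> P T J"
  let ?f = "\<lambda>i (p :: 'a \<times> 'b). h2 i (snd p)" and ?d = "\<lambda>l. (d l, g2 l)"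
  have dP: "?d l \<in> P T J" if "l < J" for l
    using d[OF that] g2[of l] h2g2[of _ l] that J by (simp add: P_def)
  have "dual_system GG {..<J} ?f ?d"
    unfolding dual_system_def int_hom_def
    using d g2 h2g2 h2 J by (auto simp: int_hom_def)
  then obtain \<xi> where \<xi>: "\<xi> \<in> generate GG (?d ` {..<J})" "\<xi> \<in> carrier GG" "\<And>i. i \<in> {..<J} \<Longrightarrow> ?f i \<xi> = ?f i p"
    using GG.dual_system_interpolation[where c = "\<lambda>i. ?f i p" and I = "{..<J}" and x = ?d and f = ?f] by blast
  have "generate GG (?d ` {..<J}) \<subseteq> Q" by (rule GG.generate_subgroup_incl[OF _ Q]) (use d in auto)
  then have \<xi>Q: "\<xi> \<in> Q" using \<xi>(1) by blast
  have "generate GG (?d ` {..<J}) \<subseteq> P T J" by (rule GG.generate_subgroup_incl[OF _ P_subgroup[OF J]]) (use dP in auto)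
  then have \<xi>P: "\<xi> \<in> P T J" using \<xi>(1) by blast
  note PS = P_subgroup[OF J, of T]
  have pc: "p \<in> carrier GG" by (rule subgroup.mem_carrier[OF PS p])
  define z where "z = p \<otimes>\<^bsub>GG\<^esub> inv\<^bsub>GG\<^esub> \<xi>"
  have zP: "z \<in> P T J" unfolding z_def by (rule subgroup.m_closed[OF PS p subgroup.m_inv_closed[OF PS \<xi>P]])
  obtain a b where ab: "z = (a, b)" "a \<in> carrier G1" "b \<in> carrier G2" "\<forall>i<J. \<psi> T i a = h2 i b"
    using zP unfolding P_def by blast
  have "h2 i b = 0" if "i < J" for i
  proof -
    have hi: "int_hom G2 (h2 i)" using h2 that J by simp
    have "b = snd p \<otimes>\<^bsub>G2\<^esub> inv\<^bsub>G2\<^esub> (snd \<xi>)"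
      using ab(1) pc \<xi>(2) unfolding z_def by (cases p; cases \<xi>) (auto simp: inv_DirProd[OF grp1 grp2])
    moreover have "snd p \<in> carrier G2" "snd \<xi> \<in> carrier G2" using pc \<xi>(2) by auto
    ultimately have "h2 i b = h2 i (snd p) - h2 i (snd \<xi>)"
      by (simp add: G2.int_hom_mult[OF hi] G2.int_hom_inv[OF hi])
    then show ?thesis using \<xi>(3)[of i] that by simp
  qed
  then have b0: "\<forall>i<J. h2 i b = 0" by blast
  then have "\<forall>i<J. h1 i a = 0" using ab(4) \<psi>_kernel[OF J, of T a] by simp
  then have "(a, \<one>\<^bsub>G2\<^esub>) \<otimes>\<^bsub>GG\<^esub> (\<one>\<^bsub>G1\<^esub>, b) \<in> Q"
    using subgroup.m_closed[OF Q left[OF ab(2)] right[OF ab(3) b0]] by blast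
  then have "z \<in> Q" using ab(1-3) by simp
  then have "z \<otimes>\<^bsub>GG\<^esub> \<xi> \<in> Q" by (rule subgroup.m_closed[OF Q _ \<xi>Q])
  moreover have "z \<otimes>\<^bsub>GG\<^esub> \<xi> = p"
    unfolding z_def using pc \<xi>(2) by (simp only: GG.m_assoc GG.l_inv GG.inv_closed GG.r_one)
  ultimately show "p \<in> Q" by simp
qed

text \<open>Ten finite families of relations are imposed on a free group over \<open>P T J\<close>.
  \<open>C1\<close> to \<open>C7\<close> provide the hypotheses of \<open>comm_word_all\<close> and
  yield commutation of the two unions of conjugation spans; \<open>C8\<close> to \<open>C10\<close>
  make these unions stable under all generators, so that they are the normal closures of finite
  sets. The constant \<open>c\<close> is found before \<open>T\<close>, which allows
  \<open>T\<close> to exceed \<open>2 * c\<close>.\<close>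

theorem commuting_cover:
  assumes J: "J \<le> m + k"
  shows "\<exists>T0. \<forall>T\<ge>T0. \<exists>(\<Gamma> :: nat letter list set monoid) \<pi> R B. group \<Gamma> \<and> finitely_presented \<Gamma> \<and>
    \<pi> \<in> hom \<Gamma> GG \<and> \<pi> ` carrier \<Gamma> = P T J \<and> finite R \<and> R \<subseteq> carrier \<Gamma> \<and> B \<lhd> \<Gamma> \<and>
    (\<forall>a\<in>normal_closure \<Gamma> R. \<forall>b\<in>B. commute \<Gamma> a b) \<and>
    \<pi> ` normal_closure \<Gamma> R = (\<lambda>a. (a, \<one>\<^bsub>G2\<^esub>)) ` {x \<in> carrier G1. \<forall>i<J. h1 i x = 0} \<and>
    \<pi> ` B = (\<lambda>b. (\<one>\<^bsub>G1\<^esub>, b)) ` {x \<in> carrier G2. \<forall>i<J. h2 i x = 0}"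
proof -
  let ?I = "{J - m..<J}" and ?W = "{m..<J}"
  let ?N1 = "{x \<in> carrier G1. \<forall>i<J. h1 i x = 0}" and ?N2 = "{x \<in> carrier G2. \<forall>i<J. h2 i x = 0}"
  let ?i1 = "\<lambda>a. (a, \<one>\<^bsub>G2\<^esub>)" and ?i2 = "\<lambda>b. (\<one>\<^bsub>G1\<^esub>, b)"
  let ?l1 = "letter_val G1 g1" and ?l2 = "letter_val G2 g2"
  obtain R1 S1 \<omega> c where D: "finite R1" "finite S1" "R1 \<subseteq> ?N1" "S1 \<subseteq> ?N2"
    "(\<Union>p. conj_span G1 g1 ?I \<omega> R1 p) = ?N1" "(\<Union>p. conj_span G2 g2 ?I \<omega> S1 p) = ?N2"
    "\<And>l l'. snd l \<in> ?I \<Longrightarrow> snd l' \<in> ?I \<Longrightarrow>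
       ?l1 l \<otimes>\<^bsub>G1\<^esub> ?l1 l' \<otimes>\<^bsub>G1\<^esub> inv\<^bsub>G1\<^esub> (?l1 l) \<otimes>\<^bsub>G1\<^esub> inv\<^bsub>G1\<^esub> (?l1 l') \<in> R1"
    "\<And>l l'. snd l \<in> ?I \<Longrightarrow> snd l' \<in> ?I \<Longrightarrow>
       ?l2 l \<otimes>\<^bsub>G2\<^esub> ?l2 l' \<otimes>\<^bsub>G2\<^esub> inv\<^bsub>G2\<^esub> (?l2 l) \<otimes>\<^bsub>G2\<^esub> inv\<^bsub>G2\<^esub> (?l2 l') \<in> S1"
    "\<And>i. 1 \<le> \<omega> i" "\<And>i. i \<in> ?W \<Longrightarrow> \<omega> i = 1"
    "\<And>l r. snd l \<in> ?I - ?W \<Longrightarrow> r \<in> R1 \<Longrightarrow> conj_by G1 (?l1 l) r \<in> conj_span G1 g1 ?I \<omega> R1 (\<omega> (snd l) - 1)"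
    "\<And>e i r. i \<in> ?W \<Longrightarrow> r \<in> R1 \<Longrightarrow> conj_by G1 (?l1 (e, i - m)) r \<in> conj_span G1 g1 ?I \<omega> R1 c"
    "\<And>e i l. i \<in> ?W \<Longrightarrow> snd l \<in> ?I \<Longrightarrow> \<exists>a\<in>conj_span G1 g1 ?I \<omega> R1 c.
       conj_by G1 (?l1 (e, i - m)) (?l1 l) = ?l1 l \<otimes>\<^bsub>G1\<^esub> a"
    "\<And>e i s. i \<in> ?W \<Longrightarrow> s \<in> S1 \<Longrightarrow> conj_by G2 (?l2 (e, i - m)) s \<in> conj_span G2 g2 ?I \<omega> S1 c"
    "\<And>e i l. i \<in> ?W \<Longrightarrow> snd l \<in> ?I \<Longrightarrow> \<exists>b\<in>conj_span G2 g2 ?I \<omega> S1 c.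
       conj_by G2 (?l2 (e, i - m)) (?l2 l) = ?l2 l \<otimes>\<^bsub>G2\<^esub> b"
    by (rule one_sided_data[OF J]) (rule that)
  have gI: "g1 i \<in> carrier G1" "g2 i \<in> carrier G2" if "i \<in> ?I" for i using that g1 g2 J by auto
  have Rc: "R1 \<subseteq> carrier G1" and Sc: "S1 \<subseteq> carrier G2" using D(3,4) by auto
  interpret S1: conj_span_group G1 g1 ?I \<omega> by unfold_locales (rule gI)
  interpret S2: conj_span_group G2 g2 ?I \<omega> by unfold_locales (rule gI)
  let ?A1 = "conj_span G1 g1 ?I \<omega> R1" and ?B1 = "conj_span G2 g2 ?I \<omega> S1"
  have l1c: "?l1 l \<in> carrier G1" and l2c: "?l2 l \<in> carrier G2" if "snd l \<in> ?I" for l using gI[OF that] by simp_all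
  define w where "w = (\<lambda>i. (g1 i, g2 i))"
  define RG where "RG = ?i1 ` R1"
  define SG where "SG = ?i2 ` S1"
  have AG: "conj_span GG w ?I \<omega> RG p = ?i1 ` ?A1 p" and BG: "conj_span GG w ?I \<omega> SG p = ?i2 ` ?B1 p" for p
    unfolding w_def RG_def SG_def by (rule conj_span_DirProd[OF grp1 grp2 gI Rc Sc], assumption+)+
  have lG: "letter_val GG w l = (?l1 l, ?l2 l)" if "snd l \<in> ?I" for l
    using gI[OF that] by (simp add: letter_val_def w_def inv_DirProd[OF grp1 grp2])
  have main: "\<exists>(\<Gamma> :: nat letter list set monoid) \<pi> R B. group \<Gamma> \<and> finitely_presented \<Gamma> \<and>
    \<pi> \<in> hom \<Gamma> GG \<and> \<pi> ` carrier \<Gamma> = P T J \<and> finite R \<and> R \<subseteq> carrier \<Gamma> \<and> B \<lhd> \<Gamma> \<and>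
    (\<forall>a\<in>normal_closure \<Gamma> R. \<forall>b\<in>B. commute \<Gamma> a b) \<and>
    \<pi> ` normal_closure \<Gamma> R = ?i1 ` ?N1 \<and> \<pi> ` B = ?i2 ` ?N2" if T: "2 * c < T" for T
  proof -
    note PS = P_subgroup[OF J, of T]
    have RGP: "RG \<subseteq> P T J" using left_in_P[OF J] D(3) by (auto simp: RG_def)
    have SGP: "SG \<subseteq> P T J" using right_in_P[OF J] D(4) by (auto simp: SG_def)
    have wP: "w i \<in> P T J" if "i \<in> ?I" for i using letters_in_P[OF J] that by (simp add: w_def)
    have tP: "shift_elem T l \<in> P T J" if "snd l \<in> ?W" for l using shift_elem_in_P[OF J] that by simp
    have Pc: "p \<in> carrier GG" if "p \<in> P T J" for p by (rule subgroup.mem_carrier[OF PS that])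
    have "\<exists>a. a \<in> carrier G1 \<and> (\<forall>i<J. \<psi> T i a = (if i = l then 1 else 0))" for l
      using lift1[of T "\<lambda>i. if i = l then 1 else 0"] J by (meson less_le_trans)
    then obtain a where a: "\<And>l. a l \<in> carrier G1" "\<And>l i. i < J \<Longrightarrow> \<psi> T i (a l) = (if i = l then 1 else 0)"
      by metis
    have dP: "(a l, g2 l) \<in> P T J" if "l < J" for l
      using a g2[of l] h2g2[of _ l] that J by (simp add: P_def)
    \<comment> \<open>By the two filtrations, \<open>RG\<close>, \<open>SG\<close> and the letters
      generate both intersections with the factors; the pairs \<open>(a l, g2 l)\<close> supply the
      free abelian quotient.\<close>
    define SP where "SP = RG \<union> SG \<union> w ` ?I \<union> (\<lambda>l. (a l, g2 l)) ` {..<J}"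
    have SP: "finite SP" "SP \<subseteq> P T J"
    proof -
      show "finite SP" using D(1,2) by (simp add: SP_def RG_def SG_def)
      have "w ` ?I \<subseteq> P T J" "(\<lambda>l. (a l, g2 l)) ` {..<J} \<subseteq> P T J" using wP dP by auto
      then show "SP \<subseteq> P T J" using RGP SGP by (simp add: SP_def)
    qed
    have SPc: "SP \<subseteq> carrier GG" using SP(2) Pc by blast
    interpret W: conj_span_group GG w ?I \<omega> by unfold_locales (rule Pc[OF wP])
    have gen: "generate GG SP = P T J"
    proof
      show "generate GG SP \<subseteq> P T J" by (rule GG.generate_subgroup_incl[OF SP(2) PS])
      have Q: "subgroup (generate GG SP) GG" by (rule GG.generate_is_subgroup[OF SPc])
      have inc: "x \<in> generate GG SP" if "x \<in> SP" for x using that by (rule generate.incl)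
      have wQ: "w ` ?I \<subseteq> generate GG SP" using inc by (auto simp: SP_def)
      have RQ: "RG \<subseteq> generate GG SP" and SQ: "SG \<subseteq> generate GG SP" using inc by (auto simp: SP_def)
      show "P T J \<subseteq> generate GG SP"
      proof (rule P_generators[OF J Q, where d = a])
        fix x assume "x \<in> carrier G1" "\<forall>i<J. h1 i x = 0"
        then have "x \<in> (\<Union>p. ?A1 p)" unfolding D(5) by simp
        then obtain p where "x \<in> ?A1 p" by blast
        then have "?i1 x \<in> conj_span GG w ?I \<omega> RG p" unfolding AG by (rule imageI)
        then show "?i1 x \<in> generate GG SP" by (rule subsetD[OF W.conj_span_in_subgroup[OF Q wQ RQ]])
      next
        fix x assume "x \<in> carrier G2" "\<forall>i<J. h2 i x = 0"
        then have "x \<in> (\<Union>p. ?B1 p)" unfolding D(6) by simp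
        then obtain p where "x \<in> ?B1 p" by blast
        then have "?i2 x \<in> conj_span GG w ?I \<omega> SG p" unfolding BG by (rule imageI)
        then show "?i2 x \<in> generate GG SP" by (rule subsetD[OF W.conj_span_in_subgroup[OF Q wQ SQ]])
      next
        fix l assume "l < J"
        then have "(a l, g2 l) \<in> SP" by (auto simp: SP_def)
        then show "a l \<in> carrier G1 \<and> (\<forall>i<J. \<psi> T i (a l) = (if i = l then 1 else 0)) \<and> (a l, g2 l) \<in> generate GG SP"
          using a(1)[of l] a(2)[of _ l] inc[of "(a l, g2 l)"] by simp
      qed
    qed
    obtain d :: nat and \<pi> where \<pi>: "\<pi> \<in> hom (free_group {..<d}) GG" "\<pi> ` carrier (free_group {..<d}) = P T J"
      by (rule GG.free_cover[OF SP(1) SPc, unfolded gen]) (rule that)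
    let ?F = "free_group {..<d}"
    interpret \<pi>: group_hom ?F GG \<pi>
      using \<pi>(1) group_free_group GG.is_group by (simp add: group_hom_def group_hom_axioms_def)
    have "\<exists>f. p \<in> P T J \<longrightarrow> f \<in> carrier ?F \<and> \<pi> f = p" for p
    proof (cases "p \<in> P T J")
      case True
      then have "p \<in> \<pi> ` carrier ?F" unfolding \<pi>(2) .
      then obtain f where f: "p = \<pi> f" "f \<in> carrier ?F" by (rule imageE)
      show ?thesis by (rule exI[of _ f]) (simp add: f)
    qed simp
    then obtain s where s: "\<And>p. p \<in> P T J \<Longrightarrow> s p \<in> carrier ?F" "\<And>p. p \<in> P T J \<Longrightarrow> \<pi> (s p) = p"
      by metis
    define wF where "wF = (\<lambda>i. s (w i))"
    define RF where "RF = s ` RG"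
    define SF where "SF = s ` SG"
    define tF where "tF = (\<lambda>l. s (shift_elem T l))"
    have wF: "wF i \<in> carrier ?F" "\<pi> (wF i) = w i" if "i \<in> ?I" for i
      using s wP[OF that] by (simp_all add: wF_def)
    have RFc: "RF \<subseteq> carrier ?F" and SFc: "SF \<subseteq> carrier ?F" using s(1) RGP SGP by (auto simp: RF_def SF_def)
    have \<pi>RF: "\<pi> ` RF = RG"
    proof -
      have "\<pi> ` RF = (\<lambda>x. x) ` RG"
        unfolding RF_def image_image by (rule image_cong[OF refl]) (rule s(2)[OF subsetD[OF RGP]])
      then show ?thesis by simp
    qed
    have \<pi>SF: "\<pi> ` SF = SG"
    proof -
      have "\<pi> ` SF = (\<lambda>x. x) ` SG"
        unfolding SF_def image_image by (rule image_cong[OF refl]) (rule s(2)[OF subsetD[OF SGP]])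
      then show ?thesis by simp
    qed
    have finRS: "finite RF" "finite SF" using D(1,2) by (simp_all add: RF_def SF_def RG_def SG_def)
    interpret F: conj_span_group ?F wF ?I \<omega> by (unfold_locales) (rule wF(1))
    let ?lF = "letter_val ?F wF" and ?A = "conj_span ?F wF ?I \<omega> RF" and ?B = "conj_span ?F wF ?I \<omega> SF"
    have lFc: "?lF l \<in> carrier ?F" if "snd l \<in> ?I" for l by (rule F.letter_closed[OF that])
    have \<pi>lF: "\<pi> (?lF l) = (?l1 l, ?l2 l)" if "snd l \<in> ?I" for l
    proof -
      have "letter_val GG (\<pi> \<circ> wF) l = letter_val GG w l" using wF(2)[OF that] by (simp add: letter_val_def)
      then show ?thesis using \<pi>.letter_val_image[of wF l] wF(1)[OF that] lG[OF that] by simp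
    qed
    have Ac: "?A p \<subseteq> carrier ?F" and Bc: "?B p \<subseteq> carrier ?F" for p
      using F.conj_span_closed[OF RFc] F.conj_span_closed[OF SFc] by blast+
    have UAc: "(\<Union>p. ?A p) \<subseteq> carrier ?F" and UBc: "(\<Union>p. ?B p) \<subseteq> carrier ?F" using Ac Bc by blast+
    have wFI: "wF ` ?I \<subseteq> carrier ?F" using wF(1) by blast
    have \<pi>A: "\<pi> ` ?A p = ?i1 ` ?A1 p" and \<pi>B: "\<pi> ` ?B p = ?i2 ` ?B1 p" for p
    proof -
      have cong: "conj_span GG (\<pi> \<circ> wF) ?I \<omega> X p = conj_span GG w ?I \<omega> X p" for X
        by (rule conj_span_cong) (simp_all add: wF(2))
      show "\<pi> ` ?A p = ?i1 ` ?A1 p"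
        unfolding \<pi>.conj_span_image[OF wFI RFc] \<pi>RF cong AG ..
      show "\<pi> ` ?B p = ?i2 ` ?B1 p"
        unfolding \<pi>.conj_span_image[OF wFI SFc] \<pi>SF cong BG ..
    qed
    have \<pi>UA: "\<pi> ` (\<Union>p. ?A p) = ?i1 ` ?N1" and \<pi>UB: "\<pi> ` (\<Union>p. ?B p) = ?i2 ` ?N2"
      unfolding image_UN \<pi>A \<pi>B D(5,6)[symmetric] by (rule refl)+
    have tFc: "tF l \<in> carrier ?F" "\<pi> (tF l) = shift_elem T l" if "snd l \<in> ?W" for l
      using s tP[OF that] by (simp_all add: tF_def)
    have WI: "i \<in> ?I" if "i \<in> ?W" for i using that J km by auto
    have \<pi>RFe: "\<exists>r1\<in>R1. \<pi> r = ?i1 r1" if "r \<in> RF" for r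
      using imageI[OF that, of \<pi>] unfolding \<pi>RF RG_def by blast
    have \<pi>SFe: "\<exists>s1\<in>S1. \<pi> r = ?i2 s1" if "r \<in> SF" for r
      using imageI[OF that, of \<pi>] unfolding \<pi>SF SG_def by blast
    have conjG: "conj_by GG (x, y) (r, r') = (conj_by G1 x r, conj_by G2 y r')"
      if "x \<in> carrier G1" "y \<in> carrier G2" for x y r r'
      by (rule G1.conj_by_DirProd[OF grp2 that])
    have split3: "(x', y') \<in> (\<lambda>(a, b). (x, y) \<otimes>\<^bsub>GG\<^esub> a \<otimes>\<^bsub>GG\<^esub> b) ` (?i1 ` X \<times> ?i2 ` Y)"
      "(x', y') \<in> (\<lambda>(b, a). (x, y) \<otimes>\<^bsub>GG\<^esub> b \<otimes>\<^bsub>GG\<^esub> a) ` (?i2 ` Y \<times> ?i1 ` X)"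
      if "x \<in> carrier G1" "y \<in> carrier G2" "\<exists>a\<in>X. x' = x \<otimes>\<^bsub>G1\<^esub> a" "\<exists>b\<in>Y. y' = y \<otimes>\<^bsub>G2\<^esub> b"
        "X \<subseteq> carrier G1" "Y \<subseteq> carrier G2" for x y x' y' X Y
    proof -
      note hyps = that
      obtain a b where ab: "a \<in> X" "x' = x \<otimes>\<^bsub>G1\<^esub> a" "b \<in> Y" "y' = y \<otimes>\<^bsub>G2\<^esub> b" using hyps(3,4) by blast
      have "a \<in> carrier G1" "b \<in> carrier G2" using ab that(5,6) by blast+
      note c = this hyps(1,2)
      show "(x', y') \<in> (\<lambda>(a, b). (x, y) \<otimes>\<^bsub>GG\<^esub> a \<otimes>\<^bsub>GG\<^esub> b) ` (?i1 ` X \<times> ?i2 ` Y)"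
        using ab c by (intro image_eqI[of _ _ "(?i1 a, ?i2 b)"]) simp_all
      show "(x', y') \<in> (\<lambda>(b, a). (x, y) \<otimes>\<^bsub>GG\<^esub> b \<otimes>\<^bsub>GG\<^esub> a) ` (?i2 ` Y \<times> ?i1 ` X)"
        using ab c by (intro image_eqI[of _ _ "(?i2 b, ?i1 a)"]) simp_all
    qed
    have A1c: "?A1 p \<subseteq> carrier G1" and B1c: "?B1 p \<subseteq> carrier G2" for p
      using S1.conj_span_closed[OF Rc] S2.conj_span_closed[OF Sc] by blast+
    \<comment> \<open>The admissibility condition for a relation: it holds in the direct product.
      The set \<open>X\<close> may be infinite, because only one of its elements enters the
      presentation.\<close>
    define good where "good = (\<lambda>f X. f \<in> carrier ?F \<and> X \<subseteq> carrier ?F \<and> \<pi> f \<in> \<pi> ` X)"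
    define Y where "Y = free_gen ` {..<d} \<union> m_inv ?F ` (free_gen ` {..<d})"
    have Yc: "free_gen ` {..<d} \<subseteq> carrier ?F" "Y \<subseteq> carrier ?F" "finite Y"
      using free_gen_closed[of _ "{..<d}"] by (auto simp: Y_def)
    \<comment> \<open>Letters commute up to a commutator in each factor. The error of the first
      factor is written on the left and that of the second on the right, which is the form required
      by \<open>comm_word_swap\<close>.\<close>
    define f1 where "f1 = (\<lambda>l l'. ?lF l \<otimes>\<^bsub>?F\<^esub> ?lF l')"
    define X1 where "X1 = (\<lambda>l l'. (\<lambda>(a, b). a \<otimes>\<^bsub>?F\<^esub> (?lF l' \<otimes>\<^bsub>?F\<^esub> ?lF l) \<otimes>\<^bsub>?F\<^esub> b) ` (?A 0 \<times> ?B 0))"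
    have good1: "good (f1 l l') (X1 l l')" if l: "snd l \<in> ?I" "snd l' \<in> ?I" for l l'
    proof -
      note c1 = l1c[OF l(1)] l1c[OF l(2)] and c2 = l2c[OF l(1)] l2c[OF l(2)]
      let ?a = "?l1 l \<otimes>\<^bsub>G1\<^esub> ?l1 l' \<otimes>\<^bsub>G1\<^esub> inv\<^bsub>G1\<^esub> (?l1 l) \<otimes>\<^bsub>G1\<^esub> inv\<^bsub>G1\<^esub> (?l1 l')"
      \<comment> \<open>With the error on the right, the commutator in the second factor is that of
        the two inverse letters.\<close>
      let ?b = "inv\<^bsub>G2\<^esub> (?l2 l) \<otimes>\<^bsub>G2\<^esub> inv\<^bsub>G2\<^esub> (?l2 l') \<otimes>\<^bsub>G2\<^esub> ?l2 l \<otimes>\<^bsub>G2\<^esub> ?l2 l'"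
      have "?a \<in> ?A1 0" by (rule subsetD[OF S1.conj_span_incl[OF Rc] D(7)[OF l]])
      then have a: "?i1 ?a \<in> \<pi> ` ?A 0" unfolding \<pi>A by (rule imageI)
      have "?b \<in> S1"
        using D(8)[of "inv_letter l" "inv_letter l'"] l gI[OF l(1)] gI[OF l(2)] by (simp add: inv_letter_def letter_val_def split: if_splits)
      then have "?b \<in> ?B1 0" by (rule subsetD[OF S2.conj_span_incl[OF Sc]])
      then have b: "?i2 ?b \<in> \<pi> ` ?B 0" unfolding \<pi>B by (rule imageI)
      have v: "?lF l' \<otimes>\<^bsub>?F\<^esub> ?lF l \<in> carrier ?F" using lFc l by simp
      have "\<pi> (f1 l l') = ?i1 ?a \<otimes>\<^bsub>GG\<^esub> \<pi> (?lF l' \<otimes>\<^bsub>?F\<^esub> ?lF l) \<otimes>\<^bsub>GG\<^esub> ?i2 ?b"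
        using c1 c2 lFc l by (simp add: f1_def \<pi>lF G1.word_simps G2.word_simps)
      then have "\<pi> (f1 l l') \<in> \<pi> ` X1 l l'"
        unfolding X1_def \<pi>.image_mult_middle[OF v Ac Bc] using a b by (intro image_eqI[of _ _ "(?i1 ?a, ?i2 ?b)"]) simp_all
      then show ?thesis
        unfolding good_def using lFc l \<pi>.G.image_mult_middle_closed[OF v Ac Bc] by (simp add: f1_def X1_def)
    qed
    define f2 where "f2 = (\<lambda>l r. conj_by ?F (?lF l) r)"
    have good2: "good (f2 l r) (?A (\<omega> (snd l) - 1))" if l: "snd l \<in> ?I - ?W" "r \<in> RF" for l r
    proof -
      obtain r1 where r1: "r1 \<in> R1" "\<pi> r = ?i1 r1" using \<pi>RFe[OF l(2)] by blast
      have lI: "snd l \<in> ?I" using l(1) by blast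
      have rc: "r \<in> carrier ?F" using l(2) RFc by blast
      have "\<pi> (f2 l r) = ?i1 (conj_by G1 (?l1 l) r1)"
        unfolding f2_def \<pi>.conj_by_image[OF lFc[OF lI] rc] \<pi>lF[OF lI] r1(2) conjG[OF l1c[OF lI] l2c[OF lI]]
        using l2c[OF lI] by simp
      then have "\<pi> (f2 l r) \<in> \<pi> ` ?A (\<omega> (snd l) - 1)" unfolding \<pi>A using D(11)[OF l(1) r1(1)] by blast
      then show ?thesis unfolding good_def using Ac lFc[OF lI] rc by (simp add: f2_def)
    qed
    let ?u1 = "\<lambda>l. ?l1 (fst l, snd l - m)" and ?u2 = "\<lambda>l. ?l2 (fst l, snd l - m)"
    have uc: "?u1 l \<in> carrier G1" "?u2 l \<in> carrier G2" if "snd l \<in> ?W" for l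
      using g1[of "snd l - m"] g2[of "snd l - m"] that J by auto
    have lW: "snd l \<in> ?I" if "snd l \<in> ?W" for l :: "nat letter" by (rule WI[OF that])
    have \<pi>tF: "\<pi> (tF l) = (?u1 l, ?u2 l \<otimes>\<^bsub>G2\<^esub> ?l2 l [^]\<^bsub>G2\<^esub> T)" if "snd l \<in> ?W" for l
      using tFc(2)[OF that] by (simp add: shift_elem_def)
    have vc: "?u2 l \<otimes>\<^bsub>G2\<^esub> ?l2 l [^]\<^bsub>G2\<^esub> T \<in> carrier G2" if "snd l \<in> ?W" for l
      using uc(2)[OF that] l2c[OF lW[OF that]] by simp
    define f3 where "f3 = (\<lambda>l r. conj_by ?F (tF l) r)"
    have good3: "good (f3 l r) (?A c)" if l: "snd l \<in> ?W" "r \<in> RF" for l r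
    proof -
      obtain r1 where r1: "r1 \<in> R1" "\<pi> r = ?i1 r1" using \<pi>RFe[OF l(2)] by blast
      have rc: "r \<in> carrier ?F" using l(2) RFc by blast
      have "\<pi> (f3 l r) = ?i1 (conj_by G1 (?u1 l) r1)"
        unfolding f3_def \<pi>.conj_by_image[OF tFc(1)[OF l(1)] rc] \<pi>tF[OF l(1)] r1(2) conjG[OF uc(1)[OF l(1)] vc[OF l(1)]]
        using G2.conj_by_one_right[OF vc[OF l(1)]] by simp
      then have "\<pi> (f3 l r) \<in> \<pi> ` ?A c" unfolding \<pi>A using D(12)[OF l(1) r1(1), of "fst l"] by blast
      then show ?thesis unfolding good_def using Ac tFc(1)[OF l(1)] rc by (simp add: f3_def)
    qed
    define f4 where "f4 = (\<lambda>l l'. conj_by ?F (tF l) (?lF l'))"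
    \<comment> \<open>In the first factor \<open>tF l\<close> acts as a short element, which
      accounts for \<open>c\<close>. In the second factor the \<open>T\<close>-th power of a letter
      takes part, which accounts for \<open>T + c\<close>.\<close>
    define X4 where "X4 = (\<lambda>l'. (\<lambda>(a, b). ?lF l' \<otimes>\<^bsub>?F\<^esub> a \<otimes>\<^bsub>?F\<^esub> b) ` (?A c \<times> ?B (T + c)))"
    have good4: "good (f4 l l') (X4 l')" if l: "snd l \<in> ?W" "snd l' \<in> ?I" for l l'
    proof -
      have "\<exists>b\<in>?B1 (T + c). conj_by G2 (?u2 l \<otimes>\<^bsub>G2\<^esub> ?l2 l [^]\<^bsub>G2\<^esub> T) (?l2 l') = ?l2 l' \<otimes>\<^bsub>G2\<^esub> b"
        by (rule S2.conj_span_shift_power[OF Sc D(8) lW[OF l(1)] D(10)[OF l(1)] uc(2)[OF l(1)] D(14)[OF l(1)] D(15)[OF l(1)] l(2)])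
      then have "\<pi> (f4 l l') \<in> \<pi> ` X4 l'"
        unfolding f4_def X4_def \<pi>.conj_by_image[OF tFc(1)[OF l(1)] lFc[OF l(2)]] \<pi>tF[OF l(1)] \<pi>lF[OF l(2)]
          conjG[OF uc(1)[OF l(1)] vc[OF l(1)]] \<pi>.image_mult_left[OF lFc[OF l(2)] Ac Bc] \<pi>A \<pi>B
        by (intro split3(1)[OF l1c[OF l(2)] l2c[OF l(2)] D(13)[OF l] _ A1c B1c])
      moreover have "X4 l' \<subseteq> carrier ?F"
        unfolding X4_def using lFc[OF l(2)] Ac[of c] Bc[of "T + c"] by (auto simp: subset_iff)
      ultimately show ?thesis unfolding good_def using tFc(1)[OF l(1)] lFc[OF l(2)] by (simp add: f4_def)
    qed
    \<comment> \<open>Dividing by the power of the diagonal letter removes it from the second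
      component, where only the short element remains, and leaves its inverse in the first. The two
      factors thus exchange their roles.\<close>
    define kF where "kF = (\<lambda>l. tF l \<otimes>\<^bsub>?F\<^esub> inv\<^bsub>?F\<^esub> (?lF l [^]\<^bsub>?F\<^esub> T))"
    have kFc: "kF l \<in> carrier ?F" if "snd l \<in> ?W" for l
      using tFc(1)[OF that] lFc[OF lW[OF that]] by (simp add: kF_def)
    let ?v1 = "\<lambda>l. ?u1 l \<otimes>\<^bsub>G1\<^esub> ?l1 (inv_letter l) [^]\<^bsub>G1\<^esub> T"
    have v1c: "?v1 l \<in> carrier G1" if "snd l \<in> ?W" for l
      using uc(1)[OF that] l1c[of "inv_letter l"] lW[OF that] by (simp add: inv_letter_def)
    have \<pi>kF: "\<pi> (kF l) = (?v1 l, ?u2 l)" if l: "snd l \<in> ?W" for l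
    proof -
      note c = uc[OF l] l1c[OF lW[OF l]] l2c[OF lW[OF l]]
      have "\<pi> (kF l) = \<pi> (tF l) \<otimes>\<^bsub>GG\<^esub> inv\<^bsub>GG\<^esub> (\<pi> (?lF l) [^]\<^bsub>GG\<^esub> T)"
        using tFc(1)[OF l] lFc[OF lW[OF l]] by (simp add: kF_def \<pi>.hom_nat_pow)
      also have "\<dots> = (?u1 l \<otimes>\<^bsub>G1\<^esub> inv\<^bsub>G1\<^esub> (?l1 l [^]\<^bsub>G1\<^esub> T), ?u2 l)"
        unfolding \<pi>tF[OF l] \<pi>lF[OF lW[OF l]] DirProd_nat_pow
        using c by (simp add: inv_DirProd[OF grp1 grp2] G2.m_assoc)
      also have "inv\<^bsub>G1\<^esub> (?l1 l [^]\<^bsub>G1\<^esub> T) = ?l1 (inv_letter l) [^]\<^bsub>G1\<^esub> T"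
        using c(3) G1.letter_val_inv_letter[of g1 l] gI(1)[OF lW[OF l]] by (simp add: G1.nat_pow_inv)
      finally show ?thesis .
    qed
    define f5 where "f5 = (\<lambda>l r. conj_by ?F (kF l) r)"
    have good5: "good (f5 l r) (?B c)" if l: "snd l \<in> ?W" "r \<in> SF" for l r
    proof -
      obtain s1 where s1: "s1 \<in> S1" "\<pi> r = ?i2 s1" using \<pi>SFe[OF l(2)] by blast
      have rc: "r \<in> carrier ?F" using l(2) SFc by blast
      have "\<pi> (f5 l r) = ?i2 (conj_by G2 (?u2 l) s1)"
        unfolding f5_def \<pi>.conj_by_image[OF kFc[OF l(1)] rc] \<pi>kF[OF l(1)] s1(2) conjG[OF v1c[OF l(1)] uc(2)[OF l(1)]]
        using G1.conj_by_one_right[OF v1c[OF l(1)]] by simp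
      then have "\<pi> (f5 l r) \<in> \<pi> ` ?B c" unfolding \<pi>B using D(14)[OF l(1) s1(1), of "fst l"] by blast
      then show ?thesis unfolding good_def using Bc kFc[OF l(1)] rc by (simp add: f5_def)
    qed
    define f6 where "f6 = (\<lambda>l l'. conj_by ?F (kF l) (?lF l'))"
    define X6 where "X6 = (\<lambda>l'. (\<lambda>(b, a). ?lF l' \<otimes>\<^bsub>?F\<^esub> b \<otimes>\<^bsub>?F\<^esub> a) ` (?B c \<times> ?A (T + c)))"
    have good6: "good (f6 l l') (X6 l')" if l: "snd l \<in> ?W" "snd l' \<in> ?I" for l l'
    proof -
      have il: "snd (inv_letter l) \<in> ?I" "\<omega> (snd (inv_letter l)) = 1"
        using lW[OF l(1)] D(10)[OF l(1)] by (simp_all add: inv_letter_def)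
      have "\<exists>a\<in>?A1 (T + c). conj_by G1 (?v1 l) (?l1 l') = ?l1 l' \<otimes>\<^bsub>G1\<^esub> a"
        by (rule S1.conj_span_shift_power[OF Rc D(7) il uc(1)[OF l(1)] D(12)[OF l(1)] D(13)[OF l(1)] l(2)])
      then have "\<pi> (f6 l l') \<in> \<pi> ` X6 l'"
        unfolding f6_def X6_def \<pi>.conj_by_image[OF kFc[OF l(1)] lFc[OF l(2)]] \<pi>kF[OF l(1)] \<pi>lF[OF l(2)]
          conjG[OF v1c[OF l(1)] uc(2)[OF l(1)]] \<pi>.image_mult_left[OF lFc[OF l(2)] Bc Ac] \<pi>A \<pi>B
        by (intro split3(2)[OF l1c[OF l(2)] l2c[OF l(2)] _ D(15)[OF l] A1c B1c])
      moreover have "X6 l' \<subseteq> carrier ?F"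
        unfolding X6_def using lFc[OF l(2)] Bc[of c] Ac[of "T + c"] by (auto simp: subset_iff)
      ultimately show ?thesis unfolding good_def using kFc[OF l(1)] lFc[OF l(2)] by (simp add: f6_def)
    qed
    \<comment> \<open>These relations hold for words of any weight, as the conjugate of
      \<open>r\<close> and the element \<open>s\<close> lie over different factors. Only those below
      the threshold \<open>?N0\<close> are imposed.\<close>
    define f7 where "f7 = (\<lambda>u r s. conj_by ?F (word_val ?F wF u) r \<otimes>\<^bsub>?F\<^esub> s)"
    define X7 where "X7 = (\<lambda>u r s. {s \<otimes>\<^bsub>?F\<^esub> conj_by ?F (word_val ?F wF u) r})"
    have good7: "good (f7 u r s) (X7 u r s)" if u: "snd ` set u \<subseteq> ?I" "r \<in> RF" "s \<in> SF" for u r s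
    proof -
      obtain r1 where r1: "r1 \<in> R1" "\<pi> r = ?i1 r1" using \<pi>RFe[OF u(2)] by blast
      obtain s1 where s1: "s1 \<in> S1" "\<pi> s = ?i2 s1" using \<pi>SFe[OF u(3)] by blast
      have c: "r \<in> carrier ?F" "s \<in> carrier ?F" "word_val ?F wF u \<in> carrier ?F" "r1 \<in> carrier G1" "s1 \<in> carrier G2"
        using u(2,3) RFc SFc F.word_closed[OF u(1)] r1(1) s1(1) Rc Sc by auto
      obtain x y where xy: "\<pi> (word_val ?F wF u) = (x, y)" "x \<in> carrier G1" "y \<in> carrier G2"
        using \<pi>.hom_closed[OF c(3)] by (cases "\<pi> (word_val ?F wF u)") auto
      have conj: "\<pi> (conj_by ?F (word_val ?F wF u) r) = ?i1 (conj_by G1 x r1)"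
        unfolding \<pi>.conj_by_image[OF c(3,1)] xy(1) r1(2) conjG[OF xy(2,3)] using xy(3) by simp
      have cc: "conj_by ?F (word_val ?F wF u) r \<in> carrier ?F" using c by simp
      have "\<pi> (f7 u r s) = \<pi> (s \<otimes>\<^bsub>?F\<^esub> conj_by ?F (word_val ?F wF u) r)"
        unfolding f7_def \<pi>.hom_mult[OF cc c(2)] \<pi>.hom_mult[OF c(2) cc] conj s1(2) using xy(2) c(4,5) by simp
      then show ?thesis unfolding good_def using c cc by (simp add: f7_def X7_def)
    qed
    have Y_split: "\<exists>x z. \<pi> y = (x, z) \<and> x \<in> carrier G1 \<and> z \<in> carrier G2" if "y \<in> Y" for y
    proof -
      have "\<pi> y \<in> carrier GG" by (rule \<pi>.hom_closed[OF subsetD[OF Yc(2) that]])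
      then show ?thesis by (cases "\<pi> y") simp
    qed
    have h1J: "\<And>i. i < J \<Longrightarrow> int_hom G1 (h1 i)" and h2J: "\<And>i. i < J \<Longrightarrow> int_hom G2 (h2 i)" using h1 h2 J by simp_all
    define UA where "UA = (\<Union>p. ?A p)"
    define UB where "UB = (\<Union>p. ?B p)"
    have UA: "UA \<subseteq> carrier ?F" "\<pi> ` UA = ?i1 ` ?N1" and UB: "UB \<subseteq> carrier ?F" "\<pi> ` UB = ?i2 ` ?N2"
      unfolding UA_def UB_def using UAc UBc \<pi>UA \<pi>UB by simp_all
    \<comment> \<open>Conjugation by a generator of the free group or its inverse preserves the
      intersections with the factors. The resulting weight is not bounded in advance, so the whole
      union serves as the set of possible values.\<close>
    define f8 where "f8 = (\<lambda>y r. conj_by ?F y r)"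
    have good8: "good (f8 y r) UA" if y: "y \<in> Y" "r \<in> RF" for y r
    proof -
      obtain r1 where r1: "r1 \<in> R1" "\<pi> r = ?i1 r1" using \<pi>RFe[OF y(2)] by blast
      have yc: "y \<in> carrier ?F" "r \<in> carrier ?F" using y Yc(2) RFc by auto
      obtain x z where xz: "\<pi> y = (x, z)" "x \<in> carrier G1" "z \<in> carrier G2" using Y_split[OF y(1)] by blast
      have eq: "\<pi> (f8 y r) = ?i1 (conj_by G1 x r1)"
        unfolding f8_def \<pi>.conj_by_image[OF yc] xz(1) r1(2) conjG[OF xz(2,3)] using xz(3) by simp
      have "r1 \<in> ?N1" using r1(1) D(3) by blast
      then have "conj_by G1 x r1 \<in> ?N1" using xz(2) by (simp add: G1.int_hom_conj_by[OF h1J])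
      then have "\<pi> (f8 y r) \<in> \<pi> ` UA" unfolding eq UA(2) by (rule imageI)
      then show ?thesis unfolding good_def using UA(1) yc by (simp add: f8_def)
    qed
    have good9: "good (f8 y r) UB" if y: "y \<in> Y" "r \<in> SF" for y r
    proof -
      obtain s1 where s1: "s1 \<in> S1" "\<pi> r = ?i2 s1" using \<pi>SFe[OF y(2)] by blast
      have yc: "y \<in> carrier ?F" "r \<in> carrier ?F" using y Yc(2) SFc by auto
      obtain x z where xz: "\<pi> y = (x, z)" "x \<in> carrier G1" "z \<in> carrier G2" using Y_split[OF y(1)] by blast
      have eq: "\<pi> (f8 y r) = ?i2 (conj_by G2 z s1)"
        unfolding f8_def \<pi>.conj_by_image[OF yc] xz(1) s1(2) conjG[OF xz(2,3)] using xz(2) by simp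
      have "s1 \<in> ?N2" using s1(1) D(4) by blast
      then have "conj_by G2 z s1 \<in> ?N2" using xz(3) by (simp add: G2.int_hom_conj_by[OF h2J])
      then have "\<pi> (f8 y r) \<in> \<pi> ` UB" unfolding eq UB(2) by (rule imageI)
      then show ?thesis unfolding good_def using UB(1) yc by (simp add: f8_def)
    qed
    define f10 where "f10 = (\<lambda>y l. conj_by ?F y (?lF l))"
    define X10 where "X10 = (\<lambda>l. (\<lambda>(a, b). ?lF l \<otimes>\<^bsub>?F\<^esub> a \<otimes>\<^bsub>?F\<^esub> b) ` (UA \<times> UB))"
    have good10: "good (f10 y l) (X10 l)" if y: "y \<in> Y" "snd l \<in> ?I" for y l
    proof -
      have yc: "y \<in> carrier ?F" using y(1) Yc(2) by auto
      obtain x z where xz: "\<pi> y = (x, z)" "x \<in> carrier G1" "z \<in> carrier G2" using Y_split[OF y(1)] by blast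
      note c = l1c[OF y(2)] l2c[OF y(2)]
      have e1: "\<exists>a\<in>?N1. conj_by G1 x (?l1 l) = ?l1 l \<otimes>\<^bsub>G1\<^esub> a"
        using c xz(2) by (intro bexI[of _ "inv\<^bsub>G1\<^esub> (?l1 l) \<otimes>\<^bsub>G1\<^esub> conj_by G1 x (?l1 l)"])
          (simp_all add: G1.inv_cancel_left G1.int_hom_mult[OF h1J] G1.int_hom_inv[OF h1J] G1.int_hom_conj_by[OF h1J])
      have e2: "\<exists>a\<in>?N2. conj_by G2 z (?l2 l) = ?l2 l \<otimes>\<^bsub>G2\<^esub> a"
        using c xz(3) by (intro bexI[of _ "inv\<^bsub>G2\<^esub> (?l2 l) \<otimes>\<^bsub>G2\<^esub> conj_by G2 z (?l2 l)"])
          (simp_all add: G2.inv_cancel_left G2.int_hom_mult[OF h2J] G2.int_hom_inv[OF h2J] G2.int_hom_conj_by[OF h2J])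
      have sub: "?N1 \<subseteq> carrier G1" "?N2 \<subseteq> carrier G2" by auto
      have "\<pi> (f10 y l) \<in> \<pi> ` X10 l"
        unfolding f10_def X10_def \<pi>.conj_by_image[OF yc lFc[OF y(2)]] xz(1) \<pi>lF[OF y(2)] conjG[OF xz(2,3)]
          \<pi>.image_mult_left[OF lFc[OF y(2)] UA(1) UB(1)] UA(2) UB(2)
        by (rule split3(1)[OF c e1 e2 sub])
      moreover have "X10 l \<subseteq> carrier ?F"
        unfolding X10_def using lFc[OF y(2)] UA(1) UB(1) by (auto simp: subset_iff)
      ultimately show ?thesis unfolding good_def using yc lFc[OF y(2)] by (simp add: f10_def)
    qed
    \<comment> \<open>The threshold of \<open>comm_word_all\<close>. As every letter has weight at
      least 1, only finitely many words lie below it.\<close>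
    let ?N0 = "2 * card ?I * T + T + 4 * c + 2"
    let ?LI = "UNIV \<times> ?I :: nat letter set" and ?LV = "UNIV \<times> (?I - ?W) :: nat letter set"
      and ?LW = "UNIV \<times> ?W :: nat letter set"
    define U where "U = {u :: nat letter list. snd ` set u \<subseteq> ?I \<and> word_weight \<omega> u \<le> ?N0}"
    have U: "finite U" unfolding U_def by (rule finite_words) (use D(9) in auto)
    define C1 where "C1 = (\<lambda>(l, l'). (f1 l l', X1 l l')) ` (?LI \<times> ?LI)"
    define C2 where "C2 = (\<lambda>(l, r). (f2 l r, ?A (\<omega> (snd l) - 1))) ` (?LV \<times> RF)"
    define C3 where "C3 = (\<lambda>(l, r). (f3 l r, ?A c)) ` (?LW \<times> RF)"
    define C4 where "C4 = (\<lambda>(l, l'). (f4 l l', X4 l')) ` (?LW \<times> ?LI)"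
    define C5 where "C5 = (\<lambda>(l, r). (f5 l r, ?B c)) ` (?LW \<times> SF)"
    define C6 where "C6 = (\<lambda>(l, l'). (f6 l l', X6 l')) ` (?LW \<times> ?LI)"
    define C7 where "C7 = (\<lambda>(u, r, s). (f7 u r s, X7 u r s)) ` (U \<times> RF \<times> SF)"
    define C8 where "C8 = (\<lambda>(y, r). (f8 y r, UA)) ` (Y \<times> RF)"
    define C9 where "C9 = (\<lambda>(y, r). (f8 y r, UB)) ` (Y \<times> SF)"
    define C10 where "C10 = (\<lambda>(y, l). (f10 y l, X10 l)) ` (Y \<times> ?LI)"
    have goodC: "case_prod good x" if "x \<in> C1 \<union> C2 \<union> C3 \<union> C4 \<union> C5 \<union> C6 \<union> C7 \<union> C8 \<union> C9 \<union> C10" for x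
    proof -
      have "\<forall>x\<in>C1. case_prod good x" unfolding C1_def using good1 by auto
      moreover have "\<forall>x\<in>C2. case_prod good x" unfolding C2_def using good2 by auto
      moreover have "\<forall>x\<in>C3. case_prod good x" unfolding C3_def using good3 by auto
      moreover have "\<forall>x\<in>C4. case_prod good x" unfolding C4_def using good4 by auto
      moreover have "\<forall>x\<in>C5. case_prod good x" unfolding C5_def using good5 by auto
      moreover have "\<forall>x\<in>C6. case_prod good x" unfolding C6_def using good6 by auto
      moreover have "\<forall>x\<in>C7. case_prod good x" unfolding C7_def U_def using good7 by auto
      moreover have "\<forall>x\<in>C8. case_prod good x" unfolding C8_def using good8 by auto
      moreover have "\<forall>x\<in>C9. case_prod good x" unfolding C9_def using good9 by auto
      moreover have "\<forall>x\<in>C10. case_prod good x" unfolding C10_def using good10 by auto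
      ultimately show ?thesis using that by blast
    qed
    define C where "C = C1 \<union> C2 \<union> C3 \<union> C4 \<union> C5 \<union> C6 \<union> C7 \<union> C8 \<union> C9 \<union> C10"
    have finC: "finite C"
      unfolding C_def C1_def C2_def C3_def C4_def C5_def C6_def C7_def C8_def C9_def C10_def
      using finRS U Yc(3) by simp
    have subC: "C1 \<subseteq> C" "C2 \<subseteq> C" "C3 \<subseteq> C" "C4 \<subseteq> C" "C5 \<subseteq> C" "C6 \<subseteq> C" "C7 \<subseteq> C" "C8 \<subseteq> C" "C9 \<subseteq> C" "C10 \<subseteq> C"
      unfolding C_def by blast+
    have goodC': "f \<in> carrier ?F \<and> X \<subseteq> carrier ?F \<and> \<pi> f \<in> \<pi> ` X" if "(f, X) \<in> C" for f X
      using goodC[OF that[unfolded C_def]] unfolding good_def by simp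
    obtain \<Gamma> :: "nat letter list set monoid" and q \<pi>' where \<Gamma>: "group \<Gamma>" "finitely_presented \<Gamma>"
      "q \<in> hom ?F \<Gamma>" "q ` carrier ?F = carrier \<Gamma>" "\<pi>' \<in> hom \<Gamma> GG"
      "\<And>f. f \<in> carrier ?F \<Longrightarrow> \<pi>' (q f) = \<pi> f" "\<And>f X. (f, X) \<in> C \<Longrightarrow> q f \<in> q ` X"
      by (rule finite_relations_cover[OF GG.is_group \<pi>(1) finC goodC']) (assumption, rule that)
    interpret q: group_hom ?F \<Gamma> q
      using group_free_group \<Gamma>(1,3) by (simp add: group_hom_def group_hom_axioms_def)
    have xq: "(q \<circ> wF) i \<in> carrier \<Gamma>" if "i \<in> ?I" for i
      using q.hom_closed[OF wF(1)[OF that]] by simp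
    have Rq: "q ` RF \<subseteq> carrier \<Gamma>" and Sq: "q ` SF \<subseteq> carrier \<Gamma>"
      using image_mono[OF RFc, of q] image_mono[OF SFc, of q] unfolding \<Gamma>(4) .
    interpret \<Gamma>: conj_span_pair \<Gamma> "q \<circ> wF" ?I \<omega> "q ` RF" "q ` SF"
      by unfold_locales (rule xq, assumption, rule Rq, rule Sq)
    have lq: "\<Gamma>.letter l = q (?lF l)" if "snd l \<in> ?I" for l
      by (rule q.letter_val_image[of wF l, OF wF(1)[OF that], symmetric])
    have Aq: "\<Gamma>.A (q ` RF) p = q ` ?A p" and Bq: "\<Gamma>.A (q ` SF) p = q ` ?B p" for p
      by (rule q.conj_span_image[symmetric]; use wF(1) RFc SFc in auto)+
    have wordq: "\<Gamma>.word u = q (word_val ?F wF u)" if "snd ` set u \<subseteq> ?I" for u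
    proof (rule q.word_val_image[symmetric], rule ballI)
      fix l assume "l \<in> set u"
      then have "snd l \<in> ?I" using that by (meson image_subset_iff)
      then show "wF (snd l) \<in> carrier ?F" by (rule wF(1))
    qed
    have rel1: "\<exists>a\<in>\<Gamma>.A (q ` RF) 0. \<exists>b\<in>\<Gamma>.A (q ` SF) 0.
        \<Gamma>.letter l \<otimes>\<^bsub>\<Gamma>\<^esub> \<Gamma>.letter l' = a \<otimes>\<^bsub>\<Gamma>\<^esub> \<Gamma>.letter l' \<otimes>\<^bsub>\<Gamma>\<^esub> \<Gamma>.letter l \<otimes>\<^bsub>\<Gamma>\<^esub> b"
      if l: "snd l \<in> ?I" "snd l' \<in> ?I" for l l'
    proof -
      note c = lFc[OF l(1)] lFc[OF l(2)]
      have v: "?lF l' \<otimes>\<^bsub>?F\<^esub> ?lF l \<in> carrier ?F" using c by simp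
      have "(f1 l l', X1 l l') \<in> C1"
        unfolding C1_def using l by (intro image_eqI[of _ _ "(l, l')"]) (simp_all add: mem_Times_iff)
      from \<Gamma>(7)[OF subsetD[OF subC(1) this]]
      have "\<exists>a\<in>q ` ?A 0. \<exists>b\<in>q ` ?B 0. q (?lF l \<otimes>\<^bsub>?F\<^esub> ?lF l') = a \<otimes>\<^bsub>\<Gamma>\<^esub> q (?lF l' \<otimes>\<^bsub>?F\<^esub> ?lF l) \<otimes>\<^bsub>\<Gamma>\<^esub> b"
        unfolding f1_def X1_def q.image_mult_middle[OF v Ac Bc] by (rule image_case_prod_bex)
      then obtain a b where ab: "a \<in> q ` ?A 0" "b \<in> q ` ?B 0"
        "q (?lF l \<otimes>\<^bsub>?F\<^esub> ?lF l') = a \<otimes>\<^bsub>\<Gamma>\<^esub> q (?lF l' \<otimes>\<^bsub>?F\<^esub> ?lF l) \<otimes>\<^bsub>\<Gamma>\<^esub> b" by blast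
      have a: "a \<in> carrier \<Gamma>" using ab(1) \<Gamma>.conj_span_closed[OF Rq, of a 0] unfolding Aq by blast
      have "\<Gamma>.letter l \<otimes>\<^bsub>\<Gamma>\<^esub> \<Gamma>.letter l' = a \<otimes>\<^bsub>\<Gamma>\<^esub> \<Gamma>.letter l' \<otimes>\<^bsub>\<Gamma>\<^esub> \<Gamma>.letter l \<otimes>\<^bsub>\<Gamma>\<^esub> b"
        unfolding lq[OF l(1)] lq[OF l(2)] using ab(3) a c by (simp add: q.H.m_assoc)
      then show ?thesis unfolding Aq Bq using ab(1,2) by blast
    qed
    have rel2: "conj_by \<Gamma> (\<Gamma>.letter l) r \<in> \<Gamma>.A (q ` RF) (\<omega> (snd l) - 1)"
      if l: "snd l \<in> ?I - ?W" "r \<in> q ` RF" for l r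
    proof -
      obtain r' where r': "r = q r'" "r' \<in> RF" using l(2) by (rule imageE)
      have lI: "snd l \<in> ?I" using l(1) by blast
      have "(f2 l r', ?A (\<omega> (snd l) - 1)) \<in> C2"
        unfolding C2_def using l(1) r'(2) by (intro image_eqI[of _ _ "(l, r')"]) (auto simp: mem_Times_iff)
      from \<Gamma>(7)[OF subsetD[OF subC(2) this]] show ?thesis
        unfolding f2_def q.conj_by_image[OF lFc[OF lI] subsetD[OF RFc r'(2)]] Aq lq[OF lI] r'(1) .
    qed
    have rel3: "conj_by \<Gamma> (q (tF l)) r \<in> \<Gamma>.A (q ` RF) c" if l: "snd l \<in> ?W" "r \<in> q ` RF" for l r
    proof -
      obtain r' where r': "r = q r'" "r' \<in> RF" using l(2) by (rule imageE)
      have "(f3 l r', ?A c) \<in> C3"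
        unfolding C3_def using l(1) r'(2) by (intro image_eqI[of _ _ "(l, r')"]) (simp_all add: mem_Times_iff)
      from \<Gamma>(7)[OF subsetD[OF subC(3) this]] show ?thesis
        unfolding f3_def q.conj_by_image[OF tFc(1)[OF l(1)] subsetD[OF RFc r'(2)]] Aq r'(1) .
    qed
    have rel4: "\<exists>a\<in>\<Gamma>.A (q ` RF) c. \<exists>b\<in>\<Gamma>.A (q ` SF) (T + c).
        conj_by \<Gamma> (q (tF l)) (\<Gamma>.letter l') = \<Gamma>.letter l' \<otimes>\<^bsub>\<Gamma>\<^esub> a \<otimes>\<^bsub>\<Gamma>\<^esub> b"
      if l: "snd l \<in> ?W" "snd l' \<in> ?I" for l l'
    proof -
      have "(f4 l l', X4 l') \<in> C4"
        unfolding C4_def using l by (intro image_eqI[of _ _ "(l, l')"]) (simp_all add: mem_Times_iff)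
      from \<Gamma>(7)[OF subsetD[OF subC(4) this]] show ?thesis
        unfolding f4_def X4_def q.conj_by_image[OF tFc(1)[OF l(1)] lFc[OF l(2)]]
          q.image_mult_left[OF lFc[OF l(2)] Ac Bc] Aq Bq lq[OF l(2)] by (rule image_case_prod_bex)
    qed
    have kq: "q (tF l) \<otimes>\<^bsub>\<Gamma>\<^esub> inv\<^bsub>\<Gamma>\<^esub> (\<Gamma>.letter l [^]\<^bsub>\<Gamma>\<^esub> T) = q (kF l)" if "snd l \<in> ?W" for l
      unfolding kF_def lq[OF lW[OF that]] using tFc(1)[OF that] lFc[OF lW[OF that]] by (simp add: q.hom_nat_pow)
    have rel5: "conj_by \<Gamma> (q (kF l)) r \<in> \<Gamma>.A (q ` SF) c" if l: "snd l \<in> ?W" "r \<in> q ` SF" for l r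
    proof -
      obtain r' where r': "r = q r'" "r' \<in> SF" using l(2) by (rule imageE)
      have "(f5 l r', ?B c) \<in> C5"
        unfolding C5_def using l(1) r'(2) by (intro image_eqI[of _ _ "(l, r')"]) (simp_all add: mem_Times_iff)
      from \<Gamma>(7)[OF subsetD[OF subC(5) this]] show ?thesis
        unfolding f5_def q.conj_by_image[OF kFc[OF l(1)] subsetD[OF SFc r'(2)]] Bq r'(1) .
    qed
    have rel6: "\<exists>a\<in>\<Gamma>.A (q ` RF) (T + c). \<exists>b\<in>\<Gamma>.A (q ` SF) c.
        conj_by \<Gamma> (q (kF l)) (\<Gamma>.letter l') = \<Gamma>.letter l' \<otimes>\<^bsub>\<Gamma>\<^esub> b \<otimes>\<^bsub>\<Gamma>\<^esub> a"
      if l: "snd l \<in> ?W" "snd l' \<in> ?I" for l l'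
    proof -
      have "(f6 l l', X6 l') \<in> C6"
        unfolding C6_def using l by (intro image_eqI[of _ _ "(l, l')"]) (simp_all add: mem_Times_iff)
      from \<Gamma>(7)[OF subsetD[OF subC(6) this]]
      have "\<exists>b\<in>\<Gamma>.A (q ` SF) c. \<exists>a\<in>\<Gamma>.A (q ` RF) (T + c).
          conj_by \<Gamma> (q (kF l)) (\<Gamma>.letter l') = \<Gamma>.letter l' \<otimes>\<^bsub>\<Gamma>\<^esub> b \<otimes>\<^bsub>\<Gamma>\<^esub> a"
        unfolding f6_def X6_def q.conj_by_image[OF kFc[OF l(1)] lFc[OF l(2)]]
          q.image_mult_left[OF lFc[OF l(2)] Bc Ac] Aq Bq lq[OF l(2)] by (rule image_case_prod_bex)
      then show ?thesis by (meson)
    qed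
    have base: "\<Gamma>.comm_word u" if u: "snd ` set u \<subseteq> ?I" "word_weight \<omega> u \<le> ?N0" for u
      unfolding \<Gamma>.comm_word_def
    proof (intro ballI)
      fix r s assume rs: "r \<in> q ` RF" "s \<in> q ` SF"
      obtain r' where r': "r = q r'" "r' \<in> RF" using rs(1) by (rule imageE)
      obtain s' where s': "s = q s'" "s' \<in> SF" using rs(2) by (rule imageE)
      note c = F.word_closed[OF u(1)] subsetD[OF RFc r'(2)] subsetD[OF SFc s'(2)]
      have "(f7 u r' s', X7 u r' s') \<in> C7"
        unfolding C7_def U_def using u r'(2) s'(2) by (intro image_eqI[of _ _ "(u, r', s')"]) simp_all
      from \<Gamma>(7)[OF subsetD[OF subC(7) this]]
      have "q (conj_by ?F (word_val ?F wF u) r' \<otimes>\<^bsub>?F\<^esub> s') = q (s' \<otimes>\<^bsub>?F\<^esub> conj_by ?F (word_val ?F wF u) r')"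
        unfolding f7_def X7_def by (simp only: image_insert image_empty singleton_iff)
      then show "commute \<Gamma> (conj_by \<Gamma> (\<Gamma>.word u) r) s"
        unfolding commute_def wordq[OF u(1)] r'(1) s'(1) q.conj_by_image[OF c(1,2), symmetric]
        using c by simp
    qed
    have \<omega>1: "1 \<le> \<omega> i" if "i \<in> ?I" for i by (rule D(9))
    have Wrel: "\<exists>t\<in>carrier \<Gamma>. (\<forall>r\<in>q ` RF. conj_by \<Gamma> t r \<in> \<Gamma>.A (q ` RF) c) \<and>
        (\<forall>l'. snd l' \<in> ?I \<longrightarrow> (\<exists>a\<in>\<Gamma>.A (q ` RF) c. \<exists>b\<in>\<Gamma>.A (q ` SF) (T + c).
          conj_by \<Gamma> t (\<Gamma>.letter l') = \<Gamma>.letter l' \<otimes>\<^bsub>\<Gamma>\<^esub> a \<otimes>\<^bsub>\<Gamma>\<^esub> b)) \<and>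
        (\<forall>s\<in>q ` SF. conj_by \<Gamma> (t \<otimes>\<^bsub>\<Gamma>\<^esub> inv\<^bsub>\<Gamma>\<^esub> (\<Gamma>.letter l [^]\<^bsub>\<Gamma>\<^esub> T)) s \<in> \<Gamma>.A (q ` SF) c) \<and>
        (\<forall>l'. snd l' \<in> ?I \<longrightarrow> (\<exists>a\<in>\<Gamma>.A (q ` RF) (T + c). \<exists>b\<in>\<Gamma>.A (q ` SF) c.
          conj_by \<Gamma> (t \<otimes>\<^bsub>\<Gamma>\<^esub> inv\<^bsub>\<Gamma>\<^esub> (\<Gamma>.letter l [^]\<^bsub>\<Gamma>\<^esub> T)) (\<Gamma>.letter l') = \<Gamma>.letter l' \<otimes>\<^bsub>\<Gamma>\<^esub> b \<otimes>\<^bsub>\<Gamma>\<^esub> a))"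
      if l: "snd l \<in> ?I \<inter> ?W" for l
    proof -
      have lw: "snd l \<in> ?W" using l by blast
      show ?thesis
      proof (rule bexI[of _ "q (tF l)"], intro conjI ballI allI impI, unfold kq[OF lw])
        show "q (tF l) \<in> carrier \<Gamma>" by (rule q.hom_closed[OF tFc(1)[OF lw]])
      qed (rule rel3[OF lw] rel4[OF lw] rel5[OF lw] rel6[OF lw], assumption)+
    qed
    have allc: "\<Gamma>.comm_word u" if "snd ` set u \<subseteq> ?I" for u
      by (rule \<Gamma>.comm_word_all[OF finite_atLeastLessThan \<omega>1 rel1 rel2 D(10) Wrel T base that])
    have comm: "commute \<Gamma> a b" if ab: "a \<in> q ` UA" "b \<in> q ` UB" for a b
    proof -
      obtain p where p: "a \<in> \<Gamma>.A (q ` RF) p" using ab(1) unfolding UA_def image_UN Aq by (rule UN_E)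
      obtain p' where p': "b \<in> \<Gamma>.A (q ` SF) p'" using ab(2) unfolding UB_def image_UN Bq by (rule UN_E)
      show ?thesis
        by (rule \<Gamma>.conj_spans_commute[where N = "p + p'" and p = p and q = p', OF _ order_refl p p']) (rule allc)
    qed
    have UAq: "(\<Union>p. \<Gamma>.A (q ` RF) p) = q ` UA" and UBq: "(\<Union>p. \<Gamma>.A (q ` SF) p) = q ` UB"
      unfolding UA_def UB_def image_UN Aq Bq by (rule refl)+
    define Yq where "Yq = q ` free_gen ` {..<d}"
    have Yqc: "Yq \<subseteq> carrier \<Gamma>" using Yc(1) q.hom_closed by (auto simp: Yq_def)
    have Ygen: "generate \<Gamma> Yq = carrier \<Gamma>"
      using q.generate_img[OF Yc(1)] unfolding generate_free_group \<Gamma>(4) Yq_def by simp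
    have "m_inv \<Gamma> ` Yq = q ` m_inv ?F ` free_gen ` {..<d}"
      unfolding Yq_def image_image using q.hom_inv[OF free_gen_closed[of _ "{..<d}"]]
      by (intro image_cong refl) simp
    then have Yq: "Yq \<union> m_inv \<Gamma> ` Yq = q ` Y" by (simp add: Y_def Yq_def image_Un)
    have rel8: "conj_by \<Gamma> y r \<in> q ` UA" if y: "y \<in> q ` Y" "r \<in> q ` RF" for y r
    proof -
      obtain y' where y': "y = q y'" "y' \<in> Y" using y(1) by (rule imageE)
      obtain r' where r': "r = q r'" "r' \<in> RF" using y(2) by (rule imageE)
      have "(f8 y' r', UA) \<in> C8"
        unfolding C8_def using y'(2) r'(2) by (intro image_eqI[of _ _ "(y', r')"]) simp_all
      from \<Gamma>(7)[OF subsetD[OF subC(8) this]] show ?thesis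
        unfolding f8_def q.conj_by_image[OF subsetD[OF Yc(2) y'(2)] subsetD[OF RFc r'(2)]] y'(1) r'(1) .
    qed
    have rel9: "conj_by \<Gamma> y r \<in> q ` UB" if y: "y \<in> q ` Y" "r \<in> q ` SF" for y r
    proof -
      obtain y' where y': "y = q y'" "y' \<in> Y" using y(1) by (rule imageE)
      obtain r' where r': "r = q r'" "r' \<in> SF" using y(2) by (rule imageE)
      have "(f8 y' r', UB) \<in> C9"
        unfolding C9_def using y'(2) r'(2) by (intro image_eqI[of _ _ "(y', r')"]) simp_all
      from \<Gamma>(7)[OF subsetD[OF subC(9) this]] show ?thesis
        unfolding f8_def q.conj_by_image[OF subsetD[OF Yc(2) y'(2)] subsetD[OF SFc r'(2)]] y'(1) r'(1) .
    qed
    have rel10: "\<exists>a\<in>q ` UA. \<exists>b\<in>q ` UB. conj_by \<Gamma> y (\<Gamma>.letter l) = \<Gamma>.letter l \<otimes>\<^bsub>\<Gamma>\<^esub> a \<otimes>\<^bsub>\<Gamma>\<^esub> b"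
      if y: "y \<in> q ` Y" "snd l \<in> ?I" for y l
    proof -
      obtain y' where y': "y = q y'" "y' \<in> Y" using y(1) by (rule imageE)
      have "(f10 y' l, X10 l) \<in> C10"
        unfolding C10_def using y'(2) y(2) by (intro image_eqI[of _ _ "(y', l)"]) (simp_all add: mem_Times_iff)
      from \<Gamma>(7)[OF subsetD[OF subC(10) this]] show ?thesis
        unfolding f10_def X10_def q.conj_by_image[OF subsetD[OF Yc(2) y'(2)] lFc[OF y(2)]]
          q.image_mult_left[OF lFc[OF y(2)] UA(1) UB(1)] lq[OF y(2)] y'(1) by (rule image_case_prod_bex)
    qed
    have UAqc: "q ` UA \<subseteq> carrier \<Gamma>" and UBqc: "q ` UB \<subseteq> carrier \<Gamma>"
      using image_mono[OF UA(1), of q] image_mono[OF UB(1), of q] unfolding \<Gamma>(4) .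
    have NR: "normal_closure \<Gamma> (q ` RF) = q ` UA"
      unfolding UAq[symmetric]
    proof (rule \<Gamma>.normal_closure_eq_Union[OF Rq Yqc Ygen], unfold UAq Yq)
      fix y and l :: "nat letter" assume y: "y \<in> q ` Y" "snd l \<in> ?I"
      obtain a b where ab: "a \<in> q ` UA" "b \<in> q ` UB" "conj_by \<Gamma> y (\<Gamma>.letter l) = \<Gamma>.letter l \<otimes>\<^bsub>\<Gamma>\<^esub> a \<otimes>\<^bsub>\<Gamma>\<^esub> b"
        using rel10[OF y] by (elim bexE)
      have "\<forall>z\<in>q ` UA. commute \<Gamma> b z" using comm[OF _ ab(2)] q.H.commute_sym by (intro ballI) metis
      then show "\<exists>a\<in>q ` UA. \<exists>b\<in>carrier \<Gamma>. (\<forall>z\<in>q ` UA. commute \<Gamma> b z) \<and>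
          conj_by \<Gamma> y (\<Gamma>.letter l) = \<Gamma>.letter l \<otimes>\<^bsub>\<Gamma>\<^esub> a \<otimes>\<^bsub>\<Gamma>\<^esub> b"
        using ab(3) by (intro bexI[OF _ ab(1)] bexI[OF _ subsetD[OF UBqc ab(2)]] conjI)
    qed (rule rel8)
    have NS: "normal_closure \<Gamma> (q ` SF) = q ` UB"
      unfolding UBq[symmetric]
    proof (rule \<Gamma>.normal_closure_eq_Union[OF Sq Yqc Ygen], unfold UBq Yq)
      fix y and l :: "nat letter" assume y: "y \<in> q ` Y" "snd l \<in> ?I"
      obtain a b where ab: "a \<in> q ` UA" "b \<in> q ` UB" "conj_by \<Gamma> y (\<Gamma>.letter l) = \<Gamma>.letter l \<otimes>\<^bsub>\<Gamma>\<^esub> a \<otimes>\<^bsub>\<Gamma>\<^esub> b"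
        using rel10[OF y] by (elim bexE)
      note abc = subsetD[OF UAqc ab(1)] subsetD[OF UBqc ab(2)] \<Gamma>.letter_closed[OF y(2)]
      \<comment> \<open>The relations \<open>C10\<close> fix the order of the two errors in favour
        of the first side. Since the errors now commute, the same relations serve the second
        side.\<close>
      have "a \<otimes>\<^bsub>\<Gamma>\<^esub> b = b \<otimes>\<^bsub>\<Gamma>\<^esub> a" using comm[OF ab(1,2)] unfolding commute_def .
      then have eq: "conj_by \<Gamma> y (\<Gamma>.letter l) = \<Gamma>.letter l \<otimes>\<^bsub>\<Gamma>\<^esub> b \<otimes>\<^bsub>\<Gamma>\<^esub> a"
        unfolding ab(3) using abc by (simp only: q.H.m_assoc)
      have "\<forall>z\<in>q ` UB. commute \<Gamma> a z" using comm[OF ab(1)] by (intro ballI)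
      then show "\<exists>a\<in>q ` UB. \<exists>b\<in>carrier \<Gamma>. (\<forall>z\<in>q ` UB. commute \<Gamma> b z) \<and>
          conj_by \<Gamma> y (\<Gamma>.letter l) = \<Gamma>.letter l \<otimes>\<^bsub>\<Gamma>\<^esub> a \<otimes>\<^bsub>\<Gamma>\<^esub> b"
        using eq by (intro bexI[OF _ ab(2)] bexI[OF _ abc(1)] conjI)
    qed (rule rel9)
    have \<pi>'img: "\<pi>' ` q ` X = \<pi> ` X" if "X \<subseteq> carrier ?F" for X
      unfolding image_image using that by (intro image_cong refl \<Gamma>(6)) blast
    show ?thesis
    proof (rule exI[where x = \<Gamma>], rule exI[where x = \<pi>'], rule exI[where x = "q ` RF"],
        rule exI[where x = "q ` UB"], intro conjI ballI)
      show "\<pi>' ` carrier \<Gamma> = P T J"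
        unfolding \<Gamma>(4)[symmetric] \<pi>'img[OF order_refl] by (rule \<pi>(2))
      show "q ` UB \<lhd> \<Gamma>" unfolding NS[symmetric] by (rule q.H.normal_closure_normal[OF Sq])
      show "commute \<Gamma> a b" if "a \<in> normal_closure \<Gamma> (q ` RF)" "b \<in> q ` UB" for a b
        by (rule comm[OF that[unfolded NR]])
      show "\<pi>' ` normal_closure \<Gamma> (q ` RF) = ?i1 ` ?N1" unfolding NR \<pi>'img[OF UA(1)] by (rule UA(2))
      show "\<pi>' ` q ` UB = ?i2 ` ?N2" unfolding \<pi>'img[OF UB(1)] by (rule UB(2))
    qed (use \<Gamma>(1,2,5) Rq finRS(1) in simp_all)
  qed
  \<comment> \<open>The construction works as soon as \<open>2 * c < T\<close>.\<close>
  then show ?thesis by (intro exI[of _ "2 * c + 1"]) auto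
qed

end

lemma (in group_hom) normal_image:
  assumes "N \<lhd> G" "h ` carrier G = carrier H"
  shows "h ` N \<lhd> H"
proof -
  interpret N: normal N G by (rule assms(1))
  show ?thesis
    unfolding H.normal_inv_iff
  proof (intro conjI ballI)
    show "subgroup (h ` N) H" by (rule subgroup_img_is_subgroup[OF N.subgroup_axioms])
    fix x y assume "x \<in> carrier H" "y \<in> h ` N"
    then have "x \<in> h ` carrier G" unfolding assms(2) by simp
    then obtain g where g: "x = h g" "g \<in> carrier G" by (rule imageE)
    obtain n where n: "y = h n" "n \<in> N" using \<open>y \<in> h ` N\<close> by (rule imageE)
    have "x \<otimes>\<^bsub>H\<^esub> y \<otimes>\<^bsub>H\<^esub> inv\<^bsub>H\<^esub> x = h (g \<otimes> n \<otimes> inv g)"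
      using g n(1) N.mem_carrier[OF n(2)] by simp
    then show "x \<otimes>\<^bsub>H\<^esub> y \<otimes>\<^bsub>H\<^esub> inv\<^bsub>H\<^esub> x \<in> h ` N"
      using N.inv_op_closed2[OF g(2) n(2)] by simp
  qed
qed

section \<open>Direct products of finitely presented groups\<close>

lemma (in group) word_val_one: "word_val G (\<lambda>_. \<one>) u = \<one>"
  by (induction u) (auto simp: letter_val_def)

lemma hom_free_group_eq_word_val:
  assumes "group G" "\<phi> \<in> hom (free_group X) G" "u \<in> carrier (free_group X)"
  shows "word_val G (\<lambda>i. \<phi> (free_gen i)) u = \<phi> u"
proof -
  interpret group_hom "free_group X" G \<phi>
    using assms group_free_group by (simp add: group_hom_def group_hom_axioms_def)
  have "\<forall>l\<in>set u. free_gen (snd l) \<in> carrier (free_group X)"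
    using assms(3) by (auto simp: free_group_def free_gen_def)
  then show ?thesis
    using word_val_image[of u free_gen] word_val_free_gen[OF assms(3)] by (simp add: comp_def)
qed

text \<open>\<open>\<Gamma>\<close> is presented by the generators of both groups with only the
  relations that a generator of \<open>G\<close> commutes with a generator of \<open>H\<close>. Its
  elements are then products of a word of either kind, so the kernel over the direct product is
  generated normally by the relators of the two groups.\<close>

theorem finitely_presented_DirProd:
  assumes "group G" "group H" "finitely_presented G" "finitely_presented H"
  shows "finitely_presented (G \<times>\<times> H)"
proof -
  interpret G: group G by (rule assms(1))
  interpret H: group H by (rule assms(2))
  let ?GH = "G \<times>\<times> H"
  have GH: "group ?GH" by (rule DirProd_group[OF assms(1,2)])
  obtain d1 :: nat and R1 \<phi>1 where R1: "finite R1" "R1 \<subseteq> carrier (free_group {..<d1})"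
    and \<phi>1: "\<phi>1 \<in> hom (free_group {..<d1}) G" "\<phi>1 ` carrier (free_group {..<d1}) = carrier G"
      "kernel (free_group {..<d1}) G \<phi>1 = normal_closure (free_group {..<d1}) R1"
    using assms(3) unfolding finitely_presented_iff[OF assms(1)] by blast
  obtain d2 :: nat and R2 \<phi>2 where R2: "finite R2" "R2 \<subseteq> carrier (free_group {..<d2})"
    and \<phi>2: "\<phi>2 \<in> hom (free_group {..<d2}) H" "\<phi>2 ` carrier (free_group {..<d2}) = carrier H"
      "kernel (free_group {..<d2}) H \<phi>2 = normal_closure (free_group {..<d2}) R2"
    using assms(4) unfolding finitely_presented_iff[OF assms(2)] by blast
  let ?F1 = "free_group {..<d1}" and ?F2 = "free_group {..<d2}" and ?F = "free_group {..<d1 + d2}"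
  interpret \<phi>1: group_hom ?F1 G \<phi>1
    using assms(1) \<phi>1(1) group_free_group by (simp add: group_hom_def group_hom_axioms_def)
  interpret \<phi>2: group_hom ?F2 H \<phi>2
    using assms(2) \<phi>2(1) group_free_group by (simp add: group_hom_def group_hom_axioms_def)
  have gen1: "free_gen i \<in> carrier ?F1" if "i < d1" for i using free_gen_closed[of i "{..<d1}"] that by simp
  have gen2: "free_gen i \<in> carrier ?F2" if "i < d2" for i using free_gen_closed[of i "{..<d2}"] that by simp
  have genF: "free_gen i \<in> carrier ?F" if "i < d1 + d2" for i using free_gen_closed[of i "{..<d1 + d2}"] that by simp
  define e where "e = (\<lambda>i. if i < d1 then (\<phi>1 (free_gen i), \<one>\<^bsub>H\<^esub>) else (\<one>\<^bsub>G\<^esub>, \<phi>2 (free_gen (i - d1))))"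
  have ec: "e i \<in> carrier ?GH" if "i < d1 + d2" for i
    using that gen1[of i] gen2[of "i - d1"] by (auto simp: e_def)
  define \<pi> where "\<pi> = word_val ?GH e"
  have \<pi>: "\<pi> \<in> hom ?F ?GH" unfolding \<pi>_def by (rule group.word_val_hom[OF GH]) (rule image_subsetI, rule ec, simp)
  interpret \<pi>: group_hom ?F ?GH \<pi>
    using GH \<pi> group_free_group by (simp add: group_hom_def group_hom_axioms_def)
  have \<pi>_gen: "\<pi> (free_gen i) = e i" if "i < d1 + d2" for i
    unfolding \<pi>_def using ec[OF that] \<pi>.H.r_one[OF ec[OF that]] by (simp add: free_gen_def letter_val_def)
  let ?x = "\<lambda>i. free_gen i" and ?y = "\<lambda>i. free_gen (d1 + i)"
  define C where "C = (\<lambda>(i, j). (?x i \<otimes>\<^bsub>?F\<^esub> ?y j, {?y j \<otimes>\<^bsub>?F\<^esub> ?x i})) ` ({..<d1} \<times> {..<d2})"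
  have finC: "finite C" by (simp add: C_def)
  have C: "f \<in> carrier ?F \<and> X \<subseteq> carrier ?F \<and> \<pi> f \<in> \<pi> ` X" if "(f, X) \<in> C" for f X
  proof -
    note f = that
    obtain i j where ij: "i < d1" "j < d2" "f = ?x i \<otimes>\<^bsub>?F\<^esub> ?y j" "X = {?y j \<otimes>\<^bsub>?F\<^esub> ?x i}"
      using f unfolding C_def by auto
    have c: "?x i \<in> carrier ?F" "?y j \<in> carrier ?F" using genF ij by simp_all
    have "\<pi> f = \<pi> (?y j \<otimes>\<^bsub>?F\<^esub> ?x i)"
      unfolding ij(3) \<pi>.hom_mult[OF c] \<pi>.hom_mult[OF c(2,1)]
      using ij gen1[of i] gen2[of j] by (simp add: \<pi>_gen e_def)
    then show ?thesis using c unfolding ij(3,4) by simp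
  qed
  obtain \<Gamma> :: "nat letter list set monoid" and q \<pi>' where \<Gamma>: "group \<Gamma>" "finitely_presented \<Gamma>"
    "q \<in> hom ?F \<Gamma>" "q ` carrier ?F = carrier \<Gamma>" "\<pi>' \<in> hom \<Gamma> ?GH"
    "\<And>f. f \<in> carrier ?F \<Longrightarrow> \<pi>' (q f) = \<pi> f" "\<And>f X. (f, X) \<in> C \<Longrightarrow> q f \<in> q ` X"
    by (rule finite_relations_cover[OF GH \<pi> finC C]) (assumption, rule that)
  interpret q: group_hom ?F \<Gamma> q
    using \<Gamma>(1,3) group_free_group by (simp add: group_hom_def group_hom_axioms_def)
  interpret \<pi>': group_hom \<Gamma> ?GH \<pi>'
    using \<Gamma>(1,5) GH by (simp add: group_hom_def group_hom_axioms_def)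
  let ?X = "\<lambda>i. q (?x i)" and ?Y = "\<lambda>i. q (?y i)"
  have Xc: "?X i \<in> carrier \<Gamma>" if "i < d1" for i using genF that by simp
  have Yc: "?Y i \<in> carrier \<Gamma>" if "i < d2" for i using genF that by simp
  define \<iota>1 where "\<iota>1 = word_val \<Gamma> ?X"
  define \<iota>2 where "\<iota>2 = word_val \<Gamma> ?Y"
  have "\<iota>1 \<in> hom ?F1 \<Gamma>" "\<iota>2 \<in> hom ?F2 \<Gamma>"
    unfolding \<iota>1_def \<iota>2_def using Xc Yc by (auto intro!: q.H.word_val_hom)
  then interpret \<iota>1: group_hom ?F1 \<Gamma> \<iota>1 + \<iota>2: group_hom ?F2 \<Gamma> \<iota>2
    using \<Gamma>(1) group_free_group by (simp_all add: group_hom_def group_hom_axioms_def)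
  have letters1: "\<forall>l\<in>set u. snd l < d1" if "u \<in> carrier ?F1" for u using that by (auto simp: free_group_def)
  have letters2: "\<forall>l\<in>set u. snd l < d2" if "u \<in> carrier ?F2" for u using that by (auto simp: free_group_def)
  have \<pi>\<iota>1: "\<pi>' (\<iota>1 u) = (\<phi>1 u, \<one>\<^bsub>H\<^esub>)" if u: "u \<in> carrier ?F1" for u
  proof -
    have "\<pi>' (\<iota>1 u) = word_val ?GH (\<pi>' \<circ> ?X) u"
      unfolding \<iota>1_def by (rule \<pi>'.word_val_image) (use letters1[OF u] Xc in blast)
    also have "\<dots> = word_val ?GH (\<lambda>i. (\<phi>1 (free_gen i), \<one>\<^bsub>H\<^esub>)) u"
    proof (rule word_val_cong)
      fix l assume "l \<in> set u"
      then have "snd l < d1" using letters1[OF u] by blast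
      then show "(\<pi>' \<circ> ?X) (snd l) = (\<phi>1 (free_gen (snd l)), \<one>\<^bsub>H\<^esub>)"
        using genF[of "snd l"] by (simp add: \<Gamma>(6) \<pi>_gen e_def)
    qed
    also have "\<dots> = (word_val G (\<lambda>i. \<phi>1 (free_gen i)) u, word_val H (\<lambda>_. \<one>\<^bsub>H\<^esub>) u)"
      by (rule word_val_DirProd[OF assms(1,2)]) (use letters1[OF u] gen1 in auto)
    finally show ?thesis
      unfolding hom_free_group_eq_word_val[OF assms(1) \<phi>1(1) u] H.word_val_one .
  qed
  have \<pi>\<iota>2: "\<pi>' (\<iota>2 u) = (\<one>\<^bsub>G\<^esub>, \<phi>2 u)" if u: "u \<in> carrier ?F2" for u
  proof -
    have "\<pi>' (\<iota>2 u) = word_val ?GH (\<pi>' \<circ> ?Y) u"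
      unfolding \<iota>2_def by (rule \<pi>'.word_val_image) (use letters2[OF u] Yc in blast)
    also have "\<dots> = word_val ?GH (\<lambda>i. (\<one>\<^bsub>G\<^esub>, \<phi>2 (free_gen i))) u"
      by (rule word_val_cong) (use letters2[OF u] genF in \<open>simp add: \<Gamma>(6) \<pi>_gen e_def\<close>)
    also have "\<dots> = (word_val G (\<lambda>_. \<one>\<^bsub>G\<^esub>) u, word_val H (\<lambda>i. \<phi>2 (free_gen i)) u)"
      by (rule word_val_DirProd[OF assms(1,2)]) (use letters2[OF u] gen2 in auto)
    finally show ?thesis
      unfolding hom_free_group_eq_word_val[OF assms(2) \<phi>2(1) u] G.word_val_one .
  qed
  have comm0: "commute \<Gamma> (?X i) (?Y j)" if "i < d1" "j < d2" for i j
  proof -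
    have "(?x i \<otimes>\<^bsub>?F\<^esub> ?y j, {?y j \<otimes>\<^bsub>?F\<^esub> ?x i}) \<in> C"
      unfolding C_def using that by (intro image_eqI[of _ _ "(i, j)"]) simp_all
    from \<Gamma>(7)[OF this] have "q (?x i \<otimes>\<^bsub>?F\<^esub> ?y j) = q (?y j \<otimes>\<^bsub>?F\<^esub> ?x i)" by simp
    then show ?thesis unfolding commute_def using that genF by simp
  qed
  have g1: "free_gen ` {..<d1} \<subseteq> carrier ?F1" and g2: "free_gen ` {..<d2} \<subseteq> carrier ?F2"
    and gF: "free_gen ` {..<d1 + d2} \<subseteq> carrier ?F" using gen1 gen2 genF by auto
  have \<iota>1_gen: "\<iota>1 (free_gen i) = ?X i" if "i < d1" for i
    unfolding \<iota>1_def using q.H.r_one[OF Xc[OF that]] by (simp add: free_gen_def letter_val_def)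
  have \<iota>2_gen: "\<iota>2 (free_gen i) = ?Y i" if "i < d2" for i
    unfolding \<iota>2_def using q.H.r_one[OF Yc[OF that]] by (simp add: free_gen_def letter_val_def)
  have im1: "\<iota>1 ` carrier ?F1 = generate \<Gamma> (?X ` {..<d1})"
    using \<iota>1.generate_img[OF g1] \<iota>1_gen unfolding generate_free_group by (simp add: image_image)
  have im2: "\<iota>2 ` carrier ?F2 = generate \<Gamma> (?Y ` {..<d2})"
    using \<iota>2.generate_img[OF g2] \<iota>2_gen unfolding generate_free_group by (simp add: image_image)
  have comm: "\<iota>2 v \<otimes>\<^bsub>\<Gamma>\<^esub> \<iota>1 u = \<iota>1 u \<otimes>\<^bsub>\<Gamma>\<^esub> \<iota>2 v" if "u \<in> carrier ?F1" "v \<in> carrier ?F2" for u v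
  proof -
    have "commute \<Gamma> (\<iota>1 u) (\<iota>2 v)"
    proof (rule q.H.commute_generate)
      show "\<iota>1 u \<in> generate \<Gamma> (?X ` {..<d1})" unfolding im1[symmetric] using that(1) by (rule imageI)
      show "\<iota>2 v \<in> generate \<Gamma> (?Y ` {..<d2})" unfolding im2[symmetric] using that(2) by (rule imageI)
    qed (use Xc Yc comm0 in auto)
    then show ?thesis by (simp add: commute_def)
  qed
  \<comment> \<open>By commutation these products form a subgroup. It contains all generators, and
    hence every element of \<open>\<Gamma>\<close> splits in this way.\<close>
  define M where "M = (\<lambda>(u, v). \<iota>1 u \<otimes>\<^bsub>\<Gamma>\<^esub> \<iota>2 v) ` (carrier ?F1 \<times> carrier ?F2)"
  have MI: "\<iota>1 u \<otimes>\<^bsub>\<Gamma>\<^esub> \<iota>2 v \<in> M" if "u \<in> carrier ?F1" "v \<in> carrier ?F2" for u v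
    unfolding M_def using that by (intro image_eqI[of _ _ "(u, v)"]) simp_all
  have ME: "\<exists>u\<in>carrier ?F1. \<exists>v\<in>carrier ?F2. z = \<iota>1 u \<otimes>\<^bsub>\<Gamma>\<^esub> \<iota>2 v" if "z \<in> M" for z
    using that unfolding M_def by (rule image_case_prod_bex)
  have M: "subgroup M \<Gamma>"
  proof (rule q.H.subgroupI)
    show "M \<subseteq> carrier \<Gamma>" using ME by force
    show "M \<noteq> {}" using MI[OF \<phi>1.G.one_closed \<phi>2.G.one_closed] by blast
    show "inv\<^bsub>\<Gamma>\<^esub> z \<in> M" if "z \<in> M" for z
    proof -
      note z = that
      obtain u v where uv: "u \<in> carrier ?F1" "v \<in> carrier ?F2" "z = \<iota>1 u \<otimes>\<^bsub>\<Gamma>\<^esub> \<iota>2 v" using ME[OF z] by blast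
      have "inv\<^bsub>\<Gamma>\<^esub> z = \<iota>2 (inv\<^bsub>?F2\<^esub> v) \<otimes>\<^bsub>\<Gamma>\<^esub> \<iota>1 (inv\<^bsub>?F1\<^esub> u)"
        unfolding uv(3) using uv(1,2) by (simp add: q.H.inv_mult_group)
      also have "\<dots> = \<iota>1 (inv\<^bsub>?F1\<^esub> u) \<otimes>\<^bsub>\<Gamma>\<^esub> \<iota>2 (inv\<^bsub>?F2\<^esub> v)" using uv(1,2) by (intro comm) simp_all
      finally show ?thesis using MI[of "inv\<^bsub>?F1\<^esub> u" "inv\<^bsub>?F2\<^esub> v"] uv(1,2) by simp
    qed
    show "z \<otimes>\<^bsub>\<Gamma>\<^esub> z' \<in> M" if "z \<in> M" "z' \<in> M" for z z'
    proof -
      note z = that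
      obtain u v where uv: "u \<in> carrier ?F1" "v \<in> carrier ?F2" "z = \<iota>1 u \<otimes>\<^bsub>\<Gamma>\<^esub> \<iota>2 v" using ME[OF z(1)] by blast
      obtain u' v' where uv': "u' \<in> carrier ?F1" "v' \<in> carrier ?F2" "z' = \<iota>1 u' \<otimes>\<^bsub>\<Gamma>\<^esub> \<iota>2 v'" using ME[OF z(2)] by blast
      note c = uv(1,2) uv'(1,2) \<iota>1.hom_closed[OF uv(1)] \<iota>1.hom_closed[OF uv'(1)] \<iota>2.hom_closed[OF uv(2)] \<iota>2.hom_closed[OF uv'(2)]
      have "z \<otimes>\<^bsub>\<Gamma>\<^esub> z' = \<iota>1 u \<otimes>\<^bsub>\<Gamma>\<^esub> (\<iota>2 v \<otimes>\<^bsub>\<Gamma>\<^esub> \<iota>1 u') \<otimes>\<^bsub>\<Gamma>\<^esub> \<iota>2 v'"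
        unfolding uv(3) uv'(3) using c(5-8) by (simp add: q.H.m_assoc)
      also have "\<dots> = \<iota>1 (u \<otimes>\<^bsub>?F1\<^esub> u') \<otimes>\<^bsub>\<Gamma>\<^esub> \<iota>2 (v \<otimes>\<^bsub>?F2\<^esub> v')"
        unfolding comm[OF uv'(1) uv(2)] using c by (simp add: q.H.m_assoc)
      finally show ?thesis using MI[of "u \<otimes>\<^bsub>?F1\<^esub> u'" "v \<otimes>\<^bsub>?F2\<^esub> v'"] c(1-4) by simp
    qed
  qed
  have genM: "q (free_gen i) \<in> M" if i: "i < d1 + d2" for i
  proof (cases "i < d1")
    case True
    then show ?thesis using MI[OF gen1[OF True] \<phi>2.G.one_closed] \<iota>1_gen[OF True] Xc[OF True] by simp
  next
    case False
    then have j: "i - d1 < d2" "d1 + (i - d1) = i" using i by auto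
    show ?thesis using MI[OF \<phi>1.G.one_closed gen2[OF j(1)]] \<iota>2_gen[OF j(1)] Yc[OF j(1)] j(2) by simp
  qed
  have "generate \<Gamma> (q ` free_gen ` {..<d1 + d2}) \<subseteq> M"
    by (rule q.H.generate_subgroup_incl[OF _ M]) (use genM in auto)
  then have onM: "carrier \<Gamma> \<subseteq> M"
    using q.generate_img[OF gF] unfolding generate_free_group \<Gamma>(4) by simp
  define Y where "Y = \<iota>1 ` R1 \<union> \<iota>2 ` R2"
  have R1k: "R1 \<subseteq> kernel ?F1 G \<phi>1" unfolding \<phi>1(3) by (rule normal_closure_superset)
  have R2k: "R2 \<subseteq> kernel ?F2 H \<phi>2" unfolding \<phi>2(3) by (rule normal_closure_superset)
  have Yc': "Y \<subseteq> carrier \<Gamma>" using R1(2) R2(2) by (auto simp: Y_def)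
  have NY: "normal_closure \<Gamma> Y \<lhd> \<Gamma>" by (rule q.H.normal_closure_normal[OF Yc'])
  have Ysub: "Y \<subseteq> normal_closure \<Gamma> Y" by (rule normal_closure_superset)
  show ?thesis
  proof (rule finitely_presented_quotient[OF \<Gamma>(1) GH \<Gamma>(2,5)])
    show "\<pi>' ` carrier \<Gamma> = carrier ?GH"
    proof
      show "\<pi>' ` carrier \<Gamma> \<subseteq> carrier ?GH" by (rule image_subsetI) (rule \<pi>'.hom_closed)
      show "carrier ?GH \<subseteq> \<pi>' ` carrier \<Gamma>"
      proof
        fix p assume "p \<in> carrier ?GH"
        then obtain a b where p: "p = (a, b)" "a \<in> \<phi>1 ` carrier ?F1" "b \<in> \<phi>2 ` carrier ?F2"
          unfolding \<phi>1(2) \<phi>2(2) by auto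
        obtain u where u: "a = \<phi>1 u" "u \<in> carrier ?F1" using p(2) by (rule imageE)
        obtain v where v: "b = \<phi>2 v" "v \<in> carrier ?F2" using p(3) by (rule imageE)
        have "p = \<pi>' (\<iota>1 u \<otimes>\<^bsub>\<Gamma>\<^esub> \<iota>2 v)"
          using u v p(1) by (simp add: \<pi>\<iota>1 \<pi>\<iota>2)
        moreover have "\<iota>1 u \<otimes>\<^bsub>\<Gamma>\<^esub> \<iota>2 v \<in> carrier \<Gamma>" using u(2) v(2) by simp
        ultimately show "p \<in> \<pi>' ` carrier \<Gamma>" by (rule image_eqI)
      qed
    qed
    show "finite Y" using R1(1) R2(1) by (simp add: Y_def)
    show "Y \<subseteq> carrier \<Gamma>" by (rule Yc')
    show "Y \<subseteq> kernel \<Gamma> ?GH \<pi>'"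
      using R1k R2k Yc' by (auto simp: Y_def kernel_def \<pi>\<iota>1 \<pi>\<iota>2 subset_iff)
    show "kernel \<Gamma> ?GH \<pi>' \<subseteq> normal_closure \<Gamma> Y"
    proof
      fix z assume z: "z \<in> kernel \<Gamma> ?GH \<pi>'"
      then have "z \<in> M" using onM by (auto simp: kernel_def)
      then obtain u v where uv: "u \<in> carrier ?F1" "v \<in> carrier ?F2" "z = \<iota>1 u \<otimes>\<^bsub>\<Gamma>\<^esub> \<iota>2 v" using ME by blast
      have "(\<phi>1 u, \<phi>2 v) = \<pi>' z" using uv by (simp add: \<pi>\<iota>1 \<pi>\<iota>2)
      then have "\<phi>1 u = \<one>\<^bsub>G\<^esub>" "\<phi>2 v = \<one>\<^bsub>H\<^esub>" using z by (simp_all add: kernel_def)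
      then have "u \<in> normal_closure ?F1 R1" "v \<in> normal_closure ?F2 R2"
        unfolding \<phi>1(3)[symmetric] \<phi>2(3)[symmetric] using uv by (simp_all add: kernel_def)
      moreover have "\<iota>1 ` normal_closure ?F1 R1 \<subseteq> normal_closure \<Gamma> Y"
        by (rule \<iota>1.normal_closure_image[OF NY R1(2)]) (use Ysub in \<open>simp add: Y_def\<close>)
      moreover have "\<iota>2 ` normal_closure ?F2 R2 \<subseteq> normal_closure \<Gamma> Y"
        by (rule \<iota>2.normal_closure_image[OF NY R2(2)]) (use Ysub in \<open>simp add: Y_def\<close>)
      ultimately have "\<iota>1 u \<in> normal_closure \<Gamma> Y" "\<iota>2 v \<in> normal_closure \<Gamma> Y" by (simp_all add: image_subset_iff)
      then show "z \<in> normal_closure \<Gamma> Y"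
        unfolding uv(3) by (rule subgroup.m_closed[OF normal_imp_subgroup[OF NY]])
    qed
  qed
qed

section \<open>Imposing the equations one at a time\<close>

context fibre_data
begin

abbreviation PG where "PG T J \<equiv> GG\<lparr>carrier := P T J\<rparr>"

text \<open>The next equation cuts out the kernel of the difference of its two sides. The cover of
  this kernel need not yet contain the preimages of the intersections in its commuting subgroups;
  refining it achieves this without losing the commutation. The elements on which the character is
  \<open>1\<close> and \<open>-1\<close> can be taken in single factors because the characters on
  either side have dual elements.\<close>

lemma finitely_presented_step:
  fixes \<Gamma> :: "('g, 'h) monoid_scheme"
  assumes J: "J < m + k" and fp: "finitely_presented (PG T J)"
    and \<Gamma>: "group \<Gamma>" "finitely_presented \<Gamma>" "\<pi> \<in> hom \<Gamma> GG" "\<pi> ` carrier \<Gamma> = P T (Suc J)"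
    and R: "finite R" "R \<subseteq> carrier \<Gamma>" and B: "B \<lhd> \<Gamma>" "\<forall>a\<in>normal_closure \<Gamma> R. \<forall>b\<in>B. commute \<Gamma> a b"
    and \<pi>A: "\<pi> ` normal_closure \<Gamma> R = (\<lambda>a. (a, \<one>\<^bsub>G2\<^esub>)) ` {x \<in> carrier G1. \<forall>i<Suc J. h1 i x = 0}"
    and \<pi>B: "\<pi> ` B = (\<lambda>b. (\<one>\<^bsub>G1\<^esub>, b)) ` {x \<in> carrier G2. \<forall>i<Suc J. h2 i x = 0}"
  shows "finitely_presented (PG T (Suc J))"
proof -
  define \<chi> where "\<chi> = (\<lambda>p. \<psi> T J (fst p) - h2 J (snd p))"
  have J': "J \<le> m + k" "Suc J \<le> m + k" using J by auto
  have PG: "group (PG T J)" by (rule GG.subgroup_imp_group[OF P_subgroup[OF J'(1)]])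
  have PSuc: "P T (Suc J) = {p \<in> P T J. \<chi> p = 0}"
    by (auto simp: P_def \<chi>_def less_Suc_eq)
  have \<pi>P: "\<pi> \<in> hom \<Gamma> (PG T J)"
  proof (rule homI)
    fix x y assume "x \<in> carrier \<Gamma>" "y \<in> carrier \<Gamma>"
    then show "\<pi> (x \<otimes>\<^bsub>\<Gamma>\<^esub> y) = \<pi> x \<otimes>\<^bsub>PG T J\<^esub> \<pi> y" using hom_mult[OF \<Gamma>(3)] by simp
  next
    fix x assume "x \<in> carrier \<Gamma>"
    then have "\<pi> x \<in> P T (Suc J)" unfolding \<Gamma>(4)[symmetric] by (rule imageI)
    then show "\<pi> x \<in> carrier (PG T J)" unfolding PSuc by simp
  qed
  have p1: "fst \<in> hom (PG T J) G1" and p2: "snd \<in> hom (PG T J) G2"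
    by (auto simp: hom_def P_def)
  have fst_onto: "fst ` P T (Suc J) = carrier G1"
  proof
    show "fst ` P T (Suc J) \<subseteq> carrier G1" by (auto simp: P_def)
    show "carrier G1 \<subseteq> fst ` P T (Suc J)"
    proof
      fix a assume a: "a \<in> carrier G1"
      obtain b where b: "b \<in> carrier G2" "\<forall>i<m + k. h2 i b = \<psi> T i a" using lift2[of "\<lambda>i. \<psi> T i a"] by blast
      have "(a, b) \<in> P T (Suc J)" using a b J by (simp add: P_def)
      then show "a \<in> fst ` P T (Suc J)" by (intro image_eqI[of _ _ "(a, b)"]) simp_all
    qed
  qed
  have snd_onto: "snd ` P T (Suc J) = carrier G2"
  proof
    show "snd ` P T (Suc J) \<subseteq> carrier G2" by (auto simp: P_def)
    show "carrier G2 \<subseteq> snd ` P T (Suc J)"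
    proof
      fix b assume b: "b \<in> carrier G2"
      obtain a where a: "a \<in> carrier G1" "\<forall>i<m + k. \<psi> T i a = h2 i b" using lift1[of T "\<lambda>i. h2 i b"] by blast
      have "(a, b) \<in> P T (Suc J)" using a b J by (simp add: P_def)
      then show "b \<in> snd ` P T (Suc J)" by (intro image_eqI[of _ _ "(a, b)"]) simp_all
    qed
  qed
  have in_P: "\<pi> g \<in> P T (Suc J)" if "g \<in> carrier \<Gamma>" for g
    unfolding \<Gamma>(4)[symmetric] using that by (rule imageI)
  have A: "normal_closure \<Gamma> R \<lhd> \<Gamma>" by (rule group.normal_closure_normal[OF \<Gamma>(1) R(2)])
  have kerA: "\<pi> g \<in> \<pi> ` normal_closure \<Gamma> R" if g: "g \<in> carrier \<Gamma>" "snd (\<pi> g) = \<one>\<^bsub>G2\<^esub>" for g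
  proof -
    obtain a where a: "\<pi> g = (a, \<one>\<^bsub>G2\<^esub>)" using g(2) by (cases "\<pi> g") simp
    have "a \<in> carrier G1" "\<forall>i<Suc J. \<psi> T i a = 0"
      using in_P[OF g(1)] a G2.int_hom_one[OF h2] J by (simp_all add: P_def)
    then show ?thesis unfolding \<pi>A a using \<psi>_kernel[OF J'(2), of T a] by blast
  qed
  have kerB: "\<pi> g \<in> \<pi> ` B" if g: "g \<in> carrier \<Gamma>" "fst (\<pi> g) = \<one>\<^bsub>G1\<^esub>" for g
  proof -
    obtain b where b: "\<pi> g = (\<one>\<^bsub>G1\<^esub>, b)" using g(2) by (cases "\<pi> g") simp
    have "b \<in> carrier G2" "\<forall>i<Suc J. h2 i b = 0"
      using in_P[OF g(1)] b G1.int_hom_one[OF \<psi>_int_hom] J by (simp_all add: P_def)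
    then show ?thesis unfolding \<pi>B b by blast
  qed
  have onto: "(fst \<circ> \<pi>) ` carrier \<Gamma> = carrier G1" "(snd \<circ> \<pi>) ` carrier \<Gamma> = carrier G2"
    unfolding image_comp[symmetric] \<Gamma>(4) by (rule fst_onto, rule snd_onto)
  obtain \<Gamma>' :: "'g set monoid" and q \<pi>' where \<Gamma>': "group \<Gamma>'" "finitely_presented \<Gamma>'"
    "q \<in> hom \<Gamma> \<Gamma>'" "q ` carrier \<Gamma> = carrier \<Gamma>'" "\<pi>' \<in> hom \<Gamma>' (PG T J)"
    "\<And>g. g \<in> carrier \<Gamma> \<Longrightarrow> \<pi>' (q g) = \<pi> g"
    "\<And>g. g \<in> carrier \<Gamma>' \<Longrightarrow> snd (\<pi>' g) = \<one>\<^bsub>G2\<^esub> \<Longrightarrow> g \<in> q ` normal_closure \<Gamma> R"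
    "\<And>g. g \<in> carrier \<Gamma>' \<Longrightarrow> fst (\<pi>' g) = \<one>\<^bsub>G1\<^esub> \<Longrightarrow> g \<in> q ` B"
    by (rule refine_cover[OF \<Gamma>(1) PG grp1 grp2 \<Gamma>(2) fp1 fp2 \<pi>P p1 p2 onto A kerA B(1) kerB])
      (assumption, assumption, assumption, assumption, rule that)
  interpret q: group_hom \<Gamma> \<Gamma>' q
    using \<Gamma>(1) \<Gamma>'(1,3) by (simp add: group_hom_def group_hom_axioms_def)
  have qR: "q ` R \<subseteq> carrier \<Gamma>'" using R(2) by auto
  have "normal_closure \<Gamma>' (q ` R) \<subseteq> q ` normal_closure \<Gamma> R"
    by (rule normal_closure_minimal[OF q.normal_image[OF A \<Gamma>'(4)] image_mono[OF normal_closure_superset]])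
  moreover have "q ` normal_closure \<Gamma> R \<subseteq> normal_closure \<Gamma>' (q ` R)"
    by (rule q.normal_closure_image[OF q.H.normal_closure_normal[OF qR] R(2) normal_closure_superset])
  ultimately have qA: "normal_closure \<Gamma>' (q ` R) = q ` normal_closure \<Gamma> R" by (rule subset_antisym)
  have Ac: "normal_closure \<Gamma> R \<subseteq> carrier \<Gamma>" by (rule subgroup.subset[OF normal_imp_subgroup[OF A]])
  have Bc: "B \<subseteq> carrier \<Gamma>" by (rule subgroup.subset[OF normal_imp_subgroup[OF B(1)]])
  obtain a0 where a0: "a0 \<in> carrier G1" "\<forall>i<m + k. \<psi> T i a0 = (if i = J then 1 else 0)"
    using lift1[of T "\<lambda>i. if i = J then 1 else 0"] by blast
  have "finitely_presented ((PG T J)\<lparr>carrier := {p \<in> carrier (PG T J). \<chi> p = 0}\<rparr>)"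
  proof (rule finitely_presented_character_kernel[where R = "q ` R" and B = "q ` B"
        and ?x0.0 = "(a0, \<one>\<^bsub>G2\<^esub>)" and ?y0.0 = "(\<one>\<^bsub>G1\<^esub>, g2 J)", OF \<Gamma>'(1) PG grp1 grp2 \<Gamma>'(2) fp \<Gamma>'(5) p1 p2])
    show "p = \<one>\<^bsub>PG T J\<^esub>" if "fst p = \<one>\<^bsub>G1\<^esub>" "snd p = \<one>\<^bsub>G2\<^esub>" for p
      using that by (cases p) simp
    show "\<chi> (p \<otimes>\<^bsub>PG T J\<^esub> r) = \<chi> p + \<chi> r" if "p \<in> carrier (PG T J)" "r \<in> carrier (PG T J)" for p r
      using that G1.int_hom_mult[OF \<psi>_int_hom[OF J]] G2.int_hom_mult[OF h2[OF J]]
      by (auto simp: \<chi>_def P_def)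
    have "\<pi>' ` carrier \<Gamma>' = \<pi> ` carrier \<Gamma>"
      unfolding \<Gamma>'(4)[symmetric] image_image by (rule image_cong[OF refl \<Gamma>'(6)])
    then show "\<pi>' ` carrier \<Gamma>' = {p \<in> carrier (PG T J). \<chi> p = 0}" unfolding \<Gamma>(4) PSuc by simp
    show "finite (q ` R)" using R(1) by simp
    show "q ` R \<subseteq> carrier \<Gamma>'" by (rule qR)
    show "q ` B \<lhd> \<Gamma>'" by (rule q.normal_image[OF B(1) \<Gamma>'(4)])
    show "commute \<Gamma>' a b" if "a \<in> normal_closure \<Gamma>' (q ` R)" "b \<in> q ` B" for a b
    proof -
      note ab = that
      obtain a' where a': "a = q a'" "a' \<in> normal_closure \<Gamma> R" using ab(1) unfolding qA by (rule imageE)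
      obtain b' where b': "b = q b'" "b' \<in> B" using ab(2) by (rule imageE)
      note c = subsetD[OF Ac a'(2)] subsetD[OF Bc b'(2)]
      have "a' \<otimes>\<^bsub>\<Gamma>\<^esub> b' = b' \<otimes>\<^bsub>\<Gamma>\<^esub> a'" by (rule bspec[OF bspec[OF B(2) a'(2)] b'(2), unfolded commute_def])
      then show ?thesis
        unfolding commute_def a'(1) b'(1) q.hom_mult[OF c, symmetric] q.hom_mult[OF c(2,1), symmetric] by simp
    qed
    show "g \<in> normal_closure \<Gamma>' (q ` R)" if "g \<in> carrier \<Gamma>'" "snd (\<pi>' g) = \<one>\<^bsub>G2\<^esub>" for g
      unfolding qA by (rule \<Gamma>'(7)[OF that])
    show "snd (\<pi>' g) = \<one>\<^bsub>G2\<^esub>" if "g \<in> normal_closure \<Gamma>' (q ` R)" for g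
    proof -
      note g = that
      obtain a' where a': "g = q a'" "a' \<in> normal_closure \<Gamma> R" using g unfolding qA by (rule imageE)
      have "\<pi> a' \<in> \<pi> ` normal_closure \<Gamma> R" using a'(2) by (rule imageI)
      then show ?thesis unfolding \<pi>A a'(1) \<Gamma>'(6)[OF subsetD[OF Ac a'(2)]] by auto
    qed
    show "g \<in> q ` B" if "g \<in> carrier \<Gamma>'" "fst (\<pi>' g) = \<one>\<^bsub>G1\<^esub>" for g by (rule \<Gamma>'(8)[OF that])
    show "(a0, \<one>\<^bsub>G2\<^esub>) \<in> carrier (PG T J)"
      using a0 J G2.int_hom_one[OF h2] by (simp add: P_def)
    show "(\<one>\<^bsub>G1\<^esub>, g2 J) \<in> carrier (PG T J)"
      using g2[OF J] h2g2[of _ J] J G1.int_hom_one[OF \<psi>_int_hom] by (simp add: P_def)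
    show "\<chi> (a0, \<one>\<^bsub>G2\<^esub>) = 1" using a0(2) J G2.int_hom_one[OF h2[OF J]] by (simp add: \<chi>_def)
    show "\<chi> (\<one>\<^bsub>G1\<^esub>, g2 J) = - 1"
      using h2g2[OF J J] G1.int_hom_one[OF \<psi>_int_hom[OF J]] by (simp add: \<chi>_def)
  qed simp_all
  then show ?thesis unfolding PSuc by simp
qed

theorem finitely_presented_fibre:
  "\<exists>\<psi> u. dual_system G1 {..<m + k} \<psi> u \<and>
    finitely_presented (GG\<lparr>carrier := {(a, b). a \<in> carrier G1 \<and> b \<in> carrier G2 \<and> (\<forall>i<m + k. \<psi> i a = h2 i b)}\<rparr>)"
proof -
  define Q where "Q = (\<lambda>J T. \<exists>(\<Gamma> :: nat letter list set monoid) \<pi> R B. group \<Gamma> \<and> finitely_presented \<Gamma> \<and>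
      \<pi> \<in> hom \<Gamma> GG \<and> \<pi> ` carrier \<Gamma> = P T J \<and> finite R \<and> R \<subseteq> carrier \<Gamma> \<and> B \<lhd> \<Gamma> \<and>
      (\<forall>a\<in>normal_closure \<Gamma> R. \<forall>b\<in>B. commute \<Gamma> a b) \<and>
      \<pi> ` normal_closure \<Gamma> R = (\<lambda>a. (a, \<one>\<^bsub>G2\<^esub>)) ` {x \<in> carrier G1. \<forall>i<J. h1 i x = 0} \<and>
      \<pi> ` B = (\<lambda>b. (\<one>\<^bsub>G1\<^esub>, b)) ` {x \<in> carrier G2. \<forall>i<J. h2 i x = 0})"
  have "\<exists>T0. \<forall>T\<ge>T0. Q J T" if "J \<le> m + k" for J
    unfolding Q_def by (rule commuting_cover[OF that])
  then obtain T0 where T0: "\<And>J T. J \<le> m + k \<Longrightarrow> T0 J \<le> T \<Longrightarrow> Q J T" by metis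
  \<comment> \<open>Each stage starts from the group \<open>PG T J\<close> of the stage before, so
    one shear has to serve all stages; the maximum of the finitely many thresholds does.\<close>
  define T where "T = Max (T0 ` {..m + k})"
  have T: "T0 J \<le> T" if "J \<le> m + k" for J unfolding T_def using that by (intro Max_ge) auto
  have fp: "finitely_presented (PG T J)" if "J \<le> m + k" for J
    using that
  proof (induction J)
    case 0
    have "PG T 0 = GG" by (simp add: P_def DirProd_def Sigma_def)
    then show ?case using finitely_presented_DirProd[OF grp1 grp2 fp1 fp2] by simp
  next
    case (Suc J)
    then have J: "J < m + k" "finitely_presented (PG T J)" by auto
    show ?case
      using T0[OF Suc.prems T[OF Suc.prems]] unfolding Q_def
      by (elim exE conjE) (rule finitely_presented_step[OF J]; assumption)
  qed
  have "\<exists>a. a \<in> carrier G1 \<and> (\<forall>i<m + k. \<psi> T i a = (if i = l then 1 else 0))" for l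
    using lift1[of T "\<lambda>i. if i = l then 1 else 0"] by blast
  then obtain u where u: "\<And>l. u l \<in> carrier G1" "\<And>i l. i < m + k \<Longrightarrow> \<psi> T i (u l) = (if i = l then 1 else 0)"
    by metis
  have "dual_system G1 {..<m + k} (\<psi> T) u"
    unfolding dual_system_def using u \<psi>_int_hom by auto
  then show ?thesis using fp[OF order_refl] unfolding P_def by blast
qed

end

section \<open>Co-rank of the fibre product and the choice of characters\<close>

lemma finitely_presented_iso:
  assumes "G \<cong> H" "finitely_presented G"
  shows "finitely_presented H"
  using assms(2) iso_trans[OF _ assms(1)] unfolding finitely_presented_def by blast

lemma (in group) derived_subset_int_kernel:
  assumes "\<And>i. i \<in> I \<Longrightarrow> int_hom G (f i)"
  shows "derived G (carrier G) \<subseteq> {x \<in> carrier G. \<forall>i\<in>I. f i x = 0}"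
  unfolding derived_def
proof (rule generate_subgroup_incl[OF _ kernel_int_homs_subgroup[OF assms]], rule subsetI)
  fix y assume "y \<in> derived_set G (carrier G)"
  then obtain a b where "a \<in> carrier G" "b \<in> carrier G" "y = a \<otimes> b \<otimes> inv a \<otimes> inv b" by blast
  then show "y \<in> {x \<in> carrier G. \<forall>i\<in>I. f i x = 0}"
    using assms by (simp add: int_hom_mult int_hom_inv)
qed

text \<open>Describing cosets as level sets of the characters lets the isomorphism between the two
  quotients be defined without choosing representatives.\<close>

lemma (in group) int_kernel_coset:
  assumes f: "\<And>i. i \<in> I \<Longrightarrow> int_hom G (f i)" and a: "a \<in> carrier G"
  shows "{x \<in> carrier G. \<forall>i\<in>I. f i x = 0} #> a = {x \<in> carrier G. \<forall>i\<in>I. f i x = f i a}" (is "?N #> a = ?R")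
proof
  show "?N #> a \<subseteq> ?R" using a f by (auto simp: r_coset_def int_hom_mult)
  show "?R \<subseteq> ?N #> a"
  proof
    fix x assume x: "x \<in> ?R"
    then have "x \<otimes> inv a \<in> ?N" using a f by (simp add: int_hom_mult int_hom_inv)
    moreover have "x = x \<otimes> inv a \<otimes> a" using x a by (simp add: m_assoc)
    ultimately show "x \<in> ?N #> a" unfolding r_coset_def by blast
  qed
qed

text \<open>The characters identify both quotients by their common kernels with the free abelian
  group of rank \<open>n\<close>, and \<open>\<mu>\<close> matches equal values. \<open>D\<close> is
  the common kernel of the differences of the two families; the elements
  \<open>(x i, \<one>)\<close> are dual to them, and so the co-rank is \<open>n\<close>.\<close>

theorem fibre_product_of_dual_systems:
  fixes f :: "nat \<Rightarrow> 'a \<Rightarrow> int" and h :: "nat \<Rightarrow> 'b \<Rightarrow> int"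
    and G :: "('a, 'c) monoid_scheme" and H :: "('b, 'd) monoid_scheme"
  assumes "group G" "group H" and dual: "dual_system G {..<n} f x" "dual_system H {..<n} h y"
  defines "D \<equiv> {(a, b). a \<in> carrier G \<and> b \<in> carrier H \<and> (\<forall>i<n. f i a = h i b)}"
  shows "is_fibre_product G H D \<and> D \<lhd> G \<times>\<times> H \<and> co_rank (G \<times>\<times> H) D = n"
proof -
  interpret G: group G by (rule assms(1))
  interpret H: group H by (rule assms(2))
  interpret GH: group "G \<times>\<times> H" by (rule DirProd_group[OF assms(1,2)])
  have f: "\<And>i. i \<in> {..<n} \<Longrightarrow> int_hom G (f i)" and x: "\<And>i. i \<in> {..<n} \<Longrightarrow> x i \<in> carrier G"
    and fx: "\<And>i l. i \<in> {..<n} \<Longrightarrow> l \<in> {..<n} \<Longrightarrow> f i (x l) = (if i = l then 1 else 0)"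
    using dual(1) unfolding dual_system_def by blast+
  have h: "\<And>i. i \<in> {..<n} \<Longrightarrow> int_hom H (h i)" using dual(2) unfolding dual_system_def by blast
  define N1 where "N1 = {a \<in> carrier G. \<forall>i\<in>{..<n}. f i a = 0}"
  define N2 where "N2 = {b \<in> carrier H. \<forall>i\<in>{..<n}. h i b = 0}"
  have N1: "N1 \<lhd> G" unfolding N1_def
    by (rule G.normal_of_derived[OF G.kernel_int_homs_subgroup[OF f] G.derived_subset_int_kernel[OF f]])
  have N2: "N2 \<lhd> H" unfolding N2_def
    by (rule H.normal_of_derived[OF H.kernel_int_homs_subgroup[OF h] H.derived_subset_int_kernel[OF h]])
  interpret N1: normal N1 G by (rule N1)
  interpret N2: normal N2 H by (rule N2)
  note one_FactGroup [simp del] mult_FactGroup [simp del]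
  have coset1: "N1 #>\<^bsub>G\<^esub> a = {x \<in> carrier G. \<forall>i\<in>{..<n}. f i x = f i a}" if "a \<in> carrier G" for a
    unfolding N1_def by (rule G.int_kernel_coset[OF f that])
  have coset2: "N2 #>\<^bsub>H\<^esub> b = {x \<in> carrier H. \<forall>i\<in>{..<n}. h i x = h i b}" if "b \<in> carrier H" for b
    unfolding N2_def by (rule H.int_kernel_coset[OF h that])
  define \<mu> where "\<mu> = (\<lambda>X. {b \<in> carrier H. \<exists>a\<in>X. \<forall>i\<in>{..<n}. f i a = h i b})"
  have \<mu>: "\<mu> (N1 #>\<^bsub>G\<^esub> a) = {b \<in> carrier H. \<forall>i\<in>{..<n}. f i a = h i b}" if a: "a \<in> carrier G" for a
    unfolding \<mu>_def coset1[OF a] using a by force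
  have \<mu>_iff: "\<mu> (N1 #>\<^bsub>G\<^esub> a) = N2 #>\<^bsub>H\<^esub> b \<longleftrightarrow> (\<forall>i\<in>{..<n}. f i a = h i b)"
    if "a \<in> carrier G" "b \<in> carrier H" for a b
    unfolding \<mu>[OF that(1)] coset2[OF that(2)] using that(2) by force
  have lift_h: "\<exists>b\<in>carrier H. \<forall>i\<in>{..<n}. f i a = h i b" for a
    using H.dual_system_interpolation[OF finite_lessThan dual(2), where c = "\<lambda>i. f i a"] by metis
  have lift_f: "\<exists>a\<in>carrier G. \<forall>i\<in>{..<n}. f i a = h i b" for b
    using G.dual_system_interpolation[OF finite_lessThan dual(1), where c = "\<lambda>i. h i b"] by metis
  have carr1: "\<exists>a\<in>carrier G. X = N1 #>\<^bsub>G\<^esub> a" if "X \<in> carrier (G Mod N1)" for X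
    using that by (auto simp: carrier_FactGroup)
  have carr1': "N1 #>\<^bsub>G\<^esub> a \<in> carrier (G Mod N1)" if "a \<in> carrier G" for a
    using that by (auto simp: carrier_FactGroup)
  have carr2': "N2 #>\<^bsub>H\<^esub> b \<in> carrier (H Mod N2)" if "b \<in> carrier H" for b
    using that by (auto simp: carrier_FactGroup)
  have iso: "\<mu> \<in> iso (G Mod N1) (H Mod N2)"
  proof (rule isoI)
    show "\<mu> \<in> hom (G Mod N1) (H Mod N2)"
    proof (rule homI)
      fix X assume "X \<in> carrier (G Mod N1)"
      then obtain a where a: "a \<in> carrier G" "X = N1 #>\<^bsub>G\<^esub> a" using carr1 by blast
      obtain b where b: "b \<in> carrier H" "\<forall>i\<in>{..<n}. f i a = h i b" using lift_h by blast
      have "\<mu> X = N2 #>\<^bsub>H\<^esub> b" unfolding a(2) \<mu>_iff[OF a(1) b(1)] by (rule b(2))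
      then show "\<mu> X \<in> carrier (H Mod N2)" using carr2'[OF b(1)] by simp
    next
      fix X X' assume "X \<in> carrier (G Mod N1)" "X' \<in> carrier (G Mod N1)"
      then obtain a a' where a: "a \<in> carrier G" "X = N1 #>\<^bsub>G\<^esub> a" "a' \<in> carrier G" "X' = N1 #>\<^bsub>G\<^esub> a'"
        using carr1 by metis
      obtain b where b: "b \<in> carrier H" "\<forall>i\<in>{..<n}. f i a = h i b" using lift_h by blast
      obtain b' where b': "b' \<in> carrier H" "\<forall>i\<in>{..<n}. f i a' = h i b'" using lift_h by blast
      have 1: "X \<otimes>\<^bsub>G Mod N1\<^esub> X' = N1 #>\<^bsub>G\<^esub> (a \<otimes>\<^bsub>G\<^esub> a')"
        unfolding a(2,4) using N1.rcos_sum[OF a(1,3)] by (simp add: FactGroup_def)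
      have 2: "\<mu> X = N2 #>\<^bsub>H\<^esub> b" "\<mu> X' = N2 #>\<^bsub>H\<^esub> b'"
        unfolding a(2,4) \<mu>_iff[OF a(1) b(1)] \<mu>_iff[OF a(3) b'(1)] by (rule b(2), rule b'(2))
      have "\<forall>i\<in>{..<n}. f i (a \<otimes>\<^bsub>G\<^esub> a') = h i (b \<otimes>\<^bsub>H\<^esub> b')"
        using a(1,3) b b' G.int_hom_mult[OF f] H.int_hom_mult[OF h] by simp
      then have "\<mu> (N1 #>\<^bsub>G\<^esub> (a \<otimes>\<^bsub>G\<^esub> a')) = N2 #>\<^bsub>H\<^esub> (b \<otimes>\<^bsub>H\<^esub> b')"
        using a(1,3) b(1) b'(1) by (subst \<mu>_iff) simp_all
      then show "\<mu> (X \<otimes>\<^bsub>G Mod N1\<^esub> X') = \<mu> X \<otimes>\<^bsub>H Mod N2\<^esub> \<mu> X'"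
        unfolding 1 2 using N2.rcos_sum[OF b(1) b'(1)] by (simp add: FactGroup_def)
    qed
    show "bij_betw \<mu> (carrier (G Mod N1)) (carrier (H Mod N2))"
      unfolding bij_betw_def
    proof
      show "inj_on \<mu> (carrier (G Mod N1))"
      proof (rule inj_onI)
        fix X X' assume X: "X \<in> carrier (G Mod N1)" "X' \<in> carrier (G Mod N1)" "\<mu> X = \<mu> X'"
        then obtain a a' where a: "a \<in> carrier G" "X = N1 #>\<^bsub>G\<^esub> a" "a' \<in> carrier G" "X' = N1 #>\<^bsub>G\<^esub> a'"
          using carr1 by metis
        obtain b where b: "b \<in> carrier H" "\<forall>i\<in>{..<n}. f i a = h i b" using lift_h by blast
        have "\<mu> X' = N2 #>\<^bsub>H\<^esub> b" unfolding X(3)[symmetric] a(2) \<mu>_iff[OF a(1) b(1)] by (rule b(2))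
        then have "\<forall>i\<in>{..<n}. f i a' = h i b" unfolding a(4) \<mu>_iff[OF a(3) b(1)] .
        then have "\<forall>i\<in>{..<n}. f i a = f i a'" using b(2) by simp
        then show "X = X'" unfolding a(2,4) coset1[OF a(1)] coset1[OF a(3)] by simp
      qed
      show "\<mu> ` carrier (G Mod N1) = carrier (H Mod N2)"
      proof
        show "\<mu> ` carrier (G Mod N1) \<subseteq> carrier (H Mod N2)"
          using hom_in_carrier[OF \<open>\<mu> \<in> hom (G Mod N1) (H Mod N2)\<close>] by blast
        show "carrier (H Mod N2) \<subseteq> \<mu> ` carrier (G Mod N1)"
        proof
          fix Z assume "Z \<in> carrier (H Mod N2)"
          then obtain b where b: "b \<in> carrier H" "Z = N2 #>\<^bsub>H\<^esub> b" by (auto simp: carrier_FactGroup)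
          obtain a where a: "a \<in> carrier G" "\<forall>i\<in>{..<n}. f i a = h i b" using lift_f by blast
          have "\<mu> (N1 #>\<^bsub>G\<^esub> a) = Z" unfolding b(2) \<mu>_iff[OF a(1) b(1)] by (rule a(2))
          then show "Z \<in> \<mu> ` carrier (G Mod N1)" using carr1'[OF a(1)] by blast
        qed
      qed
    qed
  qed
  have "D = fibre_product G H N1 N2 \<mu>"
    unfolding fibre_product_def D_def using \<mu>_iff by auto
  then have fibre: "is_fibre_product G H D" unfolding is_fibre_product_def using N1 N2 iso by blast
  define \<chi> where "\<chi> = (\<lambda>i p. f i (fst p) - h i (snd p))"
  have \<chi>: "int_hom (G \<times>\<times> H) (\<chi> i)" if "i \<in> {..<n}" for i
    using G.int_hom_mult[OF f[OF that]] H.int_hom_mult[OF h[OF that]] by (auto simp: int_hom_def \<chi>_def)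
  have D: "D = {p \<in> carrier (G \<times>\<times> H). \<forall>i\<in>{..<n}. \<chi> i p = 0}"
    by (auto simp: D_def \<chi>_def)
  have sub: "subgroup D (G \<times>\<times> H)" "derived (G \<times>\<times> H) (carrier (G \<times>\<times> H)) \<subseteq> D"
    unfolding D by (rule GH.kernel_int_homs_subgroup[OF \<chi>], assumption) (rule GH.derived_subset_int_kernel[OF \<chi>])
  have "dual_system (G \<times>\<times> H) {..<n} \<chi> (\<lambda>i. (x i, \<one>\<^bsub>H\<^esub>))"
    unfolding dual_system_def using \<chi> x fx H.int_hom_one[OF h] by (auto simp: \<chi>_def)
  then have "co_rank (G \<times>\<times> H) D = n"
  proof (rule GH.co_rank_eq[OF sub])
    show "\<chi> i p = 0" if "i < n" "p \<in> D" for i p using that unfolding D by simp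
    fix p assume p: "p \<in> carrier (G \<times>\<times> H)" "\<forall>i<n. \<chi> i p = 0"
    then have "p \<in> D" unfolding D by simp
    then have "p [^]\<^bsub>G \<times>\<times> H\<^esub> (1 :: int) \<in> D" using p(1) by simp
    then show "\<exists>q :: int. q \<noteq> 0 \<and> p [^]\<^bsub>G \<times>\<times> H\<^esub> q \<in> D" by (intro exI[of _ 1]) simp
  qed
  then show ?thesis using fibre GH.normal_of_derived[OF sub] by blast
qed

text \<open>A system vanishing on \<open>K\<close> is cut down to its first \<open>r\<close>
  characters before it is continued to a system on the whole abelianisation. The characters with
  finitely generated kernels thereby keep the first \<open>r\<close> positions, and the total number
  is limited only by the rank of the abelianisation.\<close>

lemma (in group) dual_system_with_fg_kernels:
  assumes fg: "finitely_generated G" and K: "subgroup K G" "derived G (carrier G) \<subseteq> K" "finitely_generated (G\<lparr>carrier := K\<rparr>)"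
    and "r \<le> co_rank G K" "r \<le> n" "n \<le> co_rank G (derived G (carrier G))"
  obtains h g where "dual_system G {..<n} h g"
    "\<And>j. j \<le> r \<Longrightarrow> finitely_generated (G\<lparr>carrier := {x \<in> carrier G. \<forall>i<j. h i x = 0}\<rparr>)"
proof -
  have "dual_system G {..<0 :: nat} (\<lambda>_ _. 0) (\<lambda>_. \<one>)" by (simp add: dual_system_def)
  then obtain h g where hg: "dual_system G {..<co_rank G K} h g" "\<And>i k. i < co_rank G K \<Longrightarrow> k \<in> K \<Longrightarrow> h i k = 0"
    by (rule dual_system_complete[OF K(1,2) fg]) (simp, rule that)
  have hgr: "dual_system G {..<r} h g" by (rule dual_system_subset[OF hg(1)]) (use assms(5) in auto)
  have hK: "h i k = 0" if "i < r" "k \<in> K" for i k using hg(2)[of i k] that assms(5) by simp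
  let ?D = "derived G (carrier G)"
  have D: "subgroup ?D G" by (rule derived_is_subgroup[OF subset_refl])
  have hD: "h i k = 0" if "i < r" "k \<in> ?D" for i k using hK[OF that(1) subsetD[OF K(2) that(2)]] .
  obtain h' g' where h': "dual_system G {..<co_rank G ?D} h' g'" "\<And>i. i < r \<Longrightarrow> h' i = h i"
    by (rule dual_system_complete[OF D subset_refl fg hgr hD]) (assumption, assumption, rule that)
  show ?thesis
  proof (rule that)
    show "dual_system G {..<n} h' g'" by (rule dual_system_subset[OF h'(1)]) (use assms(7) in auto)
    fix j assume j: "j \<le> r"
    have "finitely_generated (G\<lparr>carrier := {x \<in> carrier G. \<forall>i<j. h i x = 0}\<rparr>)"
      by (rule finitely_generated_dual_kernel[OF K(1,2) fg K(3) hgr hK j])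
    moreover have "{x \<in> carrier G. \<forall>i<j. h i x = 0} = {x \<in> carrier G. \<forall>i<j. h' i x = 0}"
      using h'(2) j by auto
    ultimately show "finitely_generated (G\<lparr>carrier := {x \<in> carrier G. \<forall>i<j. h' i x = 0}\<rparr>)" by simp
  qed
qed

lemma finitely_presented_swap:
  assumes "finitely_presented ((H \<times>\<times> G)\<lparr>carrier := {(b, a). b \<in> carrier H \<and> a \<in> carrier G \<and> Q b a}\<rparr>)"
  shows "finitely_presented ((G \<times>\<times> H)\<lparr>carrier := {(a, b). a \<in> carrier G \<and> b \<in> carrier H \<and> Q b a}\<rparr>)"
proof (rule finitely_presented_iso[OF _ assms], rule is_isoI, rule isoI)
  show "prod.swap \<in> hom ((H \<times>\<times> G)\<lparr>carrier := {(b, a). b \<in> carrier H \<and> a \<in> carrier G \<and> Q b a}\<rparr>)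
      ((G \<times>\<times> H)\<lparr>carrier := {(a, b). a \<in> carrier G \<and> b \<in> carrier H \<and> Q b a}\<rparr>)"
    by (rule homI) auto
  show "bij_betw prod.swap (carrier ((H \<times>\<times> G)\<lparr>carrier := {(b, a). b \<in> carrier H \<and> a \<in> carrier G \<and> Q b a}\<rparr>))
      (carrier ((G \<times>\<times> H)\<lparr>carrier := {(a, b). a \<in> carrier G \<and> b \<in> carrier H \<and> Q b a}\<rparr>))"
    by (rule bij_betwI[where g = prod.swap]) auto
qed

theorem corollary4p7:
  fixes G1 :: "('a, 'c) monoid_scheme" and G2 :: "('b, 'd) monoid_scheme"
    and K1 :: "'a set" and K2 :: "'b set" and m k n1 n2 :: nat
  assumes "group G1" and "group G2"
    and "finitely_presented G1" and "finitely_presented G2"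
    and "n1 = torsion_free_rank (G1 Mod derived G1 (carrier G1))"
    and "n2 = torsion_free_rank (G2 Mod derived G2 (carrier G2))"
    and "subgroup K1 G1" and "derived G1 (carrier G1) \<subseteq> K1"
    and "subgroup K2 G2" and "derived G2 (carrier G2) \<subseteq> K2"
    and "finitely_generated (G1\<lparr>carrier := K1\<rparr>)" and "co_rank G1 K1 = m"
    and "finitely_generated (G2\<lparr>carrier := K2\<rparr>)" and "co_rank G2 K2 = k"
  shows "\<exists>H. is_fibre_product G1 G2 H \<and> H \<lhd> G1 \<times>\<times> G2 \<and>
             finitely_presented ((G1 \<times>\<times> G2)\<lparr>carrier := H\<rparr>) \<and>
             co_rank (G1 \<times>\<times> G2) H = Min {m + k, n1, n2}"
proof -
  define n where "n = Min {m + k, n1, n2}"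
  \<comment> \<open>\<open>n\<close> is split into a part of at most \<open>m\<close> and a
    remainder, which is at most \<open>k\<close> because \<open>n \<le> m + k\<close>.\<close>
  define m' where "m' = min m n"
  define k' where "k' = n - m'"
  have n: "n \<le> m + k" "n \<le> n1" "n \<le> n2" by (auto simp: n_def)
  have mk: "m' \<le> m" "m' \<le> n" "k' \<le> k" "k' \<le> n" "m' + k' = n" "k' + m' = n"
    using n(1) by (auto simp: m'_def k'_def)
  have fg: "finitely_generated G1" "finitely_generated G2"
    using finitely_presented_imp_finitely_generated assms(1-4) by blast+
  have rk: "n \<le> co_rank G1 (derived G1 (carrier G1))" "n \<le> co_rank G2 (derived G2 (carrier G2))"
    using n(2,3) unfolding co_rank_def assms(5,6) .
  obtain h1 g1 where d1: "dual_system G1 {..<n} h1 g1"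
    "\<And>j. j \<le> m' \<Longrightarrow> finitely_generated (G1\<lparr>carrier := {x \<in> carrier G1. \<forall>i<j. h1 i x = 0}\<rparr>)"
    by (rule group.dual_system_with_fg_kernels[OF assms(1) fg(1) assms(7,8,11) _ mk(2) rk(1)])
      (use mk(1) assms(12) in simp, rule that)
  obtain h2 g2 where d2: "dual_system G2 {..<n} h2 g2"
    "\<And>j. j \<le> k' \<Longrightarrow> finitely_generated (G2\<lparr>carrier := {x \<in> carrier G2. \<forall>i<j. h2 i x = 0}\<rparr>)"
    by (rule group.dual_system_with_fg_kernels[OF assms(2) fg(2) assms(9,10,13) _ mk(4) rk(2)])
      (use mk(3) assms(14) in simp, rule that)
  have "\<exists>f x h y. dual_system G1 {..<n} f x \<and> dual_system G2 {..<n} h y \<and>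
      finitely_presented ((G1 \<times>\<times> G2)\<lparr>carrier := {(a, b). a \<in> carrier G1 \<and> b \<in> carrier G2 \<and> (\<forall>i<n. f i a = h i b)}\<rparr>)"
  proof (cases "k' \<le> m'")
    case True
    interpret fibre_data G1 G2 h1 g1 h2 g2 m' k'
      by (rule fibre_data.intro) (use assms(1-4) d1 d2 True mk(5) in simp_all)
    show ?thesis using finitely_presented_fibre d2(1) unfolding mk(5) by blast
  next
    case False
    \<comment> \<open>The larger part has to come first, so the factors are exchanged and the shear
      falls on the characters of \<open>G2\<close>. Swapping coordinates transports finite
      presentability back to \<open>G1 \<times>\<times> G2\<close>.\<close>
    interpret fibre_data G2 G1 h2 g2 h1 g1 k' m'
      by (rule fibre_data.intro) (use assms(1-4) d1 d2 False mk(6) in simp_all)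
    obtain \<psi> u where \<psi>: "dual_system G2 {..<n} \<psi> u"
      "finitely_presented ((G2 \<times>\<times> G1)\<lparr>carrier := {(b, a). b \<in> carrier G2 \<and> a \<in> carrier G1 \<and> (\<forall>i<n. \<psi> i b = h1 i a)}\<rparr>)"
      using finitely_presented_fibre unfolding mk(6) by blast
    from finitely_presented_swap[OF \<psi>(2)]
    have "finitely_presented ((G1 \<times>\<times> G2)\<lparr>carrier := {(a, b). a \<in> carrier G1 \<and> b \<in> carrier G2 \<and> (\<forall>i<n. h1 i a = \<psi> i b)}\<rparr>)"
      by (simp only: eq_commute)
    then show ?thesis using d1(1) \<psi>(1) by blast
  qed
  then obtain f x h y where fh: "dual_system G1 {..<n} f x" "dual_system G2 {..<n} h y"
    "finitely_presented ((G1 \<times>\<times> G2)\<lparr>carrier := {(a, b). a \<in> carrier G1 \<and> b \<in> carrier G2 \<and> (\<forall>i<n. f i a = h i b)}\<rparr>)"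
    by blast
  show ?thesis
    using fibre_product_of_dual_systems[OF assms(1,2) fh(1,2)] fh(3) unfolding n_def by blast
qed

end
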